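(* Let $\mathbb M=\{M_j\}_{j\ge0}$ be a good $\mathfrak q$-filtration of a Cohen-Macaulay module $M$ of dimension $r\ge1$ and let $J$ be an ideal generated by a maximal $\mathbb M$-superficial sequence for $\mathfrak q$. Consider the following conditions: 1. $s(\mathbb M)\le1$, or equivalently $P_{\mathbb M}(z)=\dfrac{h_0(\mathbb M)+h_1(\mathbb M)z}{(1-z)^r}$. 2. $e_1(\mathbb M)=h_1(\mathbb M)$. 3. $e_1(\mathbb M)=e_0(\mathbb M)-h_0(\mathbb M)$. 4. $e_0(\mathbb M)=h_0(\mathbb M)+h_1(\mathbb M)$. 5. $M_2=JM_1$. Then conditions 1, 2, 3 are equivalent, condition 2 implies condition 4, and conditions 4 and 5 are equivalent. If any of the equivalent conditions 1, 2, 3 holds, then $gr_{\mathbb M}(M)$ is Cohen-Macaulay.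
   Context: $(A,\mathfrak m)$ is a commutative Noetherian local ring, $\mathfrak q$ is a (proper) $\mathfrak m$-primary ideal of $A$, $M$ is a nonzero finitely generated $A$-module, and $\lambda(\cdot)$ denotes length. A good $\mathfrak q$-filtration $\mathbb M=\{M_n\}_{n\ge 0}$ of $M$ is a chain of submodules $M=M_0\supseteq M_1\supseteq\cdots$ with $\mathfrak qM_n\subseteq M_{n+1}$ for all $n$ and $M_{n+1}=\mathfrak qM_n$ for all large $n$. The associated graded module $gr_{\mathbb M}(M)=\bigoplus_{n\ge0}M_n/M_{n+1}$ is a graded module over $gr_{\mathfrak q}(A)=\bigoplus_{n\ge 0}\mathfrak q^n/\mathfrak q^{n+1}$. The Hilbert series is $P_{\mathbb M}(z)=\sum_{n\ge0}\lambda(M_n/M_{n+1})z^n=h_{\mathbb M}(z)/(1-z)^r$ with $h_{\mathbb M}(z)=\sum_i h_i(\mathbb M)z^i\in\mathbb Z[z]$, $h_{\mathbb M}(1)\ne0$, $r=\dim M$; thus $h_0(\mathbb M)=\lambda(M/M_1)$ and $h_1(\mathbb M)=\lambda(M_1/M_2)-r\lambda(M/M_1)$. $s(\mathbb M)$ is the degree of $h_{\mathbb M}(z)$, and the Hilbert coefficients are $e_i(\mathbb M)=h_{\mathbb M}^{(i)}(1)/i!$. For a submodule $N$ of $M$, $\mathbb M/N$ is the good $\mathfrak q$-filtration $\{(M_n+N)/N\}$ of $M/N$. An element $a\in\mathfrak q$ is $\mathbb M$-superficial for $\mathfrak q$ if there is $c\ge0$ such that $(M_{n+1}:_Ma)\cap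 M_c=M_n$ for all $n\ge c$. A sequence $a_1,\dots,a_t\in\mathfrak q$ is an $\mathbb M$-superficial sequence for $\mathfrak q$ if each $a_i$ is $\mathbb M/(a_1,\dots,a_{i-1})M$-superficial for $\mathfrak q$. It is maximal if $\mathbb M/(a_1,\dots,a_t)M$ is nilpotent (its $n$-th term is $0$ for $n\gg0$) but $\mathbb M/(a_1,\dots,a_{t-1})M$ is not; when $\dim M=r\ge1$ a maximal superficial sequence has length $t=r$. *)

theory Defs
  imports
    "HOL-Computational_Algebra.Polynomial_FPS"
    "HOL-Library.Extended_Nat"
    "HOL-Algebra.Module"
    "HOL-Algebra.Ring_Divisibility"
    "HOL-Algebra.Ideal_Product"
begin

section \<open>Ideals\<close>

definition noetherian_local_ring :: "('a, 'c) ring_scheme \<Rightarrow> 'a set \<Rightarrow> bool"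
  where "noetherian_local_ring R \<mm> \<longleftrightarrow>
    cring R \<and> noetherian_ring R \<and> maximalideal \<mm> R \<and> (\<forall>I. maximalideal I R \<longrightarrow> I = \<mm>)"

definition ideal_radical :: "('a, 'c) ring_scheme \<Rightarrow> 'a set \<Rightarrow> 'a set"
  where "ideal_radical R I = {x \<in> carrier R. \<exists>n::nat. x [^]\<^bsub>R\<^esub> n \<in> I}"

definition primary_ideal :: "('a, 'c) ring_scheme \<Rightarrow> 'a set \<Rightarrow> bool"
  where "primary_ideal R I \<longleftrightarrow> ideal I R \<and> I \<noteq> carrier R \<and>
    (\<forall>x\<in>carrier R. \<forall>y\<in>carrier R. x \<otimes>\<^bsub>R\<^esub> y \<in> I \<longrightarrow> x \<in> I \<or> y \<in> ideal_radical R I)"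

definition primary_to :: "('a, 'c) ring_scheme \<Rightarrow> 'a set \<Rightarrow> 'a set \<Rightarrow> bool"
  where "primary_to R \<mm> I \<longleftrightarrow> primary_ideal R I \<and> ideal_radical R I = \<mm>"

primrec ideal_power :: "('a, 'c) ring_scheme \<Rightarrow> 'a set \<Rightarrow> nat \<Rightarrow> 'a set"
  where
    "ideal_power R I 0 = carrier R"
  | "ideal_power R I (Suc n) = ideal_prod R I (ideal_power R I n)"


section \<open>Modules\<close>

definition submodule_span :: "('a, 'c) ring_scheme \<Rightarrow> ('a, 'b, 'd) module_scheme \<Rightarrow> 'b set \<Rightarrow> 'b set"
  where "submodule_span R M S = \<Inter>{K. submodule K R M \<and> S \<subseteq> K}"

definition finitely_generated :: "('a, 'c) ring_scheme \<Rightarrow> ('a, 'b, 'd) module_scheme \<Rightarrow> bool"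
  where "finitely_generated R M \<longleftrightarrow>
    (\<exists>S. finite S \<and> S \<subseteq> carrier M \<and> submodule_span R M S = carrier M)"

text \<open>The submodule \<open>I N\<close>, for an ideal \<open>I\<close> and a submodule \<open>N\<close> of \<open>M\<close>.\<close>

definition ideal_smult ::
    "('a, 'c) ring_scheme \<Rightarrow> ('a, 'b, 'd) module_scheme \<Rightarrow> 'a set \<Rightarrow> 'b set \<Rightarrow> 'b set"
  where "ideal_smult R M I N = submodule_span R M {a \<odot>\<^bsub>M\<^esub> x | a x. a \<in> I \<and> x \<in> N}"

definition annihilator :: "('a, 'c) ring_scheme \<Rightarrow> ('a, 'b, 'd) module_scheme \<Rightarrow> 'a set"
  where "annihilator R M = {a \<in> carrier R. \<forall>x\<in>carrier M. a \<odot>\<^bsub>M\<^esub> x = \<zero>\<^bsub>M\<^esub>}"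

text \<open>
  The record type of modules extends that of rings; the fields \<^const>\<open>mult\<close> and \<^const>\<open>one\<close>
  play no role for a module and are left unspecified.
\<close>

definition FactModule :: "('a, 'b, 'd) module_scheme \<Rightarrow> 'b set \<Rightarrow> ('a, 'b set) module"
  where "FactModule M N =
    \<lparr>carrier = a_rcosets\<^bsub>M\<^esub> N, mult = undefined, one = undefined,
     zero = N, add = set_add M,
     smult = (\<lambda>a X. \<Union>x\<in>X. N +>\<^bsub>M\<^esub> (a \<odot>\<^bsub>M\<^esub> x))\<rparr>"

definition regular_module :: "('a, 'c) ring_scheme \<Rightarrow> ('a, 'a) module"
  where "regular_module R =
    \<lparr>carrier = carrier R, mult = mult R, one = \<one>\<^bsub>R\<^esub>, zero = \<zero>\<^bsub>R\<^esub>, add = add R, smult = mult R\<rparr>"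

definition module_length :: "('a, 'c) ring_scheme \<Rightarrow> ('a, 'b, 'd) module_scheme \<Rightarrow> enat"
  where "module_length R M = Sup {enat n | n. \<exists>N :: nat \<Rightarrow> 'b set.
    (\<forall>i\<le>n. submodule (N i) R M) \<and> (\<forall>i<n. N i \<subset> N (Suc i))}"

definition prime_chain :: "('a, 'c) ring_scheme \<Rightarrow> (nat \<Rightarrow> 'a set) \<Rightarrow> nat \<Rightarrow> bool"
  where "prime_chain R P n \<longleftrightarrow> (\<forall>i\<le>n. primeideal (P i) R) \<and> (\<forall>i<n. P i \<subset> P (Suc i))"

text \<open>
  The Krull dimension of \<open>R / Ann M\<close>, whose primes are the primes of \<open>R\<close> containing \<open>Ann M\<close>.
\<close>

definition module_dim :: "('a, 'c) ring_scheme \<Rightarrow> ('a, 'b, 'd) module_scheme \<Rightarrow> enat"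
  where "module_dim R M =
    Sup {enat n | n. \<exists>P. prime_chain R P n \<and> annihilator R M \<subseteq> P 0}"

text \<open>
  The dimension of the localization \<open>M\<^sub>Q\<close> of a finitely generated module at a prime \<open>Q\<close>,
  that is, the height of \<open>Q / Ann M\<close> in \<open>R / Ann M\<close>.
\<close>

definition module_dim_at ::
    "('a, 'c) ring_scheme \<Rightarrow> ('a, 'b, 'd) module_scheme \<Rightarrow> 'a set \<Rightarrow> enat"
  where "module_dim_at R M Q =
    Sup {enat n | n. \<exists>P. prime_chain R P n \<and> annihilator R M \<subseteq> P 0 \<and> P n \<subseteq> Q}"

text \<open>The submodule \<open>(a\<^sub>1, \<dots>, a\<^sub>k) M\<close>.\<close>

definition list_smult :: "('a, 'c) ring_scheme \<Rightarrow> ('a, 'b, 'd) module_scheme \<Rightarrow> 'a list \<Rightarrow> 'b set"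
  where "list_smult R M as = ideal_smult R M (genideal R (set as)) (carrier M)"

definition nonzerodivisor_on :: "('a, 'b, 'd) module_scheme \<Rightarrow> 'a \<Rightarrow> bool"
  where "nonzerodivisor_on M a \<longleftrightarrow> (\<forall>x\<in>carrier M. a \<odot>\<^bsub>M\<^esub> x = \<zero>\<^bsub>M\<^esub> \<longrightarrow> x = \<zero>\<^bsub>M\<^esub>)"

definition regular_sequence ::
    "('a, 'c) ring_scheme \<Rightarrow> ('a, 'b, 'd) module_scheme \<Rightarrow> 'a list \<Rightarrow> bool"
  where "regular_sequence R M as \<longleftrightarrow> set as \<subseteq> carrier R \<and>
    (\<forall>i<length as. nonzerodivisor_on (FactModule M (list_smult R M (take i as))) (as ! i)) \<and>
    list_smult R M as \<noteq> carrier M"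

definition module_depth ::
    "('a, 'c) ring_scheme \<Rightarrow> 'a set \<Rightarrow> ('a, 'b, 'd) module_scheme \<Rightarrow> enat"
  where "module_depth R I M =
    Sup {enat (length as) | as. set as \<subseteq> I \<and> regular_sequence R M as}"

text \<open>
  For a finitely generated module over a Noetherian ring that need not be local, the condition is
  required at every maximal ideal \<open>Q\<close> of the support (the maximal ideals containing \<open>Ann M\<close>).
  The depth of \<open>M\<^sub>Q\<close> is the depth of \<open>Q\<close> on \<open>M\<close> because \<open>Q\<close> is maximal.
  If \<open>R\<close> is local with maximal ideal \<open>\<mm>\<close> and \<open>M\<close> is nonzero, the definition says
  \<open>depth M = dim M\<close>, as \<^term>\<open>module_dim_at R M \<mm> = module_dim R M\<close>.
\<close>

definition cohen_macaulay :: "('a, 'c) ring_scheme \<Rightarrow> ('a, 'b, 'd) module_scheme \<Rightarrow> bool"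
  where "cohen_macaulay R M \<longleftrightarrow>
    (\<forall>Q. maximalideal Q R \<and> annihilator R M \<subseteq> Q \<longrightarrow> module_depth R Q M = module_dim_at R M Q)"


section \<open>Good filtrations and superficial sequences\<close>

definition good_filtration ::
    "('a, 'c) ring_scheme \<Rightarrow> 'a set \<Rightarrow> ('a, 'b, 'd) module_scheme \<Rightarrow> (nat \<Rightarrow> 'b set) \<Rightarrow> bool"
  where "good_filtration R \<qq> M F \<longleftrightarrow>
    F 0 = carrier M \<and>
    (\<forall>n. submodule (F n) R M) \<and>
    (\<forall>n. F (Suc n) \<subseteq> F n) \<and>
    (\<forall>n. ideal_smult R M \<qq> (F n) \<subseteq> F (Suc n)) \<and>
    (\<exists>n0. \<forall>n\<ge>n0. F (Suc n) = ideal_smult R M \<qq> (F n))"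

definition quotient_filtration ::
    "('a, 'b, 'd) module_scheme \<Rightarrow> (nat \<Rightarrow> 'b set) \<Rightarrow> 'b set \<Rightarrow> nat \<Rightarrow> 'b set set"
  where "quotient_filtration M F N n = (\<lambda>x. N +>\<^bsub>M\<^esub> x) ` (F n <+>\<^bsub>M\<^esub> N)"

definition superficial_element ::
    "'a set \<Rightarrow> ('a, 'b, 'd) module_scheme \<Rightarrow> (nat \<Rightarrow> 'b set) \<Rightarrow> 'a \<Rightarrow> bool"
  where "superficial_element \<qq> M F a \<longleftrightarrow> a \<in> \<qq> \<and>
    (\<exists>c. \<forall>n\<ge>c. {x \<in> carrier M. a \<odot>\<^bsub>M\<^esub> x \<in> F (Suc n)} \<inter> F c = F n)"

definition superficial_sequence ::
    "('a, 'c) ring_scheme \<Rightarrow> 'a set \<Rightarrow> ('a, 'b, 'd) module_scheme \<Rightarrow> (nat \<Rightarrow> 'b set) \<Rightarrow> 'a list \<Rightarrow> bool"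
  where "superficial_sequence R \<qq> M F as \<longleftrightarrow>
    (\<forall>i<length as. let N = list_smult R M (take i as) in
       superficial_element \<qq> (FactModule M N) (quotient_filtration M F N) (as ! i))"

definition nilpotent_filtration :: "('a, 'b, 'd) module_scheme \<Rightarrow> (nat \<Rightarrow> 'b set) \<Rightarrow> bool"
  where "nilpotent_filtration M F \<longleftrightarrow> (\<exists>n0. \<forall>n\<ge>n0. F n = {\<zero>\<^bsub>M\<^esub>})"

definition nilpotent_modulo ::
    "('a, 'c) ring_scheme \<Rightarrow> ('a, 'b, 'd) module_scheme \<Rightarrow> (nat \<Rightarrow> 'b set) \<Rightarrow> 'a list \<Rightarrow> bool"
  where "nilpotent_modulo R M F as \<longleftrightarrow>
    (let N = list_smult R M as in
       nilpotent_filtration (FactModule M N) (quotient_filtration M F N))"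

definition maximal_superficial_sequence ::
    "('a, 'c) ring_scheme \<Rightarrow> 'a set \<Rightarrow> ('a, 'b, 'd) module_scheme \<Rightarrow> (nat \<Rightarrow> 'b set) \<Rightarrow> 'a list \<Rightarrow> bool"
  where "maximal_superficial_sequence R \<qq> M F as \<longleftrightarrow>
    superficial_sequence R \<qq> M F as \<and>
    as \<noteq> [] \<and> nilpotent_modulo R M F as \<and> \<not> nilpotent_modulo R M F (butlast as)"


section \<open>Associated graded objects\<close>

definition gr_component ::
    "('a, 'b, 'd) module_scheme \<Rightarrow> (nat \<Rightarrow> 'b set) \<Rightarrow> nat \<Rightarrow> ('a, 'b set) module"
  where "gr_component M F n = FactModule (M\<lparr>carrier := F n\<rparr>) (F (Suc n))"

text \<open>
  An element of the direct sum of the \<open>F n / F (n + 1)\<close> is a family of cosets, almost all of which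
  are zero. A family \<open>f\<close> of cosets in the \<open>\<qq>\<^sup>i / \<qq>\<^sup>i\<^sup>+\<^sup>1\<close> acts by convolution: its component
  of degree \<open>i\<close> and the component of degree \<open>j\<close> of \<open>g\<close> are multiplied to the coset
  of \<open>a x\<close> in \<open>F (i + j) / F (i + j + 1)\<close>, for any choice of representatives \<open>a\<close> and \<open>x\<close>.
\<close>

definition gr_module ::
    "('a, 'b, 'd) module_scheme \<Rightarrow> (nat \<Rightarrow> 'b set) \<Rightarrow> (nat \<Rightarrow> 'a set, nat \<Rightarrow> 'b set) module"
  where "gr_module M F =
    \<lparr>carrier = {g. (\<forall>n. g n \<in> carrier (gr_component M F n)) \<and> finite {n. g n \<noteq> F (Suc n)}},
     mult = undefined, one = undefined,
     zero = (\<lambda>n. F (Suc n)),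
     add = (\<lambda>g h n. g n \<oplus>\<^bsub>gr_component M F n\<^esub> h n),
     smult = (\<lambda>f g n. \<Oplus>\<^bsub>gr_component M F n\<^esub>i\<in>{..n}.
       (\<Union>a\<in>f i. \<Union>x\<in>g (n - i). F (Suc n) +>\<^bsub>M\<^esub> (a \<odot>\<^bsub>M\<^esub> x)))\<rparr>"

definition gr_ring :: "('a, 'c) ring_scheme \<Rightarrow> 'a set \<Rightarrow> (nat \<Rightarrow> 'a set) ring"
  where "gr_ring R \<qq> =
    (let G = gr_module (regular_module R) (ideal_power R \<qq>) in
     \<lparr>carrier = carrier G, mult = smult G,
      one = (\<lambda>n. if n = 0 then ideal_power R \<qq> 1 +>\<^bsub>R\<^esub> \<one>\<^bsub>R\<^esub> else ideal_power R \<qq> (Suc n)),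
      zero = zero G, add = add G\<rparr>)"


section \<open>Hilbert series and Hilbert coefficients\<close>

definition hilbert_series ::
    "('a, 'c) ring_scheme \<Rightarrow> ('a, 'b, 'd) module_scheme \<Rightarrow> (nat \<Rightarrow> 'b set) \<Rightarrow> int fps"
  where "hilbert_series R M F =
    Abs_fps (\<lambda>n. int (the_enat (module_length R (gr_component M F n))))"

definition h_polynomial ::
    "('a, 'c) ring_scheme \<Rightarrow> ('a, 'b, 'd) module_scheme \<Rightarrow> (nat \<Rightarrow> 'b set) \<Rightarrow> int poly"
  where "h_polynomial R M F = (THE h.
    fps_of_poly h = hilbert_series R M F * (1 - fps_X) ^ the_enat (module_dim R M) \<and> poly h 1 \<noteq> 0)"

definition h_coeff ::
    "('a, 'c) ring_scheme \<Rightarrow> ('a, 'b, 'd) module_scheme \<Rightarrow> (nat \<Rightarrow> 'b set) \<Rightarrow> nat \<Rightarrow> int"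
  where "h_coeff R M F i = poly.coeff (h_polynomial R M F) i"

definition s_degree ::
    "('a, 'c) ring_scheme \<Rightarrow> ('a, 'b, 'd) module_scheme \<Rightarrow> (nat \<Rightarrow> 'b set) \<Rightarrow> nat"
  where "s_degree R M F = degree (h_polynomial R M F)"

definition hilbert_coeff ::
    "('a, 'c) ring_scheme \<Rightarrow> ('a, 'b, 'd) module_scheme \<Rightarrow> (nat \<Rightarrow> 'b set) \<Rightarrow> nat \<Rightarrow> rat"
  where "hilbert_coeff R M F i =
    of_int (poly ((pderiv ^^ i) (h_polynomial R M F)) 1) / fact i"

end

theory Submission
  imports Defs "HOL-Algebra.Subrings"
begin

text \<open>
  Filter \<open>M / (a\<^sub>1, \<dots>, a\<^sub>i) M\<close> by the images \<open>FF i n\<close> of the \<open>F n\<close>. The lengths \<open>W i n\<close> of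
  \<open>(FF i (n + 1) : a\<^sub>i\<^sub>+\<^sub>1) / FF i n\<close> are the corrections by which the Hilbert series changes when one
  more element of the superficial sequence is divided out. The \<open>W (r - 1) n\<close> are among the
  nonnegative terms that add up to \<open>e\<^sub>1 - e\<^sub>0 + h\<^sub>0\<close>; so they vanish if this is \<open>0\<close>, as it is
  when \<open>s \<le> 1\<close>, and Sally descent then gives \<open>W i n = 0\<close> for all \<open>i < r\<close>.
  Then the initial forms of the \<open>a\<^sub>i\<close> are a regular sequence on \<open>gr M\<close>. A maximal ideal \<open>Q\<close> of \<open>gr A\<close> need
  not be homogeneous, but by Zariski's lemma the initial forms are integral modulo \<open>Q\<close>: each has a
  power that can be corrected by terms of lower degree to an element of \<open>Q\<close>, and these elements are again
  a regular sequence since their leading forms are. Hence the depth at \<open>Q\<close> is at least \<open>r\<close>, and a growth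
  estimate bounds the height of \<open>Q / Ann (gr M)\<close> by \<open>r\<close>.
\<close>

section \<open>Submodules\<close>

text \<open>Rationality of the Hilbert series is not presupposed: passing from M / (a_1, ..., a_i) M
  to the next quotient multiplies the series by 1 - z up to a polynomial correction, and solving
  this recurrence from a module of finite length upwards gives an explicit h-polynomial. So e_0 and
  e_1 become sums of lengths, and Northcott's inequality can be read off term by term. Conditions 4
  and 5 meet in one length: measuring M / J M_1 once through J M and once through M_2 gives
  length(M_2 / J M_1) = e_0 - h_0 - h_1, because J M / J M_1 has the length of r copies of M / M_1.
  That this is nonnegative, together with Northcott's inequality, squeezes e_1 = h_1 into e_1 = e_0
  - h_0. Cohen-Macaulayness of M serves to make the superficial sequence regular and of length r. It
  only promises some regular sequence of length r, which is traded for the given one element by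
  element. Statements on M / N are phrased for submodules of M containing N wherever
  possible.\<close>

context module
begin

abbreviation sub :: "'c set \<Rightarrow> bool"
  where "sub N \<equiv> submodule N R M"

lemma subD:
  assumes "sub N"
  shows sub_carrier: "x \<in> N \<Longrightarrow> x \<in> carrier M"
    and sub_zero: "\<zero>\<^bsub>M\<^esub> \<in> N"
    and sub_add: "x \<in> N \<Longrightarrow> y \<in> N \<Longrightarrow> x \<oplus>\<^bsub>M\<^esub> y \<in> N"
    and sub_neg: "x \<in> N \<Longrightarrow> \<ominus>\<^bsub>M\<^esub> x \<in> N"
    and sub_minus: "x \<in> N \<Longrightarrow> y \<in> N \<Longrightarrow> x \<ominus>\<^bsub>M\<^esub> y \<in> N"
    and sub_smult: "a \<in> carrier R \<Longrightarrow> x \<in> N \<Longrightarrow> a \<odot>\<^bsub>M\<^esub> x \<in> N"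
    and sub_subset: "N \<subseteq> carrier M"
  using submoduleE[OF assms] assms subgroup.one_closed[OF submodule.axioms(1)[OF assms]]
  by (auto simp: a_minus_def)

lemma sub_add_cancel:
  assumes "sub N" "y \<in> N" "x \<in> carrier M"
  shows "x \<oplus>\<^bsub>M\<^esub> y \<in> N \<longleftrightarrow> x \<in> N" "y \<oplus>\<^bsub>M\<^esub> x \<in> N \<longleftrightarrow> x \<in> N"
    "x \<ominus>\<^bsub>M\<^esub> y \<in> N \<longleftrightarrow> x \<in> N" "y \<ominus>\<^bsub>M\<^esub> x \<in> N \<longleftrightarrow> x \<in> N"
proof -
  have y: "y \<in> carrier M" "\<ominus>\<^bsub>M\<^esub> y \<in> N" using assms subD by auto
  have *: "x \<in> N" if "x \<oplus>\<^bsub>M\<^esub> z \<in> N" "z \<in> N" "x \<in> carrier M" for x z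
  proof -
    have "(x \<oplus>\<^bsub>M\<^esub> z) \<oplus>\<^bsub>M\<^esub> \<ominus>\<^bsub>M\<^esub> z \<in> N" using that assms subD by simp
    moreover have "(x \<oplus>\<^bsub>M\<^esub> z) \<oplus>\<^bsub>M\<^esub> \<ominus>\<^bsub>M\<^esub> z = x"
      using that sub_carrier[OF assms(1)] by (simp add: M.a_assoc M.r_neg)
    ultimately show ?thesis by simp
  qed
  show 1: "x \<oplus>\<^bsub>M\<^esub> y \<in> N \<longleftrightarrow> x \<in> N" using *[of x y] assms sub_add by blast
  show "y \<oplus>\<^bsub>M\<^esub> x \<in> N \<longleftrightarrow> x \<in> N" using 1 assms(3) y M.a_comm by metis
  show "x \<ominus>\<^bsub>M\<^esub> y \<in> N \<longleftrightarrow> x \<in> N" unfolding a_minus_def using *[of x "\<ominus>\<^bsub>M\<^esub> y"] assms y sub_add by blast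
  show "y \<ominus>\<^bsub>M\<^esub> x \<in> N \<longleftrightarrow> x \<in> N"
  proof
    assume "y \<ominus>\<^bsub>M\<^esub> x \<in> N"
    then have "\<ominus>\<^bsub>M\<^esub> x \<in> N"
      using *[of "\<ominus>\<^bsub>M\<^esub> x" y] assms y by (simp add: a_minus_def M.a_comm)
    then show "x \<in> N" using sub_neg[OF assms(1), of "\<ominus>\<^bsub>M\<^esub> x"] assms(3) by simp
  qed (use assms sub_minus in blast)
qed

lemma sub_zero_set: "sub {\<zero>\<^bsub>M\<^esub>}"
  by (rule submoduleI) auto

lemma sub_whole: "sub (carrier M)"
  by (rule carrier_is_submodule)

lemma sub_Int: "sub N \<Longrightarrow> sub K \<Longrightarrow> sub (N \<inter> K)"
  by (rule submoduleI) (auto simp: subD)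

lemma sub_Inter:
  assumes "\<And>N. N \<in> \<C> \<Longrightarrow> sub N" "\<C> \<noteq> {}"
  shows "sub (\<Inter>\<C>)"
proof (rule submoduleI)
  show "\<Inter>\<C> \<subseteq> carrier M" using assms sub_subset by blast
qed (use assms in \<open>auto simp: subD(2-6)\<close>)

lemma set_add_iff: "x \<in> N <+>\<^bsub>M\<^esub> K \<longleftrightarrow> (\<exists>n\<in>N. \<exists>k\<in>K. x = n \<oplus>\<^bsub>M\<^esub> k)"
  by (auto simp: set_add_def')

lemma set_addI: "n \<in> N \<Longrightarrow> k \<in> K \<Longrightarrow> n \<oplus>\<^bsub>M\<^esub> k \<in> N <+>\<^bsub>M\<^esub> K"
  by (auto simp: set_add_def')

lemma sub_set_add:
  assumes "sub N" "sub K"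
  shows "sub (N <+>\<^bsub>M\<^esub> K)"
proof (rule submoduleI)
  show "N <+>\<^bsub>M\<^esub> K \<subseteq> carrier M" using assms by (auto simp: set_add_iff subD)
  show "\<zero>\<^bsub>M\<^esub> \<in> N <+>\<^bsub>M\<^esub> K"
    using set_addI[OF sub_zero[OF assms(1)] sub_zero[OF assms(2)]] by simp
next
  fix a assume "a \<in> N <+>\<^bsub>M\<^esub> K"
  then obtain n k where nk: "n \<in> N" "k \<in> K" "a = n \<oplus>\<^bsub>M\<^esub> k" by (auto simp: set_add_iff)
  then have "\<ominus>\<^bsub>M\<^esub> a = \<ominus>\<^bsub>M\<^esub> n \<oplus>\<^bsub>M\<^esub> \<ominus>\<^bsub>M\<^esub> k"
    using assms subD by (simp add: M.minus_add)
  then show "\<ominus>\<^bsub>M\<^esub> a \<in> N <+>\<^bsub>M\<^esub> K" using nk assms sub_neg set_addI by metis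
next
  fix a b assume "a \<in> N <+>\<^bsub>M\<^esub> K" "b \<in> N <+>\<^bsub>M\<^esub> K"
  then obtain n k n' k' where nk: "n \<in> N" "k \<in> K" "a = n \<oplus>\<^bsub>M\<^esub> k" "n' \<in> N" "k' \<in> K" "b = n' \<oplus>\<^bsub>M\<^esub> k'"
    by (auto simp: set_add_iff)
  then have "a \<oplus>\<^bsub>M\<^esub> b = (n \<oplus>\<^bsub>M\<^esub> n') \<oplus>\<^bsub>M\<^esub> (k \<oplus>\<^bsub>M\<^esub> k')"
    using assms subD by (simp add: M.a_ac)
  then show "a \<oplus>\<^bsub>M\<^esub> b \<in> N <+>\<^bsub>M\<^esub> K" using nk assms sub_add set_addI by metis
next
  fix a x assume a: "a \<in> carrier R" and "x \<in> N <+>\<^bsub>M\<^esub> K"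
  then obtain n k where nk: "n \<in> N" "k \<in> K" "x = n \<oplus>\<^bsub>M\<^esub> k" by (auto simp: set_add_iff)
  then have "a \<odot>\<^bsub>M\<^esub> x = a \<odot>\<^bsub>M\<^esub> n \<oplus>\<^bsub>M\<^esub> a \<odot>\<^bsub>M\<^esub> k"
    using a assms subD by (simp add: smult_r_distr)
  then show "a \<odot>\<^bsub>M\<^esub> x \<in> N <+>\<^bsub>M\<^esub> K" using nk a assms sub_smult set_addI by metis
qed

lemma set_add_left: "sub N \<Longrightarrow> sub K \<Longrightarrow> N \<subseteq> N <+>\<^bsub>M\<^esub> K"
  by (metis M.r_zero set_addI sub_carrier sub_zero subsetI)

lemma set_add_right: "sub N \<Longrightarrow> sub K \<Longrightarrow> K \<subseteq> N <+>\<^bsub>M\<^esub> K"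
  by (metis M.l_zero set_addI sub_carrier sub_zero subsetI)

lemma set_add_least: "sub L \<Longrightarrow> N \<subseteq> L \<Longrightarrow> K \<subseteq> L \<Longrightarrow> N <+>\<^bsub>M\<^esub> K \<subseteq> L"
  by (auto simp: set_add_iff subset_iff subD)

lemma set_add_mono: "N \<subseteq> N' \<Longrightarrow> K \<subseteq> K' \<Longrightarrow> N <+>\<^bsub>M\<^esub> K \<subseteq> N' <+>\<^bsub>M\<^esub> K'"
  by (fastforce simp: set_add_iff)

lemma set_add_absorb: "sub N \<Longrightarrow> sub K \<Longrightarrow> K \<subseteq> N \<Longrightarrow> N <+>\<^bsub>M\<^esub> K = N"
  by (meson order_refl set_add_least set_add_left subset_antisym)

lemma set_add_commute: "sub N \<Longrightarrow> sub K \<Longrightarrow> N <+>\<^bsub>M\<^esub> K = K <+>\<^bsub>M\<^esub> N"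
  by (meson set_add_least set_add_left set_add_right subset_antisym sub_set_add)

lemma set_add_assoc:
  assumes "sub N" "sub K" "sub L"
  shows "(N <+>\<^bsub>M\<^esub> K) <+>\<^bsub>M\<^esub> L = N <+>\<^bsub>M\<^esub> (K <+>\<^bsub>M\<^esub> L)"
proof
  have s: "sub (N <+>\<^bsub>M\<^esub> K)" "sub (K <+>\<^bsub>M\<^esub> L)" "sub (N <+>\<^bsub>M\<^esub> (K <+>\<^bsub>M\<^esub> L))" "sub ((N <+>\<^bsub>M\<^esub> K) <+>\<^bsub>M\<^esub> L)"
    using assms sub_set_add by auto
  show "(N <+>\<^bsub>M\<^esub> K) <+>\<^bsub>M\<^esub> L \<subseteq> N <+>\<^bsub>M\<^esub> (K <+>\<^bsub>M\<^esub> L)"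
    using set_add_left[OF assms(1) s(2)] set_add_right[OF assms(1) s(2)]
      set_add_left[OF assms(2,3)] set_add_right[OF assms(2,3)]
    by (intro set_add_least s) auto
  show "N <+>\<^bsub>M\<^esub> (K <+>\<^bsub>M\<^esub> L) \<subseteq> (N <+>\<^bsub>M\<^esub> K) <+>\<^bsub>M\<^esub> L"
    using set_add_left[OF s(1) assms(3)] set_add_right[OF s(1) assms(3)]
      set_add_left[OF assms(1,2)] set_add_right[OF assms(1,2)]
    by (intro set_add_least s) auto
qed

lemma set_add_swap:
  assumes "sub N" "sub K" "sub L"
  shows "(N <+>\<^bsub>M\<^esub> K) <+>\<^bsub>M\<^esub> L = (N <+>\<^bsub>M\<^esub> L) <+>\<^bsub>M\<^esub> K"
  using assms by (simp add: set_add_assoc set_add_commute[of K L])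

lemma modular_law:
  assumes "sub N" "sub K" "sub L" "N \<subseteq> L"
  shows "(N <+>\<^bsub>M\<^esub> K) \<inter> L = N <+>\<^bsub>M\<^esub> (K \<inter> L)"
proof
  show "N <+>\<^bsub>M\<^esub> (K \<inter> L) \<subseteq> (N <+>\<^bsub>M\<^esub> K) \<inter> L"
    using assms set_add_least[of L N "K \<inter> L"] set_add_mono[of N N "K \<inter> L" K] by auto
  show "(N <+>\<^bsub>M\<^esub> K) \<inter> L \<subseteq> N <+>\<^bsub>M\<^esub> (K \<inter> L)"
  proof
    fix x assume x: "x \<in> (N <+>\<^bsub>M\<^esub> K) \<inter> L"
    then obtain n k where nk: "n \<in> N" "k \<in> K" "x = n \<oplus>\<^bsub>M\<^esub> k" by (auto simp: set_add_iff)
    then have "k \<in> L" using x assms sub_add_cancel(2)[of L n k] subD by auto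
    then show "x \<in> N <+>\<^bsub>M\<^esub> (K \<inter> L)" using nk set_addI by auto
  qed
qed

definition scale :: "'a \<Rightarrow> 'c set \<Rightarrow> 'c set"
  where "scale a X = (\<lambda>x. a \<odot>\<^bsub>M\<^esub> x) ` X"

lemma sub_scale:
  assumes "a \<in> carrier R" "sub X"
  shows "sub (scale a X)"
proof (rule submoduleI)
  have X: "\<And>x. x \<in> X \<Longrightarrow> x \<in> carrier M" using assms subD by auto
  show "scale a X \<subseteq> carrier M" using assms X by (auto simp: scale_def)
  show "\<zero>\<^bsub>M\<^esub> \<in> scale a X" unfolding scale_def
    using assms(1) sub_zero[OF assms(2)] by (auto intro!: image_eqI[of _ _ "\<zero>\<^bsub>M\<^esub>"])
  show "\<ominus>\<^bsub>M\<^esub> u \<in> scale a X" if "u \<in> scale a X" for u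
  proof -
    from that obtain x where "x \<in> X" "u = a \<odot>\<^bsub>M\<^esub> x" by (auto simp: scale_def)
    then show ?thesis using assms X smult_r_minus[of a x] sub_neg[of X x] unfolding scale_def by force
  qed
  show "u \<oplus>\<^bsub>M\<^esub> v \<in> scale a X" if "u \<in> scale a X" "v \<in> scale a X" for u v
  proof -
    from that obtain x y where "x \<in> X" "u = a \<odot>\<^bsub>M\<^esub> x" "y \<in> X" "v = a \<odot>\<^bsub>M\<^esub> y" by (auto simp: scale_def)
    then show ?thesis using assms X smult_r_distr[of a x y] sub_add[of X x y] unfolding scale_def by force
  qed
  show "b \<odot>\<^bsub>M\<^esub> u \<in> scale a X" if "b \<in> carrier R" "u \<in> scale a X" for b u
  proof -
    from that obtain x where x: "x \<in> X" "u = a \<odot>\<^bsub>M\<^esub> x" by (auto simp: scale_def)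
    then have "b \<odot>\<^bsub>M\<^esub> u = a \<odot>\<^bsub>M\<^esub> (b \<odot>\<^bsub>M\<^esub> x)"
      using assms(1) X that(1) smult_assoc1[of b a x] smult_assoc1[of a b x] R.m_comm[of a b] by metis
    then show ?thesis using x that sub_smult[OF assms(2)] unfolding scale_def by blast
  qed
qed

lemma scale_mono: "X \<subseteq> Y \<Longrightarrow> scale a X \<subseteq> scale a Y"
  by (auto simp: scale_def)

definition colon :: "'c set \<Rightarrow> 'a \<Rightarrow> 'c set"
  where "colon N a = {x \<in> carrier M. a \<odot>\<^bsub>M\<^esub> x \<in> N}"

lemma sub_colon:
  assumes "a \<in> carrier R" "sub N"
  shows "sub (colon N a)"
proof (rule submoduleI)
  show "b \<odot>\<^bsub>M\<^esub> x \<in> colon N a" if b: "b \<in> carrier R" "x \<in> colon N a" for b x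
  proof -
    have x: "x \<in> carrier M" "a \<odot>\<^bsub>M\<^esub> x \<in> N" using that by (auto simp: colon_def)
    then have "a \<odot>\<^bsub>M\<^esub> (b \<odot>\<^bsub>M\<^esub> x) = b \<odot>\<^bsub>M\<^esub> (a \<odot>\<^bsub>M\<^esub> x)"
      using b assms smult_assoc1[of b a x] smult_assoc1[of a b x] R.m_comm[of a b] by metis
    then show ?thesis using x b sub_smult[OF assms(2)] by (simp add: colon_def)
  qed
qed (use assms in \<open>auto simp: colon_def smult_r_minus smult_r_distr subD\<close>)

lemma colon_mono: "N \<subseteq> K \<Longrightarrow> colon N a \<subseteq> colon K a"
  by (auto simp: colon_def)

lemma subset_colon: "a \<in> carrier R \<Longrightarrow> sub N \<Longrightarrow> N \<subseteq> colon N a"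
  by (auto simp: colon_def subD)

lemma sub_span: "S \<subseteq> carrier M \<Longrightarrow> sub (submodule_span R M S)"
  unfolding submodule_span_def by (rule sub_Inter) (use sub_whole in auto)

lemma span_superset: "S \<subseteq> submodule_span R M S"
  unfolding submodule_span_def by auto

lemma span_least: "sub K \<Longrightarrow> S \<subseteq> K \<Longrightarrow> submodule_span R M S \<subseteq> K"
  unfolding submodule_span_def by auto

lemma sub_ideal_smult:
  "I \<subseteq> carrier R \<Longrightarrow> X \<subseteq> carrier M \<Longrightarrow> sub (ideal_smult R M I X)"
  unfolding ideal_smult_def by (rule sub_span) (use smult_closed in blast)

lemma ideal_smultI: "a \<in> I \<Longrightarrow> x \<in> X \<Longrightarrow> a \<odot>\<^bsub>M\<^esub> x \<in> ideal_smult R M I X"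
  unfolding ideal_smult_def by (rule subsetD[OF span_superset]) auto

lemma ideal_smult_least:
  "sub K \<Longrightarrow> (\<And>a x. a \<in> I \<Longrightarrow> x \<in> X \<Longrightarrow> a \<odot>\<^bsub>M\<^esub> x \<in> K) \<Longrightarrow> ideal_smult R M I X \<subseteq> K"
  unfolding ideal_smult_def by (rule span_least) auto

lemma ideal_smult_mono: "I \<subseteq> I' \<Longrightarrow> X \<subseteq> X' \<Longrightarrow> I' \<subseteq> carrier R \<Longrightarrow> X' \<subseteq> carrier M \<Longrightarrow>
    ideal_smult R M I X \<subseteq> ideal_smult R M I' X'"
  by (rule ideal_smult_least) (auto intro!: sub_ideal_smult ideal_smultI)

text \<open>This is N + a_1 X + ... + a_k X. Keeping X apart from the starting submodule N covers
  (a_1, ..., a_i) M, the product of J with \<open>F 1\<close>, and the mixtures that interpolate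
  between them. Accumulating in N matches the recursion of \<open>regular_seq_mod\<close>.\<close>

primrec add_scales :: "'c set \<Rightarrow> 'c set \<Rightarrow> 'a list \<Rightarrow> 'c set"
  where
    "add_scales X N [] = N"
  | "add_scales X N (a # as) = add_scales X (N <+>\<^bsub>M\<^esub> scale a X) as"

lemma sub_add_scales:
  "sub X \<Longrightarrow> sub N \<Longrightarrow> set as \<subseteq> carrier R \<Longrightarrow> sub (add_scales X N as)"
  by (induction as arbitrary: N) (auto simp: sub_set_add sub_scale)

lemma add_scales_snoc: "add_scales X N (as @ [a]) = add_scales X N as <+>\<^bsub>M\<^esub> scale a X"
  by (induction as arbitrary: N) auto

lemma add_scales_subset_iff:
  assumes "sub X" "sub N" "set as \<subseteq> carrier R" "sub K"
  shows "add_scales X N as \<subseteq> K \<longleftrightarrow> N \<subseteq> K \<and> (\<forall>a\<in>set as. scale a X \<subseteq> K)"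
  using assms
proof (induction as arbitrary: N)
  case (Cons a as)
  have "N <+>\<^bsub>M\<^esub> scale a X \<subseteq> K \<longleftrightarrow> N \<subseteq> K \<and> scale a X \<subseteq> K"
    using Cons.prems set_add_least[of K N "scale a X"] set_add_left[of N "scale a X"]
      set_add_right[of N "scale a X"] sub_scale[of a X] by auto
  then show ?case using Cons by (auto simp: sub_set_add sub_scale)
qed simp

lemma add_scales_superset:
  "sub X \<Longrightarrow> sub N \<Longrightarrow> set as \<subseteq> carrier R \<Longrightarrow> N \<subseteq> add_scales X N as"
  "sub X \<Longrightarrow> sub N \<Longrightarrow> set as \<subseteq> carrier R \<Longrightarrow> a \<in> set as \<Longrightarrow> scale a X \<subseteq> add_scales X N as"
  using add_scales_subset_iff[of X N as "add_scales X N as"] sub_add_scales by auto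

lemma add_scales_set_add:
  assumes "sub X" "sub N" "sub K" "set as \<subseteq> carrier R"
  shows "add_scales X (K <+>\<^bsub>M\<^esub> N) as = K <+>\<^bsub>M\<^esub> add_scales X N as"
  using assms(2,4)
proof (induction as arbitrary: N)
  case (Cons a as)
  then show ?case using assms(1,3) by (simp add: set_add_assoc sub_scale sub_set_add)
qed simp

text \<open>Used to extend "a carries X into K" from generators to a whole ideal: a generated ideal
  or a product of ideals lies in this colon ideal as soon as its generators do.\<close>

lemma colon_ideal: "sub X \<Longrightarrow> sub K \<Longrightarrow> ideal {a \<in> carrier R. \<forall>x\<in>X. a \<odot>\<^bsub>M\<^esub> x \<in> K} R"
proof (rule idealI)
  assume X: "sub X" and K: "sub K"
  let ?I = "{a \<in> carrier R. \<forall>x\<in>X. a \<odot>\<^bsub>M\<^esub> x \<in> K}"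
  have Xc: "\<And>x. x \<in> X \<Longrightarrow> x \<in> carrier M" using X subD by auto
  show "ring R" by (rule R.ring_axioms)
  show "subgroup ?I (add_monoid R)"
    by (rule R.add.subgroupI)
      (use K Xc in \<open>auto simp: smult_l_distr smult_l_minus subD sub_zero simp flip: a_inv_def intro!: exI[of _ "\<zero>"]\<close>)
  show "x \<otimes> a \<in> ?I" if "a \<in> ?I" "x \<in> carrier R" for a x
    using that Xc K by (auto simp: smult_assoc1 subD)
  then show "a \<otimes> x \<in> ?I" if "a \<in> ?I" "x \<in> carrier R" for a x
    using that R.m_comm[of a x] by auto
qed

lemma ideal_smult_genideal:
  assumes "sub X" "set as \<subseteq> carrier R"
  shows "ideal_smult R M (genideal R (set as)) X = add_scales X {\<zero>\<^bsub>M\<^esub>} as"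
proof
  let ?K = "add_scales X {\<zero>\<^bsub>M\<^esub>} as" and ?I = "genideal R (set as)"
  have K: "sub ?K" using assms sub_add_scales sub_zero_set by blast
  have I: "?I \<subseteq> carrier R" using R.genideal_ideal[OF assms(2)] ideal.Icarr by fastforce
  have "?I \<subseteq> {a \<in> carrier R. \<forall>x\<in>X. a \<odot>\<^bsub>M\<^esub> x \<in> ?K}"
    by (rule R.genideal_minimal[OF colon_ideal[OF assms(1) K]])
      (use assms add_scales_superset(2)[OF assms(1) sub_zero_set assms(2)] in \<open>auto simp: scale_def\<close>)
  then show "ideal_smult R M ?I X \<subseteq> ?K" by (intro ideal_smult_least K) auto
  show "?K \<subseteq> ideal_smult R M ?I X"
    using add_scales_subset_iff[OF assms(1) sub_zero_set assms(2) sub_ideal_smult[OF I sub_subset[OF assms(1)]]]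
      sub_zero[OF sub_ideal_smult[OF I sub_subset[OF assms(1)]]] R.genideal_self[OF assms(2)]
    by (auto simp: scale_def intro!: ideal_smultI)
qed

corollary list_smult_eq:
  "set as \<subseteq> carrier R \<Longrightarrow> list_smult R M as = add_scales (carrier M) {\<zero>\<^bsub>M\<^esub>} as"
  unfolding list_smult_def using ideal_smult_genideal sub_whole by blast

section \<open>Regular elements and regular sequences modulo a submodule\<close>

definition regular_mod :: "'c set \<Rightarrow> 'a \<Rightarrow> bool"
  where "regular_mod N a \<longleftrightarrow> (\<forall>u\<in>carrier M. a \<odot>\<^bsub>M\<^esub> u \<in> N \<longrightarrow> u \<in> N)"

primrec regular_seq_mod :: "'c set \<Rightarrow> 'a list \<Rightarrow> bool"
  where
    "regular_seq_mod N [] \<longleftrightarrow> True"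
  | "regular_seq_mod N (a # as) \<longleftrightarrow>
      regular_mod N a \<and> regular_seq_mod (N <+>\<^bsub>M\<^esub> scale a (carrier M)) as"

lemma regular_seq_mod_append:
  "regular_seq_mod N (as @ bs) \<longleftrightarrow>
    regular_seq_mod N as \<and> regular_seq_mod (add_scales (carrier M) N as) bs"
  by (induction as arbitrary: N) auto

lemma regular_seq_mod_nth:
  "regular_seq_mod N as \<longleftrightarrow>
    (\<forall>i<length as. regular_mod (add_scales (carrier M) N (take i as)) (as ! i))"
proof (induction as rule: rev_induct)
  case (snoc a as)
  have "(\<forall>i<length as. regular_mod (add_scales (carrier M) N (take i (as @ [a]))) ((as @ [a]) ! i)) \<longleftrightarrow>
    (\<forall>i<length as. regular_mod (add_scales (carrier M) N (take i as)) (as ! i))"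
    by (auto simp: nth_append)
  then show ?case using snoc by (auto simp: regular_seq_mod_append less_Suc_eq nth_append)
qed simp

subsection \<open>Cosets\<close>

lemma coset_mem: "y \<in> N +>\<^bsub>M\<^esub> x \<longleftrightarrow> (\<exists>n\<in>N. y = n \<oplus>\<^bsub>M\<^esub> x)"
  by (auto simp: a_r_coset_def')

lemma coset_mem_iff:
  assumes "sub N" "x \<in> carrier M"
  shows "y \<in> N +>\<^bsub>M\<^esub> x \<longleftrightarrow> y \<in> carrier M \<and> y \<ominus>\<^bsub>M\<^esub> x \<in> N"
proof
  assume "y \<in> N +>\<^bsub>M\<^esub> x"
  then obtain n where "n \<in> N" "y = n \<oplus>\<^bsub>M\<^esub> x" by (auto simp: coset_mem)
  then show "y \<in> carrier M \<and> y \<ominus>\<^bsub>M\<^esub> x \<in> N"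
    using assms subD(1)[OF assms(1)] by (simp add: a_minus_def M.a_assoc M.r_neg)
next
  assume y: "y \<in> carrier M \<and> y \<ominus>\<^bsub>M\<^esub> x \<in> N"
  then have "y = (y \<ominus>\<^bsub>M\<^esub> x) \<oplus>\<^bsub>M\<^esub> x" using assms by (simp add: a_minus_def M.a_assoc M.l_neg)
  then show "y \<in> N +>\<^bsub>M\<^esub> x" using y coset_mem by blast
qed

lemma coset_eq_iff:
  assumes "sub N" "x \<in> carrier M" "y \<in> carrier M"
  shows "N +>\<^bsub>M\<^esub> x = N +>\<^bsub>M\<^esub> y \<longleftrightarrow> x \<ominus>\<^bsub>M\<^esub> y \<in> N"
proof -
  have sg: "subgroup N (add_monoid M)" using assms(1) submodule.axioms(1) by blast
  have "x \<in> N +>\<^bsub>M\<^esub> x" using assms sub_zero[OF assms(1)] coset_mem M.l_zero by metis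
  then show ?thesis
    using M.a_repr_independence[OF _ _ sg, of x y] coset_mem_iff[OF assms(1,3), of x] assms(2,3) by metis
qed

lemma coset_eq_zero_iff:
  assumes "sub N" "x \<in> carrier M"
  shows "N +>\<^bsub>M\<^esub> x = N \<longleftrightarrow> x \<in> N"
  using coset_eq_iff[OF assms, of "\<zero>\<^bsub>M\<^esub>"] assms sub_subset[OF assms(1)]
    sub_add_cancel(3)[OF assms(1) sub_zero[OF assms(1)] assms(2)]
  by simp

lemma coset_add:
  assumes "sub N" "x \<in> carrier M" "y \<in> carrier M"
  shows "(N +>\<^bsub>M\<^esub> x) <+>\<^bsub>M\<^esub> (N +>\<^bsub>M\<^esub> y) = N +>\<^bsub>M\<^esub> (x \<oplus>\<^bsub>M\<^esub> y)"
proof -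
  interpret abelian_subgroup N M
    using assms(1) submodule.axioms(1) M.abelian_group_axioms
    by (intro abelian_subgroupI3 additive_subgroupI) auto
  show ?thesis using a_rcos_sum assms by blast
qed

lemma coset_smult:
  assumes "sub N" "x \<in> carrier M" "a \<in> carrier R"
  shows "(\<Union>y\<in>N +>\<^bsub>M\<^esub> x. N +>\<^bsub>M\<^esub> (a \<odot>\<^bsub>M\<^esub> y)) = N +>\<^bsub>M\<^esub> (a \<odot>\<^bsub>M\<^esub> x)"
proof -
  have "N +>\<^bsub>M\<^esub> (a \<odot>\<^bsub>M\<^esub> y) = N +>\<^bsub>M\<^esub> (a \<odot>\<^bsub>M\<^esub> x)" if "y \<in> N +>\<^bsub>M\<^esub> x" for y
  proof -
    have y: "y \<in> carrier M" "y \<ominus>\<^bsub>M\<^esub> x \<in> N" using that coset_mem_iff assms by auto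
    have "a \<odot>\<^bsub>M\<^esub> y \<ominus>\<^bsub>M\<^esub> a \<odot>\<^bsub>M\<^esub> x = a \<odot>\<^bsub>M\<^esub> (y \<ominus>\<^bsub>M\<^esub> x)"
      using y assms by (simp add: a_minus_def smult_r_distr smult_r_minus)
    then show ?thesis using y assms coset_eq_iff sub_smult by simp
  qed
  moreover have "x \<in> N +>\<^bsub>M\<^esub> x" using assms sub_zero[OF assms(1)] coset_mem M.l_zero by metis
  ultimately show ?thesis by blast
qed

lemma FactModule_simps:
  "carrier (FactModule M N) = (\<lambda>x. N +>\<^bsub>M\<^esub> x) ` carrier M"
  "\<zero>\<^bsub>FactModule M N\<^esub> = N"
  "X \<oplus>\<^bsub>FactModule M N\<^esub> Y = X <+>\<^bsub>M\<^esub> Y"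
  "a \<odot>\<^bsub>FactModule M N\<^esub> X = (\<Union>x\<in>X. N +>\<^bsub>M\<^esub> (a \<odot>\<^bsub>M\<^esub> x))"
  by (auto simp: FactModule_def A_RCOSETS_def')

lemma nonzerodivisor_on_FactModule:
  assumes "sub N" "a \<in> carrier R"
  shows "nonzerodivisor_on (FactModule M N) a \<longleftrightarrow> regular_mod N a"
  unfolding nonzerodivisor_on_def regular_mod_def
  using assms by (auto simp: FactModule_simps coset_smult coset_eq_zero_iff)

text \<open>The bridge between the definition through quotient modules and the form used in all
  arguments below, where only submodules of M occur.\<close>

lemma regular_sequence_iff:
  "regular_sequence R M as \<longleftrightarrow> set as \<subseteq> carrier R \<and> regular_seq_mod {\<zero>\<^bsub>M\<^esub>} as \<and>
    add_scales (carrier M) {\<zero>\<^bsub>M\<^esub>} as \<noteq> carrier M"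
proof (cases "set as \<subseteq> carrier R")
  case True
  then have t: "set (take i as) \<subseteq> carrier R" for i using set_take_subset[of i as] by blast
  have "nonzerodivisor_on (FactModule M (list_smult R M (take i as))) (as ! i) \<longleftrightarrow>
      regular_mod (add_scales (carrier M) {\<zero>\<^bsub>M\<^esub>} (take i as)) (as ! i)" if "i < length as" for i
    unfolding list_smult_eq[OF t]
    using that True by (intro nonzerodivisor_on_FactModule sub_add_scales sub_whole sub_zero_set t) auto
  then show ?thesis unfolding regular_sequence_def regular_seq_mod_nth list_smult_eq[OF True] by auto
qed (simp add: regular_sequence_def)

lemma coset_image_eq_iff:
  assumes "sub N" "sub X" "N \<subseteq> X" "sub Y" "N \<subseteq> Y"
  shows "(\<lambda>x. N +>\<^bsub>M\<^esub> x) ` X = (\<lambda>x. N +>\<^bsub>M\<^esub> x) ` Y \<longleftrightarrow> X = Y"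
proof -
  have *: "A \<subseteq> B" if "sub A" "sub B" "N \<subseteq> B" "(\<lambda>x. N +>\<^bsub>M\<^esub> x) ` A \<subseteq> (\<lambda>x. N +>\<^bsub>M\<^esub> x) ` B" for A B
  proof
    fix x assume x: "x \<in> A"
    then have xc: "x \<in> carrier M" using sub_carrier[OF that(1)] by blast
    have "N +>\<^bsub>M\<^esub> x \<in> (\<lambda>x. N +>\<^bsub>M\<^esub> x) ` B" using x that(4) by blast
    then obtain y where y: "y \<in> B" "N +>\<^bsub>M\<^esub> x = N +>\<^bsub>M\<^esub> y" by blast
    then have "x \<ominus>\<^bsub>M\<^esub> y \<in> B"
      using coset_eq_iff[OF assms(1) xc sub_carrier[OF that(2) y(1)]] that(3) by blast
    then show "x \<in> B" using sub_add_cancel(3)[OF that(2) y(1) xc] by blast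
  qed
  show ?thesis using *[of X Y] *[of Y X] assms by blast
qed

lemma quotient_filtration_mem:
  assumes "sub N" "sub X" "F n = X" "x \<in> carrier M"
  shows "N +>\<^bsub>M\<^esub> x \<in> quotient_filtration M F N n \<longleftrightarrow> x \<in> X <+>\<^bsub>M\<^esub> N"
proof
  have s: "sub (X <+>\<^bsub>M\<^esub> N)" using assms sub_set_add by blast
  assume "N +>\<^bsub>M\<^esub> x \<in> quotient_filtration M F N n"
  then obtain y where y: "y \<in> X <+>\<^bsub>M\<^esub> N" "N +>\<^bsub>M\<^esub> x = N +>\<^bsub>M\<^esub> y"
    unfolding quotient_filtration_def assms(3) by blast
  then have "x \<ominus>\<^bsub>M\<^esub> y \<in> N" using coset_eq_iff[OF assms(1,4)] sub_carrier[OF s] by metis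
  then have "x \<ominus>\<^bsub>M\<^esub> y \<in> X <+>\<^bsub>M\<^esub> N" using set_add_right assms by blast
  then show "x \<in> X <+>\<^bsub>M\<^esub> N" using sub_add_cancel(3)[OF s y(1) assms(4)] by blast
qed (auto simp: quotient_filtration_def assms(3))

text \<open>Both sides of the superficial equation are images of submodules containing N under the
  coset map, and on such submodules this map is injective by
  \<open>coset_image_eq_iff\<close>.\<close>

lemma superficial_element_FactModule:
  assumes "sub N" "\<And>n. sub (F n)" "a \<in> carrier R"
  shows "superficial_element \<qq> (FactModule M N) (quotient_filtration M F N) a \<longleftrightarrow>
    a \<in> \<qq> \<and> (\<exists>c. \<forall>n\<ge>c. colon (F (Suc n) <+>\<^bsub>M\<^esub> N) a \<inter> (F c <+>\<^bsub>M\<^esub> N) = F n <+>\<^bsub>M\<^esub> N)"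
proof -
  note mem = quotient_filtration_mem[OF assms(1,2) refl]
  have s: "\<And>n. F n <+>\<^bsub>M\<^esub> N \<subseteq> carrier M" using assms sub_set_add sub_subset by blast
  have 1: "{X \<in> carrier (FactModule M N). a \<odot>\<^bsub>FactModule M N\<^esub> X \<in> quotient_filtration M F N (Suc n)} \<inter>
      quotient_filtration M F N c = (\<lambda>x. N +>\<^bsub>M\<^esub> x) ` (colon (F (Suc n) <+>\<^bsub>M\<^esub> N) a \<inter> (F c <+>\<^bsub>M\<^esub> N))" for n c
    using assms by (auto simp: FactModule_simps coset_smult colon_def mem intro!: imageI)
  have 2: "(\<lambda>x. N +>\<^bsub>M\<^esub> x) ` X = quotient_filtration M F N n \<longleftrightarrow> X = F n <+>\<^bsub>M\<^esub> N"
    if "X = colon (F (Suc k) <+>\<^bsub>M\<^esub> N) a \<inter> (F c <+>\<^bsub>M\<^esub> N)" for X n k c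
  proof -
    have Fk: "sub (F (Suc k) <+>\<^bsub>M\<^esub> N)" "sub (F c <+>\<^bsub>M\<^esub> N)"
      using assms sub_set_add by blast+
    have X: "sub X" "N \<subseteq> X" unfolding that
      using sub_Int[OF sub_colon[OF assms(3) Fk(1)] Fk(2)] set_add_right[OF assms(2) assms(1), of c]
        set_add_right[OF assms(2) assms(1), of "Suc k"] subset_colon[OF assms(3) Fk(1)] by auto
    have Y: "sub (F n <+>\<^bsub>M\<^esub> N)" "N \<subseteq> F n <+>\<^bsub>M\<^esub> N"
      using assms sub_set_add set_add_right by blast+
    show ?thesis unfolding quotient_filtration_def by (rule coset_image_eq_iff[OF assms(1) X Y])
  qed
  show ?thesis
    unfolding superficial_element_def 1 2[OF refl] ..
qed

lemma nilpotent_modulo_iff: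
  assumes "\<And>n. sub (F n)" "set as \<subseteq> carrier R"
  shows "nilpotent_modulo R M F as \<longleftrightarrow>
    (\<exists>n0. \<forall>n\<ge>n0. F n \<subseteq> add_scales (carrier M) {\<zero>\<^bsub>M\<^esub>} as)"
proof -
  let ?N = "add_scales (carrier M) {\<zero>\<^bsub>M\<^esub>} as"
  have N: "sub ?N" using assms sub_add_scales sub_whole sub_zero_set by blast
  have "quotient_filtration M F ?N n = {?N} \<longleftrightarrow> F n \<subseteq> ?N" for n
  proof -
    have s: "sub (F n <+>\<^bsub>M\<^esub> ?N)" using assms N sub_set_add by blast
    have "quotient_filtration M F ?N n = {?N} \<longleftrightarrow> F n <+>\<^bsub>M\<^esub> ?N \<subseteq> ?N"
      using sub_zero[OF s] coset_eq_zero_iff[OF N] sub_carrier[OF s]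
      by (auto simp: quotient_filtration_def)
    also have "\<dots> \<longleftrightarrow> F n \<subseteq> ?N"
      using set_add_least[OF N, of "F n" ?N] set_add_left[OF assms(1)[of n] N] by blast
    finally show ?thesis .
  qed
  then show ?thesis
    unfolding nilpotent_modulo_def nilpotent_filtration_def Let_def list_smult_eq[OF assms(2)]
    by (simp add: FactModule_simps)
qed

end

section \<open>Prime ideals and Noetherian modules\<close>

lemma idealD:
  fixes R (structure)
  assumes "ideal I R"
  shows ideal_carrier: "x \<in> I \<Longrightarrow> x \<in> carrier R"
    and ideal_zero: "\<zero> \<in> I"
    and ideal_add: "x \<in> I \<Longrightarrow> y \<in> I \<Longrightarrow> x \<oplus> y \<in> I"
    and ideal_neg: "x \<in> I \<Longrightarrow> \<ominus> x \<in> I"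
    and ideal_mult_l: "x \<in> I \<Longrightarrow> a \<in> carrier R \<Longrightarrow> a \<otimes> x \<in> I"
    and ideal_mult_r: "x \<in> I \<Longrightarrow> a \<in> carrier R \<Longrightarrow> x \<otimes> a \<in> I"
    and ideal_subset: "I \<subseteq> carrier R"
proof -
  interpret ideal I R by fact
  show "x \<in> I \<Longrightarrow> x \<in> carrier R" "\<zero> \<in> I" "x \<in> I \<Longrightarrow> y \<in> I \<Longrightarrow> x \<oplus> y \<in> I"
    "x \<in> I \<Longrightarrow> \<ominus> x \<in> I" "x \<in> I \<Longrightarrow> a \<in> carrier R \<Longrightarrow> a \<otimes> x \<in> I"
    "x \<in> I \<Longrightarrow> a \<in> carrier R \<Longrightarrow> x \<otimes> a \<in> I" "I \<subseteq> carrier R"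
    using I_l_closed I_r_closed a_subset by (auto simp: Icarr)
qed

lemma primeidealD:
  fixes R (structure)
  assumes "primeideal P R"
  shows prime_ideal: "ideal P R"
    and prime_one: "\<one> \<notin> P"
    and prime_mult: "a \<in> carrier R \<Longrightarrow> b \<in> carrier R \<Longrightarrow> a \<otimes> b \<in> P \<Longrightarrow> a \<in> P \<or> b \<in> P"
    and prime_ne: "P \<noteq> carrier R"
proof -
  interpret primeideal P R by fact
  show "ideal P R" "a \<in> carrier R \<Longrightarrow> b \<in> carrier R \<Longrightarrow> a \<otimes> b \<in> P \<Longrightarrow> a \<in> P \<or> b \<in> P" "P \<noteq> carrier R"
    using is_ideal I_prime I_notcarr by auto
  show "\<one> \<notin> P" using one_imp_carrier I_notcarr by auto
qed

section \<open>Maximality arguments, prime avoidance and powers of ideals\<close>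

context cring
begin

lemma ideal_adjoin:
  assumes "ideal P R" "x \<in> carrier R"
  shows "ideal (P <+>\<^bsub>R\<^esub> PIdl x) R" "P \<subseteq> P <+>\<^bsub>R\<^esub> PIdl x" "x \<in> P <+>\<^bsub>R\<^esub> PIdl x"
    "y \<in> P <+>\<^bsub>R\<^esub> PIdl x \<Longrightarrow> \<exists>p\<in>P. \<exists>r\<in>carrier R. y = p \<oplus> r \<otimes> x"
proof -
  note P = idealD[OF assms(1)]
  note X = idealD[OF cgenideal_ideal[OF assms(2)]]
  show "ideal (P <+>\<^bsub>R\<^esub> PIdl x) R" using add_ideals assms cgenideal_ideal by blast
  show "P \<subseteq> P <+>\<^bsub>R\<^esub> PIdl x" using P X(2) r_zero unfolding set_add_def' by force
  show "x \<in> P <+>\<^bsub>R\<^esub> PIdl x"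
    using P(2) cgenideal_self[OF assms(2)] l_zero[OF assms(2)] unfolding set_add_def' by force
  show "\<exists>p\<in>P. \<exists>r\<in>carrier R. y = p \<oplus> r \<otimes> x" if "y \<in> P <+>\<^bsub>R\<^esub> PIdl x"
    using that unfolding set_add_def' cgenideal_def by auto
qed

text \<open>The computation behind "maximal implies prime": if x y lies in P, then (P + (x)) (P +
  (y)) stays in P, although for x and y outside P both factors are strictly larger than P.\<close>

lemma ideal_adjoin_mult:
  assumes "ideal P R" "p \<in> P" "p' \<in> P" "r \<in> carrier R" "r' \<in> carrier R"
    "x \<in> carrier R" "y \<in> carrier R" "x \<otimes> y \<in> P"
  shows "(p \<oplus> r \<otimes> x) \<otimes> (p' \<oplus> r' \<otimes> y) \<in> P"
proof -
  note P = idealD[OF assms(1)]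
  have c: "p \<in> carrier R" "p' \<in> carrier R" using assms P(1) by auto
  have "(p \<oplus> r \<otimes> x) \<otimes> (p' \<oplus> r' \<otimes> y) = p \<otimes> (p' \<oplus> r' \<otimes> y) \<oplus> ((r \<otimes> x) \<otimes> p' \<oplus> (r \<otimes> r') \<otimes> (x \<otimes> y))"
    using c assms(4-7) by algebra
  moreover have "p \<otimes> (p' \<oplus> r' \<otimes> y) \<in> P" "(r \<otimes> x) \<otimes> p' \<in> P" "(r \<otimes> r') \<otimes> (x \<otimes> y) \<in> P"
    using P(5,6) assms c by simp_all
  ultimately show ?thesis using P(3) by simp
qed

lemma prime_pow:
  "primeideal P R \<Longrightarrow> x \<in> carrier R \<Longrightarrow> x [^] (n::nat) \<in> P \<Longrightarrow> x \<in> P"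
proof (induction n)
  case 0 then show ?case using prime_one[of P R] by simp
next
  case (Suc n) then show ?case using prime_mult[of P R "x [^] n" x] by auto
qed

text \<open>Zorn's lemma for two purposes: a multiplicatively closed S makes the result prime
  (\<open>prime_avoiding\<close>), and S = {1} makes it a maximal ideal
  (\<open>exists_maximal\<close>).\<close>

lemma maximal_avoiding:
  assumes "ideal I R" "I \<inter> S = {}"
  obtains P where "ideal P R" "I \<subseteq> P" "P \<inter> S = {}"
    "\<And>J. ideal J R \<Longrightarrow> P \<subset> J \<Longrightarrow> J \<inter> S \<noteq> {}"
proof -
  let ?A = "{J. ideal J R \<and> I \<subseteq> J \<and> J \<inter> S = {}}"
  have "\<exists>P\<in>?A. \<forall>X\<in>?A. P \<subseteq> X \<longrightarrow> X = P"
  proof (rule subset_Zorn_nonempty)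
    have "I \<in> ?A" using assms by simp
    then show "?A \<noteq> {}" by blast
    fix C assume C: "C \<noteq> {}" "subset.chain ?A C"
    then have "subset.chain {J. ideal J R} C" unfolding pred_on.chain_def by auto
    then have "ideal (\<Union>C) R" using chain_Union_is_ideal[of C] C(1) by simp
    moreover have "I \<subseteq> \<Union>C" "\<Union>C \<inter> S = {}" using C unfolding pred_on.chain_def by blast+
    ultimately show "\<Union>C \<in> ?A" by simp
  qed
  then obtain P where P: "P \<in> ?A" "\<forall>X\<in>?A. P \<subseteq> X \<longrightarrow> X = P" by (rule bexE)
  show thesis
  proof (rule that[of P])
    fix J assume J: "ideal J R" "P \<subset> J"
    have "J \<in> ?A \<Longrightarrow> J = P" using P(2) J(2) by simp
    then show "J \<inter> S \<noteq> {}" using P(1) J by auto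
  qed (use P(1) in auto)
qed

lemma prime_avoiding:
  assumes "ideal I R" "I \<inter> S = {}" "S \<subseteq> carrier R" "\<one> \<in> S"
    and mult: "\<And>x y. x \<in> S \<Longrightarrow> y \<in> S \<Longrightarrow> x \<otimes> y \<in> S"
  obtains P where "primeideal P R" "I \<subseteq> P" "P \<inter> S = {}"
proof -
  obtain P where P: "ideal P R" "I \<subseteq> P" "P \<inter> S = {}"
    "\<And>J. ideal J R \<Longrightarrow> P \<subset> J \<Longrightarrow> J \<inter> S \<noteq> {}" using maximal_avoiding[OF assms(1,2)] by metis
  note Pi = idealD[OF P(1)]
  have "primeideal P R"
  proof (rule primeidealI[OF P(1) is_cring])
    show "carrier R \<noteq> P" using P(3) assms(4) by auto
    fix x y assume xy: "x \<in> carrier R" "y \<in> carrier R" "x \<otimes> y \<in> P"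
    show "x \<in> P \<or> y \<in> P"
    proof (rule ccontr)
      assume n: "\<not> (x \<in> P \<or> y \<in> P)"
      have "\<exists>p\<in>P. \<exists>r\<in>carrier R. p \<oplus> r \<otimes> z \<in> S" if z: "z \<in> carrier R" "z \<notin> P" for z
      proof -
        have "P \<subset> P <+>\<^bsub>R\<^esub> PIdl z" using ideal_adjoin(2,3)[OF P(1) z(1)] z(2) by blast
        then obtain s where "s \<in> P <+>\<^bsub>R\<^esub> PIdl z" "s \<in> S"
          using P(4)[OF ideal_adjoin(1)[OF P(1) z(1)]] by blast
        then show ?thesis using ideal_adjoin(4)[OF P(1) z(1)] by blast
      qed
      then obtain p r p' r' where s: "p \<in> P" "r \<in> carrier R" "p \<oplus> r \<otimes> x \<in> S"
        "p' \<in> P" "r' \<in> carrier R" "p' \<oplus> r' \<otimes> y \<in> S" using xy n by metis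
      have "(p \<oplus> r \<otimes> x) \<otimes> (p' \<oplus> r' \<otimes> y) \<in> P"
        using ideal_adjoin_mult[OF P(1)] s xy by blast
      then show False using mult[OF s(3,6)] P(3) by blast
    qed
  qed
  then show thesis using that P by blast
qed

lemma exists_maximal:
  assumes "ideal I R" "I \<noteq> carrier R"
  obtains Q where "maximalideal Q R" "I \<subseteq> Q"
proof -
  have "I \<inter> {\<one>} = {}" using ideal.one_imp_carrier[OF assms(1)] assms(2) by auto
  then obtain P where P: "ideal P R" "I \<subseteq> P" "P \<inter> {\<one>} = {}"
    "\<And>J. ideal J R \<Longrightarrow> P \<subset> J \<Longrightarrow> J \<inter> {\<one>} \<noteq> {}" using maximal_avoiding[OF assms(1)] by metis
  have "maximalideal P R"
  proof (rule maximalidealI[OF P(1)])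
    show "carrier R \<noteq> P" using P(3) by auto
    show "J = P \<or> J = carrier R" if "ideal J R" "P \<subseteq> J" for J
      using P(4)[OF that(1)] that ideal.one_imp_carrier[OF that(1)] by blast
  qed
  then show thesis using that P by blast
qed

text \<open>Pick for each Q an element of \<open>Q \<inter> I\<close> outside P and multiply;
  primality of P keeps the product outside P.\<close>

lemma prime_product:
  assumes "primeideal P R" "ideal I R" "finite \<Q>" "\<Q> \<noteq> {}"
    and "\<And>Q. Q \<in> \<Q> \<Longrightarrow> ideal Q R \<and> \<not> Q \<inter> I \<subseteq> P"
  shows "\<exists>y\<in>I. y \<notin> P \<and> (\<forall>Q\<in>\<Q>. y \<in> Q)"
  using assms(3,4,5)
proof (induction \<Q> rule: finite_ne_induct)
  case (singleton Q) then show ?case by blast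
next
  case (insert Q \<Q>)
  then obtain y where y: "y \<in> I" "y \<notin> P" "\<forall>Q\<in>\<Q>. y \<in> Q" by blast
  obtain z where z: "z \<in> I" "z \<in> Q" "z \<notin> P" using insert.prems by blast
  have c: "y \<in> carrier R" "z \<in> carrier R" using y z ideal_carrier[OF assms(2)] by auto
  have "y \<otimes> z \<in> I" "y \<otimes> z \<notin> P"
    using y z c ideal_mult_l[OF assms(2)] prime_mult[OF assms(1) c] by auto
  moreover have "y \<otimes> z \<in> Q'" if "Q' \<in> insert Q \<Q>" for Q'
  proof (cases "Q' = Q")
    case True then show ?thesis using ideal_mult_l[of Q R z y] z c insert.prems by simp
  next
    case False then show ?thesis using ideal_mult_r[of Q' R y z] y c insert.prems that by simp
  qed
  ultimately show ?case by blast
qed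

lemma prime_avoidance:
  assumes "finite \<P>" "ideal I R" "\<And>P. P \<in> \<P> \<Longrightarrow> primeideal P R \<and> \<not> I \<subseteq> P"
  shows "\<exists>x\<in>I. \<forall>P\<in>\<P>. x \<notin> P"
  using assms(1,3)
proof (induction "card \<P>" arbitrary: \<P>)
  case 0 then show ?case using ideal_zero[OF assms(2)] by auto
next
  case (Suc n)
  note I = idealD[OF assms(2)]
  have "\<exists>x\<in>I. \<forall>P'\<in>\<P> - {P}. x \<notin> P'" if "P \<in> \<P>" for P
  proof (rule Suc.hyps(1))
    show "n = card (\<P> - {P})" using Suc.hyps(2) that by simp
    show "finite (\<P> - {P})" using Suc.prems(1) by simp
  qed (use Suc.prems(2) in blast)
  then obtain f where f: "\<And>P. P \<in> \<P> \<Longrightarrow> f P \<in> I" "\<And>P P'. P \<in> \<P> \<Longrightarrow> P' \<in> \<P> - {P} \<Longrightarrow> f P \<notin> P'" by metis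
  obtain P where P: "P \<in> \<P>" using Suc.hyps(2) by fastforce
  show ?case
  \<comment> \<open>By induction \<open>f P\<close> lies in I and in no prime other than P. If some
    \<open>f P\<close> avoids P too, it is the required element.\<close>
  proof (cases "\<forall>P\<in>\<P>. f P \<in> P")
    case False then show ?thesis using f by blast
  next
    case True
    show ?thesis
    proof (cases "\<P> - {P} = {}")
      case True then show ?thesis using Suc.prems(2)[OF P] P by blast
    next
      case False
      have "\<exists>y\<in>I. y \<notin> P \<and> (\<forall>Q\<in>\<P> - {P}. y \<in> Q)"
      proof (rule prime_product[OF _ assms(2)])
        show "primeideal P R" using Suc.prems P by blast
        show "finite (\<P> - {P})" "\<P> - {P} \<noteq> {}" using Suc.prems False by auto
        fix Q assume "Q \<in> \<P> - {P}"
        then show "ideal Q R \<and> \<not> Q \<inter> I \<subseteq> P"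
          using Suc.prems prime_ideal f(1)[of Q] f(2)[of Q P] True P by blast
      qed
      then obtain y where y: "y \<in> I" "y \<notin> P" "\<And>Q. Q \<in> \<P> - {P} \<Longrightarrow> y \<in> Q" by blast
      have c: "f P \<in> carrier R" "y \<in> carrier R" using y f(1)[OF P] I(1) by auto
      have *: "z \<in> Q" if "ideal Q R" "w \<oplus> z \<in> Q" "w \<in> Q" "z \<in> carrier R" for Q w z
      proof -
        note Q = idealD[OF that(1)]
        have "z = \<ominus> w \<oplus> (w \<oplus> z)" using that Q(1) by algebra
        then show ?thesis using Q(3,4) that by metis
      qed
      \<comment> \<open>\<open>f P\<close> lies in P and in no other prime, y lies in all the other
        primes and not in P; so the sum lies in none.\<close>
      have "f P \<oplus> y \<notin> Q" if Q: "Q \<in> \<P>" for Q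
      proof (cases "Q = P")
        case True then show ?thesis
          using *[of P "f P" y] \<open>\<forall>P\<in>\<P>. f P \<in> P\<close> P y c Suc.prems(2) prime_ideal by blast
      next
        case False
        then have Q: "Q \<in> \<P> - {P}" using Q by blast
        then show ?thesis
          using *[of Q y "f P"] y(3)[OF Q] f(2)[OF P Q] c Suc.prems(2) prime_ideal a_comm[OF c] by auto
      qed
      then show ?thesis using I(3) f(1)[OF P] y(1) by blast
    qed
  qed
qed

lemma ideal_power_ideal: "ideal I R \<Longrightarrow> ideal (ideal_power R I n) R"
  by (induction n) (auto simp: oneideal ideal_prod_is_ideal)

lemma ideal_power_one: "ideal I R \<Longrightarrow> ideal_power R I 1 = I"
  using ideal_prod_one ideal_prod_commute oneideal by simp

lemma ideal_power_add:
  "ideal I R \<Longrightarrow> ideal_power R I (i + j) = ideal_prod R (ideal_power R I i) (ideal_power R I j)"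
proof (induction i)
  case 0 then show ?case
    using ideal_prod_one ideal_prod_commute[OF oneideal] ideal_power_ideal by simp
next
  case (Suc i) then show ?case
    using ideal_prod_assoc[OF Suc.prems ideal_power_ideal ideal_power_ideal] by simp
qed

lemma ideal_power_mult:
  "ideal I R \<Longrightarrow> a \<in> ideal_power R I i \<Longrightarrow> b \<in> ideal_power R I j \<Longrightarrow> a \<otimes> b \<in> ideal_power R I (i + j)"
  unfolding ideal_power_add by (rule ideal_prod.prod)

lemma ideal_power_Suc_subset: "ideal I R \<Longrightarrow> ideal_power R I (Suc n) \<subseteq> ideal_power R I n"
  using ideal_prod_inter[OF _ ideal_power_ideal] by auto

lemma pow_in_ideal_power: "ideal I R \<Longrightarrow> x \<in> I \<Longrightarrow> x [^] (n::nat) \<in> ideal_power R I n"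
proof (induction n)
  case (Suc n) then show ?case
    using ideal_prod.prod[of x I "x [^] n" "ideal_power R I n" R] ideal_carrier[of I R x]
      nat_pow_Suc2[of x n] by simp
qed simp

lemma ideal_prod_least:
  assumes "ideal K R" "\<And>a b. a \<in> I \<Longrightarrow> b \<in> J \<Longrightarrow> a \<otimes> b \<in> K"
  shows "ideal_prod R I J \<subseteq> K"
proof
  show "x \<in> K" if "x \<in> ideal_prod R I J" for x
    using that
  proof (induction rule: ideal_prod.induct)
    case (prod i j) then show ?case by (rule assms(2))
  next
    case (sum s t) then show ?case by (intro ideal_add[OF assms(1)])
  qed
qed

end

lemma (in noetherian_ring) ideal_maximal:
  assumes "\<C> \<noteq> {}" "\<And>I. I \<in> \<C> \<Longrightarrow> ideal I R"
  shows "\<exists>P\<in>\<C>. \<forall>J\<in>\<C>. P \<subseteq> J \<longrightarrow> J = P"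
proof (rule subset_Zorn_nonempty[OF assms(1)])
  fix C assume C: "C \<noteq> {}" "subset.chain \<C> C"
  then have C': "C \<subseteq> \<C>" "\<forall>x\<in>C. \<forall>y\<in>C. x \<subset> y \<or> x = y \<or> y \<subset> x"
    unfolding pred_on.chain_def by (auto simp: less_le)
  have "C \<subseteq> {J. ideal J R}"
  proof
    fix I assume "I \<in> C"
    then have "I \<in> \<C>" by (rule subsetD[OF C'(1)])
    then show "I \<in> {J. ideal J R}" using assms(2) by simp
  qed
  then have "subset.chain {J. ideal J R} C" using C'(2) unfolding pred_on.chain_def less_le by simp blast
  then have "\<Union>C \<in> C" by (rule ideal_chain_is_trivial[OF C(1)])
  then show "\<Union>C \<in> \<C>" using C'(1) by (rule subsetD[rotated])
qed

text \<open>A maximal ideal among those containing \<open>I\<close> but no power of \<open>\<aa>\<close> would be prime.\<close>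

lemma ideal_power_subset:
  fixes R (structure)
  assumes "cring R" "noetherian_ring R" "ideal I R" "ideal \<aa> R"
    and primes: "\<And>P. primeideal P R \<Longrightarrow> I \<subseteq> P \<Longrightarrow> \<aa> \<subseteq> P"
  shows "\<exists>k. ideal_power R \<aa> k \<subseteq> I"
proof (rule ccontr)
  interpret cring R by fact
  interpret noetherian_ring R by fact
  assume no: "\<nexists>k. ideal_power R \<aa> k \<subseteq> I"
  let ?C = "{J. ideal J R \<and> I \<subseteq> J \<and> (\<forall>k. \<not> ideal_power R \<aa> k \<subseteq> J)}"
  have "\<exists>P\<in>?C. \<forall>J\<in>?C. P \<subseteq> J \<longrightarrow> J = P" by (rule ideal_maximal) (use no assms(3) in auto)
  then obtain P where P: "P \<in> ?C" "\<forall>J\<in>?C. P \<subseteq> J \<longrightarrow> J = P" by (rule bexE)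
  then have Pi: "ideal P R" by simp
  note Pd = idealD[OF Pi]
  have "primeideal P R"
  proof (rule primeidealI[OF Pi is_cring])
    show "carrier R \<noteq> P" using P(1) ideal_subset[OF ideal_power_ideal[OF assms(4)]] by blast
    fix x y assume xy: "x \<in> carrier R" "y \<in> carrier R" "x \<otimes> y \<in> P"
    show "x \<in> P \<or> y \<in> P"
    proof (rule ccontr)
      assume n: "\<not> (x \<in> P \<or> y \<in> P)"
      have *: "\<exists>k. ideal_power R \<aa> k \<subseteq> P <+>\<^bsub>R\<^esub> PIdl z" if z: "z \<in> carrier R" "z \<notin> P" for z
      proof (rule ccontr)
        assume "\<not> ?thesis"
        then have "P <+>\<^bsub>R\<^esub> PIdl z \<in> ?C" using ideal_adjoin(1,2)[OF Pi z(1)] P(1) by blast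
        then show False using P(2) ideal_adjoin(2,3)[OF Pi z(1)] z(2) by blast
      qed
      then obtain i j where ij: "ideal_power R \<aa> i \<subseteq> P <+>\<^bsub>R\<^esub> PIdl x" "ideal_power R \<aa> j \<subseteq> P <+>\<^bsub>R\<^esub> PIdl y"
        using xy n by metis
      have "ideal_power R \<aa> (i + j) \<subseteq> P"
        unfolding ideal_power_add[OF assms(4)]
      proof (rule ideal_prod_least[OF Pi])
        fix a b assume "a \<in> ideal_power R \<aa> i" "b \<in> ideal_power R \<aa> j"
        then obtain p r p' r' where s: "p \<in> P" "r \<in> carrier R" "a = p \<oplus> r \<otimes> x"
          "p' \<in> P" "r' \<in> carrier R" "b = p' \<oplus> r' \<otimes> y"
          using ij ideal_adjoin(4)[OF Pi] xy by (meson subsetD)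
        then show "a \<otimes> b \<in> P" using ideal_adjoin_mult[OF Pi] xy by blast
      qed
      then show False using P(1) by blast
    qed
  qed
  then have "\<aa> \<subseteq> P" using primes P(1) by blast
  then have "ideal_power R \<aa> 1 \<subseteq> P" using ideal_power_one assms(4) by blast
  then show False using P(1) by blast
qed

lemma ideal_power_subset_nilpotent:
  fixes R (structure)
  assumes "cring R" "noetherian_ring R" "ideal I R" "ideal \<aa> R"
    and nil: "\<And>x. x \<in> \<aa> \<Longrightarrow> \<exists>n::nat. x [^] n \<in> I"
  shows "\<exists>k. ideal_power R \<aa> k \<subseteq> I"
proof (rule ideal_power_subset[OF assms(1-4)])
  interpret cring R by fact
  fix P assume "primeideal P R" "I \<subseteq> P"
  then show "\<aa> \<subseteq> P" using nil prime_pow ideal_carrier[OF assms(4)] by (meson subset_iff)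
qed

section \<open>Annihilators of quotients, chains of primes and Nakayama's lemma\<close>

context module
begin

definition ann_mod :: "'c set \<Rightarrow> 'a set"
  where "ann_mod N = {a \<in> carrier R. \<forall>x\<in>carrier M. a \<odot>\<^bsub>M\<^esub> x \<in> N}"

lemma ideal_ann_mod: "sub N \<Longrightarrow> ideal (ann_mod N) R"
  unfolding ann_mod_def by (rule colon_ideal[OF sub_whole])

lemma ann_mod_mono: "N \<subseteq> K \<Longrightarrow> ann_mod N \<subseteq> ann_mod K"
  by (auto simp: ann_mod_def)

lemma annihilator_eq: "annihilator R M = ann_mod {\<zero>\<^bsub>M\<^esub>}"
  by (auto simp: annihilator_def ann_mod_def)

lemma regular_mod_pow:
  assumes "regular_mod N a" "a \<in> carrier R"
  shows "regular_mod N (a [^] (k::nat))"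
proof (induction k)
  case 0 then show ?case by (simp add: regular_mod_def)
next
  case (Suc k)
  show ?case unfolding regular_mod_def
  proof (intro ballI impI)
    fix u assume u: "u \<in> carrier M" "a [^] Suc k \<odot>\<^bsub>M\<^esub> u \<in> N"
    then have "a [^] k \<odot>\<^bsub>M\<^esub> (a \<odot>\<^bsub>M\<^esub> u) \<in> N" using assms(2) by (simp add: smult_assoc1)
    then have "a \<odot>\<^bsub>M\<^esub> u \<in> N" using Suc u(1) assms(2) by (simp add: regular_mod_def)
    then show "u \<in> N" using assms(1) u(1) by (simp add: regular_mod_def)
  qed
qed

text \<open>The products s a^k with s outside P form a multiplicative set. It misses Ann (M / N),
  since a can be cancelled and Ann (M / N) lies in P. A prime above Ann (M / N) that avoids this set
  lies inside P and omits a, which belongs to P.\<close>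

lemma prime_below:
  assumes "sub N" "a \<in> carrier R" "regular_mod N a" "primeideal P R"
    and ann: "ann_mod (N <+>\<^bsub>M\<^esub> scale a (carrier M)) \<subseteq> P"
  obtains Q where "primeideal Q R" "ann_mod N \<subseteq> Q" "Q \<subset> P"
proof -
  let ?S = "{s \<otimes> a [^] k | s (k::nat). s \<in> carrier R - P}"
  have one: "\<one> \<notin> P" using prime_one assms(4) by blast
  have S1: "s \<in> ?S" if "s \<in> carrier R - P" for s
    using that by (intro CollectI exI[of _ s] exI[of _ "0::nat"]) simp
  have aS: "a \<in> ?S" using one assms(2)
    by (intro CollectI exI[of _ \<one>] exI[of _ "1::nat"]) simp
  have sK: "sub (N <+>\<^bsub>M\<^esub> scale a (carrier M))" using assms sub_set_add sub_scale sub_whole by blast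
  have aP: "a \<in> P" using ann set_add_right[OF assms(1) sub_scale[OF assms(2) sub_whole]] assms(2)
    by (auto simp: ann_mod_def scale_def)
  have "ann_mod N \<inter> ?S = {}"
  proof (rule ccontr)
    assume "ann_mod N \<inter> ?S \<noteq> {}"
    then obtain s and k::nat where s: "s \<in> carrier R" "s \<notin> P" "s \<otimes> a [^] k \<in> ann_mod N" by auto
    have "s \<odot>\<^bsub>M\<^esub> x \<in> N" if x: "x \<in> carrier M" for x
    proof -
      have "a [^] k \<odot>\<^bsub>M\<^esub> (s \<odot>\<^bsub>M\<^esub> x) = (s \<otimes> a [^] k) \<odot>\<^bsub>M\<^esub> x"
        using s x assms(2) R.m_comm[of s "a [^] k"] by (simp add: smult_assoc1)
      also have "\<dots> \<in> N" using s x by (simp add: ann_mod_def)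
      finally show ?thesis using regular_mod_pow[OF assms(3,2), of k] s x by (simp add: regular_mod_def)
    qed
    then have "s \<in> ann_mod N" using s by (simp add: ann_mod_def)
    then show False
      using ann_mod_mono[OF set_add_left[OF assms(1) sub_scale[OF assms(2) sub_whole]]] ann s by blast
  qed
  then obtain Q where Q: "primeideal Q R" "ann_mod N \<subseteq> Q" "Q \<inter> ?S = {}"
  proof (rule R.prime_avoiding[OF ideal_ann_mod[OF assms(1)]])
    show "?S \<subseteq> carrier R" using assms(2) by auto
    show "\<one> \<in> ?S" using S1 one by blast
    fix x y assume "x \<in> ?S" "y \<in> ?S"
    then obtain s t and i j :: nat where st: "s \<in> carrier R - P" "t \<in> carrier R - P"
      "x = s \<otimes> a [^] i" "y = t \<otimes> a [^] j" by auto
    then have "x \<otimes> y = (s \<otimes> t) \<otimes> a [^] (i + j)" using assms(2)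
      by (simp add: R.m_ac R.nat_pow_mult[symmetric])
    moreover have "s \<otimes> t \<in> carrier R - P" using st prime_mult[OF assms(4)] by auto
    ultimately show "x \<otimes> y \<in> ?S" by blast
  qed blast
  have "Q \<subseteq> P" using Q(3) S1 ideal_carrier[OF prime_ideal[OF Q(1)]] by blast
  moreover have "a \<notin> Q" using aS Q(3) by blast
  ultimately show thesis using that Q aP by blast
qed

text \<open>Each regular element leaves room for a strictly smaller prime, so a regular sequence
  prolongs a chain downwards by its length. With n = 0 this bounds depth by dimension at a prime;
  with n = 1 it bounds the length of a maximal superficial sequence.\<close>

lemma prime_chain_extend:
  assumes "sub N" "set as \<subseteq> carrier R" "regular_seq_mod N as"
    and "prime_chain R C n" "ann_mod (add_scales (carrier M) N as) \<subseteq> C 0"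
  shows "\<exists>P. prime_chain R P (length as + n) \<and> ann_mod N \<subseteq> P 0 \<and> P (length as + n) = C n"
  using assms(1-3,5)
proof (induction as arbitrary: N)
  case Nil then show ?case using assms(4) by auto
next
  case (Cons a as)
  let ?N = "N <+>\<^bsub>M\<^esub> scale a (carrier M)"
  have N: "sub ?N" using Cons.prems sub_set_add sub_scale sub_whole by auto
  obtain P where P: "prime_chain R P (length as + n)" "ann_mod ?N \<subseteq> P 0" "P (length as + n) = C n"
    using Cons.IH[OF N] Cons.prems by auto
  have "primeideal (P 0) R" using P(1) by (auto simp: prime_chain_def)
  then obtain Q where Q: "primeideal Q R" "ann_mod N \<subseteq> Q" "Q \<subset> P 0"
    using prime_below[of N a "P 0"] Cons.prems P(2) by auto
  let ?P = "\<lambda>i. case i of 0 \<Rightarrow> Q | Suc j \<Rightarrow> P j"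
  have "prime_chain R ?P (Suc (length as + n))"
    using P(1) Q unfolding prime_chain_def by (auto split: nat.splits)
  then show ?case using Q P(3) by (intro exI[of _ ?P]) simp
qed

subsection \<open>Generators\<close>

definition cyclic :: "'c \<Rightarrow> 'c set"
  where "cyclic x = (\<lambda>a. a \<odot>\<^bsub>M\<^esub> x) ` carrier R"

lemma sub_ideal_cyclic:
  assumes "ideal I R" "x \<in> carrier M"
  shows "sub ((\<lambda>a. a \<odot>\<^bsub>M\<^esub> x) ` I)"
proof (rule submoduleI)
  note I = idealD[OF assms(1)]
  show "(\<lambda>a. a \<odot>\<^bsub>M\<^esub> x) ` I \<subseteq> carrier M" using I assms by auto
  show "\<zero>\<^bsub>M\<^esub> \<in> (\<lambda>a. a \<odot>\<^bsub>M\<^esub> x) ` I" using I(2) smult_l_null[OF assms(2)] by force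
  show "\<ominus>\<^bsub>M\<^esub> u \<in> (\<lambda>a. a \<odot>\<^bsub>M\<^esub> x) ` I" if u: "u \<in> (\<lambda>a. a \<odot>\<^bsub>M\<^esub> x) ` I" for u
  proof -
    from u obtain a where "a \<in> I" "u = a \<odot>\<^bsub>M\<^esub> x" by blast
    then show ?thesis using I smult_l_minus[of a x] assms(2) by (metis image_eqI)
  qed
  show "u \<oplus>\<^bsub>M\<^esub> v \<in> (\<lambda>a. a \<odot>\<^bsub>M\<^esub> x) ` I"
    if uv: "u \<in> (\<lambda>a. a \<odot>\<^bsub>M\<^esub> x) ` I" "v \<in> (\<lambda>a. a \<odot>\<^bsub>M\<^esub> x) ` I" for u v
  proof -
    from uv obtain a b where "a \<in> I" "u = a \<odot>\<^bsub>M\<^esub> x" "b \<in> I" "v = b \<odot>\<^bsub>M\<^esub> x" by blast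
    then show ?thesis using I smult_l_distr[of a b x] assms(2) by (metis image_eqI)
  qed
  show "c \<odot>\<^bsub>M\<^esub> u \<in> (\<lambda>a. a \<odot>\<^bsub>M\<^esub> x) ` I"
    if c: "c \<in> carrier R" and u: "u \<in> (\<lambda>a. a \<odot>\<^bsub>M\<^esub> x) ` I" for c u
  proof -
    from u obtain a where "a \<in> I" "u = a \<odot>\<^bsub>M\<^esub> x" by blast
    then show ?thesis using I c smult_assoc1[of c a x] assms(2) by (metis image_eqI)
  qed
qed

lemma sub_cyclic: "x \<in> carrier M \<Longrightarrow> sub (cyclic x)"
  unfolding cyclic_def by (rule sub_ideal_cyclic[OF R.oneideal])

lemma cyclic_self: "x \<in> carrier M \<Longrightarrow> x \<in> cyclic x"
  unfolding cyclic_def by (rule image_eqI[of _ _ \<one>]) auto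

lemma span_insert_subset:
  assumes "x \<in> carrier M" "S \<subseteq> carrier M"
  shows "submodule_span R M (insert x S) \<subseteq> cyclic x <+>\<^bsub>M\<^esub> submodule_span R M S"
proof (rule span_least)
  have s: "sub (cyclic x)" "sub (submodule_span R M S)" using assms sub_cyclic sub_span by auto
  then show "sub (cyclic x <+>\<^bsub>M\<^esub> submodule_span R M S)" by (rule sub_set_add)
  show "insert x S \<subseteq> cyclic x <+>\<^bsub>M\<^esub> submodule_span R M S"
    using set_add_left[OF s] set_add_right[OF s] cyclic_self[OF assms(1)] span_superset by blast
qed

lemma span_mono: "S \<subseteq> T \<Longrightarrow> submodule_span R M S \<subseteq> submodule_span R M T"
  unfolding submodule_span_def by auto

lemma span_empty: "submodule_span R M {} = {\<zero>\<^bsub>M\<^esub>}"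
  using span_least[OF sub_zero_set, of "{}"] sub_zero[OF sub_span[of "{}"]] by auto

lemma ideal_smult_span_insert:
  assumes "ideal Q R" "x \<in> carrier M" "S \<subseteq> carrier M"
  shows "ideal_smult R M Q (submodule_span R M (insert x S)) \<subseteq>
    (\<lambda>q. q \<odot>\<^bsub>M\<^esub> x) ` Q <+>\<^bsub>M\<^esub> ideal_smult R M Q (submodule_span R M S)"
proof (rule ideal_smult_least)
  note Q = idealD[OF assms(1)]
  have s: "sub (submodule_span R M S)" using assms sub_span by blast
  have i: "sub (ideal_smult R M Q (submodule_span R M S))" using Q(7) sub_ideal_smult sub_subset[OF s] by blast
  show "sub ((\<lambda>q. q \<odot>\<^bsub>M\<^esub> x) ` Q <+>\<^bsub>M\<^esub> ideal_smult R M Q (submodule_span R M S))"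
    using sub_set_add sub_ideal_cyclic assms i by blast
  fix a z assume a: "a \<in> Q" and "z \<in> submodule_span R M (insert x S)"
  then obtain b y where bz: "b \<in> carrier R" "y \<in> submodule_span R M S" "z = b \<odot>\<^bsub>M\<^esub> x \<oplus>\<^bsub>M\<^esub> y"
    using span_insert_subset[OF assms(2,3)] by (auto simp: cyclic_def set_add_iff subset_iff)
  then have "a \<odot>\<^bsub>M\<^esub> z = (a \<otimes> b) \<odot>\<^bsub>M\<^esub> x \<oplus>\<^bsub>M\<^esub> a \<odot>\<^bsub>M\<^esub> y"
    using Q(1)[OF a] assms sub_carrier[OF s] by (simp add: smult_r_distr smult_assoc1)
  then show "a \<odot>\<^bsub>M\<^esub> z \<in> (\<lambda>q. q \<odot>\<^bsub>M\<^esub> x) ` Q <+>\<^bsub>M\<^esub> ideal_smult R M Q (submodule_span R M S)"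
    using set_addI ideal_smultI[OF a bz(2)] Q(6)[OF a bz(1)] by auto
qed

text \<open>The generators are eliminated one at a time.\<close>

lemma nakayama_prime:
  assumes "primeideal Q R" "sub K" "finite S" "S \<subseteq> carrier M" "s \<in> carrier R - Q"
    and "\<And>x. x \<in> S \<Longrightarrow> s \<odot>\<^bsub>M\<^esub> x \<in> K <+>\<^bsub>M\<^esub> ideal_smult R M Q (submodule_span R M S)"
  shows "\<exists>t\<in>carrier R - Q. \<forall>x\<in>S. t \<odot>\<^bsub>M\<^esub> x \<in> K"
  using assms(3-6)
proof (induction S arbitrary: s rule: finite_induct)
  case (insert x S)
  note Qi = prime_ideal[OF assms(1)]
  note Q = idealD[OF Qi]
  let ?X = "submodule_span R M S" and ?Y = "submodule_span R M (insert x S)"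
  have X: "sub ?X" using insert.prems sub_span by blast
  have IX: "sub (ideal_smult R M Q ?X)" using Q(7) sub_ideal_smult sub_subset[OF X] by blast
  have KX: "sub (K <+>\<^bsub>M\<^esub> ideal_smult R M Q ?X)" using assms(2) IX sub_set_add by blast
  have dec: "\<exists>k\<in>K. \<exists>q\<in>Q. \<exists>w\<in>ideal_smult R M Q ?X. s \<odot>\<^bsub>M\<^esub> y = k \<oplus>\<^bsub>M\<^esub> (q \<odot>\<^bsub>M\<^esub> x \<oplus>\<^bsub>M\<^esub> w)"
    if y: "y \<in> insert x S" for y
  proof -
    obtain k z where "k \<in> K" "z \<in> ideal_smult R M Q ?Y" "s \<odot>\<^bsub>M\<^esub> y = k \<oplus>\<^bsub>M\<^esub> z"
      using insert.prems(3)[OF y] by (auto simp: set_add_iff)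
    moreover have "z \<in> (\<lambda>q. q \<odot>\<^bsub>M\<^esub> x) ` Q <+>\<^bsub>M\<^esub> ideal_smult R M Q ?X"
      using ideal_smult_span_insert[OF Qi, of x S] insert.prems(1) calculation(2) by blast
    ultimately show ?thesis by (auto simp: set_add_iff)
  qed
  have xc: "x \<in> carrier M" and Sc: "S \<subseteq> carrier M" and sc: "s \<in> carrier R" "s \<notin> Q" using insert.prems by auto
  obtain k q w where kqw: "k \<in> K" "q \<in> Q" "w \<in> ideal_smult R M Q ?X"
    "s \<odot>\<^bsub>M\<^esub> x = k \<oplus>\<^bsub>M\<^esub> (q \<odot>\<^bsub>M\<^esub> x \<oplus>\<^bsub>M\<^esub> w)" using dec[of x] by blast
  \<comment> \<open>Moving q x to the left leaves t x = k + w, where x no longer occurs on the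
    right; t stays outside Q because s is outside and q inside.\<close>
  define t where "t = s \<oplus> \<ominus> q"
  have c: "q \<in> carrier R" "k \<in> carrier M" "w \<in> carrier M" using kqw Q(1) sub_carrier assms(2) IX by auto
  have "t \<notin> Q"
  proof
    assume "t \<in> Q"
    then have "t \<oplus> q \<in> Q" using Q(3) kqw by blast
    moreover have "t \<oplus> q = s" unfolding t_def using sc c by algebra
    ultimately show False using sc by simp
  qed
  then have t: "t \<in> carrier R" "t \<notin> Q" unfolding t_def using sc c by auto
  have "t \<odot>\<^bsub>M\<^esub> x = (k \<oplus>\<^bsub>M\<^esub> (q \<odot>\<^bsub>M\<^esub> x \<oplus>\<^bsub>M\<^esub> w)) \<oplus>\<^bsub>M\<^esub> \<ominus>\<^bsub>M\<^esub> (q \<odot>\<^bsub>M\<^esub> x)"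
    unfolding t_def using sc c xc kqw(4) by (simp add: smult_l_distr smult_l_minus)
  also have "\<dots> = k \<oplus>\<^bsub>M\<^esub> w" using c xc by (simp add: M.a_ac M.r_neg M.r_neg1 M.r_neg2)
  finally have tx: "t \<odot>\<^bsub>M\<^esub> x = k \<oplus>\<^bsub>M\<^esub> w" .
  \<comment> \<open>Multiplication by t turns the multiple of x into a multiple of k + w. So the
    remaining generators satisfy the hypothesis among themselves, with t s in place of s.\<close>
  have "(t \<otimes> s) \<odot>\<^bsub>M\<^esub> y \<in> K <+>\<^bsub>M\<^esub> ideal_smult R M Q ?X" if y: "y \<in> S" for y
  proof -
    obtain k' q' w' where k': "k' \<in> K" "q' \<in> Q" "w' \<in> ideal_smult R M Q ?X"
      "s \<odot>\<^bsub>M\<^esub> y = k' \<oplus>\<^bsub>M\<^esub> (q' \<odot>\<^bsub>M\<^esub> x \<oplus>\<^bsub>M\<^esub> w')" using dec[of y] y by blast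
    have c': "q' \<in> carrier R" "k' \<in> carrier M" "w' \<in> carrier M" "y \<in> carrier M"
      using k' Q(1) sub_carrier assms(2) IX y Sc by auto
    have "(t \<otimes> s) \<odot>\<^bsub>M\<^esub> y = t \<odot>\<^bsub>M\<^esub> k' \<oplus>\<^bsub>M\<^esub> (q' \<odot>\<^bsub>M\<^esub> (t \<odot>\<^bsub>M\<^esub> x) \<oplus>\<^bsub>M\<^esub> t \<odot>\<^bsub>M\<^esub> w')"
      using c' t sc k'(4) xc smult_assoc1[of t q' x] smult_assoc1[of q' t x] R.m_comm[of t q']
      by (simp add: smult_assoc1[of t s y] smult_r_distr)
    also have "\<dots> \<in> K <+>\<^bsub>M\<^esub> ideal_smult R M Q ?X"
      unfolding tx using k' kqw t c' set_add_left[OF assms(2) IX] set_add_right[OF assms(2) IX]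
      by (intro sub_add[OF KX] sub_smult[OF KX]) (auto intro!: set_addI)
    finally show ?thesis .
  qed
  moreover have ts: "t \<otimes> s \<in> carrier R - Q" using t sc prime_mult[OF assms(1)] by auto
  ultimately obtain u where u: "u \<in> carrier R - Q" "\<forall>y\<in>S. u \<odot>\<^bsub>M\<^esub> y \<in> K"
    using insert.IH[OF Sc ts] by blast
  \<comment> \<open>u carries the other generators into K, hence also w; therefore u t carries x
    into K as well.\<close>
  have "?X \<subseteq> colon K u"
    by (rule span_least[OF sub_colon]) (use u Sc assms(2) in \<open>auto simp: colon_def\<close>)
  then have uX: "u \<odot>\<^bsub>M\<^esub> z \<in> K" if "z \<in> ?X" for z using that by (auto simp: colon_def)
  have "ideal_smult R M Q ?X \<subseteq> colon K u"
  proof (rule ideal_smult_least)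
    show "sub (colon K u)" using sub_colon u assms(2) by auto
    fix a z assume az: "a \<in> Q" "z \<in> ?X"
    then have "u \<odot>\<^bsub>M\<^esub> (a \<odot>\<^bsub>M\<^esub> z) = a \<odot>\<^bsub>M\<^esub> (u \<odot>\<^bsub>M\<^esub> z)"
      using u Q(1) sub_carrier[OF X] smult_assoc1[of u a z] smult_assoc1[of a u z] R.m_comm[of u a] by auto
    then show "a \<odot>\<^bsub>M\<^esub> z \<in> colon K u"
      using az uX sub_smult[OF assms(2)] Q(1) sub_carrier[OF X] by (auto simp: colon_def)
  qed
  then have "u \<odot>\<^bsub>M\<^esub> w \<in> K" using kqw by (auto simp: colon_def)
  then have "(u \<otimes> t) \<odot>\<^bsub>M\<^esub> x \<in> K"
    using u t xc c kqw sub_add[OF assms(2)] sub_smult[OF assms(2)] by (simp add: smult_assoc1 tx smult_r_distr)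
  moreover have "(u \<otimes> t) \<odot>\<^bsub>M\<^esub> y \<in> K" if y: "y \<in> S" for y
    using u t y Sc R.m_comm[of u t] sub_smult[OF assms(2), of t "u \<odot>\<^bsub>M\<^esub> y"] smult_assoc1[of t u y] by auto
  moreover have "u \<otimes> t \<in> carrier R - Q" using u t prime_mult[OF assms(1)] by auto
  ultimately show ?case by blast
qed (use assms in auto)

end

section \<open>Noetherian modules over local rings\<close>

context module
begin

abbreviation adj :: "'c set \<Rightarrow> 'a \<Rightarrow> 'c set"
  where "adj N a \<equiv> N <+>\<^bsub>M\<^esub> scale a (carrier M)"

lemma sub_adj: "sub N \<Longrightarrow> a \<in> carrier R \<Longrightarrow> sub (adj N a)"
  by (simp add: sub_set_add sub_scale sub_whole)

lemma adj_superset: "sub N \<Longrightarrow> a \<in> carrier R \<Longrightarrow> N \<subseteq> adj N a"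
  by (simp add: set_add_left sub_scale sub_whole)

lemma adj_scale: "sub N \<Longrightarrow> a \<in> carrier R \<Longrightarrow> u \<in> carrier M \<Longrightarrow> a \<odot>\<^bsub>M\<^esub> u \<in> adj N a"
  using set_add_right[of N "scale a (carrier M)"] by (auto simp: scale_def sub_scale[unfolded scale_def] sub_whole)

lemma adj_iff: "x \<in> adj N a \<longleftrightarrow> (\<exists>n\<in>N. \<exists>u\<in>carrier M. x = n \<oplus>\<^bsub>M\<^esub> a \<odot>\<^bsub>M\<^esub> u)"
  by (auto simp: set_add_iff scale_def)

lemma adj_swap: "sub N \<Longrightarrow> a \<in> carrier R \<Longrightarrow> b \<in> carrier R \<Longrightarrow> adj (adj N a) b = adj (adj N b) a"
  by (rule set_add_swap) (auto intro: sub_scale sub_whole)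

lemma smult_swap:
  "a \<in> carrier R \<Longrightarrow> b \<in> carrier R \<Longrightarrow> x \<in> carrier M \<Longrightarrow> a \<odot>\<^bsub>M\<^esub> (b \<odot>\<^bsub>M\<^esub> x) = b \<odot>\<^bsub>M\<^esub> (a \<odot>\<^bsub>M\<^esub> x)"
  using smult_assoc1[of a b x] smult_assoc1[of b a x] R.m_comm[of a b] by simp

lemma smult_minus:
  "a \<in> carrier R \<Longrightarrow> x \<in> carrier M \<Longrightarrow> y \<in> carrier M \<Longrightarrow> a \<odot>\<^bsub>M\<^esub> (x \<ominus>\<^bsub>M\<^esub> y) = a \<odot>\<^bsub>M\<^esub> x \<ominus>\<^bsub>M\<^esub> a \<odot>\<^bsub>M\<^esub> y"
  by (simp add: a_minus_def smult_r_distr smult_r_minus)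

lemma add_minus_cancel:
  "x \<in> carrier M \<Longrightarrow> y \<in> carrier M \<Longrightarrow> (x \<oplus>\<^bsub>M\<^esub> y) \<ominus>\<^bsub>M\<^esub> y = x"
  "x \<in> carrier M \<Longrightarrow> y \<in> carrier M \<Longrightarrow> (x \<oplus>\<^bsub>M\<^esub> y) \<ominus>\<^bsub>M\<^esub> x = y"
  "x \<in> carrier M \<Longrightarrow> y \<in> carrier M \<Longrightarrow> (x \<ominus>\<^bsub>M\<^esub> y) \<oplus>\<^bsub>M\<^esub> y = x"
proof -
  show 1: "x \<in> carrier M \<Longrightarrow> y \<in> carrier M \<Longrightarrow> (x \<oplus>\<^bsub>M\<^esub> y) \<ominus>\<^bsub>M\<^esub> y = x" for x y
    by (simp add: a_minus_def M.a_assoc M.r_neg)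
  show "x \<in> carrier M \<Longrightarrow> y \<in> carrier M \<Longrightarrow> (x \<oplus>\<^bsub>M\<^esub> y) \<ominus>\<^bsub>M\<^esub> x = y"
    using 1[of y x] M.a_comm[of x y] by simp
  show "x \<in> carrier M \<Longrightarrow> y \<in> carrier M \<Longrightarrow> (x \<ominus>\<^bsub>M\<^esub> y) \<oplus>\<^bsub>M\<^esub> y = x"
    by (simp add: a_minus_def M.a_assoc M.l_neg)
qed

text \<open>From a u = n + y v, regularity of y modulo N + a M gives v = n' + a w; now a can be
  cancelled modulo N, and u - y w lies in N.\<close>

lemma regular_swap:
  assumes "sub N" "a \<in> carrier R" "y \<in> carrier R" "regular_mod N a" "regular_mod (adj N a) y"
  shows "regular_mod (adj N y) a"
  unfolding regular_mod_def
proof (intro ballI impI)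
  fix u assume u: "u \<in> carrier M" "a \<odot>\<^bsub>M\<^esub> u \<in> adj N y"
  then obtain n v where nv: "n \<in> N" "v \<in> carrier M" "a \<odot>\<^bsub>M\<^esub> u = n \<oplus>\<^bsub>M\<^esub> y \<odot>\<^bsub>M\<^esub> v" by (auto simp: adj_iff)
  have nc: "n \<in> carrier M" using nv sub_carrier[OF assms(1)] by blast
  have sa: "sub (adj N a)" and sy: "sub (adj N y)" using assms sub_adj by auto
  have "n \<oplus>\<^bsub>M\<^esub> y \<odot>\<^bsub>M\<^esub> v \<in> adj N a" using adj_scale[OF assms(1,2) u(1)] nv(3) by simp
  then have "y \<odot>\<^bsub>M\<^esub> v \<in> adj N a"
    using sub_add_cancel(2)[OF sa, of n "y \<odot>\<^bsub>M\<^esub> v"] adj_superset[OF assms(1,2)] nv assms by auto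
  then have "v \<in> adj N a" using assms(5) nv by (simp add: regular_mod_def)
  then obtain n' w where w: "n' \<in> N" "w \<in> carrier M" "v = n' \<oplus>\<^bsub>M\<^esub> a \<odot>\<^bsub>M\<^esub> w" by (auto simp: adj_iff)
  have n'c: "n' \<in> carrier M" using w sub_carrier[OF assms(1)] by blast
  have "a \<odot>\<^bsub>M\<^esub> u = (n \<oplus>\<^bsub>M\<^esub> y \<odot>\<^bsub>M\<^esub> n') \<oplus>\<^bsub>M\<^esub> a \<odot>\<^bsub>M\<^esub> (y \<odot>\<^bsub>M\<^esub> w)"
    unfolding nv(3) w(3) using w n'c nc assms smult_swap[of a y w] by (simp add: smult_r_distr M.a_assoc)
  then have "a \<odot>\<^bsub>M\<^esub> (u \<ominus>\<^bsub>M\<^esub> y \<odot>\<^bsub>M\<^esub> w) = n \<oplus>\<^bsub>M\<^esub> y \<odot>\<^bsub>M\<^esub> n'"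
    using assms u w n'c nc by (simp add: smult_minus add_minus_cancel)
  then have "u \<ominus>\<^bsub>M\<^esub> y \<odot>\<^bsub>M\<^esub> w \<in> N"
    using assms(4) u w nv assms(1,3) by (simp add: regular_mod_def sub_add sub_smult)
  then have "u \<ominus>\<^bsub>M\<^esub> y \<odot>\<^bsub>M\<^esub> w \<in> adj N y" using adj_superset[OF assms(1,3)] by blast
  then show "u \<in> adj N y"
    using sub_add_cancel(3)[OF sy adj_scale[OF assms(1,3) w(2)] u(1)] by blast
qed

lemma sub_Union_chain:
  assumes "C \<noteq> {}" "\<And>N. N \<in> C \<Longrightarrow> sub N" "\<And>N K. N \<in> C \<Longrightarrow> K \<in> C \<Longrightarrow> N \<subseteq> K \<or> K \<subseteq> N"
  shows "sub (\<Union>C)"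
proof (rule submoduleI)
  show "\<Union>C \<subseteq> carrier M" using assms(2) sub_subset by blast
  obtain N where "N \<in> C" using assms(1) by blast
  then show "\<zero>\<^bsub>M\<^esub> \<in> \<Union>C" using sub_zero assms(2) by blast
  show "\<ominus>\<^bsub>M\<^esub> u \<in> \<Union>C" if "u \<in> \<Union>C" for u using that sub_neg assms(2) by blast
  show "a \<odot>\<^bsub>M\<^esub> u \<in> \<Union>C" if "a \<in> carrier R" "u \<in> \<Union>C" for a u using that sub_smult assms(2) by blast
  show "u \<oplus>\<^bsub>M\<^esub> v \<in> \<Union>C" if uv: "u \<in> \<Union>C" "v \<in> \<Union>C" for u v
  proof -
    obtain N K where "N \<in> C" "u \<in> N" "K \<in> C" "v \<in> K" using uv by blast
    then obtain L where "L \<in> C" "u \<in> L" "v \<in> L" using assms(3)[of N K] by blast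
    then show ?thesis using sub_add assms(2) by blast
  qed
qed

definition elem_ann :: "'c set \<Rightarrow> 'c \<Rightarrow> 'a set"
  where "elem_ann N u = {a \<in> carrier R. a \<odot>\<^bsub>M\<^esub> u \<in> N}"

lemma ideal_elem_ann:
  assumes "sub N" "u \<in> carrier M"
  shows "ideal (elem_ann N u) R"
proof -
  have "a \<odot>\<^bsub>M\<^esub> (b \<odot>\<^bsub>M\<^esub> u) \<in> N" if "a \<odot>\<^bsub>M\<^esub> u \<in> N" "a \<in> carrier R" "b \<in> carrier R" for a b
    using that assms sub_smult[OF assms(1) that(3,1)] smult_swap[of a b u] by simp
  then have "elem_ann N u = {a \<in> carrier R. \<forall>x\<in>cyclic u. a \<odot>\<^bsub>M\<^esub> x \<in> N}"
    using cyclic_self[OF assms(2)] unfolding elem_ann_def cyclic_def by blast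
  then show ?thesis using colon_ideal[OF sub_cyclic[OF assms(2)] assms(1)] by simp
qed

end

section \<open>Noetherian modules: finite generation and zero divisors\<close>

locale noetherian_module = module +
  assumes ring_noetherian: "noetherian_ring R"
    and module_fg: "finitely_generated R M"
begin

text \<open>The elements of N are controlled by N \<inter> span S and by the ideal of coefficients
  that x can have in N modulo span S. Generators of the former, together with elements of N
  realizing generators of the latter, generate N.\<close>

lemma sub_of_span_fg:
  assumes "finite S" "S \<subseteq> carrier M" "sub N" "N \<subseteq> submodule_span R M S"
  shows "\<exists>T. finite T \<and> T \<subseteq> carrier M \<and> submodule_span R M T = N"
  using assms
proof (induction S arbitrary: N rule: finite_induct)
  case empty
  then have "N = {\<zero>\<^bsub>M\<^esub>}" using span_empty sub_zero[of N] by auto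
  then show ?case using span_empty by (intro exI[of _ "{}"]) auto
next
  case (insert x S)
  let ?S = "submodule_span R M S"
  have xc: "x \<in> carrier M" and Sc: "S \<subseteq> carrier M" using insert.prems by auto
  have sS: "sub ?S" using sub_span[OF Sc] .
  note N = insert.prems(2)
  have sNS: "sub (N \<inter> ?S)" "N \<inter> ?S \<subseteq> ?S" using sub_Int[OF N sS] by auto
  obtain T where T: "finite T" "T \<subseteq> carrier M" "submodule_span R M T = N \<inter> ?S"
    using insert.IH[OF Sc sNS] by blast
  have sK: "sub (N <+>\<^bsub>M\<^esub> ?S)" using sub_set_add N sS by blast
  let ?I = "elem_ann (N <+>\<^bsub>M\<^esub> ?S) x"
  have I: "ideal ?I R" using ideal_elem_ann[OF sK xc] .
  obtain A where A: "A \<subseteq> carrier R" "finite A" "?I = genideal R A"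
    using noetherian_ring.finetely_gen[OF ring_noetherian I] by blast
  have "\<exists>n\<in>N. \<exists>y\<in>?S. a \<odot>\<^bsub>M\<^esub> x = n \<oplus>\<^bsub>M\<^esub> y" if a: "a \<in> A" for a
  proof -
    have "a \<in> ?I" using a A(3) R.genideal_self[OF A(1)] by blast
    then show ?thesis by (simp add: elem_ann_def set_add_iff)
  qed
  then obtain n where n: "\<And>a. a \<in> A \<Longrightarrow> n a \<in> N \<and> (\<exists>y\<in>?S. a \<odot>\<^bsub>M\<^esub> x = n a \<oplus>\<^bsub>M\<^esub> y)" by metis
  define U where "U = T \<union> n ` A"
  have U: "finite U" "U \<subseteq> carrier M" unfolding U_def using T A n sub_carrier[OF N] by auto
  let ?K = "submodule_span R M U"
  have K: "sub ?K" using sub_span[OF U(2)] .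
  have TN: "T \<subseteq> N" using T(3) span_superset[of T] by blast
  have KN: "?K \<subseteq> N" by (rule span_least[OF N]) (use TN n in \<open>auto simp: U_def\<close>)
  have TK: "N \<inter> ?S \<subseteq> ?K" using T(3) span_mono[of T U] by (auto simp: U_def)
  have sKS: "sub (?K <+>\<^bsub>M\<^esub> ?S)" using sub_set_add K sS by blast
  have "genideal R A \<subseteq> elem_ann (?K <+>\<^bsub>M\<^esub> ?S) x"
  proof (rule R.genideal_minimal[OF ideal_elem_ann[OF sKS xc]], rule subsetI)
    fix a assume a: "a \<in> A"
    then obtain y where y: "y \<in> ?S" "a \<odot>\<^bsub>M\<^esub> x = n a \<oplus>\<^bsub>M\<^esub> y" using n by blast
    have "n a \<in> U" using a by (simp add: U_def)
    then have "n a \<in> ?K" using span_superset[of U] by (rule subsetD[rotated])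
    then show "a \<in> elem_ann (?K <+>\<^bsub>M\<^esub> ?S) x"
      using a A(1) y set_addI[of "n a" ?K y ?S] by (auto simp: elem_ann_def)
  qed
  then have IK: "?I \<subseteq> elem_ann (?K <+>\<^bsub>M\<^esub> ?S) x" using A(3) by simp
  have "N \<subseteq> ?K"
  proof
    fix z assume z: "z \<in> N"
    then have "z \<in> cyclic x <+>\<^bsub>M\<^esub> ?S" using insert.prems(3) span_insert_subset[OF xc Sc] by blast
    then obtain b y where bz: "b \<in> carrier R" "y \<in> ?S" "z = b \<odot>\<^bsub>M\<^esub> x \<oplus>\<^bsub>M\<^esub> y"
      by (auto simp: set_add_iff cyclic_def)
    have c: "z \<in> carrier M" "y \<in> carrier M" "b \<odot>\<^bsub>M\<^esub> x \<in> carrier M"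
      using z bz sub_carrier N sS xc by auto
    have "y \<in> N <+>\<^bsub>M\<^esub> ?S" "z \<in> N <+>\<^bsub>M\<^esub> ?S" using set_add_left[OF N sS] set_add_right[OF N sS] z bz by auto
    then have "b \<odot>\<^bsub>M\<^esub> x \<in> N <+>\<^bsub>M\<^esub> ?S" using sub_add_cancel(1)[OF sK _ c(3), of y] bz(3) by simp
    then have "b \<in> ?I" using bz by (simp add: elem_ann_def)
    then have "b \<odot>\<^bsub>M\<^esub> x \<in> ?K <+>\<^bsub>M\<^esub> ?S" using IK by (auto simp: elem_ann_def)
    then obtain k y' where k: "k \<in> ?K" "y' \<in> ?S" "b \<odot>\<^bsub>M\<^esub> x = k \<oplus>\<^bsub>M\<^esub> y'" by (auto simp: set_add_iff)
    have kc: "k \<in> carrier M" "y' \<in> carrier M" using k sub_carrier K sS by auto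
    have zk: "z = k \<oplus>\<^bsub>M\<^esub> (y' \<oplus>\<^bsub>M\<^esub> y)" unfolding bz(3) k(3) using kc c by (simp add: M.a_assoc)
    have "y' \<oplus>\<^bsub>M\<^esub> y \<in> N"
      using sub_add_cancel(2)[OF N, of k "y' \<oplus>\<^bsub>M\<^esub> y"] zk z k KN kc c by auto
    then have "y' \<oplus>\<^bsub>M\<^esub> y \<in> ?K" using TK sub_add[OF sS k(2) bz(2)] by blast
    then show "z \<in> ?K" unfolding zk by (rule sub_add[OF K k(1)])
  qed
  then show ?case using U KN by blast
qed

lemma sub_fg:
  assumes "sub N"
  obtains T where "finite T" "T \<subseteq> carrier M" "submodule_span R M T = N"
  using sub_of_span_fg[OF _ _ assms] module_fg sub_subset[OF assms] unfolding finitely_generated_def by metis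

text \<open>The union of a chain is a submodule, hence finitely generated, and its finitely many
  generators already lie in one member of the chain.\<close>

lemma submodule_maximal:
  assumes "\<C> \<noteq> {}" "\<And>N. N \<in> \<C> \<Longrightarrow> sub N"
  shows "\<exists>K\<in>\<C>. \<forall>L\<in>\<C>. K \<subseteq> L \<longrightarrow> L = K"
proof (rule subset_Zorn_nonempty[OF assms(1)])
  fix C assume C: "C \<noteq> {}" "subset.chain \<C> C"
  have C1: "N \<in> \<C>" if "N \<in> C" for N using C(2) that by (auto simp: subset_chain_def)
  have C2: "N \<subseteq> K \<or> K \<subseteq> N" if "N \<in> C" "K \<in> C" for N K using C(2) that by (auto simp: subset_chain_def)
  have "sub (\<Union>C)" by (rule sub_Union_chain[OF C(1)]) (use C1 C2 assms(2) in blast)+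
  then obtain T where T: "finite T" "T \<subseteq> carrier M" "submodule_span R M T = \<Union>C" by (rule sub_fg)
  then have "T \<subseteq> \<Union>C" using span_superset[of T] by simp
  then obtain N where N: "N \<in> C" "T \<subseteq> N"
    using finite_subset_Union_chain[OF T(1) _ C(1) C(2)] by metis
  then have "\<Union>C \<subseteq> N" using T(3) span_least[OF assms(2)[OF C1[OF N(1)]] N(2)] by simp
  then have "\<Union>C = N" using N(1) by blast
  then show "\<Union>C \<in> \<C>" using C1[OF N(1)] by simp
qed

text \<open>The primes are the maximal annihilators of elements; a finite subset of witnesses already spans
  all of them, so there are finitely many.\<close>

lemma zero_divisor_primes:
  assumes "sub N"
  shows "\<exists>\<P>. finite \<P> \<and> (\<forall>P\<in>\<P>. primeideal P R \<and> (\<exists>u\<in>carrier M - N. P = elem_ann N u)) \<and>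
    (\<forall>a\<in>carrier R. (\<forall>P\<in>\<P>. a \<notin> P) \<longrightarrow> regular_mod N a)"
proof -
  let ?E = "elem_ann N ` (carrier M - N)"
  let ?P = "{P \<in> ?E. \<forall>J\<in>?E. P \<subseteq> J \<longrightarrow> J = P}"
  have Ei: "ideal P R" if "P \<in> ?E" for P using that ideal_elem_ann[OF assms] by auto
  have prime: "primeideal P R" if P: "P \<in> ?P" for P
  proof -
    obtain u where u: "u \<in> carrier M" "u \<notin> N" "P = elem_ann N u" using P by auto
    show ?thesis
    proof (rule primeidealI)
      show "ideal P R" using P Ei by blast
      show "cring R" by (rule R.is_cring)
      show "carrier R \<noteq> P"
      proof
        assume "carrier R = P"
        then have "\<one> \<in> elem_ann N u" using u by auto
        then show False using u by (simp add: elem_ann_def)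
      qed
      fix a b assume ab: "a \<in> carrier R" "b \<in> carrier R" "a \<otimes> b \<in> P"
      show "a \<in> P \<or> b \<in> P"
      proof (rule disjCI)
        assume "b \<notin> P"
        \<comment> \<open>Replacing u by b u can only enlarge the annihilator, so maximality of P
          forces equality; and a kills b u modulo N.\<close>
        then have bu: "b \<odot>\<^bsub>M\<^esub> u \<in> carrier M - N" using ab u by (auto simp: elem_ann_def)
        have "c \<odot>\<^bsub>M\<^esub> (b \<odot>\<^bsub>M\<^esub> u) \<in> N" if "c \<in> carrier R" "c \<odot>\<^bsub>M\<^esub> u \<in> N" for c
          using that u ab sub_smult[OF assms ab(2) that(2)] smult_swap[of c b u] by simp
        then have "P \<subseteq> elem_ann N (b \<odot>\<^bsub>M\<^esub> u)"
          unfolding u(3) elem_ann_def by blast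
        then have "elem_ann N (b \<odot>\<^bsub>M\<^esub> u) = P" using P bu by blast
        moreover have "a \<in> elem_ann N (b \<odot>\<^bsub>M\<^esub> u)"
          using ab u smult_assoc1[of a b u] by (simp add: elem_ann_def)
        ultimately show "a \<in> P" by simp
      qed
    qed
  qed
  have "\<forall>P\<in>?P. \<exists>v. v \<in> carrier M - N \<and> P = elem_ann N v" by blast
  then obtain v where "\<forall>P\<in>?P. v P \<in> carrier M - N \<and> P = elem_ann N (v P)" by (rule bchoice[THEN exE])
  then have v: "\<And>P. P \<in> ?P \<Longrightarrow> v P \<in> carrier M - N \<and> P = elem_ann N (v P)" by (rule bspec)
  have mx: "P = Q" if "Q \<in> ?P" "P \<in> ?P" "Q \<subseteq> P" for P Q
  proof -
    have "P \<in> ?E" using that(2) by simp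
    moreover have "\<forall>J\<in>?E. Q \<subseteq> J \<longrightarrow> J = Q" using that(1) by simp
    ultimately show ?thesis using that(3) by blast
  qed
  define \<P> where "\<P> = ?P"
  note mx = mx[folded \<P>_def] and v = v[folded \<P>_def] and pr = prime[folded \<P>_def]
  \<comment> \<open>A maximal span of finitely many witnesses exists because M is Noetherian. The
    finite set F that gives it turns out to contain all the primes.\<close>
  let ?C = "{submodule_span R M (v ` F) | F. finite F \<and> F \<subseteq> \<P>}"
  have vc: "v ` F \<subseteq> carrier M" if "F \<subseteq> \<P>" for F
  proof
    fix w assume "w \<in> v ` F"
    then obtain Q where Q: "Q \<in> F" "w = v Q" by (rule imageE)
    have "Q \<in> \<P>" by (rule subsetD[OF that Q(1)])
    then show "w \<in> carrier M" using v Q(2) by simp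
  qed
  have "\<exists>K\<in>?C. \<forall>L\<in>?C. K \<subseteq> L \<longrightarrow> L = K"
  proof (rule submodule_maximal)
    have "submodule_span R M (v ` {}) \<in> ?C" by blast
    then show "?C \<noteq> {}" by blast
    fix L assume "L \<in> ?C"
    then obtain F where "L = submodule_span R M (v ` F)" "F \<subseteq> \<P>" by blast
    then show "sub L" using sub_span[OF vc] by simp
  qed
  then obtain K where K: "K \<in> ?C" "\<forall>L\<in>?C. K \<subseteq> L \<longrightarrow> L = K" by (rule bexE)
  then obtain F where F: "finite F" "F \<subseteq> \<P>" "K = submodule_span R M (v ` F)" by blast
  have "P \<in> F" if P: "P \<in> \<P>" for P
  proof (rule ccontr)
    assume PF: "P \<notin> F"
    have "submodule_span R M (v ` insert P F) \<in> ?C" using F P by blast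
    moreover have "K \<subseteq> submodule_span R M (v ` insert P F)" unfolding F(3) by (rule span_mono) auto
    ultimately have "submodule_span R M (v ` insert P F) = K" using K(2) by blast
    then have vK: "v P \<in> submodule_span R M (v ` F)" using F(3) span_superset[of "v ` insert P F"] by auto
    have "Q \<inter> carrier R \<subseteq> P \<Longrightarrow> False" if Q: "Q \<in> F" for Q
    proof -
      assume "Q \<inter> carrier R \<subseteq> P"
      moreover have "Q \<subseteq> carrier R" using Q F v[of Q] by (auto simp: elem_ann_def)
      ultimately have "Q \<subseteq> P" by blast
      then have "P = Q" using mx[OF subsetD[OF F(2) Q] P] by simp
      then show False using Q PF by simp
    qed
    \<comment> \<open>An element of all Q in F carries every witness of F into N, hence also
      \<open>v P\<close>, which lies in their span; so it belongs to P. An element chosen outside P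
      gives the contradiction.\<close>
    moreover have "\<exists>y\<in>carrier R. y \<notin> P \<and> (\<forall>Q\<in>F. y \<in> Q)"
    proof (cases "F = {}")
      case True then show ?thesis using prime_one[OF pr[OF P]] by auto
    next
      case False
      show ?thesis
        by (rule R.prime_product[OF pr[OF P] R.oneideal F(1) False])
          (use calculation F(2) pr prime_ideal in blast)
    qed
    then obtain y where y: "y \<in> carrier R" "y \<notin> P" "\<forall>Q\<in>F. y \<in> Q" by blast
    have "v ` F \<subseteq> colon N y"
    proof
      fix w assume "w \<in> v ` F"
      then obtain Q where Q: "Q \<in> F" "w = v Q" by blast
      then have "y \<in> elem_ann N (v Q)" using y(3) v[of Q] F(2) by blast
      then show "w \<in> colon N y" using Q v[of Q] F(2) by (auto simp: colon_def elem_ann_def)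
    qed
    then have "v P \<in> colon N y" using vK span_least[OF sub_colon[OF y(1) assms]] by blast
    then have "y \<in> elem_ann N (v P)" using y(1) by (simp add: colon_def elem_ann_def)
    then show False using y(2) v[OF P] by simp
  qed
  then have "\<P> \<subseteq> F" by (rule subsetI)
  then have fin: "finite \<P>" using F(1) by (rule finite_subset)
  have "regular_mod N a" if a: "a \<in> carrier R" "\<forall>P\<in>?P. a \<notin> P" for a
    unfolding regular_mod_def
  proof (intro ballI impI, rule ccontr)
    fix u assume u: "u \<in> carrier M" "a \<odot>\<^bsub>M\<^esub> u \<in> N" "u \<notin> N"
    let ?D = "{J \<in> ?E. elem_ann N u \<subseteq> J}"
    have uD: "elem_ann N u \<in> ?D" using u by blast
    have "\<exists>P\<in>?D. \<forall>J\<in>?D. P \<subseteq> J \<longrightarrow> J = P"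
    proof (rule noetherian_ring.ideal_maximal[OF ring_noetherian])
      show "?D \<noteq> {}" using uD by blast
      show "ideal I R" if "I \<in> ?D" for I using that Ei by simp
    qed
    then obtain P where P: "P \<in> ?D" "\<forall>J\<in>?D. P \<subseteq> J \<longrightarrow> J = P" by (rule bexE)
    have "P \<in> ?P"
    proof (rule CollectI, intro conjI ballI impI)
      show "P \<in> ?E" using P(1) by simp
      fix J assume J: "J \<in> ?E" "P \<subseteq> J"
      then have "J \<in> ?D" using P(1) by (simp, blast)
      then show "J = P" using P(2) J(2) by simp
    qed
    moreover have "a \<in> elem_ann N u" using a u by (simp add: elem_ann_def)
    then have "a \<in> P" using P(1) by blast
    ultimately show False using a(2) by blast
  qed
  moreover have "\<forall>P\<in>?P. primeideal P R \<and> (\<exists>u\<in>carrier M - N. P = elem_ann N u)"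
    using prime by blast
  ultimately show ?thesis using fin unfolding \<P>_def by (intro exI[of _ ?P]) simp
qed

end

section \<open>Local rings: exchange of regular elements and Krull's intersection theorem\<close>

locale local_module = module +
  fixes \<mm>
  assumes local_ring: "noetherian_local_ring R \<mm>"
    and module_fg: "finitely_generated R M"

sublocale local_module \<subseteq> noetherian_module
  using local_ring module_fg by unfold_locales (auto simp: noetherian_local_ring_def noetherian_ring_def noetherian_ring_axioms_def)

context local_module
begin

lemma mm_maximal: "maximalideal \<mm> R" and mm_unique: "maximalideal I R \<Longrightarrow> I = \<mm>"
  using local_ring by (auto simp: noetherian_local_ring_def)

lemma mm_prime: "primeideal \<mm> R"
  using R.maximalideal_prime[OF mm_maximal] .

lemma mm_ideal: "ideal \<mm> R"
  using mm_prime prime_ideal by blast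

lemmas mm_carrier = ideal_carrier[OF mm_ideal]

lemma unit_outside:
  assumes "a \<in> carrier R" "a \<notin> \<mm>"
  obtains b where "b \<in> carrier R" "b \<otimes> a = \<one>"
proof (cases "PIdl a = carrier R")
  case True
  then have "\<one> \<in> PIdl a" by simp
  then show thesis using that unfolding cgenideal_def by auto
next
  case False
  then obtain Q where "maximalideal Q R" "PIdl a \<subseteq> Q"
    using R.exists_maximal[OF R.cgenideal_ideal[OF assms(1)]] by blast
  then show thesis using mm_unique R.cgenideal_self[OF assms(1)] assms(2) by blast
qed

lemma unit_cancel:
  assumes "sub K" "a \<in> carrier R" "a \<notin> \<mm>" "x \<in> carrier M" "a \<odot>\<^bsub>M\<^esub> x \<in> K"
  shows "x \<in> K"
proof -
  obtain b where b: "b \<in> carrier R" "b \<otimes> a = \<one>" using unit_outside assms(2,3) by blast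
  then have "b \<odot>\<^bsub>M\<^esub> (a \<odot>\<^bsub>M\<^esub> x) = x" using assms smult_assoc1[of b a x] by simp
  then show ?thesis using sub_smult[OF assms(1) b(1) assms(5)] by simp
qed

text \<open>For the maximal ideal, the multiplier produced by \<open>nakayama_prime\<close> lies
  outside it and is therefore a unit.\<close>

lemma nakayama:
  assumes "sub K" "sub N" "N \<subseteq> K <+>\<^bsub>M\<^esub> ideal_smult R M \<mm> N"
  shows "N \<subseteq> K"
proof -
  obtain S where S: "finite S" "S \<subseteq> carrier M" "submodule_span R M S = N" by (rule sub_fg[OF assms(2)])
  have "\<exists>t\<in>carrier R - \<mm>. \<forall>x\<in>S. t \<odot>\<^bsub>M\<^esub> x \<in> K"
  proof (rule nakayama_prime[OF mm_prime assms(1) S(1,2)])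
    show "\<one> \<in> carrier R - \<mm>" using prime_one[OF mm_prime] by simp
    fix x assume x: "x \<in> S"
    then have "\<one> \<odot>\<^bsub>M\<^esub> x = x" "x \<in> N" using S span_superset[of S] by auto
    then show "\<one> \<odot>\<^bsub>M\<^esub> x \<in> K <+>\<^bsub>M\<^esub> ideal_smult R M \<mm> (submodule_span R M S)"
      using S(3) assms(3) by auto
  qed
  then have "S \<subseteq> K" using unit_cancel[OF assms(1)] S(2) by blast
  then show ?thesis using span_least[OF assms(1)] S(3) by blast
qed

text \<open>By \<open>no_socleI\<close> and \<open>common_regular_element\<close> this is equivalent
  to the existence of an element of \<open>\<mm>\<close> that is regular on M / N. In this form the
  property can be carried from one quotient to another by computing with elements.\<close>

definition no_socle :: "'c set \<Rightarrow> bool"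
  where "no_socle N \<longleftrightarrow> (\<forall>u\<in>carrier M - N. \<exists>s\<in>\<mm>. s \<odot>\<^bsub>M\<^esub> u \<notin> N)"

lemma no_socleI: "regular_mod N a \<Longrightarrow> a \<in> \<mm> \<Longrightarrow> no_socle N"
  unfolding no_socle_def regular_mod_def by blast

text \<open>Each prime attached to N is the annihilator of the class of some u outside N; if it
  contained \<open>\<mm>\<close>, that class would be a socle element. So prime avoidance works for
  finitely many N at once.\<close>

lemma common_regular_element:
  assumes "finite \<N>" "\<And>N. N \<in> \<N> \<Longrightarrow> sub N \<and> no_socle N"
  shows "\<exists>y\<in>\<mm>. \<forall>N\<in>\<N>. regular_mod N y"
proof -
  obtain p where p: "\<And>N. N \<in> \<N> \<Longrightarrow> finite (p N) \<and>
      (\<forall>P\<in>p N. primeideal P R \<and> (\<exists>u\<in>carrier M - N. P = elem_ann N u)) \<and>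
      (\<forall>a\<in>carrier R. (\<forall>P\<in>p N. a \<notin> P) \<longrightarrow> regular_mod N a)"
    using zero_divisor_primes assms(2) by metis
  have "\<exists>y\<in>\<mm>. \<forall>P\<in>(\<Union>N\<in>\<N>. p N). y \<notin> P"
  proof (rule R.prime_avoidance[OF _ mm_ideal])
    show "finite (\<Union>N\<in>\<N>. p N)" using assms(1) p by simp
    fix P assume "P \<in> (\<Union>N\<in>\<N>. p N)"
    then obtain N where N: "N \<in> \<N>" "P \<in> p N" by blast
    then obtain u where u: "u \<in> carrier M - N" "P = elem_ann N u" "primeideal P R" using p by blast
    obtain s where "s \<in> \<mm>" "s \<odot>\<^bsub>M\<^esub> u \<notin> N"
      using assms(2)[OF N(1)] u(1) unfolding no_socle_def by blast
    then have "\<not> \<mm> \<subseteq> P" using u(2) by (auto simp: elem_ann_def)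
    then show "primeideal P R \<and> \<not> \<mm> \<subseteq> P" using u(3) by blast
  qed
  then obtain y where y: "y \<in> \<mm>" "\<forall>P\<in>(\<Union>N\<in>\<N>. p N). y \<notin> P" by blast
  have "regular_mod N y" if N: "N \<in> \<N>" for N
    using p[OF N] y mm_carrier[OF y(1)] N by blast
  then show ?thesis using y(1) by blast
qed

text \<open>The two socles are isomorphic, both being Ext^1(k, M / N) for the residue field k.
  Concretely, if \<open>\<mm>\<close> kills u modulo N + a M and x u = n + a v, then
  \<open>\<mm>\<close> kills v modulo N + x M, and v lies in N + x M only if u lies in N + a
  M.\<close>

lemma socle_exchange:
  assumes "sub N" "a \<in> \<mm>" "x \<in> \<mm>" "regular_mod N a" "regular_mod N x" "no_socle (adj N x)"
  shows "no_socle (adj N a)"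
  unfolding no_socle_def
proof (rule ballI, rule ccontr)
  fix u assume u: "u \<in> carrier M - adj N a" and no: "\<not> (\<exists>s\<in>\<mm>. s \<odot>\<^bsub>M\<^esub> u \<notin> adj N a)"
  have c: "a \<in> carrier R" "x \<in> carrier R" using assms mm_carrier by auto
  note Nc = sub_carrier[OF assms(1)]
  have sx: "sub (adj N x)" and sa: "sub (adj N a)" using sub_adj assms(1) c by auto
  obtain n v where nv: "n \<in> N" "v \<in> carrier M" "x \<odot>\<^bsub>M\<^esub> u = n \<oplus>\<^bsub>M\<^esub> a \<odot>\<^bsub>M\<^esub> v"
    using no assms(3) adj_iff by blast
  have "v \<notin> adj N x"
  proof
    assume "v \<in> adj N x"
    then obtain n' w where w: "n' \<in> N" "w \<in> carrier M" "v = n' \<oplus>\<^bsub>M\<^esub> x \<odot>\<^bsub>M\<^esub> w" by (auto simp: adj_iff)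
    have "x \<odot>\<^bsub>M\<^esub> u = (n \<oplus>\<^bsub>M\<^esub> a \<odot>\<^bsub>M\<^esub> n') \<oplus>\<^bsub>M\<^esub> x \<odot>\<^bsub>M\<^esub> (a \<odot>\<^bsub>M\<^esub> w)"
      unfolding nv(3) w(3) using w nv Nc c smult_swap[of a x w] by (simp add: smult_r_distr M.a_assoc)
    then have "x \<odot>\<^bsub>M\<^esub> (u \<ominus>\<^bsub>M\<^esub> a \<odot>\<^bsub>M\<^esub> w) = n \<oplus>\<^bsub>M\<^esub> a \<odot>\<^bsub>M\<^esub> n'"
      using c u w nv Nc by (simp add: smult_minus add_minus_cancel)
    then have "u \<ominus>\<^bsub>M\<^esub> a \<odot>\<^bsub>M\<^esub> w \<in> N"
      using assms(5) u w nv c assms(1) by (simp add: regular_mod_def sub_add sub_smult)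
    then have "u \<ominus>\<^bsub>M\<^esub> a \<odot>\<^bsub>M\<^esub> w \<in> adj N a" using adj_superset[OF assms(1) c(1)] by blast
    then show False
      using sub_add_cancel(3)[OF sa adj_scale[OF assms(1) c(1) w(2)]] u by blast
  qed
  then obtain s where s: "s \<in> \<mm>" "s \<odot>\<^bsub>M\<^esub> v \<notin> adj N x" using assms(6) nv(2) unfolding no_socle_def by blast
  have sc: "s \<in> carrier R" using s mm_carrier by blast
  obtain n1 w where w: "n1 \<in> N" "w \<in> carrier M" "s \<odot>\<^bsub>M\<^esub> u = n1 \<oplus>\<^bsub>M\<^esub> a \<odot>\<^bsub>M\<^esub> w"
    using no s(1) adj_iff by blast
  have "s \<odot>\<^bsub>M\<^esub> n \<oplus>\<^bsub>M\<^esub> a \<odot>\<^bsub>M\<^esub> (s \<odot>\<^bsub>M\<^esub> v) = s \<odot>\<^bsub>M\<^esub> (x \<odot>\<^bsub>M\<^esub> u)"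
    unfolding nv(3) using nv Nc c sc smult_swap[of a s v] by (simp add: smult_r_distr)
  also have "\<dots> = x \<odot>\<^bsub>M\<^esub> n1 \<oplus>\<^bsub>M\<^esub> a \<odot>\<^bsub>M\<^esub> (x \<odot>\<^bsub>M\<^esub> w)"
    using w(3) u w Nc c sc smult_swap[of s x u] smult_swap[of x a w] by (simp add: smult_r_distr)
  finally have e: "s \<odot>\<^bsub>M\<^esub> n \<oplus>\<^bsub>M\<^esub> a \<odot>\<^bsub>M\<^esub> (s \<odot>\<^bsub>M\<^esub> v) = x \<odot>\<^bsub>M\<^esub> n1 \<oplus>\<^bsub>M\<^esub> a \<odot>\<^bsub>M\<^esub> (x \<odot>\<^bsub>M\<^esub> w)" .
  have m: "s \<odot>\<^bsub>M\<^esub> n \<in> N" "x \<odot>\<^bsub>M\<^esub> n1 \<in> N" using sub_smult[OF assms(1)] nv w sc c by auto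
  have "s \<odot>\<^bsub>M\<^esub> n \<oplus>\<^bsub>M\<^esub> a \<odot>\<^bsub>M\<^esub> (s \<odot>\<^bsub>M\<^esub> v \<ominus>\<^bsub>M\<^esub> x \<odot>\<^bsub>M\<^esub> w)
      = (s \<odot>\<^bsub>M\<^esub> n \<oplus>\<^bsub>M\<^esub> a \<odot>\<^bsub>M\<^esub> (s \<odot>\<^bsub>M\<^esub> v)) \<ominus>\<^bsub>M\<^esub> a \<odot>\<^bsub>M\<^esub> (x \<odot>\<^bsub>M\<^esub> w)"
    using nv w Nc c sc by (simp add: smult_minus) (simp add: a_minus_def M.a_assoc)
  also have "\<dots> = x \<odot>\<^bsub>M\<^esub> n1" unfolding e using w Nc c by (simp add: add_minus_cancel)
  finally have "s \<odot>\<^bsub>M\<^esub> n \<oplus>\<^bsub>M\<^esub> a \<odot>\<^bsub>M\<^esub> (s \<odot>\<^bsub>M\<^esub> v \<ominus>\<^bsub>M\<^esub> x \<odot>\<^bsub>M\<^esub> w) \<in> N" using m by simp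
  then have "a \<odot>\<^bsub>M\<^esub> (s \<odot>\<^bsub>M\<^esub> v \<ominus>\<^bsub>M\<^esub> x \<odot>\<^bsub>M\<^esub> w) \<in> N"
    using sub_add_cancel(2)[OF assms(1) m(1)] nv w c sc by simp
  then have "s \<odot>\<^bsub>M\<^esub> v \<ominus>\<^bsub>M\<^esub> x \<odot>\<^bsub>M\<^esub> w \<in> adj N x"
    using assms(4) nv w c sc adj_superset[OF assms(1) c(2)] by (auto simp: regular_mod_def)
  then show False
    using sub_add_cancel(3)[OF sx adj_scale[OF assms(1) c(2) w(2)], of "s \<odot>\<^bsub>M\<^esub> v"] s sc nv by auto
qed

text \<open>The first element of a regular sequence may be exchanged for any other regular element:
  interpose an element \<open>y\<close> that is regular modulo \<open>N\<close>, \<open>N + x M\<close> and \<open>N + a M\<close>.\<close>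

lemma regular_exchange:
  assumes "sub N" "a \<in> \<mm>" "x \<in> \<mm>" "regular_mod N a" "regular_mod N x"
    "set zs \<subseteq> \<mm>" "regular_seq_mod (adj N x) zs"
  shows "\<exists>ws. length ws = length zs \<and> set ws \<subseteq> \<mm> \<and> regular_seq_mod (adj N a) ws"
  using assms
proof (induction "length zs" arbitrary: N a x zs)
  case 0 then show ?case by (intro exI[of _ "[]"]) auto
next
  case (Suc k)
  then obtain z zs' where z: "zs = z # zs'" "length zs' = k" by (metis length_Suc_conv)
  have c: "a \<in> carrier R" "x \<in> carrier R" "z \<in> carrier R" using Suc.prems z mm_carrier by auto
  note N = Suc.prems(1)
  have sx: "sub (adj N x)" and sa: "sub (adj N a)" using sub_adj N c by auto
  have zr: "regular_mod (adj N x) z" "regular_seq_mod (adj (adj N x) z) zs'" "z \<in> \<mm>" "set zs' \<subseteq> \<mm>"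
    using Suc.prems(6,7) z by auto
  have "no_socle (adj N x)" using no_socleI zr by blast
  moreover have "no_socle (adj N a)" using socle_exchange[OF N] Suc.prems calculation by blast
  moreover have "no_socle N" using no_socleI Suc.prems by blast
  ultimately obtain y where y: "y \<in> \<mm>" "\<forall>K\<in>{N, adj N x, adj N a}. regular_mod K y"
    using common_regular_element[of "{N, adj N x, adj N a}"] N sx sa by blast
  have yc: "y \<in> carrier R" using y mm_carrier by blast
  have sy: "sub (adj N y)" using sub_adj N yc by blast
  \<comment> \<open>The induction hypothesis over N + x M exchanges z for y.\<close>
  obtain ys where ys: "length ys = k" "set ys \<subseteq> \<mm>" "regular_seq_mod (adj (adj N x) y) ys"
    using Suc.hyps(1)[OF z(2)[symmetric] sx y(1) zr(3) _ zr(1,4,2)] y(2) z(2) by auto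
  have "regular_mod (adj N y) x" "regular_mod (adj N y) a"
    using regular_swap[OF N _ yc] c Suc.prems y(2) by blast+
  \<comment> \<open>The induction hypothesis over N + y M exchanges x for a; both are regular there
    by \<open>regular_swap\<close>.\<close>
  then obtain ws where ws: "length ws = k" "set ws \<subseteq> \<mm>" "regular_seq_mod (adj (adj N y) a) ws"
    using Suc.hyps(1)[OF ys(1)[symmetric] sy Suc.prems(2,3) _ _ ys(2)] ys(1,3)
      adj_swap[OF N c(2) yc] by auto
  then have "regular_seq_mod (adj N a) (y # ws)" using y(2) adj_swap[OF N c(1) yc] by simp
  then show ?case using ws y(1) Suc.hyps(2) by (intro exI[of _ "y # ws"]) auto
qed

text \<open>Choose L maximal among the submodules above K + \<open>\<mm>\<close> D that meet D only
  in K + \<open>\<mm>\<close> D. Maximality forces a power of each element of \<open>\<mm>\<close>,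
  hence a power of \<open>\<mm>\<close> itself, to carry M into L. So D lies in L, whence D = K +
  \<open>\<mm>\<close> D, and Nakayama's lemma applies.\<close>

lemma krull_intersection:
  assumes "sub K" "sub D" "K \<subseteq> D"
    and small: "\<And>k. D \<subseteq> ideal_smult R M (ideal_power R \<mm> k) (carrier M) <+>\<^bsub>M\<^esub> K"
  shows "D = K"
proof -
  let ?K = "K <+>\<^bsub>M\<^esub> ideal_smult R M \<mm> D"
  have mD: "sub (ideal_smult R M \<mm> D)" using sub_ideal_smult sub_subset[OF assms(2)] ideal_subset[OF mm_ideal] by blast
  have K': "sub ?K" using sub_set_add assms(1) mD by blast
  have "ideal_smult R M \<mm> D \<subseteq> D" by (rule ideal_smult_least[OF assms(2)]) (use sub_smult[OF assms(2)] mm_carrier in auto)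
  then have KD: "?K \<subseteq> D" using set_add_least[OF assms(2,3)] by blast
  let ?C = "{L. sub L \<and> ?K \<subseteq> L \<and> L \<inter> D = ?K}"
  have "\<exists>L\<in>?C. \<forall>L'\<in>?C. L \<subseteq> L' \<longrightarrow> L' = L"
  proof (rule submodule_maximal)
    have "?K \<in> ?C" using K' KD by blast
    then show "?C \<noteq> {}" by blast
  qed simp
  then obtain L where L: "L \<in> ?C" "\<forall>L'\<in>?C. L \<subseteq> L' \<longrightarrow> L' = L" by (rule bexE)
  have Ls: "sub L" "?K \<subseteq> L" "L \<inter> D = ?K" using L(1) by auto
  have "\<exists>k::nat. x [^] k \<in> ann_mod L" if x: "x \<in> \<mm>" for x
  proof -
    have xc: "x \<in> carrier R" using x mm_carrier by blast
    \<comment> \<open>The submodules L : x^j increase with j, so they are stationary from some k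
      on.\<close>
    let ?B = "range (\<lambda>j::nat. colon L (x [^] j))"
    have "\<exists>B\<in>?B. \<forall>B'\<in>?B. B \<subseteq> B' \<longrightarrow> B' = B"
      by (rule submodule_maximal) (use sub_colon Ls(1) xc in auto)
    then obtain B where B: "B \<in> ?B" "\<forall>B'\<in>?B. B \<subseteq> B' \<longrightarrow> B' = B" by (rule bexE)
    obtain k :: nat where Bk: "B = colon L (x [^] k)" using B(1) by auto
    note k = B(2)[unfolded Bk]
    have "colon L (x [^] k) \<subseteq> colon L (x [^] Suc k)"
      using Ls(1) xc sub_smult[OF Ls(1), of x] smult_assoc1 R.nat_pow_Suc2[OF xc, of k]
      by (auto simp: colon_def simp del: R.nat_pow_Suc)
    then have stab: "colon L (x [^] Suc k) = colon L (x [^] k)" using k by blast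
    let ?L = "L <+>\<^bsub>M\<^esub> scale (x [^] k) (carrier M)"
    have sL: "sub ?L" using sub_adj Ls(1) xc by simp
    have LL: "L \<subseteq> ?L" using adj_superset Ls(1) xc by simp
    \<comment> \<open>For d = l + x^k u in D, the product x d lies in \<open>\<mm>\<close> D and so
      in L. Hence x^(k+1) u lies in L, and by stationarity x^k u already does.\<close>
    have "?L \<inter> D \<subseteq> ?K"
    proof
      fix d assume d: "d \<in> ?L \<inter> D"
      then obtain l u where lu: "l \<in> L" "u \<in> carrier M" "d = l \<oplus>\<^bsub>M\<^esub> x [^] k \<odot>\<^bsub>M\<^esub> u" by (auto simp: adj_iff)
      have lc: "l \<in> carrier M" using lu sub_carrier[OF Ls(1)] by blast
      have "x \<odot>\<^bsub>M\<^esub> d \<in> ideal_smult R M \<mm> D" using ideal_smultI[OF x] d by blast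
      then have "x \<odot>\<^bsub>M\<^esub> d \<in> L" using set_add_right[OF assms(1) mD] Ls(2) by blast
      then have "x \<odot>\<^bsub>M\<^esub> l \<oplus>\<^bsub>M\<^esub> x [^] Suc k \<odot>\<^bsub>M\<^esub> u \<in> L"
        using lu lc xc R.nat_pow_Suc2[OF xc, of k] by (simp add: smult_r_distr smult_assoc1 del: R.nat_pow_Suc)
      then have "x [^] Suc k \<odot>\<^bsub>M\<^esub> u \<in> L"
        using sub_add_cancel(2)[OF Ls(1) sub_smult[OF Ls(1) xc lu(1)]] xc lu(2)
        by (meson R.nat_pow_closed smult_closed)
      then have "u \<in> colon L (x [^] Suc k)" using lu by (simp add: colon_def)
      then have "x [^] k \<odot>\<^bsub>M\<^esub> u \<in> L" unfolding stab by (simp add: colon_def)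
      then have "d \<in> L" unfolding lu(3) using sub_add[OF Ls(1) lu(1)] by blast
      then show "d \<in> ?K" using d Ls(3) by blast
    qed
    then have "?L \<in> ?C" using sL LL Ls KD by blast
    then have "?L = L" using L(2) LL by blast
    then have "x [^] k \<in> ann_mod L" using adj_scale[OF Ls(1), of "x [^] k"] xc by (auto simp: ann_mod_def)
    then show ?thesis by blast
  qed
  then obtain k where k: "ideal_power R \<mm> k \<subseteq> ann_mod L"
    using ideal_power_subset_nilpotent[OF R.is_cring ring_noetherian ideal_ann_mod[OF Ls(1)] mm_ideal] by blast
  have "ideal_smult R M (ideal_power R \<mm> k) (carrier M) \<subseteq> L"
    by (rule ideal_smult_least[OF Ls(1)]) (use k in \<open>auto simp: ann_mod_def\<close>)
  moreover have "K \<subseteq> L" using Ls(2) set_add_left[OF assms(1) mD] by blast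
  ultimately have "D \<subseteq> L" using small[of k] set_add_least[OF Ls(1)] by blast
  then have "D \<subseteq> ?K" using Ls(3) by blast
  then have "D \<subseteq> K" using nakayama[OF assms(1,2)] by blast
  then show ?thesis using assms(3) by blast
qed

end

section \<open>Length of an interval of submodules\<close>

text \<open>The supremum of the lengths of such chains is the length of X / Y, obtained without
  forming the quotient.\<close>

definition interval_chain ::
    "('a, 'c) ring_scheme \<Rightarrow> ('a, 'b, 'd) module_scheme \<Rightarrow> 'b set \<Rightarrow> 'b set \<Rightarrow> (nat \<Rightarrow> 'b set) \<Rightarrow> nat \<Rightarrow> bool"
  where "interval_chain R M Y X C n \<longleftrightarrow>
    (\<forall>i\<le>n. submodule (C i) R M \<and> Y \<subseteq> C i \<and> C i \<subseteq> X) \<and> (\<forall>i<n. C i \<subset> C (Suc i))"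

definition interval_length ::
    "('a, 'c) ring_scheme \<Rightarrow> ('a, 'b, 'd) module_scheme \<Rightarrow> 'b set \<Rightarrow> 'b set \<Rightarrow> enat"
  where "interval_length R M Y X = Sup {enat n | n. \<exists>C. interval_chain R M Y X C n}"

lemma interval_chainD:
  assumes "interval_chain R M Y X C n"
  shows "i \<le> n \<Longrightarrow> submodule (C i) R M" "i \<le> n \<Longrightarrow> Y \<subseteq> C i" "i \<le> n \<Longrightarrow> C i \<subseteq> X"
    "i < n \<Longrightarrow> C i \<subset> C (Suc i)"
  using assms unfolding interval_chain_def by blast+

lemma interval_length_ge: "interval_chain R M Y X C n \<Longrightarrow> enat n \<le> interval_length R M Y X"
  unfolding interval_length_def by (rule Sup_upper) auto

lemma interval_length_le:
  "(\<And>C n. interval_chain R M Y X C n \<Longrightarrow> enat n \<le> k) \<Longrightarrow> interval_length R M Y X \<le> k"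
  unfolding interval_length_def by (rule Sup_least) auto

lemma module_length_eq: "module_length R M = interval_length R M {\<zero>\<^bsub>M\<^esub>} (carrier M)"
proof -
  have "{\<zero>\<^bsub>M\<^esub>} \<subseteq> N" "N \<subseteq> carrier M" if "submodule N R M" for N
    using submodule.axioms(1)[OF that] subgroup.one_closed subgroup.subset by fastforce+
  then have "interval_chain R M {\<zero>\<^bsub>M\<^esub>} (carrier M) C n \<longleftrightarrow>
      (\<forall>i\<le>n. submodule (C i) R M) \<and> (\<forall>i<n. C i \<subset> C (Suc i))" for C n
    unfolding interval_chain_def by blast
  then show ?thesis unfolding module_length_def interval_length_def by simp
qed

lemma interval_length_mono_map:
  assumes "\<And>N. submodule N R M \<Longrightarrow> Y \<subseteq> N \<Longrightarrow> N \<subseteq> X \<Longrightarrow> submodule (f N) R' M' \<and> Y' \<subseteq> f N \<and> f N \<subseteq> X'"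
    and "\<And>N K. submodule N R M \<Longrightarrow> submodule K R M \<Longrightarrow> Y \<subseteq> N \<Longrightarrow> N \<subset> K \<Longrightarrow> K \<subseteq> X \<Longrightarrow> f N \<subset> f K"
  shows "interval_length R M Y X \<le> interval_length R' M' Y' X'"
proof (rule interval_length_le)
  fix C n assume C: "interval_chain R M Y X C n"
  have "interval_chain R' M' Y' X' (\<lambda>i. f (C i)) n"
    using C assms unfolding interval_chain_def by (metis Suc_leI less_imp_le_nat)
  then show "enat n \<le> interval_length R' M' Y' X'" by (rule interval_length_ge)
qed

lemma interval_length_iso:
  assumes "\<And>N. submodule N R M \<Longrightarrow> Y \<subseteq> N \<Longrightarrow> N \<subseteq> X \<Longrightarrow> submodule (f N) R' M' \<and> Y' \<subseteq> f N \<and> f N \<subseteq> X' \<and> g (f N) = N"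
    and "\<And>N. submodule N R' M' \<Longrightarrow> Y' \<subseteq> N \<Longrightarrow> N \<subseteq> X' \<Longrightarrow> submodule (g N) R M \<and> Y \<subseteq> g N \<and> g N \<subseteq> X \<and> f (g N) = N"
    and "\<And>N K. N \<subseteq> K \<Longrightarrow> f N \<subseteq> f K" "\<And>N K. N \<subseteq> K \<Longrightarrow> g N \<subseteq> g K"
  shows "interval_length R M Y X = interval_length R' M' Y' X'"
proof (rule antisym)
  show "interval_length R M Y X \<le> interval_length R' M' Y' X'"
  proof (rule interval_length_mono_map[where f = f])
    fix N K assume a: "submodule N R M" "submodule K R M" "Y \<subseteq> N" "N \<subset> K" "K \<subseteq> X"
    then have "f N \<noteq> f K" using assms(1)[of N] assms(1)[of K] by (metis order.strict_implies_order order_trans psubset_eq)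
    then show "f N \<subset> f K" using assms(3)[of N K] a(4) by blast
  qed (use assms(1) in blast)
  show "interval_length R' M' Y' X' \<le> interval_length R M Y X"
  proof (rule interval_length_mono_map[where f = g])
    fix N K assume a: "submodule N R' M'" "submodule K R' M'" "Y' \<subseteq> N" "N \<subset> K" "K \<subseteq> X'"
    then have "g N \<noteq> g K" using assms(2)[of N] assms(2)[of K] by (metis order.strict_implies_order order_trans psubset_eq)
    then show "g N \<subset> g K" using assms(4)[of N K] a(4) by blast
  qed (use assms(2) in blast)
qed

section \<open>Additivity of length and its behaviour under multiplication\<close>

context module
begin

abbreviation ilen :: "'c set \<Rightarrow> 'c set \<Rightarrow> enat"
  where "ilen Y X \<equiv> interval_length R M Y X"

lemma interval_chain_zero: "sub Y \<Longrightarrow> Y \<subseteq> X \<Longrightarrow> interval_chain R M Y X (\<lambda>_. Y) 0"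
  by (simp add: interval_chain_def)

text \<open>A finite supremum of natural numbers is attained if the set is nonempty, and the
  constant chain at Y takes care of that.\<close>

lemma ilen_attained:
  assumes "sub Y" "Y \<subseteq> X" "ilen Y X = enat k"
  shows "\<exists>C. interval_chain R M Y X C k"
proof (rule ccontr)
  assume no: "\<nexists>C. interval_chain R M Y X C k"
  then have k: "k \<noteq> 0" using interval_chain_zero[OF assms(1,2)] by metis
  have "ilen Y X \<le> enat (k - 1)"
  proof (rule interval_length_le)
    fix C n assume C: "interval_chain R M Y X C n"
    then have "n \<le> k" using interval_length_ge[OF C] assms(3) by simp
    moreover have "n \<noteq> k" using C no by blast
    ultimately show "enat n \<le> enat (k - 1)" by simp
  qed
  then show False using assms(3) k by simp
qed

lemma interval_chain_append:
  assumes "interval_chain R M Y Z C n" "interval_chain R M Z X D m"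
  shows "interval_chain R M Y X (\<lambda>i. if i \<le> n then C i else D (i - n)) (n + m)"
proof -
  have Z: "Y \<subseteq> Z" "Z \<subseteq> X" using assms unfolding interval_chain_def by (meson le0 order_trans)+
  have 1: "(if i \<le> n then C i else D (i - n)) \<subset> (if Suc i \<le> n then C (Suc i) else D (Suc i - n))"
    if i: "i < n + m" for i
  proof -
    consider "i < n" | "i = n" | "i > n" by linarith
    then show ?thesis
    proof cases
      case 1 then show ?thesis using assms(1) by (simp add: interval_chain_def)
    next
      case 2
      then have "C n \<subseteq> Z" "Z \<subseteq> D 0" "D 0 \<subset> D (Suc 0)"
        using interval_chainD(3)[OF assms(1), of n] interval_chainD(2,4)[OF assms(2), of 0] i by auto
      then show ?thesis using 2 by auto
    next
      case 3
      then have "D (i - n) \<subset> D (Suc (i - n))" using assms(2) i by (simp add: interval_chain_def)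
      then show ?thesis using 3 by (simp add: Suc_diff_le)
    qed
  qed
  have 2: "submodule (if i \<le> n then C i else D (i - n)) R M \<and>
      Y \<subseteq> (if i \<le> n then C i else D (i - n)) \<and> (if i \<le> n then C i else D (i - n)) \<subseteq> X"
    if "i \<le> n + m" for i
  proof (cases "i \<le> n")
    case True then show ?thesis using interval_chainD(1-3)[OF assms(1) True] Z(2) by auto
  next
    case False
    then have "i - n \<le> m" using that by simp
    then show ?thesis using False interval_chainD(1-3)[OF assms(2), of "i - n"] Z(1) by auto
  qed
  show ?thesis unfolding interval_chain_def using 1 2 by blast
qed

lemma interval_chain_snoc:
  assumes "interval_chain R M Y X C n" "sub N" "C n \<subset> N" "N \<subseteq> X"
  shows "interval_chain R M Y X (C(Suc n := N)) (Suc n)"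
proof -
  have "Y \<subseteq> C n" using assms(1) unfolding interval_chain_def by blast
  then have "Y \<subseteq> N" using assms(3) by blast
  then show ?thesis using assms unfolding interval_chain_def by (auto simp: less_Suc_eq le_Suc_eq)
qed

lemma modular_cancel:
  assumes "sub N" "sub K" "sub Z" "N \<subseteq> K" "N \<inter> Z = K \<inter> Z" "N <+>\<^bsub>M\<^esub> Z = K <+>\<^bsub>M\<^esub> Z"
  shows "N = K"
proof -
  have "K = (N <+>\<^bsub>M\<^esub> Z) \<inter> K" using assms(6) set_add_left[OF assms(2,3)] by blast
  also have "\<dots> = N <+>\<^bsub>M\<^esub> (Z \<inter> K)" by (rule modular_law[OF assms(1,3,2,4)])
  also have "Z \<inter> K = N \<inter> Z" using assms(5) by blast
  also have "N <+>\<^bsub>M\<^esub> (N \<inter> Z) = N" using set_add_absorb[OF assms(1) sub_Int[OF assms(1,3)]] by blast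
  finally show ?thesis by simp
qed

text \<open>By \<open>modular_cancel\<close> a strict step of the chain remains strict after
  intersecting with Z or after adding Z, so it is counted in at least one of the two new
  chains.\<close>

lemma interval_chain_split:
  assumes "sub Z" "Y \<subseteq> Z" "Z \<subseteq> X" "sub X" "interval_chain R M Y X C n"
  shows "\<exists>A B a b. interval_chain R M Y Z A a \<and> A a = C n \<inter> Z \<and>
    interval_chain R M Z X B b \<and> B b = C n <+>\<^bsub>M\<^esub> Z \<and> n \<le> a + b"
  using assms(5)
proof (induction n)
  case 0
  then have C0: "sub (C 0)" "Y \<subseteq> C 0" "C 0 \<subseteq> X" by (auto simp: interval_chain_def)
  have "interval_chain R M Y Z (\<lambda>_. C 0 \<inter> Z) 0" "interval_chain R M Z X (\<lambda>_. C 0 <+>\<^bsub>M\<^esub> Z) 0"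
    using C0 assms sub_Int[OF C0(1) assms(1)] sub_set_add[OF C0(1) assms(1)]
      set_add_right[OF C0(1) assms(1)] set_add_least[OF assms(4) C0(3) assms(3)]
    by (auto simp: interval_chain_def)
  then show ?case by blast
next
  case (Suc n)
  have n: "interval_chain R M Y X C n" using Suc.prems by (simp add: interval_chain_def)
  have C: "sub (C n)" "sub (C (Suc n))" "C n \<subset> C (Suc n)" "C (Suc n) \<subseteq> X"
    using Suc.prems by (auto simp: interval_chain_def)
  obtain A B a b where IH: "interval_chain R M Y Z A a" "A a = C n \<inter> Z"
    "interval_chain R M Z X B b" "B b = C n <+>\<^bsub>M\<^esub> Z" "n \<le> a + b" using Suc.IH[OF n] by blast
  have s: "sub (C (Suc n) \<inter> Z)" "sub (C (Suc n) <+>\<^bsub>M\<^esub> Z)"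
    using sub_Int[OF C(2) assms(1)] sub_set_add[OF C(2) assms(1)] by auto
  have sX: "C (Suc n) <+>\<^bsub>M\<^esub> Z \<subseteq> X" using set_add_least[OF assms(4) C(4) assms(3)] .
  have m: "C n \<inter> Z \<subseteq> C (Suc n) \<inter> Z" "C n <+>\<^bsub>M\<^esub> Z \<subseteq> C (Suc n) <+>\<^bsub>M\<^esub> Z"
    using C(3) set_add_mono[of "C n" "C (Suc n)" Z Z] by auto
  have A': "\<exists>A'. interval_chain R M Y Z A' (Suc a) \<and> A' (Suc a) = C (Suc n) \<inter> Z"
    if "C n \<inter> Z \<noteq> C (Suc n) \<inter> Z"
    using interval_chain_snoc[OF IH(1) s(1)] IH(2) that m(1)
    by (intro exI[of _ "A(Suc a := C (Suc n) \<inter> Z)"]) auto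
  have B': "\<exists>B'. interval_chain R M Z X B' (Suc b) \<and> B' (Suc b) = C (Suc n) <+>\<^bsub>M\<^esub> Z"
    if "C n <+>\<^bsub>M\<^esub> Z \<noteq> C (Suc n) <+>\<^bsub>M\<^esub> Z"
    using interval_chain_snoc[OF IH(3) s(2) _ sX] IH(4) that m(2)
    by (intro exI[of _ "B(Suc b := C (Suc n) <+>\<^bsub>M\<^esub> Z)"]) auto
  have ne: "C n \<inter> Z \<noteq> C (Suc n) \<inter> Z \<or> C n <+>\<^bsub>M\<^esub> Z \<noteq> C (Suc n) <+>\<^bsub>M\<^esub> Z"
    using modular_cancel[OF C(1,2) assms(1)] C(3) by blast
  consider "C n \<inter> Z \<noteq> C (Suc n) \<inter> Z" "C n <+>\<^bsub>M\<^esub> Z \<noteq> C (Suc n) <+>\<^bsub>M\<^esub> Z"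
    | "C n \<inter> Z \<noteq> C (Suc n) \<inter> Z" "C n <+>\<^bsub>M\<^esub> Z = C (Suc n) <+>\<^bsub>M\<^esub> Z"
    | "C n \<inter> Z = C (Suc n) \<inter> Z" "C n <+>\<^bsub>M\<^esub> Z \<noteq> C (Suc n) <+>\<^bsub>M\<^esub> Z" using ne by blast
  then show ?case
  proof cases
    case 1
    obtain A' where "interval_chain R M Y Z A' (Suc a)" "A' (Suc a) = C (Suc n) \<inter> Z" using A'[OF 1(1)] by blast
    moreover obtain B' where "interval_chain R M Z X B' (Suc b)" "B' (Suc b) = C (Suc n) <+>\<^bsub>M\<^esub> Z" using B'[OF 1(2)] by blast
    moreover have "Suc n \<le> Suc a + Suc b" using IH(5) by simp
    ultimately show ?thesis by blast
  next
    case 2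
    obtain A' where "interval_chain R M Y Z A' (Suc a)" "A' (Suc a) = C (Suc n) \<inter> Z" using A'[OF 2(1)] by blast
    moreover have "Suc n \<le> Suc a + b" using IH(5) by simp
    moreover have "B b = C (Suc n) <+>\<^bsub>M\<^esub> Z" using IH(4) 2(2) by simp
    ultimately show ?thesis using IH(3) by blast
  next
    case 3
    obtain B' where "interval_chain R M Z X B' (Suc b)" "B' (Suc b) = C (Suc n) <+>\<^bsub>M\<^esub> Z" using B'[OF 3(2)] by blast
    moreover have "Suc n \<le> a + Suc b" using IH(5) by simp
    moreover have "A a = C (Suc n) \<inter> Z" using IH(2) 3(1) by simp
    ultimately show ?thesis using IH(1) by blast
  qed
qed

text \<open>One inequality splits a chain at Z; the other concatenates chains of maximal length
  below and above Z, which exist once the total length is finite.\<close>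

lemma ilen_additive:
  assumes "sub Y" "sub Z" "sub X" "Y \<subseteq> Z" "Z \<subseteq> X"
  shows "ilen Y X = ilen Y Z + ilen Z X"
proof (rule antisym)
  show "ilen Y X \<le> ilen Y Z + ilen Z X"
  proof (rule interval_length_le)
    fix C n assume "interval_chain R M Y X C n"
    then obtain A B a b where AB: "interval_chain R M Y Z A a" "interval_chain R M Z X B b" "n \<le> a + b"
      using interval_chain_split[OF assms(2,4,5,3)] by blast
    have "enat n \<le> enat a + enat b" using AB(3) by simp
    also have "\<dots> \<le> ilen Y Z + ilen Z X"
      by (rule add_mono[OF interval_length_ge[OF AB(1)] interval_length_ge[OF AB(2)]])
    finally show "enat n \<le> ilen Y Z + ilen Z X" .
  qed
  show "ilen Y Z + ilen Z X \<le> ilen Y X"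
  proof (cases "ilen Y X")
    case (enat k)
    have "ilen Y Z \<le> enat k"
      unfolding enat[symmetric] by (rule interval_length_mono_map[where f = "\<lambda>N. N"]) (use assms(5) in auto)
    moreover have "ilen Z X \<le> enat k"
      unfolding enat[symmetric] by (rule interval_length_mono_map[where f = "\<lambda>N. N"]) (use assms(4) in auto)
    ultimately obtain a b where ab: "ilen Y Z = enat a" "ilen Z X = enat b"
      by (metis enat_ord_simps(5) enat_ile)
    obtain A B where "interval_chain R M Y Z A a" "interval_chain R M Z X B b"
      using ilen_attained[OF assms(1,4) ab(1)] ilen_attained[OF assms(2,5) ab(2)] by blast
    from interval_length_ge[OF interval_chain_append[OF this]] show ?thesis using ab by simp
  qed simp
qed

lemma ilen_self: "sub Y \<Longrightarrow> ilen Y Y = 0"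
proof -
  assume "sub Y"
  have "n = 0" if C: "interval_chain R M Y Y C n" for C n
  proof (rule ccontr)
    assume "n \<noteq> 0"
    then have "C 0 \<subset> C (Suc 0)" "Y \<subseteq> C 0" "C (Suc 0) \<subseteq> Y"
      using interval_chainD(2,4)[OF C, of 0] interval_chainD(3)[OF C, of "Suc 0"] by auto
    then show False by blast
  qed
  then have "ilen Y Y \<le> 0" by (intro interval_length_le) (auto simp: zero_enat_def)
  then show ?thesis by simp
qed

lemma ilen_pos:
  assumes "sub Y" "sub X" "Y \<subset> X"
  shows "1 \<le> ilen Y X"
proof -
  have "interval_chain R M Y X (\<lambda>i. if i = 0 then Y else X) 1"
    using assms by (auto simp: interval_chain_def)
  then show ?thesis using interval_length_ge by (fastforce simp: one_enat_def)
qed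

lemma ilen_eq_0_iff:
  assumes "sub Y" "sub X" "Y \<subseteq> X"
  shows "ilen Y X = 0 \<longleftrightarrow> X = Y"
  using ilen_pos[OF assms(1,2)] ilen_self[OF assms(1)] assms(3) by (metis not_one_le_zero psubsetI)

lemma ilen_mono:
  assumes "Y' \<subseteq> Y" "X \<subseteq> X'"
  shows "ilen Y X \<le> ilen Y' X'"
  by (rule interval_length_mono_map[where f = "\<lambda>N. N"]) (use assms in auto)

text \<open>Multiplication by a identifies X / ((N : a) \<inter> X) with (N + a X) / N. On
  intermediate submodules the two inverse maps are K \<mapsto> N + a K and K \<mapsto> (K : a)
  \<inter> X.\<close>

lemma ilen_scale:
  assumes "sub N" "sub X" "a \<in> carrier R"
  shows "ilen (colon N a \<inter> X) X = ilen N (N <+>\<^bsub>M\<^esub> scale a X)"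
proof (rule interval_length_iso[where f = "\<lambda>K. N <+>\<^bsub>M\<^esub> scale a K" and g = "\<lambda>K. colon K a \<inter> X"])
  fix K assume K: "sub K" "colon N a \<inter> X \<subseteq> K" "K \<subseteq> X"
  have sK: "sub (scale a K)" using sub_scale[OF assms(3) K(1)] .
  have s: "sub (N <+>\<^bsub>M\<^esub> scale a K)" using sub_set_add[OF assms(1) sK] .
  have "u \<in> K" if u: "u \<in> colon (N <+>\<^bsub>M\<^esub> scale a K) a" "u \<in> X" for u
  proof -
    obtain n k where nk: "n \<in> N" "k \<in> K" "a \<odot>\<^bsub>M\<^esub> u = n \<oplus>\<^bsub>M\<^esub> a \<odot>\<^bsub>M\<^esub> k"
      using u by (auto simp: colon_def set_add_iff scale_def)
    have c: "u \<in> carrier M" "k \<in> carrier M" "n \<in> carrier M"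
      using u nk sub_carrier assms(1,2) K(1) by auto
    have "a \<odot>\<^bsub>M\<^esub> (u \<ominus>\<^bsub>M\<^esub> k) = n" using nk(3) c assms(3) by (simp add: smult_minus add_minus_cancel)
    then have "u \<ominus>\<^bsub>M\<^esub> k \<in> colon N a \<inter> X"
      using nk c u K(3) sub_minus[OF assms(2)] by (auto simp: colon_def)
    then have "u \<ominus>\<^bsub>M\<^esub> k \<in> K" using K(2) by blast
    then show ?thesis using sub_add_cancel(3)[OF K(1) nk(2) c(1)] by blast
  qed
  moreover have "K \<subseteq> colon (N <+>\<^bsub>M\<^esub> scale a K) a"
    using set_add_right[OF assms(1) sK] sub_carrier[OF K(1)] by (auto simp: colon_def scale_def)
  ultimately have "colon (N <+>\<^bsub>M\<^esub> scale a K) a \<inter> X = K" using K(3) by blast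
  then show "sub (N <+>\<^bsub>M\<^esub> scale a K) \<and> N \<subseteq> N <+>\<^bsub>M\<^esub> scale a K \<and>
      N <+>\<^bsub>M\<^esub> scale a K \<subseteq> N <+>\<^bsub>M\<^esub> scale a X \<and> colon (N <+>\<^bsub>M\<^esub> scale a K) a \<inter> X = K"
    by (intro conjI s set_add_left[OF assms(1) sK] set_add_mono[OF subset_refl scale_mono[OF K(3)]])
next
  fix K assume K: "sub K" "N \<subseteq> K" "K \<subseteq> N <+>\<^bsub>M\<^esub> scale a X"
  have c: "sub (colon K a \<inter> X)" using sub_Int[OF sub_colon[OF assms(3) K(1)] assms(2)] .
  have "z \<in> N <+>\<^bsub>M\<^esub> scale a (colon K a \<inter> X)" if z: "z \<in> K" for z
  proof -
    obtain n x where nx: "n \<in> N" "x \<in> X" "z = n \<oplus>\<^bsub>M\<^esub> a \<odot>\<^bsub>M\<^esub> x"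
      using z K(3) by (auto simp: set_add_iff scale_def subset_iff)
    have xc: "x \<in> carrier M" using nx sub_carrier[OF assms(2)] by blast
    have "a \<odot>\<^bsub>M\<^esub> x \<in> K"
      using sub_add_cancel(2)[OF K(1), of n "a \<odot>\<^bsub>M\<^esub> x"] nx z K(2) xc assms(3) by auto
    then have "x \<in> colon K a \<inter> X" using nx xc by (simp add: colon_def)
    then show ?thesis unfolding nx(3) scale_def by (intro set_addI nx(1) imageI)
  qed
  moreover have "N <+>\<^bsub>M\<^esub> scale a (colon K a \<inter> X) \<subseteq> K"
    by (rule set_add_least[OF K(1,2)]) (auto simp: scale_def colon_def)
  ultimately have "N <+>\<^bsub>M\<^esub> scale a (colon K a \<inter> X) = K" by blast
  then show "sub (colon K a \<inter> X) \<and> colon N a \<inter> X \<subseteq> colon K a \<inter> X \<and> colon K a \<inter> X \<subseteq> X \<and>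
      N <+>\<^bsub>M\<^esub> scale a (colon K a \<inter> X) = K"
    by (intro conjI c) (use colon_mono[OF K(2)] in auto)
next
  show "N <+>\<^bsub>M\<^esub> scale a K \<subseteq> N <+>\<^bsub>M\<^esub> scale a L" if "K \<subseteq> L" for K L
    by (rule set_add_mono[OF subset_refl scale_mono[OF that]])
  show "colon K a \<inter> X \<subseteq> colon L a \<inter> X" if "K \<subseteq> L" for K L using colon_mono[OF that] by blast
qed

lemma a_r_coset_carrier: "(H +>\<^bsub>M\<lparr>carrier := X\<rparr>\<^esub> x) = H +>\<^bsub>M\<^esub> x"
  by (simp add: a_r_coset_def')

lemma gr_component_simps:
  "carrier (gr_component M F n) = (\<lambda>x. F (Suc n) +>\<^bsub>M\<^esub> x) ` F n"
  "\<zero>\<^bsub>gr_component M F n\<^esub> = F (Suc n)"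
  "X \<oplus>\<^bsub>gr_component M F n\<^esub> Y = X <+>\<^bsub>M\<^esub> Y"
  "a \<odot>\<^bsub>gr_component M F n\<^esub> X = (\<Union>x\<in>X. F (Suc n) +>\<^bsub>M\<^esub> (a \<odot>\<^bsub>M\<^esub> x))"
  by (auto simp: gr_component_def FactModule_def A_RCOSETS_def' a_r_coset_carrier set_add_def')

lemma coset_self: "sub Y \<Longrightarrow> x \<in> carrier M \<Longrightarrow> x \<in> Y +>\<^bsub>M\<^esub> x"
  using sub_zero coset_mem M.l_zero by metis

end

section \<open>Filtrations and superficial sequences\<close>

context local_module
begin

text \<open>A member of the chain that is not inside Y contains some y + a x with a outside
  \<open>\<mm>\<close>, hence contains x and is the whole top submodule. So there is no second
  strict step.\<close>

lemma ilen_cyclic_le: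
  assumes "sub Y" "x \<in> carrier M" "\<And>a. a \<in> \<mm> \<Longrightarrow> a \<odot>\<^bsub>M\<^esub> x \<in> Y"
  shows "ilen Y (Y <+>\<^bsub>M\<^esub> cyclic x) \<le> 1"
proof (rule interval_length_le)
  fix C n assume C: "interval_chain R M Y (Y <+>\<^bsub>M\<^esub> cyclic x) C n"
  have full: "C j = Y <+>\<^bsub>M\<^esub> cyclic x" if j: "j \<le> n" "\<not> C j \<subseteq> Y" for j
  proof -
    note Cj = interval_chainD(1-3)[OF C j(1)]
    obtain z where z: "z \<in> C j" "z \<notin> Y" using j by blast
    then obtain y a where ya: "y \<in> Y" "a \<in> carrier R" "z = y \<oplus>\<^bsub>M\<^esub> a \<odot>\<^bsub>M\<^esub> x"
      using Cj(3) by (auto simp: set_add_iff cyclic_def subset_iff)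
    have "a \<notin> \<mm>" using z(2) ya assms(3) sub_add[OF assms(1)] by blast
    moreover have "a \<odot>\<^bsub>M\<^esub> x \<in> C j"
      using sub_add_cancel(2)[OF Cj(1), of y "a \<odot>\<^bsub>M\<^esub> x"] ya z(1) Cj(2) assms(2) by auto
    ultimately have "x \<in> C j" using unit_cancel[OF Cj(1) ya(2) _ assms(2)] by blast
    then have "cyclic x \<subseteq> C j" using sub_smult[OF Cj(1)] by (auto simp: cyclic_def)
    then show ?thesis using set_add_least[OF Cj(1,2)] Cj(3) by blast
  qed
  show "enat n \<le> 1"
  proof (rule ccontr)
    assume "\<not> enat n \<le> 1"
    then have n: "Suc 0 < n" by (simp add: one_enat_def)
    have "C 0 \<subset> C (Suc 0)" "C (Suc 0) \<subset> C (Suc (Suc 0))" "Y \<subseteq> C 0" "C (Suc (Suc 0)) \<subseteq> Y <+>\<^bsub>M\<^esub> cyclic x"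
      using interval_chainD(2,4)[OF C, of 0] interval_chainD(4)[OF C, of "Suc 0"]
        interval_chainD(3)[OF C, of "Suc (Suc 0)"] n by auto
    then show False using full[of "Suc 0"] n by auto
  qed
qed

lemma ilen_span_finite:
  assumes "sub Y" "finite T" "T \<subseteq> carrier M" "\<And>a x. a \<in> \<mm> \<Longrightarrow> x \<in> T \<Longrightarrow> a \<odot>\<^bsub>M\<^esub> x \<in> Y"
  shows "ilen Y (Y <+>\<^bsub>M\<^esub> submodule_span R M T) < \<infinity>"
  using assms(2-4)
proof (induction T rule: finite_induct)
  case empty
  then show ?case using assms(1) by (simp add: span_empty set_add_absorb sub_zero_set sub_zero ilen_self)
next
  case (insert x T)
  let ?Z = "Y <+>\<^bsub>M\<^esub> submodule_span R M T"
  have sT: "sub (submodule_span R M T)" "sub (submodule_span R M (insert x T))" and sx: "sub (cyclic x)"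
    using insert.prems sub_span sub_cyclic by auto
  have Z: "sub ?Z" "sub (?Z <+>\<^bsub>M\<^esub> cyclic x)" using assms(1) sT sx sub_set_add by auto
  have YZ: "Y \<subseteq> ?Z" using set_add_left[OF assms(1) sT(1)] .
  have "Y <+>\<^bsub>M\<^esub> submodule_span R M (insert x T) \<subseteq> ?Z <+>\<^bsub>M\<^esub> cyclic x"
  proof (rule set_add_least[OF Z(2)])
    show "Y \<subseteq> ?Z <+>\<^bsub>M\<^esub> cyclic x" using YZ set_add_left[OF Z(1) sx] by blast
    show "submodule_span R M (insert x T) \<subseteq> ?Z <+>\<^bsub>M\<^esub> cyclic x"
      using set_add_left[OF Z(1) sx] set_add_right[OF Z(1) sx] set_add_right[OF assms(1) sT(1)]
        cyclic_self[of x] insert.prems(1) span_superset[of T]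
      by (intro span_least[OF Z(2)]) auto
  qed
  then have "ilen Y (Y <+>\<^bsub>M\<^esub> submodule_span R M (insert x T)) \<le> ilen Y (?Z <+>\<^bsub>M\<^esub> cyclic x)"
    by (rule ilen_mono[OF subset_refl])
  also have "\<dots> = ilen Y ?Z + ilen ?Z (?Z <+>\<^bsub>M\<^esub> cyclic x)"
    using assms(1) Z YZ set_add_left[OF Z(1) sx] by (intro ilen_additive) auto
  also have "\<dots> \<le> ilen Y ?Z + 1"
    using ilen_cyclic_le[OF Z(1), of x] insert.prems YZ by (intro add_left_mono) auto
  also have "\<dots> < \<infinity>"
  proof -
    have "ilen Y ?Z < \<infinity>" using insert.IH insert.prems by auto
    then show ?thesis by (auto simp: one_enat_def less_infinityE plus_enat_simps)
  qed
  finally show ?case .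
qed

lemma ilen_mm_finite:
  assumes "sub Y" "sub X" "Y \<subseteq> X" "ideal_smult R M \<mm> X \<subseteq> Y"
  shows "ilen Y X < \<infinity>"
proof -
  obtain T where T: "finite T" "T \<subseteq> carrier M" "submodule_span R M T = X" by (rule sub_fg[OF assms(2)])
  have "a \<odot>\<^bsub>M\<^esub> x \<in> Y" if "a \<in> \<mm>" "x \<in> T" for a x
    using that ideal_smultI[of a \<mm> x X] T(3) span_superset[of T] assms(4) by blast
  then have "ilen Y (Y <+>\<^bsub>M\<^esub> X) < \<infinity>" using ilen_span_finite[OF assms(1) T(1,2)] T(3) by simp
  moreover have "Y <+>\<^bsub>M\<^esub> X = X"
    using set_add_absorb[OF assms(2,1,3)] set_add_commute[OF assms(1,2)] by simp
  ultimately show ?thesis by simp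
qed

lemma ideal_smult_power_Suc:
  assumes "ideal I R" "sub X"
  shows "ideal_smult R M I (ideal_smult R M (ideal_power R I k) X) \<subseteq> ideal_smult R M (ideal_power R I (Suc k)) X"
proof -
  note P = ideal_subset[OF R.ideal_power_ideal[OF assms(1)]]
  note Xc = sub_subset[OF assms(2)]
  have s: "sub (ideal_smult R M (ideal_power R I (Suc k)) X)" using sub_ideal_smult[OF P Xc] .
  show ?thesis
  proof (rule ideal_smult_least[OF s])
    fix a z assume a: "a \<in> I" and z: "z \<in> ideal_smult R M (ideal_power R I k) X"
    have ac: "a \<in> carrier R" using a ideal_carrier[OF assms(1)] by blast
    have "ideal_smult R M (ideal_power R I k) X \<subseteq> colon (ideal_smult R M (ideal_power R I (Suc k)) X) a"
    proof (rule ideal_smult_least[OF sub_colon[OF ac s]])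
      fix b x assume b: "b \<in> ideal_power R I k" and x: "x \<in> X"
      have bc: "b \<in> carrier R" and xc: "x \<in> carrier M" using b P x Xc by auto
      have "a \<otimes> b \<in> ideal_power R I (Suc k)" using a b by (auto intro: ideal_prod.prod)
      then have "(a \<otimes> b) \<odot>\<^bsub>M\<^esub> x \<in> ideal_smult R M (ideal_power R I (Suc k)) X" using x by (rule ideal_smultI)
      then show "b \<odot>\<^bsub>M\<^esub> x \<in> colon (ideal_smult R M (ideal_power R I (Suc k)) X) a"
        using ac bc xc by (simp add: colon_def smult_assoc1)
    qed
    then show "a \<odot>\<^bsub>M\<^esub> z \<in> ideal_smult R M (ideal_power R I (Suc k)) X" using z by (auto simp: colon_def)
  qed
qed

lemma ilen_power_finite:
  "ilen (ideal_smult R M (ideal_power R \<mm> k) (carrier M)) (carrier M) < \<infinity>"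
proof (induction k)
  case 0
  have "carrier M \<subseteq> ideal_smult R M (carrier R) (carrier M)"
    using ideal_smultI[of \<one> "carrier R" _ "carrier M"] by fastforce
  then have "ideal_smult R M (carrier R) (carrier M) = carrier M"
    using sub_subset[OF sub_ideal_smult[of "carrier R" "carrier M"]] by blast
  then show ?case using ilen_self[OF sub_whole] by simp
next
  case (Suc k)
  let ?X = "\<lambda>k. ideal_smult R M (ideal_power R \<mm> k) (carrier M)"
  have s: "sub (?X k)" for k
    using sub_ideal_smult[OF ideal_subset[OF R.ideal_power_ideal[OF mm_ideal]]] by blast
  have dec: "?X (Suc k) \<subseteq> ?X k"
    by (rule ideal_smult_mono)
      (use R.ideal_power_Suc_subset[OF mm_ideal] ideal_subset[OF R.ideal_power_ideal[OF mm_ideal]] in auto)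
  have "ilen (?X (Suc k)) (carrier M) = ilen (?X (Suc k)) (?X k) + ilen (?X k) (carrier M)"
    by (rule ilen_additive[OF s s sub_whole dec sub_subset[OF s]])
  moreover have "ilen (?X (Suc k)) (?X k) < \<infinity>"
    by (rule ilen_mm_finite[OF s s dec ideal_smult_power_Suc[OF mm_ideal sub_whole]])
  ultimately show ?case using Suc.IH by (auto elim!: less_infinityE)
qed

end

context module
begin

definition len :: "'c set \<Rightarrow> 'c set \<Rightarrow> nat"
  where "len Y X = the_enat (ilen Y X)"

lemma len_additive:
  assumes "sub Y" "sub Z" "sub X" "Y \<subseteq> Z" "Z \<subseteq> X" "ilen Y X < \<infinity>"
  shows "len Y X = len Y Z + len Z X"
  using ilen_additive[OF assms(1-5)] assms(6) unfolding len_def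
  by (cases "ilen Y Z"; cases "ilen Z X") auto

lemma len_eq_0:
  assumes "sub Y" "sub X" "Y \<subseteq> X" "ilen Y X < \<infinity>" "len Y X = 0"
  shows "X = Y"
  using assms ilen_eq_0_iff[OF assms(1-3)] unfolding len_def by (cases "ilen Y X") (auto simp: zero_enat_def)

lemma len_self: "sub Y \<Longrightarrow> len Y Y = 0"
  by (simp add: len_def ilen_self zero_enat_def)

text \<open>Take m for which the length of \<open>D m\<close> over K is least; by additivity any
  later strict decrease would lower it.\<close>

lemma stabilize:
  assumes "sub K" "\<And>n. sub (D n)" "\<And>n. K \<subseteq> D n" "\<And>n. D (Suc n) \<subseteq> D n" "ilen K (D 0) < \<infinity>"
  shows "\<exists>m. \<forall>n\<ge>m. D n = D m"
proof -
  obtain m where m: "\<forall>n. len K (D m) \<le> len K (D n)"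
    using ex_has_least_nat[of "\<lambda>_. True" 0 "\<lambda>n. len K (D n)"] by auto
  have anti: "D n \<subseteq> D k" if "k \<le> n" for k n
    using lift_Suc_antimono_le[of D, OF assms(4) that] .
  have "D n = D m" if n: "n \<ge> m" for n
  proof -
    have fin: "ilen K (D m) < \<infinity>" using ilen_mono[OF subset_refl anti[of 0 m]] assms(5) by (meson le0 order_le_less_trans)
    have "len K (D m) = len K (D n) + len (D n) (D m)"
      by (rule len_additive[OF assms(1) assms(2) assms(2) assms(3) anti[OF n] fin])
    then have "len (D n) (D m) = 0" using m[rule_format, of n] by simp
    moreover have "ilen (D n) (D m) < \<infinity>" using ilen_mono[OF assms(3)[of n] subset_refl, of "D m"] fin by (meson order_le_less_trans)
    ultimately show ?thesis using len_eq_0[OF assms(2) assms(2) anti[OF n]] by simp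
  qed
  then show ?thesis by blast
qed

end

section \<open>Good filtrations and the topology they define\<close>

locale filtered_module = local_module +
  fixes \<qq> and F :: "nat \<Rightarrow> 'c set"
  assumes primary: "primary_to R \<mm> \<qq>"
    and good: "good_filtration R \<qq> M F"
begin

lemma q_ideal: "ideal \<qq> R"
  using primary by (simp add: primary_to_def primary_ideal_def)

lemma q_subset: "\<qq> \<subseteq> \<mm>"
proof
  fix x assume x: "x \<in> \<qq>"
  then have "x \<in> carrier R" using ideal_carrier[OF q_ideal] by blast
  moreover from this x have "x [^] (1::nat) \<in> \<qq>" by simp
  ultimately have "x \<in> ideal_radical R \<qq>" unfolding ideal_radical_def by blast
  then show "x \<in> \<mm>" using primary by (simp add: primary_to_def)
qed

lemma mm_power_subset: "\<exists>k. ideal_power R \<mm> k \<subseteq> \<qq>"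
  using primary ideal_power_subset_nilpotent[OF R.is_cring ring_noetherian q_ideal mm_ideal]
  by (auto simp: primary_to_def ideal_radical_def)

lemma F_zero: "F 0 = carrier M" and sub_F: "sub (F n)" and F_Suc: "F (Suc n) \<subseteq> F n"
  and q_F: "ideal_smult R M \<qq> (F n) \<subseteq> F (Suc n)"
  and F_stable: "\<exists>n0. \<forall>n\<ge>n0. F (Suc n) = ideal_smult R M \<qq> (F n)"
  using good by (auto simp: good_filtration_def)

lemma q_carrier: "a \<in> \<qq> \<Longrightarrow> a \<in> carrier R"
  using ideal_carrier[OF q_ideal] .

lemma F_antimono: "i \<le> j \<Longrightarrow> F j \<subseteq> F i"
  using lift_Suc_antimono_le[of F, OF F_Suc] .

lemma q_smult_F: "a \<in> \<qq> \<Longrightarrow> x \<in> F n \<Longrightarrow> a \<odot>\<^bsub>M\<^esub> x \<in> F (Suc n)"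
  using ideal_smultI q_F by blast

text \<open>Some power \<open>\<mm>\<close>^e lies in \<open>\<qq>\<close>, so e further factors
  from \<open>\<mm>\<close> push elements of \<open>F n\<close> into
  \<open>F (Suc n)\<close>.\<close>

lemma F_power_lower: "ideal_smult R M (ideal_power R \<mm> k) (carrier M) \<subseteq> F n \<Longrightarrow>
    \<exists>k'. ideal_smult R M (ideal_power R \<mm> k') (carrier M) \<subseteq> F (Suc n)"
proof -
  assume k: "ideal_smult R M (ideal_power R \<mm> k) (carrier M) \<subseteq> F n"
  obtain e where e: "ideal_power R \<mm> e \<subseteq> \<qq>" using mm_power_subset by blast
  note P = ideal_carrier[OF R.ideal_power_ideal[OF mm_ideal]]
  have "ideal_smult R M (ideal_power R \<mm> (e + k)) (carrier M) \<subseteq> F (Suc n)"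
  proof (rule ideal_smult_least[OF sub_F])
    fix a x assume a: "a \<in> ideal_power R \<mm> (e + k)" and x: "x \<in> carrier M"
    have "ideal_power R \<mm> (e + k) \<subseteq> {a \<in> carrier R. \<forall>x\<in>carrier M. a \<odot>\<^bsub>M\<^esub> x \<in> F (Suc n)}"
      unfolding R.ideal_power_add[OF mm_ideal]
    proof (rule R.ideal_prod_least[OF colon_ideal[OF sub_whole sub_F]])
      fix b c assume bc: "b \<in> ideal_power R \<mm> e" "c \<in> ideal_power R \<mm> k"
      then have "b \<odot>\<^bsub>M\<^esub> (c \<odot>\<^bsub>M\<^esub> y) \<in> F (Suc n)" if "y \<in> carrier M" for y
        using q_smult_F[of b "c \<odot>\<^bsub>M\<^esub> y" n] e k ideal_smultI[OF bc(2) that] by blast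
      then show "b \<otimes> c \<in> {a \<in> carrier R. \<forall>x\<in>carrier M. a \<odot>\<^bsub>M\<^esub> x \<in> F (Suc n)}"
        using P[OF bc(1)] P[OF bc(2)] by (simp add: smult_assoc1)
    qed
    then show "a \<odot>\<^bsub>M\<^esub> x \<in> F (Suc n)" using a x by blast
  qed
  then show ?thesis by blast
qed

text \<open>Together with \<open>F_in_power\<close> this says that the filtration defines the
  \<open>\<mm>\<close>-adic topology. So lengths over \<open>F n\<close> are finite, and Krull's
  theorem can be applied to the filtration.\<close>

lemma F_contains_power: "\<exists>k. ideal_smult R M (ideal_power R \<mm> k) (carrier M) \<subseteq> F n"
proof (induction n)
  case 0
  have "ideal_smult R M (ideal_power R \<mm> 0) (carrier M) \<subseteq> F 0"
    unfolding F_zero by (rule ideal_smult_least[OF sub_whole]) auto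
  then show ?case by blast
qed (use F_power_lower in blast)

lemma F_in_power: "\<exists>n0. \<forall>n\<ge>n0. F n \<subseteq> ideal_smult R M (ideal_power R \<mm> k) (carrier M)"
proof -
  obtain n0 where n0: "\<forall>n\<ge>n0. F (Suc n) = ideal_smult R M \<qq> (F n)" using F_stable by blast
  have "F (n0 + k) \<subseteq> ideal_smult R M (ideal_power R \<mm> k) (carrier M)" for k
  proof (induction k)
    case 0
    have "x \<in> ideal_smult R M (carrier R) (carrier M)" if "x \<in> carrier M" for x
      using ideal_smultI[of \<one> "carrier R" x "carrier M"] that by simp
    then show ?case using sub_subset[OF sub_F] by auto
  next
    case (Suc k)
    have c: "ideal_smult R M (ideal_power R \<mm> k) (carrier M) \<subseteq> carrier M"
      using sub_subset[OF sub_ideal_smult[OF ideal_subset[OF R.ideal_power_ideal[OF mm_ideal]]]] by blast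
    have "F (n0 + Suc k) = ideal_smult R M \<qq> (F (n0 + k))" using n0 by simp
    also have "\<dots> \<subseteq> ideal_smult R M \<mm> (ideal_smult R M (ideal_power R \<mm> k) (carrier M))"
      by (rule ideal_smult_mono[OF q_subset Suc.IH ideal_subset[OF mm_ideal] c])
    also have "\<dots> \<subseteq> ideal_smult R M (ideal_power R \<mm> (Suc k)) (carrier M)"
      by (rule ideal_smult_power_Suc[OF mm_ideal sub_whole])
    finally show ?case .
  qed
  then show ?thesis using F_antimono by (meson order_trans)
qed

lemma ilen_F_finite: "F n \<subseteq> Y \<Longrightarrow> X \<subseteq> carrier M \<Longrightarrow> ilen Y X < \<infinity>"
proof -
  assume a: "F n \<subseteq> Y" "X \<subseteq> carrier M"
  obtain k where "ideal_smult R M (ideal_power R \<mm> k) (carrier M) \<subseteq> F n" using F_contains_power by blast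
  then have "ilen Y X \<le> ilen (ideal_smult R M (ideal_power R \<mm> k) (carrier M)) (carrier M)"
    using a by (intro ilen_mono) auto
  then show ?thesis using ilen_power_finite[of k] by (rule order_le_less_trans)
qed

lemma F_intersection:
  assumes "sub K" "sub D" "K \<subseteq> D" "\<And>n. D \<subseteq> F n <+>\<^bsub>M\<^esub> K"
  shows "D = K"
proof (rule krull_intersection[OF assms(1-3)])
  fix k
  obtain n where "F n \<subseteq> ideal_smult R M (ideal_power R \<mm> k) (carrier M)" using F_in_power by blast
  then show "D \<subseteq> ideal_smult R M (ideal_power R \<mm> k) (carrier M) <+>\<^bsub>M\<^esub> K"
    using assms(4)[of n] set_add_mono[OF _ subset_refl, of "F n" _ K] by blast
qed

text \<open>A superficial element is regular as soon as there is no socle: \<open>N :\<^sub>M a\<close> meets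
  \<open>F c + N\<close> in \<open>\<Inter>(F n + N) = N\<close>, so it is killed by a power of \<open>\<mm>\<close> modulo \<open>N\<close>.\<close>

lemma superficial_regular:
  assumes "sub N" "a \<in> \<qq>" "regular_mod N z" "z \<in> \<mm>"
    and sup: "\<forall>n\<ge>c. colon (F (Suc n) <+>\<^bsub>M\<^esub> N) a \<inter> (F c <+>\<^bsub>M\<^esub> N) = F n <+>\<^bsub>M\<^esub> N"
  shows "regular_mod N a"
proof -
  have ac: "a \<in> carrier R" and zc: "z \<in> carrier R" using assms q_carrier mm_carrier by auto
  have sF: "sub (F n <+>\<^bsub>M\<^esub> N)" for n using sub_set_add sub_F assms(1) by blast
  let ?D = "colon N a \<inter> (F c <+>\<^bsub>M\<^esub> N)"
  have sD: "sub ?D" using sub_Int sub_colon ac assms(1) sF by blast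
  have ND: "N \<subseteq> ?D" using subset_colon[OF ac assms(1)] set_add_right[OF sub_F assms(1)] by blast
  have "?D \<subseteq> F n <+>\<^bsub>M\<^esub> N" for n
  proof -
    \<comment> \<open>The superficial equation speaks only from c on, hence the maximum.\<close>
    have "?D \<subseteq> F (max n c) <+>\<^bsub>M\<^esub> N"
      using sup[rule_format, of "max n c"] colon_mono[OF set_add_right[OF sub_F assms(1)]] by fastforce
    also have "\<dots> \<subseteq> F n <+>\<^bsub>M\<^esub> N" by (rule set_add_mono[OF F_antimono subset_refl]) simp
    finally show ?thesis .
  qed
  then have D: "?D = N" using F_intersection[OF assms(1) sD ND] by blast
  obtain k where k: "ideal_smult R M (ideal_power R \<mm> k) (carrier M) \<subseteq> F c" using F_contains_power by blast
  show ?thesis unfolding regular_mod_def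
  proof (intro ballI impI)
    fix u assume u: "u \<in> carrier M" "a \<odot>\<^bsub>M\<^esub> u \<in> N"
    \<comment> \<open>A power of z carries u into F c, where the elements of N : a are known to lie
      in N; regularity of z then brings u itself into N.\<close>
    have "z [^] k \<odot>\<^bsub>M\<^esub> u \<in> F c"
      using k ideal_smultI[OF R.pow_in_ideal_power[OF mm_ideal assms(4)] u(1)] by blast
    then have "z [^] k \<odot>\<^bsub>M\<^esub> u \<in> F c <+>\<^bsub>M\<^esub> N" using set_add_left[OF sub_F assms(1)] by blast
    moreover have "z [^] k \<odot>\<^bsub>M\<^esub> u \<in> colon N a"
      using u sub_smult[OF sub_colon[OF ac assms(1)], of "z [^] k" u] zc by (simp add: colon_def)
    ultimately have "z [^] k \<odot>\<^bsub>M\<^esub> u \<in> N" using D by blast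
    then show "u \<in> N" using regular_mod_pow[OF assms(3) zc, of k] u(1) by (simp add: regular_mod_def)
  qed
qed

end

section \<open>The Hilbert series of a filtration\<close>

context module
begin

lemma module_gr_component:
  assumes "sub (F (Suc n))" "sub (F n)"
  shows "module R (gr_component M F n)"
proof (rule moduleI)
  let ?G = "gr_component M F n" and ?Y = "F (Suc n)"
  note Fc = sub_carrier[OF assms(2)]
  note add = coset_add[OF assms(1)]
  note smul = coset_smult[OF assms(1)]
  show "cring R" by (rule R.is_cring)
  show "abelian_group ?G"
  proof (rule abelian_groupI)
    fix X Z W assume "X \<in> carrier ?G" "Z \<in> carrier ?G" "W \<in> carrier ?G"
    then obtain x z w where "x \<in> F n" "z \<in> F n" "w \<in> F n" "X = ?Y +>\<^bsub>M\<^esub> x" "Z = ?Y +>\<^bsub>M\<^esub> z" "W = ?Y +>\<^bsub>M\<^esub> w"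
      by (auto simp: gr_component_simps)
    then show "X \<oplus>\<^bsub>?G\<^esub> Z \<oplus>\<^bsub>?G\<^esub> W = X \<oplus>\<^bsub>?G\<^esub> (Z \<oplus>\<^bsub>?G\<^esub> W)"
      using Fc by (simp add: gr_component_simps add M.a_assoc)
  next
    fix X Z assume "X \<in> carrier ?G" "Z \<in> carrier ?G"
    then obtain x z where xz: "x \<in> F n" "z \<in> F n" "X = ?Y +>\<^bsub>M\<^esub> x" "Z = ?Y +>\<^bsub>M\<^esub> z"
      by (auto simp: gr_component_simps)
    then show "X \<oplus>\<^bsub>?G\<^esub> Z = Z \<oplus>\<^bsub>?G\<^esub> X"
      using Fc by (simp add: gr_component_simps add M.a_comm)
    show "X \<oplus>\<^bsub>?G\<^esub> Z \<in> carrier ?G"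
      using xz Fc sub_add[OF assms(2)] by (auto simp: gr_component_simps add)
  next
    show "\<zero>\<^bsub>?G\<^esub> \<in> carrier ?G"
      using coset_eq_zero_iff[OF assms(1), of "\<zero>\<^bsub>M\<^esub>"] sub_zero assms
      by (auto simp: gr_component_simps intro!: image_eqI[of _ _ "\<zero>\<^bsub>M\<^esub>"])
  next
    fix X assume "X \<in> carrier ?G"
    then obtain x where x: "x \<in> F n" "X = ?Y +>\<^bsub>M\<^esub> x" by (auto simp: gr_component_simps)
    have Y: "?Y = ?Y +>\<^bsub>M\<^esub> \<zero>\<^bsub>M\<^esub>" using sub_subset[OF assms(1)] by simp
    have "?Y <+>\<^bsub>M\<^esub> (?Y +>\<^bsub>M\<^esub> x) = ?Y +>\<^bsub>M\<^esub> x"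
      using add[of "\<zero>\<^bsub>M\<^esub>" x] x Fc Y by simp
    then show "\<zero>\<^bsub>?G\<^esub> \<oplus>\<^bsub>?G\<^esub> X = X" using x by (simp add: gr_component_simps)
    have "(?Y +>\<^bsub>M\<^esub> (\<ominus>\<^bsub>M\<^esub> x)) <+>\<^bsub>M\<^esub> (?Y +>\<^bsub>M\<^esub> x) = ?Y"
      using add[of "\<ominus>\<^bsub>M\<^esub> x" x] x Fc Y by (simp add: M.l_neg)
    then show "\<exists>Z\<in>carrier ?G. Z \<oplus>\<^bsub>?G\<^esub> X = \<zero>\<^bsub>?G\<^esub>"
      using x sub_neg[OF assms(2)] by (auto simp: gr_component_simps)
  qed
  have rep: "\<exists>x\<in>F n. X = ?Y +>\<^bsub>M\<^esub> x" if "X \<in> carrier ?G" for X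
    using that by (auto simp: gr_component_simps)
  fix a X assume a: "a \<in> carrier R" and X: "X \<in> carrier ?G"
  obtain x where x: "x \<in> F n" "X = ?Y +>\<^bsub>M\<^esub> x" using rep[OF X] by blast
  show "a \<odot>\<^bsub>?G\<^esub> X \<in> carrier ?G"
    using x a Fc sub_smult[OF assms(2)] by (auto simp: gr_component_simps smul)
  show "(a \<oplus> b) \<odot>\<^bsub>?G\<^esub> X = a \<odot>\<^bsub>?G\<^esub> X \<oplus>\<^bsub>?G\<^esub> b \<odot>\<^bsub>?G\<^esub> X" if "b \<in> carrier R" for b
    using x a that Fc by (simp add: gr_component_simps smul add smult_l_distr)
  show "(a \<otimes> b) \<odot>\<^bsub>?G\<^esub> X = a \<odot>\<^bsub>?G\<^esub> (b \<odot>\<^bsub>?G\<^esub> X)" if "b \<in> carrier R" for b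
    using x a that Fc by (simp add: gr_component_simps smul smult_assoc1)
  show "a \<odot>\<^bsub>?G\<^esub> (X \<oplus>\<^bsub>?G\<^esub> Z) = a \<odot>\<^bsub>?G\<^esub> X \<oplus>\<^bsub>?G\<^esub> a \<odot>\<^bsub>?G\<^esub> Z" if Z: "Z \<in> carrier ?G" for Z
  proof -
    obtain z where "z \<in> F n" "Z = ?Y +>\<^bsub>M\<^esub> z" using rep[OF Z] by blast
    then show ?thesis using x a Fc by (simp add: gr_component_simps smul add smult_r_distr)
  qed
next
  fix X assume "X \<in> carrier (gr_component M F n)"
  then obtain x where "x \<in> F n" "X = F (Suc n) +>\<^bsub>M\<^esub> x" by (auto simp: gr_component_simps)
  then show "\<one> \<odot>\<^bsub>gr_component M F n\<^esub> X = X"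
    using sub_carrier[OF assms(2)] by (simp add: gr_component_simps coset_smult[OF assms(1)])
qed

text \<open>The correspondence between submodules of a quotient and intermediate submodules: unions
  of cosets in one direction, sets of cosets in the other.\<close>

lemma module_length_gr_component:
  assumes "sub (F (Suc n))" "sub (F n)" "F (Suc n) \<subseteq> F n"
  shows "module_length R (gr_component M F n) = ilen (F (Suc n)) (F n)"
proof -
  let ?G = "gr_component M F n" and ?Y = "F (Suc n)"
  interpret G: module R ?G by (rule module_gr_component[where F = F and n = n, OF assms(1,2)])
  note Fc = sub_carrier[OF assms(2)]
  have Ymem: "y \<in> ?Y +>\<^bsub>M\<^esub> x \<longleftrightarrow> y \<in> carrier M \<and> y \<ominus>\<^bsub>M\<^esub> x \<in> ?Y" if "x \<in> carrier M" for x y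
    using coset_mem_iff[OF assms(1) that] .
  have "interval_length R ?G {\<zero>\<^bsub>?G\<^esub>} (carrier ?G) = interval_length R M ?Y (F n)"
  proof (rule interval_length_iso[where f = "\<lambda>K. \<Union>K" and g = "\<lambda>N. (\<lambda>x. ?Y +>\<^bsub>M\<^esub> x) ` N"])
    fix K assume K: "submodule K R ?G" "{\<zero>\<^bsub>?G\<^esub>} \<subseteq> K" "K \<subseteq> carrier ?G"
    have rep: "\<exists>x\<in>F n. X = ?Y +>\<^bsub>M\<^esub> x" if "X \<in> K" for X
      using that K(3) by (auto simp: gr_component_simps)
    have mem: "?Y +>\<^bsub>M\<^esub> x \<in> K \<and> x \<in> F n" if x: "x \<in> \<Union>K" for x
    proof -
      obtain X z where X: "X \<in> K" "x \<in> X" "z \<in> F n" "X = ?Y +>\<^bsub>M\<^esub> z" using x rep by blast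
      then have xz: "x \<in> carrier M" "x \<ominus>\<^bsub>M\<^esub> z \<in> ?Y" using Ymem Fc by auto
      then have "?Y +>\<^bsub>M\<^esub> x = X" using coset_eq_iff[OF assms(1)] X Fc by simp
      moreover have "x \<in> F n" using sub_add_cancel(3)[OF assms(2) X(3) xz(1)] xz(2) assms(3) by blast
      ultimately show ?thesis using X(1) by simp
    qed
    have memI: "x \<in> \<Union>K" if "?Y +>\<^bsub>M\<^esub> x \<in> K" "x \<in> carrier M" for x
      using that coset_self[OF assms(1)] by blast
    have "sub (\<Union>K)"
    proof (rule submoduleI)
      show "\<Union>K \<subseteq> carrier M" using mem Fc by blast
      show "\<zero>\<^bsub>M\<^esub> \<in> \<Union>K" using K(2) sub_zero[OF assms(1)] by (auto simp: gr_component_simps)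
      fix x assume x: "x \<in> \<Union>K"
      have xc: "x \<in> carrier M" using mem[OF x] Fc by blast
      have s: "?Y +>\<^bsub>M\<^esub> (a \<odot>\<^bsub>M\<^esub> x) \<in> K" if "a \<in> carrier R" for a
        using submodule.smult_closed[OF K(1) that, of "?Y +>\<^bsub>M\<^esub> x"] mem[OF x] coset_smult[OF assms(1) xc that]
        by (simp add: gr_component_simps)
      show "\<ominus>\<^bsub>M\<^esub> x \<in> \<Union>K" using s[of "\<ominus> \<one>"] xc by (intro memI) (simp_all add: smult_l_minus)
      show "a \<odot>\<^bsub>M\<^esub> x \<in> \<Union>K" if "a \<in> carrier R" for a using s that xc by (intro memI) auto
      fix y assume y: "y \<in> \<Union>K"
      have yc: "y \<in> carrier M" using mem[OF y] Fc by blast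
      have "(?Y +>\<^bsub>M\<^esub> x) \<oplus>\<^bsub>?G\<^esub> (?Y +>\<^bsub>M\<^esub> y) \<in> K" using G.sub_add[OF K(1)] mem x y by blast
      then show "x \<oplus>\<^bsub>M\<^esub> y \<in> \<Union>K"
        using xc yc coset_add[OF assms(1) xc yc] by (intro memI) (simp_all add: gr_component_simps)
    qed
    moreover have "?Y \<subseteq> \<Union>K" using K(2) by (auto simp: gr_component_simps)
    moreover have "\<Union>K \<subseteq> F n" using mem by blast
    moreover have "(\<lambda>x. ?Y +>\<^bsub>M\<^esub> x) ` \<Union>K = K"
    proof
      show "(\<lambda>x. ?Y +>\<^bsub>M\<^esub> x) ` \<Union>K \<subseteq> K" using mem by blast
      show "K \<subseteq> (\<lambda>x. ?Y +>\<^bsub>M\<^esub> x) ` \<Union>K"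
      proof
        fix X assume X: "X \<in> K"
        then obtain x where x: "x \<in> F n" "X = ?Y +>\<^bsub>M\<^esub> x" using rep by blast
        then have "x \<in> \<Union>K" using memI X Fc by blast
        then show "X \<in> (\<lambda>x. ?Y +>\<^bsub>M\<^esub> x) ` \<Union>K" unfolding x(2) by (rule imageI)
      qed
    qed
    ultimately show "sub (\<Union>K) \<and> ?Y \<subseteq> \<Union>K \<and> \<Union>K \<subseteq> F n \<and> (\<lambda>x. ?Y +>\<^bsub>M\<^esub> x) ` \<Union>K = K" by (intro conjI)
  next
    fix N assume N: "sub N" "?Y \<subseteq> N" "N \<subseteq> F n"
    let ?K = "(\<lambda>x. ?Y +>\<^bsub>M\<^esub> x) ` N"
    note Nc = sub_carrier[OF N(1)]
    have Yz: "?Y +>\<^bsub>M\<^esub> \<zero>\<^bsub>M\<^esub> = ?Y" using sub_subset[OF assms(1)] by simp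
    have zK: "?Y \<in> ?K" using sub_zero[OF N(1)] Yz by (metis imageI)
    have smK: "a \<odot>\<^bsub>?G\<^esub> X \<in> ?K" if "a \<in> carrier R" "X \<in> ?K" for a X
      using that Nc sub_smult[OF N(1)] coset_smult[OF assms(1)] by (auto simp: gr_component_simps)
    have "submodule ?K R ?G"
    proof (rule G.submoduleI)
      show KG: "?K \<subseteq> carrier ?G" using N(3) by (auto simp: gr_component_simps)
      show "\<zero>\<^bsub>?G\<^esub> \<in> ?K" using zK by (simp add: gr_component_simps)
      show "\<ominus>\<^bsub>?G\<^esub> X \<in> ?K" if "X \<in> ?K" for X
      proof -
        have "X \<in> carrier ?G" using that KG by (rule subsetD[rotated])
        then have "(\<ominus> \<one>) \<odot>\<^bsub>?G\<^esub> X = \<ominus>\<^bsub>?G\<^esub> X" using G.smult_l_minus[of \<one> X] by simp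
        then show ?thesis using smK[OF _ that, of "\<ominus> \<one>"] by simp
      qed
      show "X \<oplus>\<^bsub>?G\<^esub> Z \<in> ?K" if "X \<in> ?K" "Z \<in> ?K" for X Z
        using that Nc sub_add[OF N(1)] coset_add[OF assms(1)] by (auto simp: gr_component_simps)
    qed (rule smK)
    moreover have "\<Union>?K = N"
    proof
      show "N \<subseteq> \<Union>?K" using coset_self[OF assms(1)] Nc by blast
      show "\<Union>?K \<subseteq> N"
      proof
        fix y assume "y \<in> \<Union>?K"
        then obtain x where x: "x \<in> N" "y \<in> ?Y +>\<^bsub>M\<^esub> x" by blast
        then have "y \<in> carrier M" "y \<ominus>\<^bsub>M\<^esub> x \<in> N" using Ymem Nc N(2) by auto
        then show "y \<in> N" using sub_add_cancel(3)[OF N(1) x(1)] by blast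
      qed
    qed
    moreover have "{\<zero>\<^bsub>?G\<^esub>} \<subseteq> ?K" using zK by (simp add: gr_component_simps)
    moreover have "?K \<subseteq> carrier ?G" using N(3) by (auto simp: gr_component_simps)
    ultimately show "submodule ?K R ?G \<and> {\<zero>\<^bsub>?G\<^esub>} \<subseteq> ?K \<and> ?K \<subseteq> carrier ?G \<and> \<Union>?K = N" by (intro conjI)
  qed auto
  then show ?thesis by (simp add: module_length_eq)
qed

end

section \<open>Lengths modulo a superficial sequence and an explicit h-polynomial\<close>

definition int_poly_of :: "nat \<Rightarrow> (nat \<Rightarrow> nat) \<Rightarrow> int poly"
  where "int_poly_of m f = (\<Sum>n<m. Polynomial.monom (int (f n)) n)"

lemma coeff_int_poly_of: "poly.coeff (int_poly_of m f) n = (if n < m then int (f n) else 0)"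
  by (simp add: int_poly_of_def Polynomial.coeff_sum)

lemma fps_of_int_poly_of:
  assumes "\<And>n. n \<ge> m \<Longrightarrow> f n = 0"
  shows "fps_of_poly (int_poly_of m f) = Abs_fps (\<lambda>n. int (f n))"
  using assms by (intro fps_ext) (simp add: coeff_int_poly_of)

lemma poly_int_poly_of: "poly (int_poly_of m f) 1 = (\<Sum>n<m. int (f n))"
  by (simp add: int_poly_of_def poly_sum poly_monom)

lemma pderiv_sum': "pderiv (sum f A) = (\<Sum>x\<in>A. pderiv (f x))"
  by (induction A rule: infinite_finite_induct) (simp_all add: pderiv_add)

lemma poly_pderiv_int_poly_of: "poly (pderiv (int_poly_of m f)) 1 = (\<Sum>n<m. int n * int (f n))"
  by (simp add: int_poly_of_def pderiv_sum' pderiv_monom poly_sum poly_monom)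

text \<open>The situation in terms of submodules of M. Cohen-Macaulayness of M enters through the
  assumption \<open>regular\<close>, which \<open>maximal_superficial_length\<close> derives from
  it.\<close>

locale superficial_module = filtered_module +
  fixes as
  assumes as_q: "set as \<subseteq> \<qq>" and as_ne: "as \<noteq> []"
    and superficial: "i < length as \<Longrightarrow> \<exists>c. \<forall>n\<ge>c.
      colon (F (Suc n) <+>\<^bsub>M\<^esub> add_scales (carrier M) {\<zero>\<^bsub>M\<^esub>} (take i as)) (as ! i) \<inter>
      (F c <+>\<^bsub>M\<^esub> add_scales (carrier M) {\<zero>\<^bsub>M\<^esub>} (take i as)) =
      F n <+>\<^bsub>M\<^esub> add_scales (carrier M) {\<zero>\<^bsub>M\<^esub>} (take i as)"
    and regular: "regular_seq_mod {\<zero>\<^bsub>M\<^esub>} as"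
    and nil: "\<exists>n0. F n0 \<subseteq> add_scales (carrier M) {\<zero>\<^bsub>M\<^esub>} as"
    and proper: "add_scales (carrier M) {\<zero>\<^bsub>M\<^esub>} as \<noteq> carrier M"
begin

definition N :: "nat \<Rightarrow> 'c set"
  where "N i = add_scales (carrier M) {\<zero>\<^bsub>M\<^esub>} (take i as)"

definition FF :: "nat \<Rightarrow> nat \<Rightarrow> 'c set"
  where "FF i n = F n <+>\<^bsub>M\<^esub> N i"

abbreviation r where "r \<equiv> length as"

lemma as_carrier: "set as \<subseteq> carrier R" and nth_q: "i < r \<Longrightarrow> as ! i \<in> \<qq>" and nth_carrier: "i < r \<Longrightarrow> as ! i \<in> carrier R"
  using as_q q_carrier nth_mem[of i as] by blast+

lemma sub_N: "sub (N i)"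
  unfolding N_def using as_carrier set_take_subset[of i as] by (intro sub_add_scales sub_whole sub_zero_set) blast

lemma N_zero: "N 0 = {\<zero>\<^bsub>M\<^esub>}"
  by (simp add: N_def)

lemma N_Suc: "i < r \<Longrightarrow> N (Suc i) = adj (N i) (as ! i)"
  by (simp add: N_def take_Suc_conv_app_nth add_scales_snoc)

lemma N_r: "N r = add_scales (carrier M) {\<zero>\<^bsub>M\<^esub>} as"
  by (simp add: N_def)

lemma regular_N: "i < r \<Longrightarrow> regular_mod (N i) (as ! i)"
  using regular unfolding regular_seq_mod_nth N_def by blast

lemma N_mono: "i \<le> j \<Longrightarrow> j \<le> r \<Longrightarrow> N i \<subseteq> N j"
proof (induction j)
  case (Suc j)
  then show ?case using adj_superset[OF sub_N[of j] nth_carrier[of j]] N_Suc[of j] by (cases "i = Suc j") auto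
qed simp

lemma N_F1: "i \<le> r \<Longrightarrow> N i \<subseteq> F 1"
  unfolding N_def
proof (subst add_scales_subset_iff[OF sub_whole sub_zero_set _ sub_F])
  show "set (take i as) \<subseteq> carrier R" using as_carrier set_take_subset[of i as] by blast
  show "{\<zero>\<^bsub>M\<^esub>} \<subseteq> F 1 \<and> (\<forall>a\<in>set (take i as). scale a (carrier M) \<subseteq> F 1)"
    using sub_zero[OF sub_F] as_q set_take_subset[of i as] q_smult_F[of _ _ 0] by (auto simp: scale_def F_zero)
qed

lemma sub_FF: "sub (FF i n)"
  unfolding FF_def by (rule sub_set_add[OF sub_F sub_N])

lemma F_FF: "F n \<subseteq> FF i n" and N_FF: "N i \<subseteq> FF i n"
  unfolding FF_def using set_add_left[OF sub_F sub_N] set_add_right[OF sub_F sub_N] by auto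

lemma FF_antimono: "m \<le> n \<Longrightarrow> FF i n \<subseteq> FF i m"
  unfolding FF_def by (rule set_add_mono[OF F_antimono subset_refl])

lemma FF_zero: "FF i 0 = carrier M"
  using F_FF[of 0 i] sub_subset[OF sub_FF] F_zero by blast

lemma FF_0: "FF 0 n = F n"
  unfolding FF_def N_zero by (rule set_add_absorb[OF sub_F sub_zero_set]) (use sub_zero[OF sub_F] in blast)

lemma FF_Suc: "i < r \<Longrightarrow> FF (Suc i) n = adj (FF i n) (as ! i)"
  unfolding FF_def N_Suc using set_add_assoc[OF sub_F sub_N sub_scale[OF nth_carrier sub_whole]] N_Suc by simp

lemma FF_finite: "FF i n \<subseteq> Y \<Longrightarrow> X \<subseteq> carrier M \<Longrightarrow> ilen Y X < \<infinity>"
  using ilen_F_finite F_FF by (meson order_trans)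

lemma q_smult_FF: "a \<in> \<qq> \<Longrightarrow> x \<in> FF i n \<Longrightarrow> a \<odot>\<^bsub>M\<^esub> x \<in> FF i (Suc n)"
proof -
  assume a: "a \<in> \<qq>" and "x \<in> FF i n"
  then obtain f u where "f \<in> F n" "u \<in> N i" "x = f \<oplus>\<^bsub>M\<^esub> u" by (auto simp: FF_def set_add_iff)
  then show ?thesis
    using a q_carrier[OF a] sub_carrier[OF sub_F] sub_carrier[OF sub_N] sub_smult[OF sub_N]
      q_smult_F[OF a] set_addI by (auto simp: FF_def smult_r_distr)
qed

lemma superficial_FF:
  "i < r \<Longrightarrow> \<exists>c. \<forall>n\<ge>c. colon (FF i (Suc n)) (as ! i) \<inter> FF i c = FF i n"
  using superficial unfolding FF_def N_def .

lemma FF_subset_colon: "i < r \<Longrightarrow> FF i n \<subseteq> colon (FF i (Suc n)) (as ! i)"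
  using q_smult_FF[OF nth_q] sub_carrier[OF sub_FF] by (auto simp: colon_def)

lemma sub_colon_FF: "i < r \<Longrightarrow> sub (colon (FF i n) (as ! i))"
  using sub_colon nth_carrier sub_FF by blast

text \<open>The interval from \<open>N + a (F c + N)\<close> to \<open>N + a M\<close> has finite length, so the traces of the
  \<open>F n\<close> on it become stationary, and the limit is the lower bound by Krull's theorem.\<close>

lemma colon_FF_eventually:
  assumes i: "i < r"
  shows "\<exists>m. \<forall>n\<ge>m. colon (FF i (Suc n)) (as ! i) = FF i n"
proof -
  let ?a = "as ! i"
  have ac: "?a \<in> carrier R" using nth_carrier i by blast
  obtain c where c: "\<forall>n\<ge>c. colon (FF i (Suc n)) ?a \<inter> FF i c = FF i n" using superficial_FF[OF i] by blast
  \<comment> \<open>K is made so that K : a leads back into F c + N i, the range where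
    superficiality speaks; this is \<open>cK\<close>, and it uses that a is regular modulo N
    i.\<close>
  define K where "K = N i <+>\<^bsub>M\<^esub> scale ?a (FF i c)"
  have sK: "sub K" unfolding K_def by (intro sub_set_add sub_N sub_scale ac sub_FF)
  have NK: "N i \<subseteq> K" unfolding K_def by (rule set_add_left[OF sub_N sub_scale[OF ac sub_FF]])
  have aK: "?a \<odot>\<^bsub>M\<^esub> x \<in> K" if "x \<in> FF i c" for x
  proof -
    have "scale ?a (FF i c) \<subseteq> K" unfolding K_def by (rule set_add_right[OF sub_N sub_scale[OF ac sub_FF]])
    then show ?thesis using that unfolding scale_def by blast
  qed
  have cK: "u \<in> FF i c" if u: "u \<in> colon K ?a" for u
  proof -
    obtain n x where nx: "n \<in> N i" "x \<in> FF i c" "?a \<odot>\<^bsub>M\<^esub> u = n \<oplus>\<^bsub>M\<^esub> ?a \<odot>\<^bsub>M\<^esub> x" and uc: "u \<in> carrier M"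
      using u by (auto simp: K_def colon_def set_add_iff scale_def)
    have xc: "x \<in> carrier M" "n \<in> carrier M" using nx sub_carrier[OF sub_FF] sub_carrier[OF sub_N] by auto
    have "?a \<odot>\<^bsub>M\<^esub> (u \<ominus>\<^bsub>M\<^esub> x) = n" using nx uc xc ac by (simp add: smult_minus add_minus_cancel)
    then have "u \<ominus>\<^bsub>M\<^esub> x \<in> N i" using regular_N[OF i] nx uc xc by (simp add: regular_mod_def)
    then have "u \<ominus>\<^bsub>M\<^esub> x \<in> FF i c" using N_FF by blast
    then show ?thesis using sub_add_cancel(3)[OF sub_FF nx(2) uc] by blast
  qed
  have saK: "sub (adj K ?a)" by (rule sub_adj[OF sK ac])
  have "FF i c \<subseteq> colon K ?a" using aK sub_carrier[OF sub_FF] by (auto simp: colon_def)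
  \<comment> \<open>(K + a M) / K is isomorphic to M / (K : a), and K : a contains F c + N i; hence
    the length is finite.\<close>
  then have "ilen (colon K ?a \<inter> carrier M) (carrier M) < \<infinity>"
    using sub_subset[OF sub_FF] by (intro FF_finite[of i c]) auto
  then have finK: "ilen K (adj K ?a) < \<infinity>" using ilen_scale[OF sK sub_whole ac] by simp
  define D where "D n = (F (Suc n) <+>\<^bsub>M\<^esub> K) \<inter> adj K ?a" for n
  have sFK: "sub (F n <+>\<^bsub>M\<^esub> K)" for n by (rule sub_set_add[OF sub_F sK])
  have sD: "sub (D n)" for n unfolding D_def by (rule sub_Int[OF sFK saK])
  have KD: "K \<subseteq> D n" for n
    unfolding D_def using set_add_right[OF sub_F sK] adj_superset[OF sK ac] by blast
  have dD: "D (Suc n) \<subseteq> D n" for n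
    unfolding D_def using set_add_mono[OF F_Suc[of "Suc n"] subset_refl[of K]] by blast
  have "ilen K (D 0) \<le> ilen K (adj K ?a)" by (rule ilen_mono) (auto simp: D_def)
  then obtain m where m: "\<forall>n\<ge>m. D n = D m"
    using stabilize[of K D, OF sK sD KD dD] finK by (meson order_le_less_trans)
  have Dm: "D m = K"
  proof (rule F_intersection[OF sK sD KD])
    fix n
    have "D m = D (max m n)" using m[rule_format, of "max m n"] by simp
    also have "\<dots> \<subseteq> F (Suc (max m n)) <+>\<^bsub>M\<^esub> K" unfolding D_def by blast
    also have "\<dots> \<subseteq> F n <+>\<^bsub>M\<^esub> K" by (rule set_add_mono[OF F_antimono subset_refl]) simp
    finally show "D m \<subseteq> F n <+>\<^bsub>M\<^esub> K" .
  qed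
  have DK: "D n = K" if "n \<ge> m" for n using m[rule_format, OF that] Dm by (rule trans)
  \<comment> \<open>If a u lies in \<open>FF i (Suc n)\<close>, it lies in \<open>D n = K\<close>;
    so u is in \<open>FF i c\<close>, and the superficial equation decides.\<close>
  have "colon (FF i (Suc n)) ?a = FF i n" if n: "n \<ge> max m c" for n
  proof -
    have "colon (FF i (Suc n)) ?a \<subseteq> FF i c"
    proof
      fix u assume u: "u \<in> colon (FF i (Suc n)) ?a"
      then have uc: "u \<in> carrier M" and "?a \<odot>\<^bsub>M\<^esub> u \<in> FF i (Suc n)" by (auto simp: colon_def)
      moreover have "FF i (Suc n) \<subseteq> F (Suc n) <+>\<^bsub>M\<^esub> K" unfolding FF_def by (rule set_add_mono[OF subset_refl NK])
      ultimately have "?a \<odot>\<^bsub>M\<^esub> u \<in> D n" using adj_scale[OF sK ac uc] unfolding D_def by blast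
      then have "u \<in> colon K ?a" using DK[of n] n uc by (simp add: colon_def)
      then show "u \<in> FF i c" by (rule cK)
    qed
    then show ?thesis using c n by (metis inf.absorb1 max.bounded_iff)
  qed
  then show ?thesis by blast
qed

definition L :: "nat \<Rightarrow> nat \<Rightarrow> nat"
  where "L i n = len (FF i n) (carrier M)"

definition W :: "nat \<Rightarrow> nat \<Rightarrow> nat"
  where "W i n = len (FF i n) (colon (FF i (Suc n)) (as ! i))"

definition ell :: "nat \<Rightarrow> nat \<Rightarrow> nat"
  where "ell i n = len (FF i (Suc n)) (FF i n)"

lemma L_zero: "L i 0 = 0"
  unfolding L_def FF_zero by (rule len_self[OF sub_whole])

lemma L_Suc: "L i (Suc n) = ell i n + L i n"
  unfolding L_def ell_def
  by (rule len_additive[OF sub_FF sub_FF sub_whole FF_antimono sub_subset[OF sub_FF] FF_finite]) auto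

text \<open>Multiplication by \<open>as ! i\<close> from M / \<open>FF i n\<close> to M /
  \<open>FF i (Suc n)\<close> has a kernel of length \<open>W i n\<close> and the cokernel M /
  \<open>FF (Suc i) (Suc n)\<close>; the equation balances these four lengths.\<close>

lemma L_step:
  assumes i: "i < r"
  shows "L (Suc i) (Suc n) + L i n = L i (Suc n) + W i n"
proof -
  let ?a = "as ! i" and ?c = "colon (FF i (Suc n)) (as ! i)"
  have ac: "?a \<in> carrier R" using nth_carrier i by blast
  have sc: "sub ?c" "?c \<subseteq> carrier M" using sub_colon_FF[OF i] sub_subset by blast+
  have ad: "FF i (Suc n) \<subseteq> FF (Suc i) (Suc n)" unfolding FF_Suc[OF i] by (rule adj_superset[OF sub_FF ac])
  have "?c \<inter> carrier M = ?c" using sc by blast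
  then have "ilen ?c (carrier M) = ilen (FF i (Suc n)) (FF (Suc i) (Suc n))"
    using ilen_scale[OF sub_FF sub_whole ac, of i "Suc n"] FF_Suc[OF i] by simp
  then have 1: "len ?c (carrier M) = len (FF i (Suc n)) (FF (Suc i) (Suc n))" by (simp add: len_def)
  have 2: "L i (Suc n) = len (FF i (Suc n)) (FF (Suc i) (Suc n)) + L (Suc i) (Suc n)"
    unfolding L_def
    by (rule len_additive[OF sub_FF sub_FF sub_whole ad sub_subset[OF sub_FF] FF_finite]) auto
  have 3: "L i n = W i n + len ?c (carrier M)"
    unfolding L_def W_def
    by (rule len_additive[OF sub_FF sc(1) sub_whole FF_subset_colon[OF i] sc(2) FF_finite]) auto
  show ?thesis using 1 2 3 by simp
qed

lemma W_eq_0_iff: "i < r \<Longrightarrow> W i n = 0 \<longleftrightarrow> colon (FF i (Suc n)) (as ! i) = FF i n"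
  unfolding W_def
  using len_eq_0[OF sub_FF sub_colon_FF FF_subset_colon FF_finite[OF subset_refl]]
    len_self[OF sub_FF] sub_subset[OF sub_colon_FF] by metis

lemma W_eventually: "i < r \<Longrightarrow> \<exists>m. \<forall>n\<ge>m. W i n = 0"
  using colon_FF_eventually W_eq_0_iff by metis

lemma ell_eventually: "\<exists>m. \<forall>n\<ge>m. ell r n = 0"
proof -
  obtain n0 where n0: "F n0 \<subseteq> N r" using nil N_r by blast
  have "FF r n = N r" if "n \<ge> n0" for n
    using set_add_absorb[OF sub_N sub_F, of n r] set_add_commute[OF sub_F sub_N] F_antimono[OF that] n0
    unfolding FF_def by auto
  then have "ell r n = 0" if "n \<ge> n0" for n
    using that len_self[OF sub_N] unfolding ell_def by simp
  then show ?thesis by blast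
qed

lemma bound_exists: "\<exists>m. (\<forall>n\<ge>m. ell r n = 0) \<and> (\<forall>i<r. \<forall>n\<ge>m. W i n = 0)"
proof -
  obtain m0 where m0: "\<forall>n\<ge>m0. ell r n = 0" using ell_eventually by blast
  have "\<exists>m\<ge>m0. \<forall>i<k. \<forall>n\<ge>m. W i n = 0" if "k \<le> r" for k
    using that
  proof (induction k)
    case (Suc k)
    then obtain m where m: "m \<ge> m0" "\<forall>i<k. \<forall>n\<ge>m. W i n = 0" by auto
    obtain m' where "\<forall>n\<ge>m'. W k n = 0" using W_eventually[of k] Suc.prems by auto
    then show ?case using m by (intro exI[of _ "max m m'"]) (auto simp: less_Suc_eq)
  qed auto
  from this[of r] m0 show ?thesis by (meson order_refl order_trans)
qed

text \<open>One bound for all i < r, so that the generating series of \<open>ell r\<close> and of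
  every \<open>W i\<close> are polynomials of degree below it.\<close>

definition bd :: nat
  where "bd = (SOME m. (\<forall>n\<ge>m. ell r n = 0) \<and> (\<forall>i<r. \<forall>n\<ge>m. W i n = 0))"

lemma bd: "n \<ge> bd \<Longrightarrow> ell r n = 0" "i < r \<Longrightarrow> n \<ge> bd \<Longrightarrow> W i n = 0"
  using someI_ex[OF bound_exists] unfolding bd_def by blast+

lemma hilbert_series_nth: "fps_nth (hilbert_series R M F) n = int (ell 0 n)"
  using module_length_gr_component[of F n, OF sub_F sub_F F_Suc] by (simp add: hilbert_series_def ell_def FF_0 len_def)

text \<open>The shift by one makes the coefficient of degree n the sum of \<open>ell i 0\<close>,
  ..., \<open>ell i n\<close>, so that multiplication by 1 - z undoes the summation.\<close>

lemma L_series: "(1 - fps_X) * Abs_fps (\<lambda>n. int (L i (Suc n))) = Abs_fps (\<lambda>n. int (ell i n))"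
proof (rule fps_ext)
  fix n
  show "fps_nth ((1 - fps_X) * Abs_fps (\<lambda>n. int (L i (Suc n)))) n = fps_nth (Abs_fps (\<lambda>n. int (ell i n))) n"
    by (cases n) (simp_all add: left_diff_distrib L_Suc L_zero)
qed

lemma L_series_step: "i < r \<Longrightarrow> Abs_fps (\<lambda>n. int (L (Suc i) (Suc n))) =
    (1 - fps_X) * Abs_fps (\<lambda>n. int (L i (Suc n))) + Abs_fps (\<lambda>n. int (W i n))"
proof (rule fps_ext)
  fix n assume i: "i < r"
  have "int (L (Suc i) (Suc n)) + int (L i n) = int (L i (Suc n)) + int (W i n)"
    using L_step[OF i, of n] by (metis of_nat_add)
  then show "fps_nth (Abs_fps (\<lambda>n. int (L (Suc i) (Suc n)))) n =
    fps_nth ((1 - fps_X) * Abs_fps (\<lambda>n. int (L i (Suc n))) + Abs_fps (\<lambda>n. int (W i n))) n"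
    by (cases n) (simp_all add: left_diff_distrib L_zero)
qed

text \<open>Write P_i and W_i for the generating series of \<open>ell i\<close> and
  \<open>W i\<close>. Lemmas \<open>L_series\<close> and \<open>L_series_step\<close> give P_(i+1) =
  (1 - z) (P_i + W_i); solving for (1 - z)^r P_0 yields this expression. It is the h-polynomial by
  \<open>h_polynomial_eq\<close>.\<close>

definition hp :: "int poly"
  where "hp = int_poly_of bd (ell r) - (\<Sum>i<r. [:1, -1:] ^ (r - i) * int_poly_of bd (W i))"

lemma fps_of_poly_one_minus: "fps_of_poly [:1, -1::int:] = 1 - fps_X"
  by (simp add: fps_of_poly_pCons)

lemma hp_series: "fps_of_poly hp = hilbert_series R M F * (1 - fps_X) ^ r"
proof -
  let ?P = "\<lambda>i. Abs_fps (\<lambda>n. int (ell i n))" and ?W = "\<lambda>i. Abs_fps (\<lambda>n. int (W i n))"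
  have step: "?P (Suc i) = (1 - fps_X) * ?P i + (1 - fps_X) * ?W i" if "i < r" for i
    unfolding L_series[symmetric] L_series_step[OF that] by (simp add: algebra_simps)
  have "?P k * (1 - fps_X) ^ (r - k) = ?P 0 * (1 - fps_X) ^ r + (\<Sum>i<k. (1 - fps_X) ^ (r - i) * ?W i)" if "k \<le> r" for k
    using that
  proof (induction k)
    case (Suc k)
    have pw: "(1 - fps_X :: int fps) ^ (r - k) = (1 - fps_X) * (1 - fps_X) ^ (r - Suc k)"
      using Suc.prems by (metis Suc_diff_Suc Suc_le_lessD power_Suc)
    have gen: "p' * c' = p * c + c * w" if "p' = y * p + y * w" "c = y * c'" for p p' w y c c' :: "int fps"
      unfolding that by (simp only: ring_distribs mult_ac)
    have "?P (Suc k) * (1 - fps_X) ^ (r - Suc k) = ?P k * (1 - fps_X) ^ (r - k) + (1 - fps_X) ^ (r - k) * ?W k"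
      using Suc.prems by (intro gen[OF step pw]) simp
    also have "?P k * (1 - fps_X) ^ (r - k) = ?P 0 * (1 - fps_X) ^ r + (\<Sum>i<k. (1 - fps_X) ^ (r - i) * ?W i)"
      using Suc by simp
    finally show ?case by (simp only: sum.lessThan_Suc add.assoc)
  qed simp
  from this[of r] have "?P r = ?P 0 * (1 - fps_X) ^ r + (\<Sum>i<r. (1 - fps_X) ^ (r - i) * ?W i)" by simp
  moreover have "fps_of_poly hp = ?P r - (\<Sum>i<r. (1 - fps_X) ^ (r - i) * ?W i)"
    unfolding hp_def using bd
    by (simp add: fps_of_poly_diff fps_of_poly_sum fps_of_poly_mult fps_of_poly_power
        fps_of_int_poly_of fps_of_poly_one_minus)
  moreover have "hilbert_series R M F = ?P 0" by (rule fps_ext) (simp add: hilbert_series_nth)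
  ultimately show ?thesis by simp
qed

lemma r_pos: "0 < r"
  using as_ne by simp

lemma poly_hp: "poly hp 1 = (\<Sum>n<bd. int (ell r n))"
proof -
  have "(\<Sum>i<r. poly ([:1, -1:] ^ (r - i) * int_poly_of bd (W i)) 1) = (0::int)"
    by (rule sum.neutral) (simp add: poly_power power_0_left)
  then show ?thesis by (simp add: hp_def poly_int_poly_of poly_sum)
qed

text \<open>The factor (1 - z)^(r - i) vanishes to order at least two at 1 unless i = r - 1, so only
  the last correction survives; the derivative -1 of 1 - z cancels the minus sign in
  \<open>hp\<close>.\<close>

lemma poly_pderiv_hp: "poly (pderiv hp) 1 = (\<Sum>n<bd. int n * int (ell r n)) + (\<Sum>n<bd. int (W (r - 1) n))"
proof -
  have z: "poly (pderiv ([:1, -1:] ^ (r - i) * int_poly_of bd (W i))) 1 =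
      (if i = r - 1 then - (\<Sum>n<bd. int (W i n)) else 0)" if i: "i < r" for i
  proof -
    have A: "poly (pderiv ([:1, -1:] * w)) 1 = - poly w 1" for w :: "int poly"
      unfolding pderiv_mult by (simp add: pderiv_pCons)
    show ?thesis
    proof (cases "i = r - 1")
      case True
      obtain k where "r = Suc k" using r_pos gr0_implies_Suc by blast
      then have "r - i = 1" using True by simp
      then show ?thesis using True A by (simp only: power_one_right if_True poly_int_poly_of refl)
    next
      case False
      then obtain k where "r - i = Suc (Suc k)" using i by (metis One_nat_def Suc_diff_Suc Suc_lessI diff_Suc_1)
      then have "poly (pderiv ([:1, -1:] ^ (r - i) * int_poly_of bd (W i))) 1 =
          - poly ([:1, -1:] * ([:1, -1:] ^ k * int_poly_of bd (W i))) 1"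
        by (simp only: power_Suc mult.assoc A)
      then show ?thesis using False by (simp only: poly_mult) simp
    qed
  qed
  have "(\<Sum>i<r. poly (pderiv ([:1, -1:] ^ (r - i) * int_poly_of bd (W i))) 1) = - (\<Sum>n<bd. int (W (r - 1) n))"
    using r_pos by (simp add: z)
  then show ?thesis
    by (simp add: hp_def pderiv_diff pderiv_sum' poly_sum poly_pderiv_int_poly_of)
qed

lemma ell_sum: "L r n = (\<Sum>k<n. ell r k)"
  by (induction n) (simp_all add: L_zero L_Suc)

text \<open>If the value were 0, all \<open>ell r n\<close> would vanish and M would equal F n + J M
  for every n; for large n this sum is J M, against \<open>proper\<close>.\<close>

lemma hp_pos: "poly hp 1 > 0"
proof (rule ccontr)
  assume "\<not> poly hp 1 > 0"
  moreover have "poly hp 1 \<ge> 0" unfolding poly_hp by (rule sum_nonneg) simp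
  ultimately have "(\<Sum>n<bd. int (ell r n)) = 0" using poly_hp by simp
  then have "ell r n = 0" if "n < bd" for n using that by (simp add: sum_nonneg_eq_0_iff)
  then have "ell r n = 0" for n using bd(1) by (meson not_le)
  then have L0: "L r n = 0" for n by (simp add: ell_sum)
  obtain n0 where n0: "F n0 \<subseteq> N r" using nil N_r by blast
  have "FF r n0 = carrier M"
    using len_eq_0[OF sub_FF sub_whole sub_subset[OF sub_FF] FF_finite[OF subset_refl subset_refl], of r n0, symmetric] L0[of n0]
    unfolding L_def by blast
  moreover have "FF r n0 \<subseteq> N r" unfolding FF_def using set_add_least[OF sub_N n0 subset_refl] .
  ultimately show False using proper N_r sub_subset[OF sub_N] by blast
qed

text \<open>N r lies in F 1 because the sequence lies in \<open>\<qq>\<close>. So h_0 can be read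
  off from the last quotient, which the defect formula exploits.\<close>

lemma ell_zero: "ell r 0 = ell 0 0"
proof -
  have "FF r 1 = F 1"
    unfolding FF_def by (rule set_add_absorb[OF sub_F sub_N N_F1]) simp
  then show ?thesis by (simp add: ell_def FF_zero FF_0)
qed

lemma hp_coeff_0: "poly.coeff hp 0 = int (ell 0 0)"
proof -
  have "fps_nth (fps_of_poly hp) 0 = int (ell 0 0)"
    unfolding hp_series by (simp add: fps_mult_nth_0 hilbert_series_nth fps_nth_power_0)
  then show ?thesis by simp
qed

lemma one_minus_X_power_nth_1: "fps_nth ((1 - fps_X :: int fps) ^ k) 1 = - int k"
  by (induction k) (simp_all add: left_diff_distrib fps_nth_power_0)

lemma hp_coeff_1: "poly.coeff hp 1 = int (ell 0 1) - int r * int (ell 0 0)"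
proof -
  have "fps_nth (fps_of_poly hp) 1 = int (ell 0 1) - int r * int (ell 0 0)"
    unfolding hp_series using one_minus_X_power_nth_1[of r]
    by (simp add: fps_mult_nth_1 hilbert_series_nth fps_nth_power_0)
  then show ?thesis by simp
qed

text \<open>\<open>L r\<close> is bounded since \<open>ell r\<close> is eventually zero. By
  \<open>L_step\<close> the differences of \<open>L i\<close> are at most the values of
  \<open>L (Suc i)\<close>, so each step back costs one power of n. The case j = r later bounds the
  dimension of the graded module.\<close>

lemma L_bound: "\<exists>C. \<forall>j\<le>r. \<forall>n. L (r - j) n \<le> C * n ^ j"
proof -
  define C where "C = L r bd"
  have "L r n \<le> C" for n
  proof -
    have "(\<Sum>k<n. ell r k) \<le> (\<Sum>k<max n bd. ell r k)" by (rule sum_mono2) auto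
    also have "\<dots> = (\<Sum>k<bd. ell r k)" by (rule sum.mono_neutral_right) (use bd(1) in auto)
    finally show ?thesis by (simp add: C_def ell_sum)
  qed
  then have "L (r - j) n \<le> C * n ^ j" if "j \<le> r" for j n
    using that
  proof (induction j arbitrary: n)
    case (Suc j)
    have IH: "L (r - j) n \<le> C * n ^ j" for n using Suc by simp
    let ?i = "r - Suc j"
    have i: "?i < r" "Suc ?i = r - j" using Suc.prems by auto
    show ?case
    proof (induction n)
      case (Suc n)
      have "L ?i (Suc n) \<le> L (r - j) (Suc n) + L ?i n" using L_step[OF i(1), of n] i(2) by simp
      also have "\<dots> \<le> C * Suc n ^ j + C * n ^ Suc j" by (rule add_mono[OF IH Suc.IH])
      also have "n ^ Suc j \<le> n * Suc n ^ j" by (simp add: power_mono)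
      then have "C * Suc n ^ j + C * n ^ Suc j \<le> C * Suc n ^ j + C * (n * Suc n ^ j)" by (intro add_mono mult_le_mono) auto
      also have "\<dots> = C * Suc n ^ Suc j" by (simp add: algebra_simps)
      finally show ?case .
    qed (simp add: L_zero)
  qed simp
  then show ?thesis by blast
qed

end

section \<open>Equality in Northcott's inequality\<close>

context module
begin

text \<open>Multiplication by a sends b x to b (a x), and a x lies in X. In \<open>colon_Y\<close>
  this turns an element of N j into a combination with coefficients in F 1.\<close>

lemma add_scales_restrict:
  assumes "sub X" "a \<in> carrier R" "set bs \<subseteq> carrier R" "v \<in> add_scales (carrier M) {\<zero>\<^bsub>M\<^esub>} bs"
    and aX: "\<And>x. x \<in> carrier M \<Longrightarrow> a \<odot>\<^bsub>M\<^esub> x \<in> X"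
  shows "a \<odot>\<^bsub>M\<^esub> v \<in> add_scales X {\<zero>\<^bsub>M\<^esub>} bs"
proof -
  let ?K = "add_scales X {\<zero>\<^bsub>M\<^esub>} bs"
  have K: "sub ?K" using sub_add_scales[OF assms(1) sub_zero_set assms(3)] .
  have "add_scales (carrier M) {\<zero>\<^bsub>M\<^esub>} bs \<subseteq> colon ?K a"
  proof (subst add_scales_subset_iff[OF sub_whole sub_zero_set assms(3) sub_colon[OF assms(2) K]], intro conjI ballI)
    show "{\<zero>\<^bsub>M\<^esub>} \<subseteq> colon ?K a" using sub_zero[OF sub_colon[OF assms(2) K]] by blast
    fix b assume b: "b \<in> set bs"
    then have bc: "b \<in> carrier R" using assms(3) by blast
    have "a \<odot>\<^bsub>M\<^esub> (b \<odot>\<^bsub>M\<^esub> x) \<in> ?K" if "x \<in> carrier M" for x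
      using add_scales_superset(2)[OF assms(1) sub_zero_set assms(3) b] aX[OF that]
        smult_swap[OF assms(2) bc that] by (auto simp: scale_def)
    then show "scale b (carrier M) \<subseteq> colon ?K a" using bc by (auto simp: scale_def colon_def)
  qed
  then show ?thesis using assms(4) by (auto simp: colon_def)
qed

end

context module
begin

lemma ilen_eq_len: "ilen Y X < \<infinity> \<Longrightarrow> ilen Y X = enat (len Y X)"
  unfolding len_def by (cases "ilen Y X") simp_all

end

context superficial_module
begin

text \<open>Sally descent: \<open>y = a\<^sub>i\<^sub>+\<^sub>1\<close> is regular on the associated graded module modulo \<open>a\<^sub>i\<close>, so
  \<open>F (n + j) : y\<^sup>j = F n\<close> for large \<open>j\<close> by induction on \<open>n\<close>, and this gives the regularity of \<open>a\<^sub>i\<close>.\<close>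

lemma W_descent:
  assumes i: "Suc i < r" and W: "\<And>n. W (Suc i) n = 0"
  shows "W i n = 0"
proof -
  let ?a = "as ! i" and ?y = "as ! Suc i"
  have i': "i < r" using i by simp
  have q: "?a \<in> \<qq>" "?y \<in> \<qq>" using nth_q i i' by auto
  have c: "?a \<in> carrier R" "?y \<in> carrier R" using q q_carrier by auto
  have y1: "u \<in> FF (Suc i) n" if "u \<in> carrier M" "?y \<odot>\<^bsub>M\<^esub> u \<in> FF (Suc i) (Suc n)" for u n
    using W_eq_0_iff[OF i, of n] W[of n] that by (auto simp: colon_def)
  have yj: "u \<in> FF (Suc i) n" if "u \<in> carrier M" "?y [^] j \<odot>\<^bsub>M\<^esub> u \<in> FF (Suc i) (n + j)" for u n and j::nat
    using that
  proof (induction j arbitrary: u)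
    case (Suc j)
    have "?y [^] Suc j \<odot>\<^bsub>M\<^esub> u = ?y \<odot>\<^bsub>M\<^esub> (?y [^] j \<odot>\<^bsub>M\<^esub> u)"
      using Suc.prems(1) c by (simp add: smult_assoc1 smult_swap)
    then have "?y [^] j \<odot>\<^bsub>M\<^esub> u \<in> FF (Suc i) (n + j)" using y1 Suc.prems c by simp
    then show ?case using Suc.IH Suc.prems(1) by blast
  qed simp
  \<comment> \<open>d is the constant of superficiality of a_i. Since y^d carries M into
    \<open>FF i d\<close>, multiplying by y^d moves any element to where the superficial equation is
    available.\<close>
  obtain d where d: "\<forall>n\<ge>d. colon (FF i (Suc n)) ?a \<inter> FF i d = FF i n" using superficial_FF[OF i'] by blast
  have ypow: "?y [^] j \<odot>\<^bsub>M\<^esub> u \<in> FF i (n + j)" if "u \<in> FF i n" for u n and j::nat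
    using that
  proof (induction j)
    case 0
    then show ?case using sub_carrier[OF sub_FF 0] by simp
  next
    case (Suc j)
    have "?y [^] Suc j \<odot>\<^bsub>M\<^esub> u = ?y \<odot>\<^bsub>M\<^esub> (?y [^] j \<odot>\<^bsub>M\<^esub> u)"
      using sub_carrier[OF sub_FF Suc.prems] c by (simp add: smult_assoc1 smult_swap)
    then show ?case using q_smult_FF[OF q(2) Suc.IH[OF Suc.prems]] by simp
  qed
  have key: "u \<in> FF i n" if "u \<in> carrier M" "?y [^] d \<odot>\<^bsub>M\<^esub> u \<in> FF i (n + d)" for u n
    using that
  proof (induction n arbitrary: u)
    case 0 then show ?case by (simp add: FF_zero)
  next
    case (Suc n)
    have "?y [^] d \<odot>\<^bsub>M\<^esub> u \<in> FF (Suc i) (Suc n + d)"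
      using Suc.prems(2) adj_superset[OF sub_FF c(1)] FF_Suc[OF i'] by blast
    \<comment> \<open>Modulo a_i the power of y can be cancelled outright. The multiple of a_i that
      is left over is treated by superficiality and the induction hypothesis for v.\<close>
    then have "u \<in> adj (FF i (Suc n)) ?a" using yj[OF Suc.prems(1)] FF_Suc[OF i'] by simp
    then obtain w v where wv: "w \<in> FF i (Suc n)" "v \<in> carrier M" "u = w \<oplus>\<^bsub>M\<^esub> ?a \<odot>\<^bsub>M\<^esub> v" by (auto simp: adj_iff)
    have wc: "w \<in> carrier M" using wv sub_carrier[OF sub_FF] by blast
    have "?y [^] d \<odot>\<^bsub>M\<^esub> u = ?y [^] d \<odot>\<^bsub>M\<^esub> w \<oplus>\<^bsub>M\<^esub> ?a \<odot>\<^bsub>M\<^esub> (?y [^] d \<odot>\<^bsub>M\<^esub> v)"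
      unfolding wv(3) using c wc wv(2) by (simp add: smult_r_distr smult_swap)
    then have "?a \<odot>\<^bsub>M\<^esub> (?y [^] d \<odot>\<^bsub>M\<^esub> v) \<in> FF i (Suc n + d)"
      using sub_add_cancel(2)[OF sub_FF ypow[OF wv(1), of d]] Suc.prems(2) c wv(2) by simp
    then have "?y [^] d \<odot>\<^bsub>M\<^esub> v \<in> colon (FF i (Suc (n + d))) ?a" using c wv(2) by (simp add: colon_def)
    moreover have "?y [^] d \<odot>\<^bsub>M\<^esub> v \<in> FF i d" using ypow[of v 0 d] wv(2) by (simp add: FF_zero)
    ultimately have "?y [^] d \<odot>\<^bsub>M\<^esub> v \<in> FF i (n + d)" using d[rule_format, of "n + d"] by auto
    then have "v \<in> FF i n" using Suc.IH wv(2) by blast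
    then have "?a \<odot>\<^bsub>M\<^esub> v \<in> FF i (Suc n)" using q_smult_FF q(1) by blast
    then show ?case unfolding wv(3) using sub_add[OF sub_FF wv(1)] by blast
  qed
  \<comment> \<open>Multiply by y^d, apply superficiality of a_i, and cancel y^d again by
    \<open>key\<close>.\<close>
  have "colon (FF i (Suc n)) ?a \<subseteq> FF i n"
  proof
    fix u assume "u \<in> colon (FF i (Suc n)) ?a"
    then have u: "u \<in> carrier M" "?a \<odot>\<^bsub>M\<^esub> u \<in> FF i (Suc n)" by (auto simp: colon_def)
    have "?a \<odot>\<^bsub>M\<^esub> (?y [^] d \<odot>\<^bsub>M\<^esub> u) = ?y [^] d \<odot>\<^bsub>M\<^esub> (?a \<odot>\<^bsub>M\<^esub> u)" using c u by (intro smult_swap) auto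
    then have "?a \<odot>\<^bsub>M\<^esub> (?y [^] d \<odot>\<^bsub>M\<^esub> u) \<in> FF i (Suc (n + d))" using ypow[OF u(2), of d] by simp
    moreover have "?y [^] d \<odot>\<^bsub>M\<^esub> u \<in> FF i d" using ypow[of u 0 d] u(1) by (simp add: FF_zero)
    ultimately have "?y [^] d \<odot>\<^bsub>M\<^esub> u \<in> FF i (n + d)"
      using d[rule_format, of "n + d"] u(1) c by (auto simp: colon_def)
    then show "u \<in> FF i n" using key u(1) by blast
  qed
  then show ?thesis using W_eq_0_iff[OF i'] FF_subset_colon[OF i'] by blast
qed

lemma W_all_zero:
  assumes "\<And>n. W (r - 1) n = 0" "i < r"
  shows "W i n = 0"
proof -
  have "\<forall>n. W (r - 1 - k) n = 0" if "k < r" for k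
    using that
  proof (induction k)
    case (Suc k)
    then have "Suc (r - 1 - Suc k) = r - 1 - k" "Suc (r - 1 - Suc k) < r" by linarith+
    then show ?case using W_descent[of "r - 1 - Suc k"] Suc by simp
  qed (use assms(1) in simp)
  from this[of "r - 1 - i"] show ?thesis using assms(2) by simp
qed

definition e0 :: int where "e0 = poly hp 1"
definition e1 :: int where "e1 = poly (pderiv hp) 1"
definition h0 :: int where "h0 = poly.coeff hp 0"
definition h1 :: int where "h1 = poly.coeff hp 1"

text \<open>The defect in Northcott's inequality \<open>e\<^sub>1 \<ge> e\<^sub>0 - h\<^sub>0\<close>.\<close>

lemma northcott_defect:
  "e1 - (e0 - h0) = (\<Sum>n<bd. int (n - 1) * int (ell r n)) + (\<Sum>n<bd. int (W (r - 1) n))"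
proof -
  \<comment> \<open>For n = 0 natural subtraction gives the coefficient 0 instead of -1; the added
    term \<open>ell r 0\<close>, which is h_0, makes up the difference.\<close>
  have "(\<Sum>n<bd. int n * int (ell r n)) - (\<Sum>n<bd. int (ell r n)) + int (ell r 0) = (\<Sum>n<bd. int (n - 1) * int (ell r n))"
  proof (cases bd)
    case 0
    then have "ell r 0 = 0" using bd(1)[of 0] by simp
    then show ?thesis using 0 by simp
  next
    case (Suc m)
    have "(\<Sum>n<Suc m. int n * int (ell r n)) - (\<Sum>n<Suc m. int (ell r n)) + int (ell r 0) =
        (\<Sum>n<Suc m. (int n - 1) * int (ell r n)) + int (ell r 0)"
      by (simp add: sum_subtractf left_diff_distrib)
    also have "\<dots> = (\<Sum>n<m. int n * int (ell r (Suc n)))"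
      unfolding sum.lessThan_Suc_shift by simp
    also have "\<dots> = (\<Sum>n<Suc m. int (n - 1) * int (ell r n))"
      unfolding sum.lessThan_Suc_shift by simp
    finally show ?thesis using Suc by simp
  qed
  then show ?thesis
    unfolding e0_def e1_def h0_def poly_hp poly_pderiv_hp hp_coeff_0 ell_zero[symmetric] by simp
qed

lemma northcott: "e1 \<ge> e0 - h0"
proof -
  have "e1 - (e0 - h0) \<ge> 0" unfolding northcott_defect by (intro add_nonneg_nonneg sum_nonneg) auto
  then show ?thesis by simp
qed

text \<open>A sum of nonnegative terms vanishes only termwise. The factor n - 1 in the first sum
  leaves \<open>ell r 0\<close> and \<open>ell r 1\<close> free, which is why the degree bound
  deduced from this is 1.\<close>

lemma northcott_equality:
  assumes "e1 = e0 - h0"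
  shows "n \<ge> 2 \<Longrightarrow> ell r n = 0" "i < r \<Longrightarrow> W i n = 0"
proof -
  let ?A = "\<Sum>n<bd. int (n - 1) * int (ell r n)" and ?B = "\<Sum>n<bd. int (W (r - 1) n)"
  have "?A \<ge> 0" "?B \<ge> 0" by (auto intro: sum_nonneg)
  moreover have "?A + ?B = 0" using northcott_defect assms by simp
  ultimately have AB: "?A = 0" "?B = 0" by linarith+
  show "ell r n = 0" if n: "n \<ge> 2"
  proof (cases "n < bd")
    case True
    have "int (n - 1) * int (ell r n) = 0" using AB(1) True by (subst (asm) sum_nonneg_eq_0_iff) auto
    then show ?thesis using n by simp
  qed (use bd(1) in simp)
  have "W (r - 1) n = 0" for n
  proof (cases "n < bd")
    case True
    then show ?thesis using AB(2) by (subst (asm) sum_nonneg_eq_0_iff) auto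
  next
    case False
    then show ?thesis using bd(2)[of "r - 1" n] r_pos by simp
  qed
  then show "W i n = 0" if "i < r" using W_all_zero that by blast
qed

lemma degree_from_equality:
  assumes "e1 = e0 - h0"
  shows "Polynomial.degree hp \<le> 1"
proof (rule degree_le, intro allI impI)
  fix n :: nat assume n: "1 < n"
  have "int_poly_of bd (W i) = 0" if "i < r" for i
    using northcott_equality(2)[OF assms that] by (simp add: int_poly_of_def)
  then have "hp = int_poly_of bd (ell r)" unfolding hp_def by simp
  then show "poly.coeff hp n = 0" using northcott_equality(1)[OF assms, of n] n by (simp add: coeff_int_poly_of)
qed

lemma linear_hp:
  assumes "Polynomial.degree hp \<le> 1"
  shows "hp = [:h0, h1:]" "e0 = h0 + h1" "e1 = h1"
proof -
  show 1: "hp = [:h0, h1:]"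
  proof (rule poly_eqI)
    fix n
    show "poly.coeff hp n = poly.coeff [:h0, h1:] n"
    proof (cases "n \<le> 1")
      case True then show ?thesis by (cases n) (auto simp: h0_def h1_def)
    next
      case False
      then have "poly.coeff hp n = 0" using assms by (intro coeff_eq_0) simp
      then show ?thesis using False by (auto simp: coeff_pCons split: nat.split)
    qed
  qed
  show "e0 = h0 + h1" unfolding e0_def by (subst 1) simp
  show "e1 = h1" unfolding e1_def by (subst 1) (simp add: pderiv_pCons)
qed

section \<open>The length of \<open>F 2\<close> over the product of J with
  \<open>F 1\<close>\<close>

definition G :: "'c set"
  where "G = add_scales (F 1) {\<zero>\<^bsub>M\<^esub>} as"

text \<open>Interpolates between J F_1 (i = 0) and J M (i = r): the first i generators already act
  on all of M, the others only on F_1. Each step will have the length of M / F_1.\<close>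

definition Y :: "nat \<Rightarrow> 'c set"
  where "Y i = add_scales (F 1) (N i) (drop i as)"

lemma set_drop_carrier: "set (drop i as) \<subseteq> carrier R"
  using as_carrier set_drop_subset[of i as] by blast

lemma set_take_drop_carrier: "set (take k (drop i as)) \<subseteq> carrier R"
  using set_drop_carrier set_take_subset[of k "drop i as"] by blast

lemma sub_Y: "sub (Y i)"
  unfolding Y_def by (rule sub_add_scales[OF sub_F sub_N set_drop_carrier])

lemma Y_0: "Y 0 = G"
  by (simp add: Y_def G_def N_zero)

lemma Y_r: "Y r = N r"
  by (simp add: Y_def)

lemma drop_nth: "i < r \<Longrightarrow> drop i as = as ! i # drop (Suc i) as"
  by (simp add: Cons_nth_drop_Suc)

lemma adj_Y:
  assumes i: "i < r"
  shows "adj (Y i) (as ! i) = Y (Suc i)"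
proof -
  have ac: "as ! i \<in> carrier R" using nth_carrier i by blast
  let ?a = "as ! i" and ?bs = "drop (Suc i) as"
  have s1: "sub (scale ?a (carrier M))" "sub (scale ?a (F 1))" using sub_scale ac sub_whole sub_F by auto
  have s2: "sub (N i <+>\<^bsub>M\<^esub> scale ?a (F 1))" using sub_set_add sub_N s1 by blast
  have YE: "Y i = add_scales (F 1) (N i <+>\<^bsub>M\<^esub> scale ?a (F 1)) ?bs" unfolding Y_def drop_nth[OF i] by simp
  have "adj (Y i) ?a = scale ?a (carrier M) <+>\<^bsub>M\<^esub> add_scales (F 1) (N i <+>\<^bsub>M\<^esub> scale ?a (F 1)) ?bs"
    unfolding YE[symmetric] by (rule set_add_commute[OF sub_Y s1(1)])
  also have "\<dots> = add_scales (F 1) (scale ?a (carrier M) <+>\<^bsub>M\<^esub> (N i <+>\<^bsub>M\<^esub> scale ?a (F 1))) ?bs"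
    using add_scales_set_add[OF sub_F s2 s1(1) set_drop_carrier] by simp
  also have "scale ?a (carrier M) <+>\<^bsub>M\<^esub> (N i <+>\<^bsub>M\<^esub> scale ?a (F 1)) = N (Suc i)"
  proof -
    have "scale ?a (carrier M) <+>\<^bsub>M\<^esub> (N i <+>\<^bsub>M\<^esub> scale ?a (F 1)) = (N i <+>\<^bsub>M\<^esub> scale ?a (F 1)) <+>\<^bsub>M\<^esub> scale ?a (carrier M)"
      by (rule set_add_commute[OF s1(1) s2])
    also have "\<dots> = N i <+>\<^bsub>M\<^esub> (scale ?a (carrier M) <+>\<^bsub>M\<^esub> scale ?a (F 1))"
      unfolding set_add_assoc[OF sub_N s1(2,1)] set_add_commute[OF s1(2,1)] ..
    also have "scale ?a (carrier M) <+>\<^bsub>M\<^esub> scale ?a (F 1) = scale ?a (carrier M)"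
      by (rule set_add_absorb[OF s1 scale_mono[OF sub_subset[OF sub_F]]])
    finally show ?thesis using N_Suc[OF i] by simp
  qed
  finally show ?thesis by (simp add: Y_def)
qed

text \<open>A regular sequence has only the trivial relations, so a u in \<open>Y i\<close> tells
  nothing more about u than membership in F 1. The summands \<open>as ! j\<close> F_1 with j > i are
  removed, the last one first; then a is cancelled modulo N i, which lies in F 1.\<close>

lemma colon_Y:
  assumes i: "i < r"
  shows "colon (Y i) (as ! i) = F 1"
proof
  let ?a = "as ! i" and ?bs = "drop (Suc i) as"
  have aq: "?a \<in> \<qq>" and ac: "?a \<in> carrier R" using nth_q nth_carrier i by auto
  let ?X = "\<lambda>k. add_scales (F 1) (N i <+>\<^bsub>M\<^esub> scale ?a (F 1)) (take k ?bs)"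
  have s1: "sub (scale ?a (F 1))" using sub_scale ac sub_F by auto
  have s2: "sub (N i <+>\<^bsub>M\<^esub> scale ?a (F 1))" using sub_set_add sub_N s1 by blast
  have sX: "sub (?X k)" for k by (rule sub_add_scales[OF sub_F s2 set_take_drop_carrier])
  have Yi: "Y i = ?X (r - Suc i)" unfolding Y_def drop_nth[OF i] by simp
  show "F 1 \<subseteq> colon (Y i) ?a"
  proof
    fix x assume x: "x \<in> F 1"
    have "scale ?a (F 1) \<subseteq> Y i" unfolding Y_def
      by (rule add_scales_superset(2)[OF sub_F sub_N set_drop_carrier]) (simp add: drop_nth[OF i])
    then show "x \<in> colon (Y i) ?a" using x sub_carrier[OF sub_F] by (auto simp: scale_def colon_def)
  qed
  show "colon (Y i) ?a \<subseteq> F 1"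
  proof
    fix u assume u: "u \<in> colon (Y i) ?a"
    then have uc: "u \<in> carrier M" by (simp add: colon_def)
    \<comment> \<open>\<open>?X k\<close> keeps the first k of the later generators; each step of
      the induction removes \<open>as ! j\<close> with j = i + 1 + k.\<close>
    have st: "?a \<odot>\<^bsub>M\<^esub> u \<in> ?X k \<Longrightarrow> ?a \<odot>\<^bsub>M\<^esub> u \<in> ?X 0" if "k \<le> r - Suc i" for k
      using that
    proof (induction k)
      case (Suc k)
      define j where "j = Suc i + k"
      have j: "j < r" using Suc.prems(2) unfolding j_def by linarith
      have jq: "as ! j \<in> \<qq>" and jc: "as ! j \<in> carrier R" using nth_q nth_carrier j by auto
      have tk: "take (Suc k) ?bs = take k ?bs @ [as ! j]"
        using j by (simp add: take_Suc_conv_app_nth j_def)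
      have "?X (Suc k) = ?X k <+>\<^bsub>M\<^esub> scale (as ! j) (F 1)" unfolding tk by (rule add_scales_snoc)
      then obtain x v where xv: "x \<in> ?X k" "v \<in> F 1" "?a \<odot>\<^bsub>M\<^esub> u = x \<oplus>\<^bsub>M\<^esub> as ! j \<odot>\<^bsub>M\<^esub> v"
        using Suc.prems(1) by (auto simp: set_add_iff scale_def)
      have vc: "v \<in> carrier M" using xv sub_carrier[OF sub_F] by blast
      have tj: "set (take j as) \<subseteq> carrier R" using as_carrier set_take_subset[of j as] by blast
      have Nj: "N i \<subseteq> N j" "N (Suc i) \<subseteq> N j" using N_mono j j_def by auto
      have aN: "scale ?a (carrier M) \<subseteq> N j"
        using Nj(2) N_Suc[OF i] set_add_right[OF sub_N sub_scale[OF ac sub_whole]] by blast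
      have XN: "?X k \<subseteq> N j"
      proof (subst add_scales_subset_iff[OF sub_F s2 set_take_drop_carrier sub_N], intro conjI ballI)
        show "N i <+>\<^bsub>M\<^esub> scale ?a (F 1) \<subseteq> N j"
          using set_add_least[OF sub_N Nj(1)] aN scale_mono[OF sub_subset[OF sub_F]] by blast
        fix b assume "b \<in> set (take k ?bs)"
        then obtain l where l: "l < k" "b = as ! (Suc i + l)" using j unfolding j_def by (auto simp: in_set_conv_nth)
        have lr: "Suc i + l < r" "Suc (Suc i + l) \<le> j" using l j j_def by auto
        have "scale b (carrier M) \<subseteq> N (Suc (Suc i + l))"
          unfolding N_Suc[OF lr(1)] l(2) by (rule set_add_right[OF sub_N sub_scale[OF nth_carrier[OF lr(1)] sub_whole]])
        then show "scale b (F 1) \<subseteq> N j"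
          using N_mono[OF lr(2)] j scale_mono[OF sub_subset[OF sub_F[of 1]], of b] by auto
      qed
      have "as ! j \<odot>\<^bsub>M\<^esub> v \<in> N j"
      proof -
        have "?a \<odot>\<^bsub>M\<^esub> u \<in> N j" using aN uc by (auto simp: scale_def)
        then show ?thesis
          using sub_add_cancel(2)[OF sub_N, of x j "as ! j \<odot>\<^bsub>M\<^esub> v"] xv XN jc vc by auto
      qed
      then have "v \<in> N j" using regular_N[OF j] vc by (simp add: regular_mod_def)
      \<comment> \<open>Since \<open>as ! j\<close> carries M into F 1, its product with an element
        of N j is a combination of the earlier generators with coefficients in F 1, and those all
        occur in \<open>?X k\<close>.\<close>
      then have "as ! j \<odot>\<^bsub>M\<^esub> v \<in> add_scales (F 1) {\<zero>\<^bsub>M\<^esub>} (take j as)"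
        unfolding N_def using as_carrier set_take_subset[of j as] q_smult_F[OF jq, of _ 0]
        by (intro add_scales_restrict[OF sub_F jc]) (auto simp: F_zero)
      also have "\<dots> \<subseteq> ?X k"
      proof (rule iffD2[OF add_scales_subset_iff[OF sub_F sub_zero_set tj sX]], intro conjI ballI)
        show "{\<zero>\<^bsub>M\<^esub>} \<subseteq> ?X k" using sub_zero[OF sX] by blast
        fix b assume "b \<in> set (take j as)"
        then obtain l where l: "l < j" "b = as ! l" using j by (auto simp: in_set_conv_nth)
        consider "l < i" | "l = i" | "l > i" by linarith
        then show "scale b (F 1) \<subseteq> ?X k"
        proof cases
          case 1
          then have lr: "l < r" "Suc l \<le> i" using i by auto
          have "scale b (carrier M) \<subseteq> N (Suc l)"
            unfolding N_Suc[OF lr(1)] l(2) by (rule set_add_right[OF sub_N sub_scale[OF nth_carrier[OF lr(1)] sub_whole]])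
          then have "scale b (F 1) \<subseteq> N i"
            using N_mono[OF lr(2)] i scale_mono[OF sub_subset[OF sub_F[of 1]], of b] by auto
          then show ?thesis
            using set_add_left[OF sub_N s1] add_scales_superset(1)[OF sub_F s2 set_take_drop_carrier] by blast
        next
          case 2
          then show ?thesis
            using set_add_right[OF sub_N s1] add_scales_superset(1)[OF sub_F s2 set_take_drop_carrier] l(2) by blast
        next
          case 3
          then have "b \<in> set (take k ?bs)"
            using l j unfolding j_def in_set_conv_nth by (intro exI[of _ "l - Suc i"]) auto
          then show ?thesis by (rule add_scales_superset(2)[OF sub_F s2 set_take_drop_carrier])
        qed
      qed
      finally have "?a \<odot>\<^bsub>M\<^esub> u \<in> ?X k" unfolding xv(3) by (rule sub_add[OF sX xv(1)])
      then show ?case using Suc.IH Suc.prems(2) by simp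
    qed simp
    have "?a \<odot>\<^bsub>M\<^esub> u \<in> Y i" using u by (simp add: colon_def)
    then have "?a \<odot>\<^bsub>M\<^esub> u \<in> ?X 0" unfolding Yi by (rule st[OF order_refl])
    then have "?a \<odot>\<^bsub>M\<^esub> u \<in> N i <+>\<^bsub>M\<^esub> scale ?a (F 1)" by simp
    then obtain n v where nv: "n \<in> N i" "v \<in> F 1" "?a \<odot>\<^bsub>M\<^esub> u = n \<oplus>\<^bsub>M\<^esub> ?a \<odot>\<^bsub>M\<^esub> v"
      by (auto simp: set_add_iff scale_def)
    have vc: "v \<in> carrier M" "n \<in> carrier M" using nv sub_carrier[OF sub_F] sub_carrier[OF sub_N] by auto
    have "?a \<odot>\<^bsub>M\<^esub> (u \<ominus>\<^bsub>M\<^esub> v) = n" using nv uc vc ac by (simp add: smult_minus add_minus_cancel)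
    then have "u \<ominus>\<^bsub>M\<^esub> v \<in> N i" using regular_N[OF i] nv uc vc by (simp add: regular_mod_def)
    then have "u \<ominus>\<^bsub>M\<^esub> v \<in> F 1" by (rule subsetD[OF N_F1[OF less_imp_le[OF i]]])
    then show "u \<in> F 1" using sub_add_cancel(3)[OF sub_F nv(2) uc] by blast
  qed
qed

lemma Y_step: "i < r \<Longrightarrow> Y i \<subseteq> Y (Suc i)" "i < r \<Longrightarrow> ilen (Y i) (Y (Suc i)) = ilen (F 1) (carrier M)"
proof -
  assume i: "i < r"
  have ac: "as ! i \<in> carrier R" using nth_carrier i by blast
  show "Y i \<subseteq> Y (Suc i)" unfolding adj_Y[OF i, symmetric] by (rule adj_superset[OF sub_Y ac])
  have "F 1 \<inter> carrier M = F 1" using sub_subset[OF sub_F] by blast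
  then show "ilen (Y i) (Y (Suc i)) = ilen (F 1) (carrier M)"
    using ilen_scale[OF sub_Y sub_whole ac, of i] adj_Y[OF i] colon_Y[OF i] by simp
qed

lemma G_length: "ilen G (N r) = enat (r * len (F 1) (carrier M))"
proof -
  have f: "ilen (F 1) (carrier M) = enat (len (F 1) (carrier M))"
    by (rule ilen_eq_len[OF ilen_F_finite[OF subset_refl subset_refl]])
  have "G \<subseteq> Y k \<and> ilen G (Y k) = enat (k * len (F 1) (carrier M))" if "k \<le> r" for k
    using that
  proof (induction k)
    case 0 then show ?case using ilen_self[OF sub_Y[of 0]] Y_0 by (simp add: zero_enat_def)
  next
    case (Suc k)
    then have k: "k < r" "G \<subseteq> Y k" "ilen G (Y k) = enat (k * len (F 1) (carrier M))" by auto
    have "ilen G (Y (Suc k)) = ilen G (Y k) + ilen (Y k) (Y (Suc k))"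
      using sub_Y[of 0] Y_0 by (intro ilen_additive sub_Y k Y_step) auto
    then have "ilen G (Y (Suc k)) = enat (Suc k * len (F 1) (carrier M))"
      unfolding k(3) Y_step(2)[OF k(1)] f by simp
    then show ?case using Y_step(1)[OF k(1)] k(2) by (simp only: order_trans simp_thms)
  qed
  from this[of r] show ?thesis by (simp add: Y_r)
qed

lemma G_F2: "G \<subseteq> F 2" and sub_G: "sub G"
proof -
  show "sub G" using sub_Y[of 0] Y_0 by simp
  show "G \<subseteq> F 2" unfolding G_def
    by (subst add_scales_subset_iff[OF sub_F sub_zero_set as_carrier sub_F])
      (use sub_zero[OF sub_F] as_q q_smult_F[of _ _ 1] in \<open>auto simp: scale_def numeral_2_eq_2\<close>)
qed

lemma G_N: "G \<subseteq> N r"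
  unfolding G_def N_r
  by (subst add_scales_subset_iff[OF sub_F sub_zero_set as_carrier sub_add_scales[OF sub_whole sub_zero_set as_carrier]])
    (use sub_zero[OF sub_add_scales[OF sub_whole sub_zero_set as_carrier]]
      add_scales_superset(2)[OF sub_whole sub_zero_set as_carrier] scale_mono[OF sub_subset[OF sub_F]] in blast)

text \<open>F n lies in J M for large n, so M / J M is filtered by the pieces that
  \<open>ell r\<close> counts, and their total length is the value of \<open>hp\<close> at
  1.\<close>

lemma N_r_length: "ilen (N r) (carrier M) = enat (nat e0)"
proof -
  obtain n0 where n0: "F n0 \<subseteq> N r" using nil N_r by blast
  define n where "n = max n0 bd"
  have "F n \<subseteq> N r" using n0 F_antimono[of n0 n] unfolding n_def by auto
  then have FN: "FF r n = N r"
    unfolding FF_def using set_add_absorb[OF sub_N sub_F] set_add_commute[OF sub_F sub_N] by simp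
  have "L r n = (\<Sum>k<n. ell r k)" by (rule ell_sum)
  also have "\<dots> = (\<Sum>k<bd. ell r k)"
    by (rule sum.mono_neutral_right) (use bd(1) in \<open>auto simp: n_def\<close>)
  finally have "int (L r n) = e0" unfolding e0_def poly_hp by simp
  then have "len (N r) (carrier M) = nat e0" using FN by (simp add: L_def)
  moreover have "ilen (N r) (carrier M) < \<infinity>" using FF_finite[of r n "N r" "carrier M"] FN by simp
  ultimately show ?thesis using ilen_eq_len by metis
qed

text \<open>M / J F_1 is measured twice. Through J M its length is r h_0 + e_0; through F_2 and F_1
  it is h_0 plus the lengths of F_1 / F_2 and F_2 / J F_1. Since h_1 is the length of F_1 / F_2
  minus r h_0, the difference is as claimed.\<close>

lemma G_defect: "int (len G (F 2)) = e0 - h0 - h1" and G_F2_finite: "ilen G (F 2) < \<infinity>"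
proof -
  have 1: "ilen G (carrier M) = enat (r * len (F 1) (carrier M)) + enat (nat e0)"
    using ilen_additive[OF sub_G sub_N sub_whole G_N sub_subset[OF sub_N]] G_length N_r_length by simp
  have fin: "ilen G (carrier M) < \<infinity>" using 1 by simp
  have F21: "F 2 \<subseteq> F 1" using F_Suc[of 1] by (simp add: numeral_2_eq_2)
  have "len G (carrier M) = len G (F 2) + len (F 2) (carrier M)"
    by (rule len_additive[OF sub_G sub_F sub_whole G_F2 sub_subset[OF sub_F] fin])
  also have "len (F 2) (carrier M) = len (F 2) (F 1) + len (F 1) (carrier M)"
    by (rule len_additive[OF sub_F sub_F sub_whole F21 sub_subset[OF sub_F] ilen_F_finite[OF subset_refl subset_refl]])
  finally have 2: "len G (carrier M) = len G (F 2) + (len (F 2) (F 1) + len (F 1) (carrier M))" .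
  have e: "len (F 1) (carrier M) = ell 0 0" "len (F 2) (F 1) = ell 0 1"
    by (simp_all add: ell_def FF_0 F_zero numeral_2_eq_2)
  have "e0 \<ge> 0" using hp_pos by (simp add: e0_def)
  then have "int (len G (carrier M)) = int r * int (ell 0 0) + e0" using 1 e by (simp add: len_def)
  then show "int (len G (F 2)) = e0 - h0 - h1"
    using 2 e unfolding h0_def h1_def hp_coeff_0 hp_coeff_1 by simp
  show "ilen G (F 2) < \<infinity>" using ilen_mono[OF subset_refl sub_subset[OF sub_F]] fin by (rule order_le_less_trans)
qed

lemma F2_eq_G_iff: "e0 = h0 + h1 \<longleftrightarrow> F 2 = G"
proof
  assume "e0 = h0 + h1"
  then have "len G (F 2) = 0" using G_defect by simp
  then show "F 2 = G" by (rule len_eq_0[OF sub_G sub_F G_F2 G_F2_finite])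
next
  assume "F 2 = G"
  then have "len G (F 2) = 0" using len_self[OF sub_G] by simp
  then show "e0 = h0 + h1" using G_defect by simp
qed

text \<open>From e_1 = h_1 to e_1 = e_0 - h_0 there is a squeeze: \<open>G_defect\<close> gives h_1
  \<le> e_0 - h_0, and Northcott's inequality gives e_1 \<ge> e_0 - h_0. The way back goes through
  the degree of \<open>hp\<close>.\<close>

lemma equivalences:
  shows "Polynomial.degree hp \<le> 1 \<longleftrightarrow> e1 = h1" "e1 = h1 \<longleftrightarrow> e1 = e0 - h0" "e1 = h1 \<Longrightarrow> e0 = h0 + h1"
proof -
  have 1: "e1 = e0 - h0" if "e1 = h1" using that northcott G_defect by linarith
  have 2: "e1 = h1" "Polynomial.degree hp \<le> 1" if "e1 = e0 - h0"
    using linear_hp(3) degree_from_equality[OF that] by auto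
  show "Polynomial.degree hp \<le> 1 \<longleftrightarrow> e1 = h1" using 1 2(2) linear_hp(3) by blast
  show "e1 = h1 \<longleftrightarrow> e1 = e0 - h0" using 1 2(1) by blast
  show "e0 = h0 + h1" if "e1 = h1" using linear_hp(2)[OF 2(2)[OF 1[OF that]]] .
qed

end

section \<open>Maximal superficial sequences of Cohen--Macaulay modules\<close>

text \<open>Positivity of d excludes the empty set, whose supremum is 0.\<close>

lemma Sup_enat_attained:
  assumes "Sup {enat (f x) | x. P x} = enat d" "d > 0"
  shows "\<exists>x. P x \<and> f x = d"
proof (rule ccontr)
  assume no: "\<nexists>x. P x \<and> f x = d"
  have "Sup {enat (f x) | x. P x} \<le> enat (d - 1)"
  proof (rule Sup_least)
    fix y assume y: "y \<in> {enat (f x) | x. P x}"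
    then obtain x where x: "y = enat (f x)" "P x" by blast
    have "y \<le> enat d" using Sup_upper[OF y] assms(1) by simp
    then have "f x \<le> d" using x by simp
    moreover have "f x \<noteq> d" using no x by blast
    ultimately show "y \<le> enat (d - 1)" using x by simp
  qed
  then show False using assms by simp
qed

context local_module
begin

lemma prime_subset_mm: "primeideal P R \<Longrightarrow> P \<subseteq> \<mm>"
  using R.exists_maximal[of P] prime_ideal[of P R] prime_ne[of P R] mm_unique by metis

lemma module_dim_at_mm: "module_dim_at R M \<mm> = module_dim R M"
proof -
  have "P n \<subseteq> \<mm>" if "prime_chain R P n" for P n
    using that prime_subset_mm[of "P n"] by (simp add: prime_chain_def)
  then have "(prime_chain R P n \<and> annihilator R M \<subseteq> P 0 \<and> P n \<subseteq> \<mm>) \<longleftrightarrow>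
      (prime_chain R P n \<and> annihilator R M \<subseteq> P 0)" for P n by blast
  then show ?thesis unfolding module_dim_at_def module_dim_def by simp
qed

lemma annihilator_subset_mm:
  assumes "carrier M \<noteq> {\<zero>\<^bsub>M\<^esub>}"
  shows "annihilator R M \<subseteq> \<mm>"
proof -
  have i: "ideal (annihilator R M) R" unfolding annihilator_eq by (rule ideal_ann_mod[OF sub_zero_set])
  have "annihilator R M \<noteq> carrier R"
  proof
    assume "annihilator R M = carrier R"
    then have "\<one> \<in> annihilator R M" by simp
    then have "\<forall>x\<in>carrier M. x = \<zero>\<^bsub>M\<^esub>" by (simp add: annihilator_def)
    then show False using assms sub_zero[OF sub_whole] by blast
  qed
  then show ?thesis using R.exists_maximal[OF i] mm_unique by metis
qed

lemma add_scales_proper: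
  assumes "carrier M \<noteq> {\<zero>\<^bsub>M\<^esub>}" "set as \<subseteq> \<mm>"
  shows "add_scales (carrier M) {\<zero>\<^bsub>M\<^esub>} as \<noteq> carrier M"
proof
  assume e: "add_scales (carrier M) {\<zero>\<^bsub>M\<^esub>} as = carrier M"
  have c: "set as \<subseteq> carrier R" using assms(2) mm_carrier by blast
  have s: "sub (ideal_smult R M \<mm> (carrier M))" using sub_ideal_smult ideal_subset[OF mm_ideal] by blast
  have "add_scales (carrier M) {\<zero>\<^bsub>M\<^esub>} as \<subseteq> ideal_smult R M \<mm> (carrier M)"
    by (rule iffD2[OF add_scales_subset_iff[OF sub_whole sub_zero_set c s]])
      (use sub_zero[OF s] assms(2) in \<open>auto simp: scale_def intro!: ideal_smultI\<close>)
  then have "carrier M \<subseteq> {\<zero>\<^bsub>M\<^esub>} <+>\<^bsub>M\<^esub> ideal_smult R M \<mm> (carrier M)"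
    using e set_add_right[OF sub_zero_set s] by simp
  then have "carrier M \<subseteq> {\<zero>\<^bsub>M\<^esub>}" by (rule nakayama[OF sub_zero_set sub_whole])
  then show False using assms(1) sub_zero[OF sub_whole] by blast
qed

lemma dim_ge:
  assumes "prime_chain R P n" "annihilator R M \<subseteq> P 0"
  shows "enat n \<le> module_dim R M"
  unfolding module_dim_def by (rule Sup_upper) (use assms in blast)

end

context filtered_module
begin

text \<open>A regular sequence of length d exists because the depth is d; it is traded for the
  superficial one element by element. A superficial sequence shorter than d would leave a regular
  element on a quotient killed by a power of \<open>\<mm>\<close>, and a longer one would produce a
  chain of d + 2 primes.\<close>

lemma maximal_superficial_length:
  assumes ne: "carrier M \<noteq> {\<zero>\<^bsub>M\<^esub>}" and cm: "cohen_macaulay R M"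
    and dim: "module_dim R M = enat d" and d: "d \<ge> 1"
    and max: "maximal_superficial_sequence R \<qq> M F as"
  shows "length as = d" "superficial_module R M \<mm> \<qq> F as"
proof -
  let ?N = "\<lambda>i. add_scales (carrier M) {\<zero>\<^bsub>M\<^esub>} (take i as)"
  have sup: "superficial_sequence R \<qq> M F as" and as_ne: "as \<noteq> []"
    and nilm: "nilpotent_modulo R M F as" "\<not> nilpotent_modulo R M F (butlast as)"
    using max by (auto simp: maximal_superficial_sequence_def)
  have nthq: "as ! i \<in> \<qq>" if "i < length as" for i
    using sup that by (auto simp: superficial_sequence_def Let_def superficial_element_def)
  then have asq: "set as \<subseteq> \<qq>" by (auto simp: in_set_conv_nth)
  have asc: "set as \<subseteq> carrier R" using asq q_carrier by blast
  have tk: "set (take i as) \<subseteq> carrier R" for i using asc set_take_subset[of i as] by blast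
  have sN: "sub (?N i)" for i by (rule sub_add_scales[OF sub_whole sub_zero_set tk])
  have nthc: "as ! i \<in> carrier R" if "i < length as" for i using nthq[OF that] q_carrier by blast
  have NS: "?N (Suc i) = adj (?N i) (as ! i)" if "i < length as" for i
    using that by (simp add: take_Suc_conv_app_nth add_scales_snoc)
  have Nmono: "?N i \<subseteq> ?N j" if "i \<le> j" "j \<le> length as" for i j
    using that
  proof (induction j)
    case (Suc j)
    show ?case
    proof (cases "i = Suc j")
      case False
      then have "?N i \<subseteq> ?N j" using Suc by simp
      also have "?N j \<subseteq> ?N (Suc j)" unfolding NS[OF Suc_le_lessD[OF Suc.prems(2)]]
        by (rule adj_superset[OF sN nthc]) (use Suc.prems in simp)
      finally show ?thesis .
    qed simp
  qed simp
  have supf: "\<exists>c. \<forall>n\<ge>c. colon (F (Suc n) <+>\<^bsub>M\<^esub> ?N i) (as ! i) \<inter> (F c <+>\<^bsub>M\<^esub> ?N i) = F n <+>\<^bsub>M\<^esub> ?N i"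
    if i: "i < length as" for i
  proof -
    have "superficial_element \<qq> (FactModule M (?N i)) (quotient_filtration M F (?N i)) (as ! i)"
      using sup i unfolding superficial_sequence_def Let_def list_smult_eq[OF tk] by blast
    then show ?thesis unfolding superficial_element_FactModule[OF sN sub_F nthc[OF i]] by blast
  qed
  have prp: "add_scales (carrier M) {\<zero>\<^bsub>M\<^esub>} bs \<noteq> carrier M" if "set bs \<subseteq> set as" for bs
    using add_scales_proper[OF ne] asq q_subset that by blast
  have "module_depth R \<mm> M = enat d"
    using cm mm_maximal annihilator_subset_mm[OF ne] dim unfolding cohen_macaulay_def module_dim_at_mm[symmetric] by simp
  then obtain xs where xs: "set xs \<subseteq> \<mm>" "regular_sequence R M xs" "length xs = d"
    using Sup_enat_attained[of length "\<lambda>xs. set xs \<subseteq> \<mm> \<and> regular_sequence R M xs" d] d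
    unfolding module_depth_def by auto
  \<comment> \<open>The invariant: the first i elements form a regular sequence, and d - i further
    elements of \<open>\<mm>\<close> are still regular after them. The head z of the latter makes
    \<open>as ! i\<close> regular by \<open>superficial_regular\<close>, and exchanging z for
    \<open>as ! i\<close> preserves the invariant.\<close>
  have main: "regular_seq_mod {\<zero>\<^bsub>M\<^esub>} (take i as) \<and>
      (\<exists>zs. length zs = d - i \<and> set zs \<subseteq> \<mm> \<and> regular_seq_mod (?N i) zs)" if "i \<le> length as" "i \<le> d" for i
    using that
  proof (induction i)
    case 0
    then show ?case using xs by (auto simp: regular_sequence_iff)
  next
    case (Suc i)
    then obtain zs where zs: "length zs = d - i" "set zs \<subseteq> \<mm>" "regular_seq_mod (?N i) zs"
      and reg: "regular_seq_mod {\<zero>\<^bsub>M\<^esub>} (take i as)" by auto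
    have i: "i < length as" "i < d" using Suc.prems by auto
    obtain z zs' where z: "zs = z # zs'" "length zs' = d - Suc i"
      using zs(1) i(2) by (cases zs) auto
    have zr: "regular_mod (?N i) z" "z \<in> \<mm>" using z zs by auto
    obtain c where "\<forall>n\<ge>c. colon (F (Suc n) <+>\<^bsub>M\<^esub> ?N i) (as ! i) \<inter> (F c <+>\<^bsub>M\<^esub> ?N i) = F n <+>\<^bsub>M\<^esub> ?N i"
      using supf[OF i(1)] by blast
    then have ra: "regular_mod (?N i) (as ! i)" by (rule superficial_regular[OF sN nthq[OF i(1)] zr])
    have am: "as ! i \<in> \<mm>" using nthq[OF i(1)] q_subset by blast
    have "set zs' \<subseteq> \<mm>" "regular_seq_mod (adj (?N i) z) zs'" using z zs by auto
    from regular_exchange[OF sN am zr(2) ra zr(1) this]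
    obtain ws where "length ws = d - Suc i" "set ws \<subseteq> \<mm>" "regular_seq_mod (?N (Suc i)) ws"
      unfolding NS[OF i(1)] using z(2) by auto
    moreover have "regular_seq_mod {\<zero>\<^bsub>M\<^esub>} (take (Suc i) as)"
      using reg ra i(1) by (simp add: take_Suc_conv_app_nth regular_seq_mod_append)
    ultimately show ?case by blast
  qed
  have nil: "\<exists>n0. F n0 \<subseteq> add_scales (carrier M) {\<zero>\<^bsub>M\<^esub>} as"
    using nilm(1) unfolding nilpotent_modulo_iff[OF sub_F asc] by blast
  \<comment> \<open>Otherwise some z in \<open>\<mm>\<close> is regular modulo the whole sequence,
    while a power of z carries M into F n0 and thus into the submodule generated by the sequence.
    That would force this submodule to be M.\<close>
  have ge: "d \<le> length as"
  proof (rule ccontr)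
    assume "\<not> d \<le> length as"
    then have lt: "length as < d" by simp
    then obtain zs where zs: "length zs = d - length as" "set zs \<subseteq> \<mm>" "regular_seq_mod (?N (length as)) zs"
      using main[of "length as"] by auto
    then obtain z where z: "z \<in> \<mm>" "regular_mod (?N (length as)) z" using lt by (cases zs) auto
    obtain n0 where n0: "F n0 \<subseteq> ?N (length as)" using nil by auto
    obtain k where k: "ideal_smult R M (ideal_power R \<mm> k) (carrier M) \<subseteq> F n0" using F_contains_power by blast
    have "u \<in> ?N (length as)" if u: "u \<in> carrier M" for u
    proof -
      have "z [^] k \<odot>\<^bsub>M\<^esub> u \<in> ?N (length as)"
        using k n0 ideal_smultI[OF R.pow_in_ideal_power[OF mm_ideal z(1)] u] by blast
      then show ?thesis using regular_mod_pow[OF z(2) mm_carrier[OF z(1)], of k] u by (simp add: regular_mod_def)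
    qed
    then have "?N (length as) = carrier M" using sub_subset[OF sN] by blast
    then show False using prp[of as] by simp
  qed
  have le: "length as \<le> d"
  proof (rule ccontr)
    assume "\<not> length as \<le> d"
    then have lt: "d < length as" by simp
    have reg: "regular_seq_mod {\<zero>\<^bsub>M\<^esub>} (take d as)" using main[of d] lt by simp
    have bl: "butlast as = take (length as - 1) as" by (simp add: butlast_conv_take)
    \<comment> \<open>If F n were inside N_d, the filtration would already be nilpotent modulo all
      but the last element, contrary to maximality.\<close>
    have notF: "\<not> F n \<subseteq> ?N d" for n
    proof
      assume n: "F n \<subseteq> ?N d"
      have K: "F k \<subseteq> add_scales (carrier M) {\<zero>\<^bsub>M\<^esub>} (butlast as)" if "k \<ge> n" for k
      proof -
        have "F k \<subseteq> ?N d" using F_antimono[OF that] n by blast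
        also have "?N d \<subseteq> ?N (length as - 1)" by (rule Nmono) (use lt in auto)
        finally show ?thesis unfolding bl .
      qed
      have c: "set (butlast as) \<subseteq> carrier R" unfolding bl by (rule tk)
      have "nilpotent_modulo R M F (butlast as)" unfolding nilpotent_modulo_iff[OF sub_F c] using K by blast
      then show False using nilm(2) by blast
    qed
    \<comment> \<open>If every prime above Ann (M / N_d) contained \<open>\<mm>\<close>, a power of
      \<open>\<mm>\<close> would carry M into N_d, and so some F n would lie there. The prime found
      is strictly inside \<open>\<mm>\<close>; this chain of length 1 is prolonged by the d regular
      elements.\<close>
    have "\<exists>P. primeideal P R \<and> ann_mod (?N d) \<subseteq> P \<and> \<not> \<mm> \<subseteq> P"
    proof (rule ccontr)
      assume "\<not> ?thesis"
      then obtain k where k: "ideal_power R \<mm> k \<subseteq> ann_mod (?N d)"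
        using ideal_power_subset[OF R.is_cring ring_noetherian ideal_ann_mod[OF sN] mm_ideal] by blast
      have "ideal_smult R M (ideal_power R \<mm> k) (carrier M) \<subseteq> ?N d"
        by (rule ideal_smult_least[OF sN]) (use k in \<open>auto simp: ann_mod_def\<close>)
      then show False using F_in_power[of k] notF by blast
    qed
    then obtain P where P: "primeideal P R" "ann_mod (?N d) \<subseteq> P" "\<not> \<mm> \<subseteq> P" by blast
    then have "P \<subset> \<mm>" using prime_subset_mm by blast
    then have "prime_chain R (\<lambda>i. if i = 0 then P else \<mm>) 1"
      using P(1) mm_prime by (simp add: prime_chain_def)
    then have "\<exists>C. prime_chain R C (length (take d as) + 1) \<and> ann_mod {\<zero>\<^bsub>M\<^esub>} \<subseteq> C 0 \<and>
        C (length (take d as) + 1) = (if (1::nat) = 0 then P else \<mm>)"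
      by (rule prime_chain_extend[OF sub_zero_set tk reg]) (simp add: P(2))
    then obtain C where "prime_chain R C (Suc d)" "ann_mod {\<zero>\<^bsub>M\<^esub>} \<subseteq> C 0" using lt by auto
    then have "enat (Suc d) \<le> module_dim R M" using dim_ge annihilator_eq by simp
    then show False using dim by simp
  qed
  show len: "length as = d" using ge le by simp
  show "superficial_module R M \<mm> \<qq> F as"
  proof (unfold_locales)
    show "set as \<subseteq> \<qq>" by (rule asq)
    show "as \<noteq> []" by (rule as_ne)
    show "regular_seq_mod {\<zero>\<^bsub>M\<^esub>} as" using main[of d] len by simp
    show "\<exists>n0. F n0 \<subseteq> add_scales (carrier M) {\<zero>\<^bsub>M\<^esub>} as" by (rule nil)
    show "add_scales (carrier M) {\<zero>\<^bsub>M\<^esub>} as \<noteq> carrier M" by (rule prp) simp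
  qed (rule supf)
qed

end

context superficial_module
begin

lemma h_polynomial_eq: "module_dim R M = enat r \<Longrightarrow> h_polynomial R M F = hp"
  unfolding h_polynomial_def
proof (rule the_equality)
  assume d: "module_dim R M = enat r"
  show "fps_of_poly hp = hilbert_series R M F * (1 - fps_X) ^ the_enat (module_dim R M) \<and> poly hp 1 \<noteq> 0"
    using hp_series hp_pos d by simp
  fix h assume "fps_of_poly h = hilbert_series R M F * (1 - fps_X) ^ the_enat (module_dim R M) \<and> poly h 1 \<noteq> 0"
  then have "fps_of_poly h = fps_of_poly hp" using hp_series d by simp
  then show "h = hp" by (simp only: fps_of_poly_eq_iff)
qed

lemma F2_eq_JF1_iff: "e0 = h0 + h1 \<longleftrightarrow> F 2 = ideal_smult R M (genideal R (set as)) (F 1)"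
  unfolding F2_eq_G_iff G_def ideal_smult_genideal[OF sub_F as_carrier] ..

lemma hilbert_equivalences:
  assumes d: "module_dim R M = enat r"
  defines "e \<equiv> hilbert_coeff R M F" and "h \<equiv> h_coeff R M F"
  shows "s_degree R M F \<le> 1 \<longleftrightarrow> hilbert_series R M F * (1 - fps_X) ^ r = fps_of_poly [:h 0, h 1:]"
    "s_degree R M F \<le> 1 \<longleftrightarrow> e 1 = of_int (h 1)"
    "e 1 = of_int (h 1) \<longleftrightarrow> e 1 = e 0 - of_int (h 0)"
    "e 1 = of_int (h 1) \<longrightarrow> e 0 = of_int (h 0 + h 1)"
    "e 0 = of_int (h 0 + h 1) \<longleftrightarrow> F 2 = ideal_smult R M (genideal R (set as)) (F 1)"
    "s_degree R M F \<le> 1 \<Longrightarrow> i < r \<Longrightarrow> W i n = 0"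
proof -
  note hp = h_polynomial_eq[OF d]
  have c: "e 0 = of_int e0" "e 1 = of_int e1" "h 0 = h0" "h 1 = h1"
    by (simp_all add: e_def h_def hilbert_coeff_def h_coeff_def hp e0_def e1_def h0_def h1_def)
  have s: "s_degree R M F = Polynomial.degree hp" by (simp add: s_degree_def hp)
  have q: "(of_int a :: rat) = of_int b - of_int c \<longleftrightarrow> a = b - c" for a b c :: int
    by (metis of_int_diff of_int_eq_iff)
  show "s_degree R M F \<le> 1 \<longleftrightarrow> hilbert_series R M F * (1 - fps_X) ^ r = fps_of_poly [:h 0, h 1:]"
  proof
    assume "s_degree R M F \<le> 1"
    then show "hilbert_series R M F * (1 - fps_X) ^ r = fps_of_poly [:h 0, h 1:]"
      using linear_hp(1) hp_series s c by metis
  next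
    assume "hilbert_series R M F * (1 - fps_X) ^ r = fps_of_poly [:h 0, h 1:]"
    then have "hp = [:h 0, h 1:]" using hp_series fps_of_poly_eq_iff by metis
    then show "s_degree R M F \<le> 1" unfolding s by (metis degree_pCons_eq_if degree_pCons_le le_numeral_extra(4) One_nat_def degree_0 not_less_eq_eq le0)
  qed
  show "s_degree R M F \<le> 1 \<longleftrightarrow> e 1 = of_int (h 1)" unfolding s c using equivalences(1) by simp
  show "e 1 = of_int (h 1) \<longleftrightarrow> e 1 = e 0 - of_int (h 0)" unfolding c q using equivalences(2) by simp
  show "e 1 = of_int (h 1) \<longrightarrow> e 0 = of_int (h 0 + h 1)" unfolding c using equivalences(3) by simp
  show "e 0 = of_int (h 0 + h 1) \<longleftrightarrow> F 2 = ideal_smult R M (genideal R (set as)) (F 1)"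
    unfolding c of_int_eq_iff by (rule F2_eq_JF1_iff)
  show "W i n = 0" if "s_degree R M F \<le> 1" "i < r"
    using northcott_equality(2) equivalences(1,2) that unfolding s by blast
qed

end

section \<open>The associated graded ring and module\<close>

locale filtration = module +
  fixes F :: "nat \<Rightarrow> 'c set"
  assumes filt_sub: "submodule (F n) R M"
    and filt_Suc: "F (Suc n) \<subseteq> F n"
begin

text \<open>Finitely supported families of representatives. Every element of the graded module is
  the class of such a family, so one can compute with elements of M instead of cosets.\<close>

definition seqs :: "(nat \<Rightarrow> 'c) set"
  where "seqs = {\<alpha>. (\<forall>n. \<alpha> n \<in> F n) \<and> finite {n. \<alpha> n \<noteq> \<zero>\<^bsub>M\<^esub>}}"

definition cls :: "(nat \<Rightarrow> 'c) \<Rightarrow> nat \<Rightarrow> 'c set"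
  where "cls \<alpha> = (\<lambda>n. F (Suc n) +>\<^bsub>M\<^esub> \<alpha> n)"

definition single :: "nat \<Rightarrow> 'c \<Rightarrow> nat \<Rightarrow> 'c"
  where "single k x = (\<lambda>n. if n = k then x else \<zero>\<^bsub>M\<^esub>)"

text \<open>The homogeneous element of degree k represented by x (the name does not refer to
  homomorphisms): the initial form of x if x is outside \<open>F (Suc k)\<close>, and zero
  otherwise.\<close>

definition hom :: "nat \<Rightarrow> 'c \<Rightarrow> nat \<Rightarrow> 'c set"
  where "hom k x = cls (single k x)"

abbreviation gr where "gr \<equiv> gr_module M F"

lemma filt_carrier: "x \<in> F n \<Longrightarrow> x \<in> carrier M"
  using sub_carrier[OF filt_sub] .

lemma seqsD: "\<alpha> \<in> seqs \<Longrightarrow> \<alpha> n \<in> F n" "\<alpha> \<in> seqs \<Longrightarrow> \<alpha> n \<in> carrier M"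
  using filt_carrier by (auto simp: seqs_def)

lemma coset_filt_zero: "F (Suc n) +>\<^bsub>M\<^esub> \<zero>\<^bsub>M\<^esub> = F (Suc n)"
  using sub_subset[OF filt_sub] by simp

lemma gr_simps:
  "carrier gr = {g. (\<forall>n. g n \<in> (\<lambda>x. F (Suc n) +>\<^bsub>M\<^esub> x) ` F n) \<and> finite {n. g n \<noteq> F (Suc n)}}"
  "\<zero>\<^bsub>gr\<^esub> = (\<lambda>n. F (Suc n))"
  "g \<oplus>\<^bsub>gr\<^esub> h = (\<lambda>n. g n <+>\<^bsub>M\<^esub> h n)"
  by (auto simp: gr_module_def gr_component_simps)

lemma carrier_gr: "carrier gr = cls ` seqs"
proof
  show "cls ` seqs \<subseteq> carrier gr"
  proof
    fix g assume "g \<in> cls ` seqs"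
    then obtain \<alpha> where a: "\<alpha> \<in> seqs" "g = cls \<alpha>" by blast
    have "{n. g n \<noteq> F (Suc n)} \<subseteq> {n. \<alpha> n \<noteq> \<zero>\<^bsub>M\<^esub>}"
      unfolding a(2) cls_def using coset_filt_zero by auto
    then have "finite {n. g n \<noteq> F (Suc n)}" using a(1) finite_subset by (auto simp: seqs_def)
    then show "g \<in> carrier gr" using a seqsD(1)[OF a(1)] by (auto simp: gr_simps cls_def)
  qed
  show "carrier gr \<subseteq> cls ` seqs"
  proof
    fix g assume "g \<in> carrier gr"
    then have g: "\<forall>n. \<exists>x\<in>F n. g n = F (Suc n) +>\<^bsub>M\<^esub> x" "finite {n. g n \<noteq> F (Suc n)}" by (auto simp: gr_simps)
    then obtain x where x: "\<forall>n. x n \<in> F n \<and> g n = F (Suc n) +>\<^bsub>M\<^esub> x n" by metis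
    define \<alpha> where "\<alpha> = (\<lambda>n. if g n = F (Suc n) then \<zero>\<^bsub>M\<^esub> else x n)"
    have "{n. \<alpha> n \<noteq> \<zero>\<^bsub>M\<^esub>} \<subseteq> {n. g n \<noteq> F (Suc n)}" by (auto simp: \<alpha>_def)
    then have "finite {n. \<alpha> n \<noteq> \<zero>\<^bsub>M\<^esub>}" using g(2) by (rule finite_subset)
    then have "\<alpha> \<in> seqs" using x sub_zero[OF filt_sub] by (auto simp: seqs_def \<alpha>_def)
    moreover have "g = cls \<alpha>"
    proof
      fix n
      show "g n = cls \<alpha> n" using x coset_filt_zero[of n] by (simp add: cls_def \<alpha>_def)
    qed
    ultimately show "g \<in> cls ` seqs" by blast
  qed
qed

lemma cls_closed: "\<alpha> \<in> seqs \<Longrightarrow> cls \<alpha> \<in> carrier gr"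
  using carrier_gr by blast

lemma cls_eq_iff:
  assumes "\<alpha> \<in> seqs" "\<beta> \<in> seqs"
  shows "cls \<alpha> = cls \<beta> \<longleftrightarrow> (\<forall>n. \<alpha> n \<ominus>\<^bsub>M\<^esub> \<beta> n \<in> F (Suc n))"
  unfolding cls_def fun_eq_iff using coset_eq_iff[OF filt_sub] seqsD(2)[OF assms(1)] seqsD(2)[OF assms(2)] by simp

lemma seqs_add: "\<alpha> \<in> seqs \<Longrightarrow> \<beta> \<in> seqs \<Longrightarrow> (\<lambda>n. \<alpha> n \<oplus>\<^bsub>M\<^esub> \<beta> n) \<in> seqs"
proof -
  assume a: "\<alpha> \<in> seqs" "\<beta> \<in> seqs"
  have "{n. \<alpha> n \<oplus>\<^bsub>M\<^esub> \<beta> n \<noteq> \<zero>\<^bsub>M\<^esub>} \<subseteq> {n. \<alpha> n \<noteq> \<zero>\<^bsub>M\<^esub>} \<union> {n. \<beta> n \<noteq> \<zero>\<^bsub>M\<^esub>}" by auto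
  then have "finite {n. \<alpha> n \<oplus>\<^bsub>M\<^esub> \<beta> n \<noteq> \<zero>\<^bsub>M\<^esub>}" using a by (auto simp: seqs_def dest: finite_subset)
  then show ?thesis using a sub_add[OF filt_sub] by (auto simp: seqs_def)
qed

lemma seqs_neg: "\<alpha> \<in> seqs \<Longrightarrow> (\<lambda>n. \<ominus>\<^bsub>M\<^esub> \<alpha> n) \<in> seqs"
proof -
  assume a: "\<alpha> \<in> seqs"
  have "{n. \<ominus>\<^bsub>M\<^esub> \<alpha> n \<noteq> \<zero>\<^bsub>M\<^esub>} \<subseteq> {n. \<alpha> n \<noteq> \<zero>\<^bsub>M\<^esub>}" by auto
  then have "finite {n. \<ominus>\<^bsub>M\<^esub> \<alpha> n \<noteq> \<zero>\<^bsub>M\<^esub>}" using a by (auto simp: seqs_def dest: finite_subset)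
  then show ?thesis using a sub_neg[OF filt_sub] by (auto simp: seqs_def)
qed

lemma seqs_zero: "(\<lambda>n. \<zero>\<^bsub>M\<^esub>) \<in> seqs"
  using sub_zero[OF filt_sub] by (simp add: seqs_def)

lemma cls_add: "\<alpha> \<in> seqs \<Longrightarrow> \<beta> \<in> seqs \<Longrightarrow> cls \<alpha> \<oplus>\<^bsub>gr\<^esub> cls \<beta> = cls (\<lambda>n. \<alpha> n \<oplus>\<^bsub>M\<^esub> \<beta> n)"
  unfolding gr_simps cls_def using coset_add[OF filt_sub] seqsD(2) by auto

lemma cls_zero: "cls (\<lambda>n. \<zero>\<^bsub>M\<^esub>) = \<zero>\<^bsub>gr\<^esub>"
  unfolding gr_simps cls_def coset_filt_zero ..

lemma gr_abelian_group: "abelian_group gr"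
proof (rule abelian_groupI)
  show "\<zero>\<^bsub>gr\<^esub> \<in> carrier gr" using cls_closed[OF seqs_zero] cls_zero by simp
  fix f assume f: "f \<in> carrier gr"
  then obtain \<alpha> where a: "\<alpha> \<in> seqs" "f = cls \<alpha>" using carrier_gr by blast
  have ac: "\<alpha> n \<in> carrier M" for n using seqsD(2)[OF a(1)] .
  show "\<zero>\<^bsub>gr\<^esub> \<oplus>\<^bsub>gr\<^esub> f = f"
    using cls_add[OF seqs_zero a(1)] ac unfolding a(2) cls_zero by simp
  show "\<exists>g\<in>carrier gr. g \<oplus>\<^bsub>gr\<^esub> f = \<zero>\<^bsub>gr\<^esub>"
    using cls_add[OF seqs_neg[OF a(1)] a(1)] ac cls_closed[OF seqs_neg[OF a(1)]]
    unfolding a(2) by (intro bexI[of _ "cls (\<lambda>n. \<ominus>\<^bsub>M\<^esub> \<alpha> n)"]) (simp_all add: M.l_neg cls_zero)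
  fix g assume "g \<in> carrier gr"
  then obtain \<beta> where b: "\<beta> \<in> seqs" "g = cls \<beta>" using carrier_gr by blast
  have bc: "\<beta> n \<in> carrier M" for n using seqsD(2)[OF b(1)] .
  show "f \<oplus>\<^bsub>gr\<^esub> g \<in> carrier gr" unfolding a(2) b(2) cls_add[OF a(1) b(1)] by (rule cls_closed[OF seqs_add[OF a(1) b(1)]])
  show "f \<oplus>\<^bsub>gr\<^esub> g = g \<oplus>\<^bsub>gr\<^esub> f"
    unfolding a(2) b(2) cls_add[OF a(1) b(1)] cls_add[OF b(1) a(1)] using ac bc by (simp add: M.a_comm)
  fix h assume "h \<in> carrier gr"
  then obtain \<gamma> where c: "\<gamma> \<in> seqs" "h = cls \<gamma>" using carrier_gr by blast
  have cc: "\<gamma> n \<in> carrier M" for n using seqsD(2)[OF c(1)] .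
  show "f \<oplus>\<^bsub>gr\<^esub> g \<oplus>\<^bsub>gr\<^esub> h = f \<oplus>\<^bsub>gr\<^esub> (g \<oplus>\<^bsub>gr\<^esub> h)"
    unfolding a(2) b(2) c(2) cls_add[OF a(1) b(1)] cls_add[OF b(1) c(1)]
      cls_add[OF seqs_add[OF a(1) b(1)] c(1)] cls_add[OF a(1) seqs_add[OF b(1) c(1)]]
    using ac bc cc by (simp add: M.a_assoc)
qed

lemma single_seqs: "x \<in> F k \<Longrightarrow> single k x \<in> seqs"
proof -
  assume x: "x \<in> F k"
  have "{n. single k x n \<noteq> \<zero>\<^bsub>M\<^esub>} \<subseteq> {k}" by (auto simp: single_def)
  then have "finite {n. single k x n \<noteq> \<zero>\<^bsub>M\<^esub>}" using finite_subset by blast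
  then show ?thesis using x sub_zero[OF filt_sub] by (auto simp: seqs_def single_def)
qed

lemma hom_closed: "x \<in> F k \<Longrightarrow> hom k x \<in> carrier gr"
  unfolding hom_def by (rule cls_closed[OF single_seqs])

lemma hom_add: "x \<in> F k \<Longrightarrow> y \<in> F k \<Longrightarrow> hom k x \<oplus>\<^bsub>gr\<^esub> hom k y = hom k (x \<oplus>\<^bsub>M\<^esub> y)"
  unfolding hom_def cls_add[OF single_seqs single_seqs] by (rule arg_cong[of _ _ cls]) (auto simp: single_def)

lemma hom_zero: "hom k \<zero>\<^bsub>M\<^esub> = \<zero>\<^bsub>gr\<^esub>"
  unfolding hom_def cls_zero[symmetric] by (rule arg_cong[of _ _ cls]) (auto simp: single_def)

lemma hom_eq_zero_iff: "x \<in> F k \<Longrightarrow> hom k x = \<zero>\<^bsub>gr\<^esub> \<longleftrightarrow> x \<in> F (Suc k)"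
proof -
  assume x: "x \<in> F k"
  have "hom k x = \<zero>\<^bsub>gr\<^esub> \<longleftrightarrow> (\<forall>n. single k x n \<ominus>\<^bsub>M\<^esub> \<zero>\<^bsub>M\<^esub> \<in> F (Suc n))"
    unfolding hom_def cls_zero[symmetric] by (rule cls_eq_iff[OF single_seqs[OF x] seqs_zero])
  also have "\<dots> \<longleftrightarrow> x \<in> F (Suc k)"
  proof -
    have z: "y \<ominus>\<^bsub>M\<^esub> \<zero>\<^bsub>M\<^esub> \<in> F m \<longleftrightarrow> y \<in> F m" if "y \<in> carrier M" for y m
      by (rule sub_add_cancel(3)[OF filt_sub sub_zero[OF filt_sub] that])
    have "single k x n \<in> carrier M" for n using filt_carrier[OF x] by (simp add: single_def)
    then show ?thesis using z sub_zero[OF filt_sub] by (simp add: single_def)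
  qed
  finally show ?thesis .
qed

text \<open>The strict bound makes \<open>deg_lt 0\<close> the zero submodule, so the zero element
  needs no convention for its degree and inductions can start there.\<close>

definition deg_lt :: "nat \<Rightarrow> (nat \<Rightarrow> 'c set) set"
  where "deg_lt n = {g \<in> carrier gr. \<forall>k\<ge>n. g k = F (Suc k)}"

lemma deg_lt_0: "deg_lt 0 = {\<zero>\<^bsub>gr\<^esub>}"
  using abelian_group.axioms(1)[OF gr_abelian_group] abelian_monoid.zero_closed[of gr]
  by (auto simp: deg_lt_def gr_simps(2))

lemma deg_lt_carrier: "deg_lt n \<subseteq> carrier gr"
  by (auto simp: deg_lt_def)

lemma deg_lt_mono: "m \<le> n \<Longrightarrow> deg_lt m \<subseteq> deg_lt n"
  by (auto simp: deg_lt_def)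

lemma deg_lt_Union: "g \<in> carrier gr \<Longrightarrow> \<exists>n. g \<in> deg_lt n"
proof -
  assume g: "g \<in> carrier gr"
  then have "finite {n. g n \<noteq> F (Suc n)}" by (simp add: gr_simps)
  then obtain n where "\<forall>k\<in>{n. g n \<noteq> F (Suc n)}. k < n" using finite_nat_set_iff_bounded by blast
  then have "g \<in> deg_lt n" using g by (fastforce simp: deg_lt_def)
  then show ?thesis by blast
qed

lemma deg_lt_iff_cls: "g \<in> deg_lt n \<longleftrightarrow> (\<exists>\<alpha>\<in>seqs. g = cls \<alpha> \<and> (\<forall>k\<ge>n. \<alpha> k = \<zero>\<^bsub>M\<^esub>))"
proof
  assume g: "g \<in> deg_lt n"
  then obtain \<alpha> where a: "\<alpha> \<in> seqs" "g = cls \<alpha>" using carrier_gr by (auto simp: deg_lt_def)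
  define \<beta> where "\<beta> = (\<lambda>k. if k < n then \<alpha> k else \<zero>\<^bsub>M\<^esub>)"
  have "{k. \<beta> k \<noteq> \<zero>\<^bsub>M\<^esub>} \<subseteq> {..<n}" by (auto simp: \<beta>_def)
  then have "\<beta> \<in> seqs" using a(1) sub_zero[OF filt_sub] finite_subset by (auto simp: seqs_def \<beta>_def)
  moreover have "g = cls \<beta>"
  proof
    fix k
    show "g k = cls \<beta> k" using g a(2) coset_filt_zero[of k] by (auto simp: deg_lt_def cls_def \<beta>_def)
  qed
  ultimately show "\<exists>\<alpha>\<in>seqs. g = cls \<alpha> \<and> (\<forall>k\<ge>n. \<alpha> k = \<zero>\<^bsub>M\<^esub>)" by (auto simp: \<beta>_def)
next
  assume "\<exists>\<alpha>\<in>seqs. g = cls \<alpha> \<and> (\<forall>k\<ge>n. \<alpha> k = \<zero>\<^bsub>M\<^esub>)"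
  then show "g \<in> deg_lt n" using cls_closed coset_filt_zero by (auto simp: deg_lt_def cls_def)
qed

lemma hom_deg: "x \<in> F k \<Longrightarrow> hom k x \<in> deg_lt (Suc k)"
  unfolding deg_lt_iff_cls hom_def using single_seqs by (auto simp: single_def)

lemma deg_lt_add: "g \<in> deg_lt n \<Longrightarrow> h \<in> deg_lt n \<Longrightarrow> g \<oplus>\<^bsub>gr\<^esub> h \<in> deg_lt n"
proof -
  assume "g \<in> deg_lt n" "h \<in> deg_lt n"
  then obtain \<alpha> \<beta> where ab: "\<alpha> \<in> seqs" "g = cls \<alpha>" "\<forall>k\<ge>n. \<alpha> k = \<zero>\<^bsub>M\<^esub>" "\<beta> \<in> seqs" "h = cls \<beta>" "\<forall>k\<ge>n. \<beta> k = \<zero>\<^bsub>M\<^esub>"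
    unfolding deg_lt_iff_cls by blast
  have "g \<oplus>\<^bsub>gr\<^esub> h = cls (\<lambda>n. \<alpha> n \<oplus>\<^bsub>M\<^esub> \<beta> n)" unfolding ab(2,5) by (rule cls_add[OF ab(1,4)])
  moreover have "\<forall>k\<ge>n. \<alpha> k \<oplus>\<^bsub>M\<^esub> \<beta> k = \<zero>\<^bsub>M\<^esub>" using ab(3,6) by simp
  ultimately show ?thesis unfolding deg_lt_iff_cls using seqs_add[OF ab(1,4)] by blast
qed

lemma deg_lt_split:
  assumes "g \<in> deg_lt (Suc n)"
  shows "\<exists>g'\<in>deg_lt n. \<exists>x\<in>F n. g = g' \<oplus>\<^bsub>gr\<^esub> hom n x"
proof -
  obtain \<alpha> where a: "\<alpha> \<in> seqs" "g = cls \<alpha>" "\<forall>k\<ge>Suc n. \<alpha> k = \<zero>\<^bsub>M\<^esub>" using assms deg_lt_iff_cls by blast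
  define \<beta> where "\<beta> = (\<lambda>k. if k < n then \<alpha> k else \<zero>\<^bsub>M\<^esub>)"
  have "{k. \<beta> k \<noteq> \<zero>\<^bsub>M\<^esub>} \<subseteq> {..<n}" by (auto simp: \<beta>_def)
  then have b: "\<beta> \<in> seqs" using a(1) sub_zero[OF filt_sub] finite_subset by (auto simp: seqs_def \<beta>_def)
  have x: "\<alpha> n \<in> F n" using seqsD(1)[OF a(1)] .
  have "(\<lambda>k. \<beta> k \<oplus>\<^bsub>M\<^esub> single n (\<alpha> n) k) = \<alpha>"
    using a(3) seqsD(2)[OF a(1)] by (auto simp: \<beta>_def single_def fun_eq_iff not_less_eq)
  then have "g = cls \<beta> \<oplus>\<^bsub>gr\<^esub> hom n (\<alpha> n)" unfolding a(2) hom_def using cls_add[OF b single_seqs[OF x]] by simp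
  moreover have "cls \<beta> \<in> deg_lt n" using b by (auto simp: deg_lt_iff_cls \<beta>_def)
  ultimately show ?thesis using x by blast
qed

lemma gr_induct:
  assumes "g \<in> carrier gr" "P \<zero>\<^bsub>gr\<^esub>" "\<And>k x. x \<in> F k \<Longrightarrow> P (hom k x)"
    and "\<And>g h. g \<in> carrier gr \<Longrightarrow> h \<in> carrier gr \<Longrightarrow> P g \<Longrightarrow> P h \<Longrightarrow> P (g \<oplus>\<^bsub>gr\<^esub> h)"
  shows "P g"
proof -
  obtain n where "g \<in> deg_lt n" using deg_lt_Union assms(1) by blast
  then show ?thesis
  proof (induction n arbitrary: g)
    case 0 then show ?case using assms(2) deg_lt_0 by simp
  next
    case (Suc n)
    then obtain g' x where "g' \<in> deg_lt n" "x \<in> F n" "g = g' \<oplus>\<^bsub>gr\<^esub> hom n x" using deg_lt_split by blast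
    then show ?case using assms(3,4) Suc.IH hom_closed deg_lt_carrier by blast
  qed
qed

text \<open>Serves to check identities that are additive in g on homogeneous elements only.\<close>

lemma gr_induct_hom:
  assumes "g \<in> carrier gr" "\<And>k x. x \<in> F k \<Longrightarrow> P (hom k x)"
    and "\<And>g h. g \<in> carrier gr \<Longrightarrow> h \<in> carrier gr \<Longrightarrow> P g \<Longrightarrow> P h \<Longrightarrow> P (g \<oplus>\<^bsub>gr\<^esub> h)"
  shows "P g"
  using assms(1)
proof (rule gr_induct)
  show "P \<zero>\<^bsub>gr\<^esub>" using assms(2)[OF sub_zero[OF filt_sub], of 0] hom_zero by simp
qed (use assms in auto)

text \<open>The projection to degree n with values in the graded module itself: the other entries
  become F (k + 1), which is the zero coset in degree k.\<close>

definition comp :: "nat \<Rightarrow> (nat \<Rightarrow> 'c set) \<Rightarrow> nat \<Rightarrow> 'c set"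
  where "comp n g = (\<lambda>k. if k = n then g k else F (Suc k))"

lemma comp_cls: "\<alpha> \<in> seqs \<Longrightarrow> comp n (cls \<alpha>) = hom n (\<alpha> n)"
  unfolding comp_def hom_def cls_def single_def by (rule ext) (simp add: coset_filt_zero)

lemma comp_hom: "x \<in> F k \<Longrightarrow> comp n (hom k x) = (if n = k then hom k x else \<zero>\<^bsub>gr\<^esub>)"
proof -
  assume x: "x \<in> F k"
  have "comp n (hom k x) = hom n (single k x n)" unfolding hom_def[of k x] by (rule comp_cls[OF single_seqs[OF x]])
  then show ?thesis by (simp add: single_def hom_zero)
qed

lemma comp_add: "g \<in> carrier gr \<Longrightarrow> h \<in> carrier gr \<Longrightarrow> comp n (g \<oplus>\<^bsub>gr\<^esub> h) = comp n g \<oplus>\<^bsub>gr\<^esub> comp n h"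
proof -
  assume "g \<in> carrier gr" "h \<in> carrier gr"
  then obtain \<alpha> \<beta> where ab: "\<alpha> \<in> seqs" "g = cls \<alpha>" "\<beta> \<in> seqs" "h = cls \<beta>" using carrier_gr by blast
  show ?thesis
    unfolding ab(2,4) cls_add[OF ab(1,3)] comp_cls[OF seqs_add[OF ab(1,3)]] comp_cls[OF ab(1)] comp_cls[OF ab(3)]
    using hom_add[OF seqsD(1)[OF ab(1)] seqsD(1)[OF ab(3)]] by simp
qed

lemma comp_is_hom: "g \<in> carrier gr \<Longrightarrow> \<exists>x\<in>F n. comp n g = hom n x"
proof -
  assume "g \<in> carrier gr"
  then obtain \<alpha> where a: "\<alpha> \<in> seqs" "g = cls \<alpha>" using carrier_gr by blast
  show ?thesis unfolding a(2) comp_cls[OF a(1)] using seqsD(1)[OF a(1)] by blast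
qed

lemma comp_zero: "comp n \<zero>\<^bsub>gr\<^esub> = \<zero>\<^bsub>gr\<^esub>"
  by (auto simp: comp_def gr_simps)

lemma comp_deg_lt: "g \<in> deg_lt n \<Longrightarrow> n \<le> k \<Longrightarrow> comp k g = \<zero>\<^bsub>gr\<^esub>"
  unfolding gr_simps(2) comp_def deg_lt_def by (rule ext) simp

lemma deg_lt_comp:
  assumes "g \<in> deg_lt (Suc n)"
  shows "\<exists>g'\<in>deg_lt n. g = g' \<oplus>\<^bsub>gr\<^esub> comp n g"
proof -
  obtain g' x where g: "g' \<in> deg_lt n" "x \<in> F n" "g = g' \<oplus>\<^bsub>gr\<^esub> hom n x" using deg_lt_split[OF assms] by blast
  have c: "g' \<in> carrier gr" "hom n x \<in> carrier gr" using g hom_closed deg_lt_carrier by auto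
  have "comp n g = \<zero>\<^bsub>gr\<^esub> \<oplus>\<^bsub>gr\<^esub> hom n x"
    unfolding g(3) comp_add[OF c] comp_deg_lt[OF g(1) order_refl] comp_hom[OF g(2)] by simp
  then have "comp n g = hom n x"
    using c(2) abelian_monoid.l_zero[OF abelian_group.axioms(1)[OF gr_abelian_group]] by simp
  then show ?thesis using g by auto
qed

end

section \<open>The graded ring and its action on the graded module\<close>

lemma regular_module_simps [simp]:
  "carrier (regular_module R) = carrier R" "zero (regular_module R) = zero R"
  "add (regular_module R) = add R" "smult (regular_module R) = mult R"
  by (simp_all add: regular_module_def)

lemma a_r_coset_regular_module: "N +>\<^bsub>regular_module R\<^esub> x = N +>\<^bsub>R\<^esub> x"
  by (simp add: a_r_coset_def')

lemma a_inv_regular_module: "\<ominus>\<^bsub>regular_module R\<^esub> x = \<ominus>\<^bsub>R\<^esub> x"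
  by (simp add: a_inv_def m_inv_def)

lemma (in cring) module_regular_module: "module R (regular_module R)"
proof (rule moduleI)
  show "cring R" by (rule is_cring)
  show "abelian_group (regular_module R)"
    by (rule abelian_groupI) (auto simp: a_ac intro: l_neg)
qed (simp_all add: l_distr r_distr m_assoc)

lemma (in cring) submodule_regular_module:
  "ideal I R \<Longrightarrow> submodule I R (regular_module R)"
proof -
  assume I: "ideal I R"
  interpret reg: module R "regular_module R" by (rule module_regular_module)
  note Id = idealD[OF I]
  show ?thesis
  proof (rule reg.submoduleI)
    fix a assume a: "a \<in> I"
    show "\<ominus>\<^bsub>regular_module R\<^esub> a \<in> I" using Id(4)[OF a] by (simp add: a_inv_regular_module)
  qed (use Id in auto)
qed

text \<open>The powers of \<open>\<qq>\<close> are replaced by any multiplicative filtration Q by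
  ideals, so that the locale also applies to Q acting on itself
  (\<open>graded_action_regular\<close>). The ring laws of the graded ring are then instances of the
  laws for the graded module.\<close>

locale graded_action = filtration +
  fixes Q :: "nat \<Rightarrow> 'a set"
  assumes Q_ideal: "ideal (Q n) R" and Q_Suc: "Q (Suc n) \<subseteq> Q n"
    and Q_zero: "Q 0 = carrier R"
    and Q_mult: "a \<in> Q i \<Longrightarrow> b \<in> Q j \<Longrightarrow> a \<otimes>\<^bsub>R\<^esub> b \<in> Q (i + j)"
    and Q_smult: "a \<in> Q i \<Longrightarrow> x \<in> F j \<Longrightarrow> a \<odot>\<^bsub>M\<^esub> x \<in> F (i + j)"

sublocale graded_action \<subseteq> QQ: filtration R "regular_module R" Q
  by (intro filtration.intro filtration_axioms.intro R.module_regular_module R.submodule_regular_module Q_ideal Q_Suc)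

context graded_action
begin

lemma Q_carrier: "a \<in> Q i \<Longrightarrow> a \<in> carrier R"
  using ideal_carrier[OF Q_ideal] .

lemma QQ_seqsD: "p \<in> QQ.seqs \<Longrightarrow> p n \<in> Q n" "p \<in> QQ.seqs \<Longrightarrow> p n \<in> carrier R"
  using QQ.seqsD by auto

definition conv :: "(nat \<Rightarrow> 'a) \<Rightarrow> (nat \<Rightarrow> 'c) \<Rightarrow> nat \<Rightarrow> 'c"
  where "conv p \<alpha> n = (\<Oplus>\<^bsub>M\<^esub> i \<in> {..n}. p i \<odot>\<^bsub>M\<^esub> \<alpha> (n - i))"

lemma finsum_filt:
  "finite A \<Longrightarrow> (\<And>i. i \<in> A \<Longrightarrow> f i \<in> F n) \<Longrightarrow> (\<Oplus>\<^bsub>M\<^esub> i \<in> A. f i) \<in> F n"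
proof (induction A rule: finite_induct)
  case empty then show ?case using sub_zero[OF filt_sub] by simp
next
  case (insert a A)
  then have "f \<in> A \<rightarrow> carrier M" "f a \<in> carrier M" using filt_carrier by auto
  then show ?case using insert sub_add[OF filt_sub] by simp
qed

lemma conv_term: "p \<in> QQ.seqs \<Longrightarrow> \<alpha> \<in> seqs \<Longrightarrow> i \<le> n \<Longrightarrow> p i \<odot>\<^bsub>M\<^esub> \<alpha> (n - i) \<in> F n"
  using Q_smult[of "p i" i "\<alpha> (n - i)" "n - i"] QQ_seqsD(1) seqsD(1) by simp

lemma conv_seqs:
  assumes "p \<in> QQ.seqs" "\<alpha> \<in> seqs"
  shows "conv p \<alpha> \<in> seqs"
proof -
  have "conv p \<alpha> n \<in> F n" for n
    unfolding conv_def by (rule finsum_filt) (use conv_term[OF assms] in auto)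
  moreover have "{n. conv p \<alpha> n \<noteq> \<zero>\<^bsub>M\<^esub>} \<subseteq> (\<lambda>(i, j). i + j) ` ({n. p n \<noteq> \<zero>\<^bsub>R\<^esub>} \<times> {n. \<alpha> n \<noteq> \<zero>\<^bsub>M\<^esub>})"
  proof
    fix n assume n: "n \<in> {n. conv p \<alpha> n \<noteq> \<zero>\<^bsub>M\<^esub>}"
    have "\<exists>i\<le>n. p i \<noteq> \<zero>\<^bsub>R\<^esub> \<and> \<alpha> (n - i) \<noteq> \<zero>\<^bsub>M\<^esub>"
    proof (rule ccontr)
      assume "\<not> ?thesis"
      then have "p i \<odot>\<^bsub>M\<^esub> \<alpha> (n - i) = \<zero>\<^bsub>M\<^esub>" if "i \<le> n" for i
        using that seqsD(2)[OF assms(2)] QQ_seqsD(2)[OF assms(1)]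
        by (cases "p i = \<zero>\<^bsub>R\<^esub>") auto
      then have "conv p \<alpha> n = (\<Oplus>\<^bsub>M\<^esub> i \<in> {..n}. \<zero>\<^bsub>M\<^esub>)"
        unfolding conv_def by (intro M.finsum_cong') auto
      then show False using n by simp
    qed
    then show "n \<in> (\<lambda>(i, j). i + j) ` ({n. p n \<noteq> \<zero>\<^bsub>R\<^esub>} \<times> {n. \<alpha> n \<noteq> \<zero>\<^bsub>M\<^esub>})"
      by (auto intro!: image_eqI[of _ _ "(_, n - _)"])
  qed
  moreover have "finite {n. p n \<noteq> \<zero>\<^bsub>R\<^esub>}" "finite {n. \<alpha> n \<noteq> \<zero>\<^bsub>M\<^esub>}"
    using assms by (auto simp: seqs_def QQ.seqs_def)
  ultimately show ?thesis unfolding seqs_def by (auto intro: finite_subset)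
qed

lemma finsum_gr_component:
  assumes "finite A" "\<And>i. i \<in> A \<Longrightarrow> f i \<in> F n"
  shows "(\<Oplus>\<^bsub>gr_component M F n\<^esub> i \<in> A. F (Suc n) +>\<^bsub>M\<^esub> f i) = F (Suc n) +>\<^bsub>M\<^esub> (\<Oplus>\<^bsub>M\<^esub> i \<in> A. f i)"
  using assms
proof (induction A rule: finite_induct)
  case empty
  interpret C: module R "gr_component M F n" by (rule module_gr_component[OF filt_sub filt_sub])
  show ?case using coset_filt_zero by (simp add: gr_component_simps)
next
  case (insert a A)
  interpret C: module R "gr_component M F n" by (rule module_gr_component[OF filt_sub filt_sub])
  have c: "f \<in> A \<rightarrow> carrier M" "f a \<in> carrier M" using insert.prems filt_carrier by auto
  then have c: "f \<in> A \<rightarrow> carrier M" "f a \<in> carrier M" "(\<Oplus>\<^bsub>M\<^esub> i \<in> A. f i) \<in> carrier M"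
    using M.finsum_closed[of f A] by auto
  have "(\<lambda>i. F (Suc n) +>\<^bsub>M\<^esub> f i) \<in> A \<rightarrow> carrier (gr_component M F n)"
    "F (Suc n) +>\<^bsub>M\<^esub> f a \<in> carrier (gr_component M F n)"
    using insert.prems by (auto simp: gr_component_simps)
  then have "(\<Oplus>\<^bsub>gr_component M F n\<^esub> i \<in> insert a A. F (Suc n) +>\<^bsub>M\<^esub> f i)
      = (F (Suc n) +>\<^bsub>M\<^esub> f a) <+>\<^bsub>M\<^esub> (F (Suc n) +>\<^bsub>M\<^esub> (\<Oplus>\<^bsub>M\<^esub> i \<in> A. f i))"
    using insert by (simp add: gr_component_simps(3))
  then show ?case using insert c coset_add[OF filt_sub c(2,3)] by simp
qed

lemma smult_cls:
  assumes "p \<in> QQ.seqs" "\<alpha> \<in> seqs"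
  shows "QQ.cls p \<odot>\<^bsub>gr\<^esub> cls \<alpha> = cls (conv p \<alpha>)"
proof
  fix n
  have "(\<Union>a\<in>QQ.cls p i. \<Union>x\<in>cls \<alpha> (n - i). F (Suc n) +>\<^bsub>M\<^esub> (a \<odot>\<^bsub>M\<^esub> x)) = F (Suc n) +>\<^bsub>M\<^esub> (p i \<odot>\<^bsub>M\<^esub> \<alpha> (n - i))"
    if i: "i \<le> n" for i
  proof -
    have pc: "p i \<in> carrier R" "p i \<in> Q i" and ac: "\<alpha> (n - i) \<in> carrier M" "\<alpha> (n - i) \<in> F (n - i)"
      using QQ_seqsD[OF assms(1)] seqsD[OF assms(2)] by auto
    have "F (Suc n) +>\<^bsub>M\<^esub> (a \<odot>\<^bsub>M\<^esub> x) = F (Suc n) +>\<^bsub>M\<^esub> (p i \<odot>\<^bsub>M\<^esub> \<alpha> (n - i))"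
      if a: "a \<in> QQ.cls p i" and x: "x \<in> cls \<alpha> (n - i)" for a x
    proof -
      obtain q where q: "q \<in> Q (Suc i)" "a = q \<oplus>\<^bsub>R\<^esub> p i"
        using a by (auto simp: QQ.cls_def a_r_coset_regular_module a_r_coset_def')
      obtain y where y: "y \<in> F (Suc (n - i))" "x = y \<oplus>\<^bsub>M\<^esub> \<alpha> (n - i)"
        using x by (auto simp: cls_def coset_mem)
      have qc: "q \<in> carrier R" and yc: "y \<in> carrier M" "y \<in> F (n - i)"
        using q y Q_carrier filt_carrier subsetD[OF filt_Suc y(1)] by auto
      \<comment> \<open>Changing both representatives adds three terms, each with a factor one step
        further down in its filtration; so all three lie in \<open>F (Suc n)\<close> and the coset
        stays the same.\<close>
      have e: "a \<odot>\<^bsub>M\<^esub> x = (q \<odot>\<^bsub>M\<^esub> y \<oplus>\<^bsub>M\<^esub> (q \<odot>\<^bsub>M\<^esub> \<alpha> (n - i) \<oplus>\<^bsub>M\<^esub> p i \<odot>\<^bsub>M\<^esub> y)) \<oplus>\<^bsub>M\<^esub> p i \<odot>\<^bsub>M\<^esub> \<alpha> (n - i)"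
        unfolding q(2) y(2) using qc yc pc ac by (simp add: smult_l_distr smult_r_distr M.a_ac)
      have "q \<odot>\<^bsub>M\<^esub> y \<in> F (Suc n)" "q \<odot>\<^bsub>M\<^esub> \<alpha> (n - i) \<in> F (Suc n)" "p i \<odot>\<^bsub>M\<^esub> y \<in> F (Suc n)"
        using Q_smult[OF q(1) yc(2)] Q_smult[OF q(1) ac(2)] Q_smult[OF pc(2) y(1)] i by auto
      then have "q \<odot>\<^bsub>M\<^esub> y \<oplus>\<^bsub>M\<^esub> (q \<odot>\<^bsub>M\<^esub> \<alpha> (n - i) \<oplus>\<^bsub>M\<^esub> p i \<odot>\<^bsub>M\<^esub> y) \<in> F (Suc n)"
        using sub_add[OF filt_sub] by simp
      then show ?thesis
        unfolding e using coset_eq_iff[OF filt_sub] qc yc pc ac by (simp add: add_minus_cancel)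
    qed
    moreover have "p i \<in> QQ.cls p i" using QQ.coset_self[OF QQ.filt_sub, of "p i" "Suc i"] pc by (simp add: QQ.cls_def)
    moreover have "\<alpha> (n - i) \<in> cls \<alpha> (n - i)" using coset_self[OF filt_sub ac(1)] by (simp add: cls_def)
    ultimately show ?thesis by blast
  qed
  then have "(\<Oplus>\<^bsub>gr_component M F n\<^esub> i \<in> {..n}. \<Union>a\<in>QQ.cls p i. \<Union>x\<in>cls \<alpha> (n - i). F (Suc n) +>\<^bsub>M\<^esub> (a \<odot>\<^bsub>M\<^esub> x))
    = (\<Oplus>\<^bsub>gr_component M F n\<^esub> i \<in> {..n}. F (Suc n) +>\<^bsub>M\<^esub> (p i \<odot>\<^bsub>M\<^esub> \<alpha> (n - i)))"
  proof -
    interpret C: module R "gr_component M F n" by (rule module_gr_component[OF filt_sub filt_sub])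
    assume e: "\<And>i. i \<le> n \<Longrightarrow> (\<Union>a\<in>QQ.cls p i. \<Union>x\<in>cls \<alpha> (n - i). F (Suc n) +>\<^bsub>M\<^esub> (a \<odot>\<^bsub>M\<^esub> x)) =
      F (Suc n) +>\<^bsub>M\<^esub> (p i \<odot>\<^bsub>M\<^esub> \<alpha> (n - i))"
    show ?thesis
      by (rule C.M.finsum_cong') (use e conv_term[OF assms] in \<open>auto simp: gr_component_simps\<close>)
  qed
  also have "\<dots> = F (Suc n) +>\<^bsub>M\<^esub> conv p \<alpha> n"
    unfolding conv_def by (rule finsum_gr_component) (use conv_term[OF assms] in auto)
  finally show "(QQ.cls p \<odot>\<^bsub>gr\<^esub> cls \<alpha>) n = cls (conv p \<alpha>) n"
    by (simp add: gr_module_def cls_def)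
qed

lemma conv_single:
  assumes "a \<in> Q i" "x \<in> F j"
  shows "conv (QQ.single i a) (single j x) = single (i + j) (a \<odot>\<^bsub>M\<^esub> x)"
proof
  fix n
  have c: "a \<in> carrier R" "x \<in> carrier M" using assms Q_carrier filt_carrier by auto
  show "conv (QQ.single i a) (single j x) n = single (i + j) (a \<odot>\<^bsub>M\<^esub> x) n"
  proof (cases "n = i + j")
    case True
    have "conv (QQ.single i a) (single j x) n = (\<Oplus>\<^bsub>M\<^esub> l \<in> {..n}. if i = l then a \<odot>\<^bsub>M\<^esub> x else \<zero>\<^bsub>M\<^esub>)"
      unfolding conv_def by (rule M.finsum_cong') (use c True in \<open>auto simp: QQ.single_def single_def\<close>)
    also have "\<dots> = a \<odot>\<^bsub>M\<^esub> x" using M.finsum_singleton[of i "{..n}" "\<lambda>_. a \<odot>\<^bsub>M\<^esub> x"] c True by simp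
    finally show ?thesis using True by (simp add: single_def)
  next
    case False
    have "conv (QQ.single i a) (single j x) n = (\<Oplus>\<^bsub>M\<^esub> l \<in> {..n}. \<zero>\<^bsub>M\<^esub>)"
      unfolding conv_def by (rule M.finsum_cong') (use c False in \<open>auto simp: QQ.single_def single_def\<close>)
    then show ?thesis using False by (simp add: single_def)
  qed
qed

lemma hom_smult: "a \<in> Q i \<Longrightarrow> x \<in> F j \<Longrightarrow> QQ.hom i a \<odot>\<^bsub>gr\<^esub> hom j x = hom (i + j) (a \<odot>\<^bsub>M\<^esub> x)"
  unfolding hom_def QQ.hom_def by (simp add: smult_cls QQ.single_seqs single_seqs conv_single)

lemma gr_smult_closed: "f \<in> carrier QQ.gr \<Longrightarrow> g \<in> carrier gr \<Longrightarrow> f \<odot>\<^bsub>gr\<^esub> g \<in> carrier gr"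
  using QQ.carrier_gr carrier_gr smult_cls cls_closed conv_seqs by auto

lemma gr_smult_r_distr:
  assumes "f \<in> carrier QQ.gr" "g \<in> carrier gr" "h \<in> carrier gr"
  shows "f \<odot>\<^bsub>gr\<^esub> (g \<oplus>\<^bsub>gr\<^esub> h) = f \<odot>\<^bsub>gr\<^esub> g \<oplus>\<^bsub>gr\<^esub> f \<odot>\<^bsub>gr\<^esub> h"
proof -
  obtain p \<alpha> \<beta> where s: "p \<in> QQ.seqs" "f = QQ.cls p" "\<alpha> \<in> seqs" "g = cls \<alpha>" "\<beta> \<in> seqs" "h = cls \<beta>"
    using assms QQ.carrier_gr carrier_gr by blast
  have "conv p (\<lambda>n. \<alpha> n \<oplus>\<^bsub>M\<^esub> \<beta> n) n = conv p \<alpha> n \<oplus>\<^bsub>M\<^esub> conv p \<beta> n" for n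
    unfolding conv_def using QQ_seqsD(2)[OF s(1)] seqsD(2)[OF s(3)] seqsD(2)[OF s(5)]
    by (simp add: smult_r_distr M.finsum_addf)
  then have "conv p (\<lambda>n. \<alpha> n \<oplus>\<^bsub>M\<^esub> \<beta> n) = (\<lambda>n. conv p \<alpha> n \<oplus>\<^bsub>M\<^esub> conv p \<beta> n)" by blast
  then show ?thesis
    unfolding s(2,4,6) using s by (simp add: cls_add seqs_add smult_cls conv_seqs)
qed

lemma gr_smult_l_distr:
  assumes "f \<in> carrier QQ.gr" "g \<in> carrier QQ.gr" "h \<in> carrier gr"
  shows "(f \<oplus>\<^bsub>QQ.gr\<^esub> g) \<odot>\<^bsub>gr\<^esub> h = f \<odot>\<^bsub>gr\<^esub> h \<oplus>\<^bsub>gr\<^esub> g \<odot>\<^bsub>gr\<^esub> h"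
proof -
  obtain p q \<beta> where s: "p \<in> QQ.seqs" "f = QQ.cls p" "q \<in> QQ.seqs" "g = QQ.cls q" "\<beta> \<in> seqs" "h = cls \<beta>"
    using assms QQ.carrier_gr carrier_gr by blast
  have "conv (\<lambda>n. p n \<oplus>\<^bsub>R\<^esub> q n) \<beta> n = conv p \<beta> n \<oplus>\<^bsub>M\<^esub> conv q \<beta> n" for n
    unfolding conv_def using QQ_seqsD(2)[OF s(1)] QQ_seqsD(2)[OF s(3)] seqsD(2)[OF s(5)]
    by (simp add: smult_l_distr M.finsum_addf)
  then have "conv (\<lambda>n. p n \<oplus>\<^bsub>R\<^esub> q n) \<beta> = (\<lambda>n. conv p \<beta> n \<oplus>\<^bsub>M\<^esub> conv q \<beta> n)" by blast
  then show ?thesis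
    unfolding s(2,4,6) using s QQ.cls_add[OF s(1,3)] QQ.seqs_add[OF s(1,3)]
    by (simp add: cls_add smult_cls conv_seqs)
qed

end

context graded_action
begin

definition GR :: "(nat \<Rightarrow> 'a set) ring"
  where "GR = \<lparr>carrier = carrier QQ.gr, mult = smult QQ.gr, one = QQ.hom 0 \<one>\<^bsub>R\<^esub>,
    zero = zero QQ.gr, add = add QQ.gr\<rparr>"

lemma GR_simps: "carrier GR = carrier QQ.gr" "mult GR = smult QQ.gr" "one GR = QQ.hom 0 \<one>\<^bsub>R\<^esub>"
  "zero GR = zero QQ.gr" "add GR = add QQ.gr"
  by (simp_all add: GR_def)

lemma graded_action_regular: "graded_action R (regular_module R) Q Q"
proof (intro graded_action.intro graded_action_axioms.intro QQ.filtration_axioms Q_ideal Q_Suc Q_zero)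
  show "a \<otimes>\<^bsub>R\<^esub> b \<in> Q (i + j)" if "a \<in> Q i" "b \<in> Q j" for a b i j
    using that by (rule Q_mult)
  then show "a \<odot>\<^bsub>regular_module R\<^esub> b \<in> Q (i + j)" if "a \<in> Q i" "b \<in> Q j" for a b i j
    using that by simp
qed

lemma QQ_smult_closed: "f \<in> carrier QQ.gr \<Longrightarrow> g \<in> carrier QQ.gr \<Longrightarrow> f \<odot>\<^bsub>QQ.gr\<^esub> g \<in> carrier QQ.gr"
  using graded_action.gr_smult_closed[OF graded_action_regular] .

lemma QQ_smult_r_distr:
  "f \<in> carrier QQ.gr \<Longrightarrow> g \<in> carrier QQ.gr \<Longrightarrow> h \<in> carrier QQ.gr \<Longrightarrow>
    f \<odot>\<^bsub>QQ.gr\<^esub> (g \<oplus>\<^bsub>QQ.gr\<^esub> h) = f \<odot>\<^bsub>QQ.gr\<^esub> g \<oplus>\<^bsub>QQ.gr\<^esub> f \<odot>\<^bsub>QQ.gr\<^esub> h"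
  using graded_action.gr_smult_r_distr[OF graded_action_regular] .

lemma QQ_smult_l_distr:
  "f \<in> carrier QQ.gr \<Longrightarrow> g \<in> carrier QQ.gr \<Longrightarrow> h \<in> carrier QQ.gr \<Longrightarrow>
    (f \<oplus>\<^bsub>QQ.gr\<^esub> g) \<odot>\<^bsub>QQ.gr\<^esub> h = f \<odot>\<^bsub>QQ.gr\<^esub> h \<oplus>\<^bsub>QQ.gr\<^esub> g \<odot>\<^bsub>QQ.gr\<^esub> h"
  using graded_action.gr_smult_l_distr[OF graded_action_regular] .

lemma QQ_hom_smult: "a \<in> Q i \<Longrightarrow> b \<in> Q j \<Longrightarrow> QQ.hom i a \<odot>\<^bsub>QQ.gr\<^esub> QQ.hom j b = QQ.hom (i + j) (a \<otimes>\<^bsub>R\<^esub> b)"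
  using graded_action.hom_smult[OF graded_action_regular, of a i b j] by simp

text \<open>Additivity reduces h, then g, then f to homogeneous elements, for which the law is
  associativity of the action of R on M.\<close>

lemma gr_smult_assoc:
  assumes f: "f \<in> carrier QQ.gr" and g: "g \<in> carrier QQ.gr" and h: "h \<in> carrier gr"
  shows "(f \<odot>\<^bsub>QQ.gr\<^esub> g) \<odot>\<^bsub>gr\<^esub> h = f \<odot>\<^bsub>gr\<^esub> (g \<odot>\<^bsub>gr\<^esub> h)"
proof -
  have 1: "(QQ.hom i a \<odot>\<^bsub>QQ.gr\<^esub> QQ.hom j b) \<odot>\<^bsub>gr\<^esub> h = QQ.hom i a \<odot>\<^bsub>gr\<^esub> (QQ.hom j b \<odot>\<^bsub>gr\<^esub> h)"
    if a: "a \<in> Q i" and b: "b \<in> Q j" for a b i j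
    using h
  proof (rule gr_induct_hom)
    fix k x assume x: "x \<in> F k"
    show "(QQ.hom i a \<odot>\<^bsub>QQ.gr\<^esub> QQ.hom j b) \<odot>\<^bsub>gr\<^esub> hom k x = QQ.hom i a \<odot>\<^bsub>gr\<^esub> (QQ.hom j b \<odot>\<^bsub>gr\<^esub> hom k x)"
      unfolding QQ_hom_smult[OF a b] hom_smult[OF b x] hom_smult[OF Q_mult[OF a b] x] hom_smult[OF a Q_smult[OF b x]]
      using Q_carrier[OF a] Q_carrier[OF b] filt_carrier[OF x] by (simp add: smult_assoc1 add.assoc)
  next
    fix g h assume gh: "g \<in> carrier gr" "h \<in> carrier gr"
      "(QQ.hom i a \<odot>\<^bsub>QQ.gr\<^esub> QQ.hom j b) \<odot>\<^bsub>gr\<^esub> g = QQ.hom i a \<odot>\<^bsub>gr\<^esub> (QQ.hom j b \<odot>\<^bsub>gr\<^esub> g)"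
      "(QQ.hom i a \<odot>\<^bsub>QQ.gr\<^esub> QQ.hom j b) \<odot>\<^bsub>gr\<^esub> h = QQ.hom i a \<odot>\<^bsub>gr\<^esub> (QQ.hom j b \<odot>\<^bsub>gr\<^esub> h)"
    have c: "QQ.hom i a \<in> carrier QQ.gr" "QQ.hom j b \<in> carrier QQ.gr" using QQ.hom_closed a b by auto
    show "(QQ.hom i a \<odot>\<^bsub>QQ.gr\<^esub> QQ.hom j b) \<odot>\<^bsub>gr\<^esub> (g \<oplus>\<^bsub>gr\<^esub> h) = QQ.hom i a \<odot>\<^bsub>gr\<^esub> (QQ.hom j b \<odot>\<^bsub>gr\<^esub> (g \<oplus>\<^bsub>gr\<^esub> h))"
      using gh c QQ_smult_closed[OF c] gr_smult_closed by (simp add: gr_smult_r_distr)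
  qed
  have 2: "(QQ.hom i a \<odot>\<^bsub>QQ.gr\<^esub> g) \<odot>\<^bsub>gr\<^esub> h = QQ.hom i a \<odot>\<^bsub>gr\<^esub> (g \<odot>\<^bsub>gr\<^esub> h)" if a: "a \<in> Q i" for a i
    using g
  proof (rule QQ.gr_induct_hom)
    fix g g' assume gg: "g \<in> carrier QQ.gr" "g' \<in> carrier QQ.gr"
      "(QQ.hom i a \<odot>\<^bsub>QQ.gr\<^esub> g) \<odot>\<^bsub>gr\<^esub> h = QQ.hom i a \<odot>\<^bsub>gr\<^esub> (g \<odot>\<^bsub>gr\<^esub> h)"
      "(QQ.hom i a \<odot>\<^bsub>QQ.gr\<^esub> g') \<odot>\<^bsub>gr\<^esub> h = QQ.hom i a \<odot>\<^bsub>gr\<^esub> (g' \<odot>\<^bsub>gr\<^esub> h)"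
    have c: "QQ.hom i a \<in> carrier QQ.gr" using QQ.hom_closed a by auto
    show "(QQ.hom i a \<odot>\<^bsub>QQ.gr\<^esub> (g \<oplus>\<^bsub>QQ.gr\<^esub> g')) \<odot>\<^bsub>gr\<^esub> h = QQ.hom i a \<odot>\<^bsub>gr\<^esub> ((g \<oplus>\<^bsub>QQ.gr\<^esub> g') \<odot>\<^bsub>gr\<^esub> h)"
      using gg c h QQ_smult_closed[OF c] gr_smult_closed
      by (simp add: gr_smult_r_distr gr_smult_l_distr QQ_smult_r_distr)
  qed (rule 1[OF a])
  show ?thesis
    using f
  proof (rule QQ.gr_induct_hom)
    fix f f' assume ff: "f \<in> carrier QQ.gr" "f' \<in> carrier QQ.gr"
      "(f \<odot>\<^bsub>QQ.gr\<^esub> g) \<odot>\<^bsub>gr\<^esub> h = f \<odot>\<^bsub>gr\<^esub> (g \<odot>\<^bsub>gr\<^esub> h)" "(f' \<odot>\<^bsub>QQ.gr\<^esub> g) \<odot>\<^bsub>gr\<^esub> h = f' \<odot>\<^bsub>gr\<^esub> (g \<odot>\<^bsub>gr\<^esub> h)"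
    show "((f \<oplus>\<^bsub>QQ.gr\<^esub> f') \<odot>\<^bsub>QQ.gr\<^esub> g) \<odot>\<^bsub>gr\<^esub> h = (f \<oplus>\<^bsub>QQ.gr\<^esub> f') \<odot>\<^bsub>gr\<^esub> (g \<odot>\<^bsub>gr\<^esub> h)"
      using ff g h QQ_smult_closed gr_smult_closed
      by (simp add: gr_smult_l_distr QQ_smult_l_distr)
  qed (rule 2)
qed

lemma QQ_smult_comm:
  assumes f: "f \<in> carrier QQ.gr" and g: "g \<in> carrier QQ.gr"
  shows "f \<odot>\<^bsub>QQ.gr\<^esub> g = g \<odot>\<^bsub>QQ.gr\<^esub> f"
proof -
  have 1: "QQ.hom i a \<odot>\<^bsub>QQ.gr\<^esub> g = g \<odot>\<^bsub>QQ.gr\<^esub> QQ.hom i a" if a: "a \<in> Q i" for a i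
    using g
  proof (rule QQ.gr_induct_hom)
    fix j b assume b: "b \<in> Q j"
    show "QQ.hom i a \<odot>\<^bsub>QQ.gr\<^esub> QQ.hom j b = QQ.hom j b \<odot>\<^bsub>QQ.gr\<^esub> QQ.hom i a"
      unfolding QQ_hom_smult[OF a b] QQ_hom_smult[OF b a] using Q_carrier[OF a] Q_carrier[OF b]
      by (simp add: R.m_comm add.commute)
  next
    fix g h assume "g \<in> carrier QQ.gr" "h \<in> carrier QQ.gr"
      "QQ.hom i a \<odot>\<^bsub>QQ.gr\<^esub> g = g \<odot>\<^bsub>QQ.gr\<^esub> QQ.hom i a" "QQ.hom i a \<odot>\<^bsub>QQ.gr\<^esub> h = h \<odot>\<^bsub>QQ.gr\<^esub> QQ.hom i a"
    then show "QQ.hom i a \<odot>\<^bsub>QQ.gr\<^esub> (g \<oplus>\<^bsub>QQ.gr\<^esub> h) = (g \<oplus>\<^bsub>QQ.gr\<^esub> h) \<odot>\<^bsub>QQ.gr\<^esub> QQ.hom i a"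
      using QQ.hom_closed[OF a] by (simp add: QQ_smult_r_distr QQ_smult_l_distr)
  qed
  show ?thesis
    using f
  proof (rule QQ.gr_induct_hom)
    fix f f' assume "f \<in> carrier QQ.gr" "f' \<in> carrier QQ.gr"
      "f \<odot>\<^bsub>QQ.gr\<^esub> g = g \<odot>\<^bsub>QQ.gr\<^esub> f" "f' \<odot>\<^bsub>QQ.gr\<^esub> g = g \<odot>\<^bsub>QQ.gr\<^esub> f'"
    then show "(f \<oplus>\<^bsub>QQ.gr\<^esub> f') \<odot>\<^bsub>QQ.gr\<^esub> g = g \<odot>\<^bsub>QQ.gr\<^esub> (f \<oplus>\<^bsub>QQ.gr\<^esub> f')"
      using g by (simp add: QQ_smult_r_distr QQ_smult_l_distr)
  qed (rule 1)
qed

lemma one_Q: "\<one>\<^bsub>R\<^esub> \<in> Q 0"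
  using Q_zero by simp

lemma gr_smult_one: "g \<in> carrier gr \<Longrightarrow> QQ.hom 0 \<one>\<^bsub>R\<^esub> \<odot>\<^bsub>gr\<^esub> g = g"
proof (erule gr_induct_hom)
  fix k x assume x: "x \<in> F k"
  then show "QQ.hom 0 \<one>\<^bsub>R\<^esub> \<odot>\<^bsub>gr\<^esub> hom k x = hom k x"
    using hom_smult[OF one_Q x] filt_carrier by simp
next
  fix g h assume "g \<in> carrier gr" "h \<in> carrier gr" "QQ.hom 0 \<one>\<^bsub>R\<^esub> \<odot>\<^bsub>gr\<^esub> g = g" "QQ.hom 0 \<one>\<^bsub>R\<^esub> \<odot>\<^bsub>gr\<^esub> h = h"
  then show "QQ.hom 0 \<one>\<^bsub>R\<^esub> \<odot>\<^bsub>gr\<^esub> (g \<oplus>\<^bsub>gr\<^esub> h) = g \<oplus>\<^bsub>gr\<^esub> h"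
    using QQ.hom_closed[OF one_Q] by (simp add: gr_smult_r_distr)
qed

end

context graded_action
begin

lemmas QQ_smult_assoc = graded_action.gr_smult_assoc[OF graded_action_regular]
lemmas QQ_smult_one = graded_action.gr_smult_one[OF graded_action_regular]

lemma cring_GR: "cring GR"
proof (rule cringI)
  interpret A: abelian_group QQ.gr by (rule QQ.gr_abelian_group)
  show "abelian_group GR"
    by (rule abelian_groupI) (auto simp: GR_simps A.a_ac intro: A.l_neg)
  show "comm_monoid GR"
    by (rule comm_monoidI)
      (auto simp: GR_simps QQ_smult_closed QQ.hom_closed one_Q QQ_smult_assoc QQ_smult_one intro: QQ_smult_comm)
  show "(x \<oplus>\<^bsub>GR\<^esub> y) \<otimes>\<^bsub>GR\<^esub> z = x \<otimes>\<^bsub>GR\<^esub> z \<oplus>\<^bsub>GR\<^esub> y \<otimes>\<^bsub>GR\<^esub> z"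
    if "x \<in> carrier GR" "y \<in> carrier GR" "z \<in> carrier GR" for x y z
    using that by (simp add: GR_simps QQ_smult_l_distr)
qed

lemma module_GR: "module GR gr"
  by (rule moduleI[OF cring_GR gr_abelian_group])
    (simp_all add: GR_simps gr_smult_closed gr_smult_l_distr gr_smult_r_distr gr_smult_assoc gr_smult_one)

interpretation GM: module GR gr
  by (rule module_GR)

lemma hom_GR: "a \<in> Q i \<Longrightarrow> QQ.hom i a \<in> carrier GR"
  using QQ.hom_closed by (simp add: GR_simps)

lemma hom_mult_GR: "a \<in> Q i \<Longrightarrow> b \<in> Q j \<Longrightarrow> QQ.hom i a \<otimes>\<^bsub>GR\<^esub> QQ.hom j b = QQ.hom (i + j) (a \<otimes>\<^bsub>R\<^esub> b)"
  using QQ_hom_smult by (simp add: GR_simps)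

lemma hom_pow_GR:
  assumes "a \<in> Q 1"
  shows "a [^]\<^bsub>R\<^esub> d \<in> Q d" "QQ.hom 1 a [^]\<^bsub>GR\<^esub> d = QQ.hom d (a [^]\<^bsub>R\<^esub> d)"
proof -
  show p: "a [^]\<^bsub>R\<^esub> d \<in> Q d" for d :: nat
    by (induction d) (use one_Q Q_mult[OF _ assms] in auto)
  show "QQ.hom 1 a [^]\<^bsub>GR\<^esub> d = QQ.hom d (a [^]\<^bsub>R\<^esub> d)"
  proof (induction d)
    case 0 then show ?case by (simp add: GR_simps)
  next
    case (Suc d) then show ?case using hom_mult_GR[OF p[of d] assms] by simp
  qed
qed

lemma deg_smult:
  assumes "f \<in> QQ.deg_lt (Suc m)" "g \<in> deg_lt n"
  shows "f \<odot>\<^bsub>gr\<^esub> g \<in> deg_lt (m + n)"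
proof -
  obtain p where p: "p \<in> QQ.seqs" "f = QQ.cls p" "\<forall>k\<ge>Suc m. p k = \<zero>\<^bsub>R\<^esub>"
    using assms(1) unfolding QQ.deg_lt_iff_cls by auto
  obtain \<alpha> where a: "\<alpha> \<in> seqs" "g = cls \<alpha>" "\<forall>k\<ge>n. \<alpha> k = \<zero>\<^bsub>M\<^esub>"
    using assms(2) unfolding deg_lt_iff_cls by auto
  have "conv p \<alpha> k = \<zero>\<^bsub>M\<^esub>" if k: "k \<ge> m + n" for k
  proof -
    have "p i \<odot>\<^bsub>M\<^esub> \<alpha> (k - i) = \<zero>\<^bsub>M\<^esub>" if "i \<le> k" for i
    proof (cases "i \<le> m")
      case True
      then have "\<alpha> (k - i) = \<zero>\<^bsub>M\<^esub>" using a(3) k by simp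
      then show ?thesis using QQ_seqsD(2)[OF p(1)] by simp
    next
      case False
      then show ?thesis using p(3) seqsD(2)[OF a(1)] by simp
    qed
    then have "conv p \<alpha> k = (\<Oplus>\<^bsub>M\<^esub> i \<in> {..k}. \<zero>\<^bsub>M\<^esub>)" unfolding conv_def by (intro M.finsum_cong') auto
    then show ?thesis by simp
  qed
  then show ?thesis
    unfolding deg_lt_iff_cls p(2) a(2) smult_cls[OF p(1) a(1)] using conv_seqs[OF p(1) a(1)] by blast
qed

text \<open>All bounds are strict: degrees at most m - 1 and n - 1 add up to at most m + n - 2. For
  m = 0 the factor f is zero, and this case is separated because of the truncated
  subtraction.\<close>

lemma deg_smult_less: "f \<in> QQ.deg_lt m \<Longrightarrow> g \<in> deg_lt n \<Longrightarrow> f \<odot>\<^bsub>gr\<^esub> g \<in> deg_lt (m + n - 1)"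
proof (cases m)
  case 0
  assume "f \<in> QQ.deg_lt m" "g \<in> deg_lt n"
  then have "f = \<zero>\<^bsub>GR\<^esub>" "g \<in> carrier gr" using 0 QQ.deg_lt_0 deg_lt_carrier by (auto simp: GR_simps)
  then have "f \<odot>\<^bsub>gr\<^esub> g = \<zero>\<^bsub>gr\<^esub>" by simp
  then show ?thesis using deg_lt_mono[of 0 "m + n - 1"] deg_lt_0 by auto
next
  case (Suc k)
  assume "f \<in> QQ.deg_lt m" "g \<in> deg_lt n"
  then show ?thesis using deg_smult[of f k g n] Suc by simp
qed

lemma comp_smult:
  assumes "t \<in> Q d" "z \<in> carrier gr"
  shows "comp n (QQ.hom d t \<odot>\<^bsub>gr\<^esub> z) = (if d \<le> n then QQ.hom d t \<odot>\<^bsub>gr\<^esub> comp (n - d) z else \<zero>\<^bsub>gr\<^esub>)"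
  using assms(2)
proof (rule gr_induct_hom)
  have h: "QQ.hom d t \<in> carrier GR" using hom_GR assms(1) by blast
  fix k x assume x: "x \<in> F k"
  show "comp n (QQ.hom d t \<odot>\<^bsub>gr\<^esub> hom k x) = (if d \<le> n then QQ.hom d t \<odot>\<^bsub>gr\<^esub> comp (n - d) (hom k x) else \<zero>\<^bsub>gr\<^esub>)"
    unfolding hom_smult[OF assms(1) x] comp_hom[OF Q_smult[OF assms(1) x]] comp_hom[OF x]
    using h hom_smult[OF assms(1) x] by auto
next
  have h: "QQ.hom d t \<in> carrier GR" using hom_GR assms(1) by blast
  fix g g' assume g: "g \<in> carrier gr" "g' \<in> carrier gr"
    "comp n (QQ.hom d t \<odot>\<^bsub>gr\<^esub> g) = (if d \<le> n then QQ.hom d t \<odot>\<^bsub>gr\<^esub> comp (n - d) g else \<zero>\<^bsub>gr\<^esub>)"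
    "comp n (QQ.hom d t \<odot>\<^bsub>gr\<^esub> g') = (if d \<le> n then QQ.hom d t \<odot>\<^bsub>gr\<^esub> comp (n - d) g' else \<zero>\<^bsub>gr\<^esub>)"
  have cc: "comp k g \<in> carrier gr" "comp k g' \<in> carrier gr" for k
    using comp_is_hom g(1,2) hom_closed by metis+
  show "comp n (QQ.hom d t \<odot>\<^bsub>gr\<^esub> (g \<oplus>\<^bsub>gr\<^esub> g')) =
    (if d \<le> n then QQ.hom d t \<odot>\<^bsub>gr\<^esub> comp (n - d) (g \<oplus>\<^bsub>gr\<^esub> g') else \<zero>\<^bsub>gr\<^esub>)"
    using g h cc by (simp add: GM.smult_r_distr comp_add)
qed

lemma comp_closed: "g \<in> carrier gr \<Longrightarrow> comp n g \<in> carrier gr"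
  using comp_is_hom hom_closed by metis

lemma comp_deg: "g \<in> carrier gr \<Longrightarrow> comp n g \<in> deg_lt (Suc n)"
  using comp_is_hom hom_deg by metis

definition homogeneous :: "(nat \<Rightarrow> 'c set) set \<Rightarrow> bool"
  where "homogeneous K \<longleftrightarrow> (\<forall>g\<in>K. \<forall>n. comp n g \<in> K)"

lemma homogeneous_adj:
  assumes "homogeneous K" "GM.sub K" "t \<in> Q d"
  shows "homogeneous (GM.adj K (QQ.hom d t))"
  unfolding homogeneous_def
proof (intro ballI allI)
  fix g n assume "g \<in> GM.adj K (QQ.hom d t)"
  then obtain y z where yz: "y \<in> K" "z \<in> carrier gr" "g = y \<oplus>\<^bsub>gr\<^esub> QQ.hom d t \<odot>\<^bsub>gr\<^esub> z"
    by (auto simp: GM.adj_iff)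
  have h: "QQ.hom d t \<in> carrier GR" using hom_GR assms(3) by blast
  have yc: "y \<in> carrier gr" using GM.sub_carrier[OF assms(2) yz(1)] .
  have cy: "comp n y \<in> K" using assms(1) yz(1) by (auto simp: homogeneous_def)
  have e: "comp n g = comp n y \<oplus>\<^bsub>gr\<^esub> (if d \<le> n then QQ.hom d t \<odot>\<^bsub>gr\<^esub> comp (n - d) z else \<zero>\<^bsub>gr\<^esub>)"
    unfolding yz(3) using comp_add[OF yc] h yz(2) comp_smult[OF assms(3) yz(2)] by simp
  show "comp n g \<in> GM.adj K (QQ.hom d t)"
  proof (cases "d \<le> n")
    case True
    then show ?thesis using e cy comp_closed[OF yz(2)] by (auto simp: GM.adj_iff)
  next
    case False
    then have "comp n g = comp n y \<oplus>\<^bsub>gr\<^esub> QQ.hom d t \<odot>\<^bsub>gr\<^esub> \<zero>\<^bsub>gr\<^esub>" using e h by simp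
    then show ?thesis using cy GM.adj_iff by blast
  qed
qed

lemma homogeneous_zero: "homogeneous {\<zero>\<^bsub>gr\<^esub>}"
  by (simp add: homogeneous_def comp_zero)

lemma mem_by_comps:
  assumes "GM.sub K" "g \<in> carrier gr" "\<And>n. comp n g \<in> K"
  shows "g \<in> K"
proof -
  obtain n where "g \<in> deg_lt n" using deg_lt_Union assms(2) by blast
  then show ?thesis using assms(2,3)
  proof (induction n arbitrary: g)
    case 0 then show ?case using deg_lt_0 GM.sub_zero[OF assms(1)] by auto
  next
    case (Suc n)
    obtain g' where g': "g' \<in> deg_lt n" "g = g' \<oplus>\<^bsub>gr\<^esub> comp n g" using deg_lt_comp[OF Suc.prems(1)] by blast
    have g'c: "g' \<in> carrier gr" using g'(1) deg_lt_carrier by blast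
    have "comp k g' \<in> K" for k
    proof (cases "k < n")
      case True
      obtain x where x: "x \<in> F n" "comp n g = hom n x" using comp_is_hom[OF Suc.prems(2)] by blast
      have "comp k g = comp k g' \<oplus>\<^bsub>gr\<^esub> comp k (hom n x)"
        using g'(2) x(2) comp_add[OF g'c hom_closed[OF x(1)], of k] by simp
      also have "comp k (hom n x) = \<zero>\<^bsub>gr\<^esub>" using comp_hom[OF x(1), of k] True by simp
      finally have "comp k g = comp k g'" using comp_closed[OF g'c] by simp
      then show ?thesis using Suc.prems(3)[of k] by simp
    next
      case False
      then show ?thesis using comp_deg_lt[OF g'(1), of k] GM.sub_zero[OF assms(1)] by simp
    qed
    then have "g' \<in> K" using Suc.IH[OF g'(1) g'c] by blast
    then show ?case using GM.sub_add[OF assms(1) _ Suc.prems(3)[of n]] g'(2) by metis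
  qed
qed

text \<open>With a homogeneous submodule and a homogeneous multiplier, membership of u is decided
  component by component.\<close>

lemma regular_mod_homogeneous:
  assumes "homogeneous K" "GM.sub K" "t \<in> Q d"
    and "\<And>n x. x \<in> F n \<Longrightarrow> hom (d + n) (t \<odot>\<^bsub>M\<^esub> x) \<in> K \<Longrightarrow> hom n x \<in> K"
  shows "GM.regular_mod K (QQ.hom d t)"
  unfolding GM.regular_mod_def
proof (intro ballI impI)
  fix u assume u: "u \<in> carrier gr" "QQ.hom d t \<odot>\<^bsub>gr\<^esub> u \<in> K"
  show "u \<in> K"
  proof (rule mem_by_comps[OF assms(2) u(1)])
    fix n
    obtain x where x: "x \<in> F n" "comp n u = hom n x" using comp_is_hom[OF u(1)] by blast
    have "comp (d + n) (QQ.hom d t \<odot>\<^bsub>gr\<^esub> u) = QQ.hom d t \<odot>\<^bsub>gr\<^esub> comp n u"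
      using comp_smult[OF assms(3) u(1), of "d + n"] by simp
    then have "hom (d + n) (t \<odot>\<^bsub>M\<^esub> x) \<in> K"
      using assms(1) u(2) x(2) hom_smult[OF assms(3) x(1)] unfolding homogeneous_def by metis
    then show "comp n u \<in> K" using assms(4)[OF x(1)] x(2) by simp
  qed
qed

end

section \<open>Powers of the members of a regular sequence\<close>

context module
begin

lemma sum_eq_diff_eq:
  assumes "a \<in> carrier M" "b \<in> carrier M" "c \<in> carrier M" "d \<in> carrier M" "a \<oplus>\<^bsub>M\<^esub> b = c \<oplus>\<^bsub>M\<^esub> d"
  shows "b \<ominus>\<^bsub>M\<^esub> d = c \<ominus>\<^bsub>M\<^esub> a"
proof -
  have "b \<ominus>\<^bsub>M\<^esub> d = ((a \<oplus>\<^bsub>M\<^esub> b) \<ominus>\<^bsub>M\<^esub> a) \<ominus>\<^bsub>M\<^esub> d" using assms(1,2) by (simp add: add_minus_cancel)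
  also have "\<dots> = ((c \<oplus>\<^bsub>M\<^esub> d) \<ominus>\<^bsub>M\<^esub> d) \<ominus>\<^bsub>M\<^esub> a"
    unfolding assms(5) a_minus_def using assms(1,3,4) by (simp add: M.a_ac)
  also have "\<dots> = c \<ominus>\<^bsub>M\<^esub> a" using assms(3,4) by (simp add: add_minus_cancel)
  finally show ?thesis .
qed

text \<open>By \<open>regular_swap\<close>, x stays regular modulo N + y M for the head y of the
  rest, so the induction hypothesis for the shorter list applies there. What remains is that y is
  regular modulo N + x^k M for every k.\<close>

lemma regular_seq_mod_head_pow:
  assumes "sub N" "x \<in> carrier R" "regular_mod N x" "regular_seq_mod (adj N x) ys" "set ys \<subseteq> carrier R"
  shows "regular_seq_mod (adj N (x [^]\<^bsub>R\<^esub> Suc d)) ys"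
  using assms
proof (induction ys arbitrary: N)
  case Nil then show ?case by simp
next
  case (Cons y ys)
  have y: "y \<in> carrier R" "set ys \<subseteq> carrier R" using Cons.prems(5) by auto
  have ry: "regular_mod (adj N x) y" and rys: "regular_seq_mod (adj (adj N x) y) ys" using Cons.prems(4) by auto
  have yx: "regular_mod (adj N y) x" by (rule regular_swap[OF Cons.prems(1,2) y(1) Cons.prems(3) ry])
  have xc: "x [^]\<^bsub>R\<^esub> k \<in> carrier R" for k :: nat using Cons.prems(2) by simp
  have "regular_seq_mod (adj (adj N y) x) ys" using rys adj_swap[OF Cons.prems(1,2) y(1)] by simp
  then have 1: "regular_seq_mod (adj (adj N (x [^]\<^bsub>R\<^esub> Suc d)) y) ys"
    using Cons.IH[OF sub_adj[OF Cons.prems(1) y(1)] Cons.prems(2) yx _ y(2)] adj_swap[OF Cons.prems(1) y(1) xc[of "Suc d"]]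
    by simp
  \<comment> \<open>If y u lies in N + x^(k+1) M, then regularity modulo N + x M gives u = n' + x v,
    and cancelling x puts y v into N + x^k M; now the induction hypothesis applies to v.\<close>
  have 2: "regular_mod (adj N (x [^]\<^bsub>R\<^esub> k)) y" for k :: nat
  proof (induction k)
    case 0
    have "u \<in> adj N \<one>" if u: "u \<in> carrier M" for u
      using adj_scale[OF Cons.prems(1) R.one_closed u] u by simp
    then show ?case by (simp add: regular_mod_def)
  next
    case (Suc k)
    show ?case unfolding regular_mod_def
    proof (intro ballI impI)
      fix u assume u: "u \<in> carrier M" "y \<odot>\<^bsub>M\<^esub> u \<in> adj N (x [^]\<^bsub>R\<^esub> Suc k)"
      then obtain n m where nm: "n \<in> N" "m \<in> carrier M" "y \<odot>\<^bsub>M\<^esub> u = n \<oplus>\<^bsub>M\<^esub> x [^]\<^bsub>R\<^esub> Suc k \<odot>\<^bsub>M\<^esub> m"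
        by (auto simp: adj_iff)
      have nc: "n \<in> carrier M" using sub_carrier[OF Cons.prems(1) nm(1)] .
      have pw: "x [^]\<^bsub>R\<^esub> Suc k \<odot>\<^bsub>M\<^esub> w = x \<odot>\<^bsub>M\<^esub> (x [^]\<^bsub>R\<^esub> k \<odot>\<^bsub>M\<^esub> w)" if "w \<in> carrier M" for w
        using that Cons.prems(2) xc[of k] smult_assoc1[of "x [^]\<^bsub>R\<^esub> k" x w] smult_swap[of x "x [^]\<^bsub>R\<^esub> k" w] by simp
      have "y \<odot>\<^bsub>M\<^esub> u \<in> adj N x" unfolding nm(3) pw[OF nm(2)] adj_iff using nm xc[of k] by (metis smult_closed)
      then have "u \<in> adj N x" using ry u(1) by (simp add: regular_mod_def)
      then obtain n' v where v: "n' \<in> N" "v \<in> carrier M" "u = n' \<oplus>\<^bsub>M\<^esub> x \<odot>\<^bsub>M\<^esub> v" by (auto simp: adj_iff)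
      have n'c: "n' \<in> carrier M" using sub_carrier[OF Cons.prems(1) v(1)] .
      have "y \<odot>\<^bsub>M\<^esub> n' \<oplus>\<^bsub>M\<^esub> x \<odot>\<^bsub>M\<^esub> (y \<odot>\<^bsub>M\<^esub> v) = n \<oplus>\<^bsub>M\<^esub> x \<odot>\<^bsub>M\<^esub> (x [^]\<^bsub>R\<^esub> k \<odot>\<^bsub>M\<^esub> m)"
        using nm(3) unfolding v(3) pw[OF nm(2)] using v(2) n'c y(1) Cons.prems(2) smult_swap[of x y v]
        by (simp add: smult_r_distr)
      then have "x \<odot>\<^bsub>M\<^esub> (y \<odot>\<^bsub>M\<^esub> v) \<ominus>\<^bsub>M\<^esub> x \<odot>\<^bsub>M\<^esub> (x [^]\<^bsub>R\<^esub> k \<odot>\<^bsub>M\<^esub> m) = n \<ominus>\<^bsub>M\<^esub> y \<odot>\<^bsub>M\<^esub> n'"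
        by (rule sum_eq_diff_eq[rotated -1]) (use v(2) n'c y(1) Cons.prems(2) nm(2) nc xc[of k] in auto)
      then have "x \<odot>\<^bsub>M\<^esub> (y \<odot>\<^bsub>M\<^esub> v \<ominus>\<^bsub>M\<^esub> x [^]\<^bsub>R\<^esub> k \<odot>\<^bsub>M\<^esub> m) \<in> N"
        using sub_minus[OF Cons.prems(1) nm(1) sub_smult[OF Cons.prems(1) y(1) v(1)]]
          v(2) y(1) Cons.prems(2) nm(2) xc[of k] by (simp add: smult_minus)
      then have "y \<odot>\<^bsub>M\<^esub> v \<ominus>\<^bsub>M\<^esub> x [^]\<^bsub>R\<^esub> k \<odot>\<^bsub>M\<^esub> m \<in> N"
        using Cons.prems(3) v(2) y(1) nm(2) xc[of k] by (simp add: regular_mod_def)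
      then have "(y \<odot>\<^bsub>M\<^esub> v \<ominus>\<^bsub>M\<^esub> x [^]\<^bsub>R\<^esub> k \<odot>\<^bsub>M\<^esub> m) \<oplus>\<^bsub>M\<^esub> x [^]\<^bsub>R\<^esub> k \<odot>\<^bsub>M\<^esub> m \<in> adj N (x [^]\<^bsub>R\<^esub> k)"
        unfolding adj_iff using nm(2) by blast
      then have "y \<odot>\<^bsub>M\<^esub> v \<in> adj N (x [^]\<^bsub>R\<^esub> k)" using v(2) y(1) nm(2) xc[of k] by (simp add: add_minus_cancel)
      then have "v \<in> adj N (x [^]\<^bsub>R\<^esub> k)" using Suc v(2) by (simp add: regular_mod_def)
      then obtain n'' w where w: "n'' \<in> N" "w \<in> carrier M" "v = n'' \<oplus>\<^bsub>M\<^esub> x [^]\<^bsub>R\<^esub> k \<odot>\<^bsub>M\<^esub> w" by (auto simp: adj_iff)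
      have n''c: "n'' \<in> carrier M" using sub_carrier[OF Cons.prems(1) w(1)] .
      have "u = (n' \<oplus>\<^bsub>M\<^esub> x \<odot>\<^bsub>M\<^esub> n'') \<oplus>\<^bsub>M\<^esub> x [^]\<^bsub>R\<^esub> Suc k \<odot>\<^bsub>M\<^esub> w"
        unfolding v(3) w(3) pw[OF w(2)] using w n'c n''c xc[of k] Cons.prems(2) by (simp add: smult_r_distr M.a_assoc)
      moreover have "n' \<oplus>\<^bsub>M\<^esub> x \<odot>\<^bsub>M\<^esub> n'' \<in> N"
        using sub_add[OF Cons.prems(1) v(1) sub_smult[OF Cons.prems(1,2) w(1)]] .
      ultimately show "u \<in> adj N (x [^]\<^bsub>R\<^esub> Suc k)" unfolding adj_iff using w(2) by blast
    qed
  qed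
  show ?case using 1 2[of "Suc d"] by simp
qed

lemma regular_seq_mod_pows:
  assumes "sub N" "regular_seq_mod N (map x bs)" "\<And>b. b \<in> set bs \<Longrightarrow> x b \<in> carrier R"
    and "\<And>b. b \<in> set bs \<Longrightarrow> 0 < d b"
  shows "regular_seq_mod N (map (\<lambda>b. x b [^]\<^bsub>R\<^esub> (d b :: nat)) bs)"
  using assms
proof (induction bs arbitrary: N)
  case Nil then show ?case by simp
next
  case (Cons b bs)
  let ?x = "x b" and ?p = "x b [^]\<^bsub>R\<^esub> d b"
  have x: "?x \<in> carrier R" "set (map x bs) \<subseteq> carrier R" "regular_mod N ?x" "regular_seq_mod (adj N ?x) (map x bs)"
    using Cons.prems by auto
  have d: "d b = Suc (d b - 1)" using Cons.prems(4) by simp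
  have "regular_seq_mod (adj N ?p) (map x bs)"
    using regular_seq_mod_head_pow[OF Cons.prems(1) x(1,3,4,2), of "d b - 1"] d by simp
  moreover have "sub (adj N ?p)" using sub_adj[OF Cons.prems(1)] x(1) by blast
  ultimately have "regular_seq_mod (adj N ?p) (map (\<lambda>b. x b [^]\<^bsub>R\<^esub> d b) bs)"
    using Cons.IH Cons.prems(3,4) by simp
  then show ?case using regular_mod_pow[OF x(3,1), of "d b"] by simp
qed

end

section \<open>Leading forms of inhomogeneous elements\<close>

context graded_action
begin

interpretation GM: module GR gr
  by (rule module_GR)

text \<open>\<open>K'\<close> is the homogeneous submodule spanned by the leading forms of the elements of \<open>K\<close>.\<close>

definition lead :: "(nat \<Rightarrow> 'c set) set \<Rightarrow> (nat \<Rightarrow> 'c set) set \<Rightarrow> bool"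
  where "lead K K' \<longleftrightarrow> (\<forall>n. \<forall>u\<in>K. u \<in> deg_lt (Suc n) \<longrightarrow> comp n u \<in> K') \<and>
    (\<forall>n. \<forall>x\<in>F n. hom n x \<in> K' \<longrightarrow> (\<exists>v\<in>deg_lt n. hom n x \<oplus>\<^bsub>gr\<^esub> v \<in> K))"

lemma lead_zero: "lead {\<zero>\<^bsub>gr\<^esub>} {\<zero>\<^bsub>gr\<^esub>}"
proof -
  have "\<zero>\<^bsub>gr\<^esub> \<in> deg_lt n" for n using deg_lt_mono[of 0 n] deg_lt_0 by auto
  moreover have "\<zero>\<^bsub>gr\<^esub> \<oplus>\<^bsub>gr\<^esub> \<zero>\<^bsub>gr\<^esub> = \<zero>\<^bsub>gr\<^esub>" by simp
  ultimately show ?thesis unfolding lead_def using comp_zero by (metis singletonD singletonI)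
qed

lemma deg_lt_neg: "g \<in> deg_lt n \<Longrightarrow> \<ominus>\<^bsub>gr\<^esub> g \<in> deg_lt n"
proof -
  assume g: "g \<in> deg_lt n"
  then obtain \<alpha> where a: "\<alpha> \<in> seqs" "g = cls \<alpha>" "\<forall>k\<ge>n. \<alpha> k = \<zero>\<^bsub>M\<^esub>" unfolding deg_lt_iff_cls by blast
  have "cls (\<lambda>n. \<ominus>\<^bsub>M\<^esub> \<alpha> n) \<oplus>\<^bsub>gr\<^esub> g = \<zero>\<^bsub>gr\<^esub>"
    unfolding a(2) cls_add[OF seqs_neg[OF a(1)] a(1)] using seqsD(2)[OF a(1)] by (simp add: M.l_neg cls_zero)
  then have "\<ominus>\<^bsub>gr\<^esub> g = cls (\<lambda>n. \<ominus>\<^bsub>M\<^esub> \<alpha> n)"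
    using GM.M.minus_equality[of _ g] cls_closed[OF seqs_neg[OF a(1)]] cls_closed[OF a(1)] a(2) by metis
  moreover have "cls (\<lambda>n. \<ominus>\<^bsub>M\<^esub> \<alpha> n) \<in> deg_lt n"
    unfolding deg_lt_iff_cls using seqs_neg[OF a(1)] a(3) by auto
  ultimately show ?thesis by simp
qed

lemma deg_lt_minus: "g \<in> deg_lt n \<Longrightarrow> h \<in> deg_lt n \<Longrightarrow> g \<ominus>\<^bsub>gr\<^esub> h \<in> deg_lt n"
  unfolding a_minus_def using deg_lt_add deg_lt_neg by blast

context
  fixes K K' d t l f
  assumes K: "GM.sub K" and K': "GM.sub K'" "homogeneous K'" and ld: "lead K K'"
    and t: "t \<in> Q d" and l: "l \<in> QQ.deg_lt d" and f: "f = QQ.hom d t \<oplus>\<^bsub>GR\<^esub> l"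
    and reg: "GM.regular_mod K' (QQ.hom d t)"
begin

lemma f_closed: "QQ.hom d t \<in> carrier GR" "l \<in> carrier GR" "f \<in> carrier GR"
proof -
  show 1: "QQ.hom d t \<in> carrier GR" "l \<in> carrier GR"
    using hom_GR t l QQ.deg_lt_carrier by (auto simp: GR_simps)
  then show "f \<in> carrier GR" unfolding f by (rule GM.R.a_closed)
qed

lemma f_smult: "z \<in> carrier gr \<Longrightarrow> f \<odot>\<^bsub>gr\<^esub> z = QQ.hom d t \<odot>\<^bsub>gr\<^esub> z \<oplus>\<^bsub>gr\<^esub> l \<odot>\<^bsub>gr\<^esub> z"
  unfolding f using f_closed(1,2) by (simp add: GM.smult_l_distr)

lemma l_smult_deg: "z \<in> deg_lt (Suc n) \<Longrightarrow> l \<odot>\<^bsub>gr\<^esub> z \<in> deg_lt (d + n)"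
  using deg_smult_less[OF l, of z "Suc n"] by simp

lemma t_smult_deg: "z \<in> deg_lt n \<Longrightarrow> QQ.hom d t \<odot>\<^bsub>gr\<^esub> z \<in> deg_lt (d + n)"
  using deg_smult[OF QQ.hom_deg[of t d]] t by simp

lemma f_smult_deg: "z \<in> deg_lt n \<Longrightarrow> f \<odot>\<^bsub>gr\<^esub> z \<in> deg_lt (d + n)"
proof -
  assume z: "z \<in> deg_lt n"
  have "l \<odot>\<^bsub>gr\<^esub> z \<in> deg_lt (d + n)"
    using deg_smult_less[OF l z] by (rule subsetD[OF deg_lt_mono, rotated]) simp
  then show ?thesis using f_smult[of z] z subsetD[OF deg_lt_carrier z] deg_lt_add[OF t_smult_deg[OF z]] by simp
qed

lemma comp_f:
  assumes "z \<in> deg_lt (Suc n)"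
  shows "comp (d + n) (f \<odot>\<^bsub>gr\<^esub> z) = QQ.hom d t \<odot>\<^bsub>gr\<^esub> comp n z"
proof -
  have z: "z \<in> carrier gr" using assms deg_lt_carrier by blast
  have "comp (d + n) (l \<odot>\<^bsub>gr\<^esub> z) = \<zero>\<^bsub>gr\<^esub>" using comp_deg_lt[OF l_smult_deg[OF assms]] by simp
  then show ?thesis
    unfolding f_smult[OF z] using z f_closed comp_smult[OF t z, of "d + n"] comp_closed[OF z]
    by (simp add: comp_add)
qed

text \<open>By regularity of the leading form of f, the top component of z lies in K', so it is the
  leading form of an element of K; subtracting that element lowers the degree of z.\<close>

lemma lift_top:
  assumes "z \<in> deg_lt (Suc n)" "QQ.hom d t \<odot>\<^bsub>gr\<^esub> comp n z \<in> K'"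
  shows "\<exists>z'\<in>deg_lt n. \<exists>k\<in>K. k \<in> deg_lt (Suc n) \<and> z = z' \<oplus>\<^bsub>gr\<^esub> k"
proof -
  have z: "z \<in> carrier gr" using assms(1) deg_lt_carrier by blast
  obtain x where x: "x \<in> F n" "comp n z = hom n x" using comp_is_hom[OF z] by blast
  have "hom n x \<in> K'" using reg assms(2) x comp_closed[OF z, of n] by (simp add: GM.regular_mod_def)
  then obtain v where v: "v \<in> deg_lt n" "hom n x \<oplus>\<^bsub>gr\<^esub> v \<in> K" using ld x(1) unfolding lead_def by blast
  obtain g where g: "g \<in> deg_lt n" "z = g \<oplus>\<^bsub>gr\<^esub> comp n z" using deg_lt_comp[OF assms(1)] by blast
  have c: "v \<in> carrier gr" "g \<in> carrier gr" "hom n x \<in> carrier gr" using v g hom_closed[OF x(1)] deg_lt_carrier by auto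
  have "z = g \<oplus>\<^bsub>gr\<^esub> hom n x" using g(2) x(2) by simp
  also have "\<dots> = (g \<oplus>\<^bsub>gr\<^esub> hom n x) \<oplus>\<^bsub>gr\<^esub> (v \<oplus>\<^bsub>gr\<^esub> \<ominus>\<^bsub>gr\<^esub> v)" using c by (simp add: GM.M.r_neg)
  also have "\<dots> = (g \<ominus>\<^bsub>gr\<^esub> v) \<oplus>\<^bsub>gr\<^esub> (hom n x \<oplus>\<^bsub>gr\<^esub> v)" unfolding a_minus_def using c by (simp add: GM.M.a_ac)
  finally have "z = (g \<ominus>\<^bsub>gr\<^esub> v) \<oplus>\<^bsub>gr\<^esub> (hom n x \<oplus>\<^bsub>gr\<^esub> v)" .
  moreover have "hom n x \<oplus>\<^bsub>gr\<^esub> v \<in> deg_lt (Suc n)"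
    using deg_lt_add[OF hom_deg[OF x(1)]] v(1) deg_lt_mono[of n "Suc n"] by auto
  ultimately show ?thesis using v deg_lt_minus[OF g(1) v(1)] by blast
qed

text \<open>The degree of u is lowered step by step: the leading form of f u lies in K', so
  \<open>lift_top\<close> splits off from u an element of K with the same top component.\<close>

lemma lead_regular: "GM.regular_mod K f"
proof -
  have "u \<in> K" if "u \<in> deg_lt n" "f \<odot>\<^bsub>gr\<^esub> u \<in> K" for u n
    using that
  proof (induction n arbitrary: u)
    case 0 then show ?case using deg_lt_0 GM.sub_zero[OF K] by auto
  next
    case (Suc n)
    have fu: "f \<odot>\<^bsub>gr\<^esub> u \<in> deg_lt (Suc (d + n))" using f_smult_deg[OF Suc.prems(1)] by simp
    have "comp (d + n) (f \<odot>\<^bsub>gr\<^esub> u) \<in> K'" using ld fu Suc.prems(2) by (auto simp: lead_def)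
    then obtain z k where zk: "z \<in> deg_lt n" "k \<in> K" "u = z \<oplus>\<^bsub>gr\<^esub> k"
      using lift_top[OF Suc.prems(1)] unfolding comp_f[OF Suc.prems(1)] by blast
    have zc: "z \<in> carrier gr" "k \<in> carrier gr" using zk deg_lt_carrier GM.sub_carrier[OF K] by auto
    have "f \<odot>\<^bsub>gr\<^esub> z \<oplus>\<^bsub>gr\<^esub> f \<odot>\<^bsub>gr\<^esub> k \<in> K" using Suc.prems(2) zk(3) zc f_closed(3) by (simp add: GM.smult_r_distr)
    then have "f \<odot>\<^bsub>gr\<^esub> z \<in> K"
      using GM.sub_add_cancel(1)[OF K GM.sub_smult[OF K f_closed(3) zk(2)]] zc f_closed(3) by simp
    then have "z \<in> K" by (rule Suc.IH[OF zk(1)])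
    then show ?case unfolding zk(3) using zk(2) GM.sub_add[OF K] by simp
  qed
  then show ?thesis unfolding GM.regular_mod_def using deg_lt_Union by blast
qed

text \<open>If f z may reach beyond degree n, its top component cancels against that of y, so
  \<open>lift_top\<close> moves the top of z into K and the bound on the degree of z drops. Once f z
  has degree at most n, the components of degree n are simply added.\<close>

lemma lead_adj_comp:
  assumes "z \<in> deg_lt m" "y \<in> K" "y \<oplus>\<^bsub>gr\<^esub> f \<odot>\<^bsub>gr\<^esub> z \<in> deg_lt (Suc n)"
  shows "comp n (y \<oplus>\<^bsub>gr\<^esub> f \<odot>\<^bsub>gr\<^esub> z) \<in> GM.adj K' (QQ.hom d t)"
  using assms
proof (induction m arbitrary: y z)
  case 0
  have "y \<in> carrier gr" using GM.sub_carrier[OF K 0(2)] .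
  then have "y \<oplus>\<^bsub>gr\<^esub> f \<odot>\<^bsub>gr\<^esub> z = y" using 0(1) deg_lt_0 f_closed(3) by simp
  then have "comp n (y \<oplus>\<^bsub>gr\<^esub> f \<odot>\<^bsub>gr\<^esub> z) \<in> K'" using 0 ld by (auto simp: lead_def)
  then show ?case using GM.adj_superset[OF K'(1) f_closed(1)] by blast
next
  case (Suc m)
  have c: "z \<in> carrier gr" "y \<in> carrier gr" "f \<odot>\<^bsub>gr\<^esub> z \<in> carrier gr"
    using Suc.prems deg_lt_carrier GM.sub_carrier[OF K] f_closed(3) by auto
  have fz: "f \<odot>\<^bsub>gr\<^esub> z \<in> deg_lt (Suc (d + m))" using f_smult_deg[OF Suc.prems(1)] by simp
  show ?case
  proof (cases "d + m \<le> n")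
    case True
    then have fz': "f \<odot>\<^bsub>gr\<^esub> z \<in> deg_lt (Suc n)" using fz deg_lt_mono[of "Suc (d + m)" "Suc n"] by auto
    have "y = (y \<oplus>\<^bsub>gr\<^esub> f \<odot>\<^bsub>gr\<^esub> z) \<ominus>\<^bsub>gr\<^esub> f \<odot>\<^bsub>gr\<^esub> z" using c by (simp add: GM.add_minus_cancel)
    then have "y \<in> deg_lt (Suc n)" using deg_lt_minus[OF Suc.prems(3) fz'] by simp
    then have cy: "comp n y \<in> K'" using ld Suc.prems(2) by (auto simp: lead_def)
    have z': "z \<in> deg_lt (Suc (n - d))" by (rule subsetD[OF deg_lt_mono Suc.prems(1)]) (use True in simp)
    have "comp n (f \<odot>\<^bsub>gr\<^esub> z) = QQ.hom d t \<odot>\<^bsub>gr\<^esub> comp (n - d) z" using comp_f[OF z'] True by simp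
    then have "comp n (y \<oplus>\<^bsub>gr\<^esub> f \<odot>\<^bsub>gr\<^esub> z) = comp n y \<oplus>\<^bsub>gr\<^esub> QQ.hom d t \<odot>\<^bsub>gr\<^esub> comp (n - d) z"
      using c by (simp add: comp_add)
    then show ?thesis unfolding GM.adj_iff using cy comp_closed[OF c(1)] by blast
  next
    case False
    have s: "y \<oplus>\<^bsub>gr\<^esub> f \<odot>\<^bsub>gr\<^esub> z \<in> deg_lt (d + m)" using Suc.prems(3) False deg_lt_mono[of "Suc n" "d + m"] by auto
    have s': "y \<oplus>\<^bsub>gr\<^esub> f \<odot>\<^bsub>gr\<^esub> z \<in> deg_lt (Suc (d + m))" using s deg_lt_mono[of "d + m" "Suc (d + m)"] by auto
    have "y = (y \<oplus>\<^bsub>gr\<^esub> f \<odot>\<^bsub>gr\<^esub> z) \<ominus>\<^bsub>gr\<^esub> f \<odot>\<^bsub>gr\<^esub> z" using c by (simp add: GM.add_minus_cancel)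
    then have "y \<in> deg_lt (Suc (d + m))" using deg_lt_minus[OF s' fz] by simp
    then have cy: "comp (d + m) y \<in> K'" using ld Suc.prems(2) by (auto simp: lead_def)
    have "comp (d + m) y \<oplus>\<^bsub>gr\<^esub> QQ.hom d t \<odot>\<^bsub>gr\<^esub> comp m z = \<zero>\<^bsub>gr\<^esub>"
      using comp_deg_lt[OF s order_refl] c comp_f[OF Suc.prems(1)] by (simp add: comp_add)
    then have "QQ.hom d t \<odot>\<^bsub>gr\<^esub> comp m z \<in> K'"
      using GM.sub_add_cancel(2)[OF K'(1) cy, of "QQ.hom d t \<odot>\<^bsub>gr\<^esub> comp m z"] GM.sub_zero[OF K'(1)]
        f_closed(1) comp_closed[OF c(1)] by simp
    then obtain z' k where zk: "z' \<in> deg_lt m" "k \<in> K" "z = z' \<oplus>\<^bsub>gr\<^esub> k"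
      using lift_top[OF Suc.prems(1)] by blast
    have zc: "z' \<in> carrier gr" "k \<in> carrier gr" using zk deg_lt_carrier GM.sub_carrier[OF K] by auto
    have e: "y \<oplus>\<^bsub>gr\<^esub> f \<odot>\<^bsub>gr\<^esub> z = (y \<oplus>\<^bsub>gr\<^esub> f \<odot>\<^bsub>gr\<^esub> k) \<oplus>\<^bsub>gr\<^esub> f \<odot>\<^bsub>gr\<^esub> z'"
      unfolding zk(3) using zc c(2) f_closed(3) by (simp add: GM.smult_r_distr GM.M.a_ac)
    show ?thesis unfolding e
      by (rule Suc.IH[OF zk(1)])
        (use GM.sub_add[OF K Suc.prems(2) GM.sub_smult[OF K f_closed(3) zk(2)]] Suc.prems(3) e in auto)
  qed
qed

text \<open>Since the leading form of f is regular modulo K', adjoining f creates no leading forms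
  beyond K' and the multiples of that form. This lets the comparison of K with K' run along a whole
  sequence.\<close>

lemma lead_adj: "lead (GM.adj K f) (GM.adj K' (QQ.hom d t))"
  unfolding lead_def
proof (intro conjI allI ballI impI)
  fix n u assume u: "u \<in> GM.adj K f" "u \<in> deg_lt (Suc n)"
  then obtain y z where yz: "y \<in> K" "z \<in> carrier gr" "u = y \<oplus>\<^bsub>gr\<^esub> f \<odot>\<^bsub>gr\<^esub> z" by (auto simp: GM.adj_iff)
  obtain m where "z \<in> deg_lt m" using deg_lt_Union[OF yz(2)] by blast
  then show "comp n u \<in> GM.adj K' (QQ.hom d t)" using lead_adj_comp[of z m y n] yz u(2) by simp
next
  fix n x assume x: "x \<in> F n" "hom n x \<in> GM.adj K' (QQ.hom d t)"
  then obtain y z where yz: "y \<in> K'" "z \<in> carrier gr" "hom n x = y \<oplus>\<^bsub>gr\<^esub> QQ.hom d t \<odot>\<^bsub>gr\<^esub> z" by (auto simp: GM.adj_iff)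
  have yc: "y \<in> carrier gr" using GM.sub_carrier[OF K'(1) yz(1)] .
  obtain v where v: "v \<in> F n" "comp n y = hom n v" using comp_is_hom[OF yc] by blast
  have "comp n y \<in> K'" using K'(2) yz(1) unfolding homogeneous_def by blast
  then have "hom n v \<in> K'" using v(2) by simp
  then obtain v' where v': "v' \<in> deg_lt n" "hom n v \<oplus>\<^bsub>gr\<^esub> v' \<in> K" using ld v(1) unfolding lead_def by blast
  have "hom n x = comp n (hom n x)" using comp_hom[OF x(1), of n] by simp
  also have "\<dots> = hom n v \<oplus>\<^bsub>gr\<^esub> (if d \<le> n then QQ.hom d t \<odot>\<^bsub>gr\<^esub> comp (n - d) z else \<zero>\<^bsub>gr\<^esub>)"
    unfolding yz(3) using yc yz(2) f_closed(1) v(2) comp_smult[OF t yz(2), of n] by (simp add: comp_add)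
  finally have e: "hom n x = hom n v \<oplus>\<^bsub>gr\<^esub> (if d \<le> n then QQ.hom d t \<odot>\<^bsub>gr\<^esub> comp (n - d) z else \<zero>\<^bsub>gr\<^esub>)" .
  have c: "hom n v \<in> carrier gr" "v' \<in> carrier gr" using hom_closed[OF v(1)] v'(1) deg_lt_carrier by auto
  show "\<exists>v\<in>deg_lt n. hom n x \<oplus>\<^bsub>gr\<^esub> v \<in> GM.adj K f"
  proof (cases "d \<le> n")
    case True
    let ?w = "comp (n - d) z"
    have w: "?w \<in> carrier gr" "?w \<in> deg_lt (Suc (n - d))" using comp_closed[OF yz(2)] comp_deg[OF yz(2)] by auto
    have lw: "l \<odot>\<^bsub>gr\<^esub> ?w \<in> deg_lt n" using l_smult_deg[OF w(2)] True by simp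
    have "hom n x \<oplus>\<^bsub>gr\<^esub> (v' \<oplus>\<^bsub>gr\<^esub> l \<odot>\<^bsub>gr\<^esub> ?w) = (hom n v \<oplus>\<^bsub>gr\<^esub> v') \<oplus>\<^bsub>gr\<^esub> f \<odot>\<^bsub>gr\<^esub> ?w"
      unfolding f_smult[OF w(1)] using e True c w(1) f_closed by (simp add: GM.M.a_ac)
    then have "hom n x \<oplus>\<^bsub>gr\<^esub> (v' \<oplus>\<^bsub>gr\<^esub> l \<odot>\<^bsub>gr\<^esub> ?w) \<in> GM.adj K f" unfolding GM.adj_iff using v'(2) w(1) by blast
    then show ?thesis using deg_lt_add[OF v'(1) lw] by blast
  next
    case False
    then have "hom n x \<oplus>\<^bsub>gr\<^esub> v' \<in> K" using e v'(2) c by simp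
    then show ?thesis using v'(1) GM.adj_superset[OF K f_closed(3)] by blast
  qed
qed

end

lemma regular_seq_lift:
  assumes "GM.sub K" "GM.sub K'" "homogeneous K'" "lead K K'"
    and "GM.regular_seq_mod K' (map (\<lambda>b. QQ.hom (d b) (t b)) bs)"
    and "\<And>b. b \<in> set bs \<Longrightarrow> t b \<in> Q (d b)" "\<And>b. b \<in> set bs \<Longrightarrow> l b \<in> QQ.deg_lt (d b)"
  shows "GM.regular_seq_mod K (map (\<lambda>b. QQ.hom (d b) (t b) \<oplus>\<^bsub>GR\<^esub> l b) bs)"
  using assms
proof (induction bs arbitrary: K K')
  case Nil then show ?case by simp
next
  case (Cons b bs)
  have tl: "t b \<in> Q (d b)" "l b \<in> QQ.deg_lt (d b)" using Cons.prems(6,7) by auto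
  have r: "GM.regular_mod K' (QQ.hom (d b) (t b))" using Cons.prems(5) by simp
  note a = Cons.prems(1,2,3,4) tl refl r
  have c: "QQ.hom (d b) (t b) \<in> carrier GR" "QQ.hom (d b) (t b) \<oplus>\<^bsub>GR\<^esub> l b \<in> carrier GR"
    using f_closed[OF a] by auto
  have "GM.regular_seq_mod (GM.adj K (QQ.hom (d b) (t b) \<oplus>\<^bsub>GR\<^esub> l b)) (map (\<lambda>b. QQ.hom (d b) (t b) \<oplus>\<^bsub>GR\<^esub> l b) bs)"
  proof (rule Cons.IH)
    show "GM.sub (GM.adj K (QQ.hom (d b) (t b) \<oplus>\<^bsub>GR\<^esub> l b))" using GM.sub_adj[OF Cons.prems(1) c(2)] .
    show "GM.sub (GM.adj K' (QQ.hom (d b) (t b)))" using GM.sub_adj[OF Cons.prems(2) c(1)] .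
    show "homogeneous (GM.adj K' (QQ.hom (d b) (t b)))" using homogeneous_adj[OF Cons.prems(3,2) tl(1)] .
    show "lead (GM.adj K (QQ.hom (d b) (t b) \<oplus>\<^bsub>GR\<^esub> l b)) (GM.adj K' (QQ.hom (d b) (t b)))" by (rule lead_adj[OF a])
    show "GM.regular_seq_mod (GM.adj K' (QQ.hom (d b) (t b))) (map (\<lambda>b. QQ.hom (d b) (t b)) bs)"
      using Cons.prems(5) by simp
  qed (use Cons.prems(6,7) in auto)
  then show ?case using lead_regular[OF a] by simp
qed

end

section \<open>The graded module of the given filtration over the powers of the ideal\<close>

context filtered_module
begin

lemma q_power_smult_F: "a \<in> ideal_power R \<qq> i \<Longrightarrow> x \<in> F j \<Longrightarrow> a \<odot>\<^bsub>M\<^esub> x \<in> F (i + j)"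
proof (induction i arbitrary: a x j)
  case 0 then show ?case using sub_smult[OF sub_F] by simp
next
  case (Suc i)
  have "ideal_prod R \<qq> (ideal_power R \<qq> i) \<subseteq> {a \<in> carrier R. \<forall>x\<in>F j. a \<odot>\<^bsub>M\<^esub> x \<in> F (Suc i + j)}"
  proof (rule R.ideal_prod_least)
    show "ideal {a \<in> carrier R. \<forall>x\<in>F j. a \<odot>\<^bsub>M\<^esub> x \<in> F (Suc i + j)} R"
      by (rule colon_ideal[OF sub_F sub_F])
    fix a b assume a: "a \<in> \<qq>" and b: "b \<in> ideal_power R \<qq> i"
    have c: "a \<in> carrier R" "b \<in> carrier R"
      using a q_carrier ideal_carrier[OF R.ideal_power_ideal[OF q_ideal] b] by auto
    have "(a \<otimes> b) \<odot>\<^bsub>M\<^esub> x \<in> F (Suc i + j)" if x: "x \<in> F j" for x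
      using q_smult_F[OF a Suc.IH[OF b x]] c sub_carrier[OF sub_F x] by (simp add: smult_assoc1)
    then show "a \<otimes> b \<in> {a \<in> carrier R. \<forall>x\<in>F j. a \<odot>\<^bsub>M\<^esub> x \<in> F (Suc i + j)}" using c by simp
  qed
  then show ?case using Suc.prems by auto
qed

lemma graded_action_power: "graded_action R M F (ideal_power R \<qq>)"
proof (intro graded_action.intro filtration.intro filtration_axioms.intro graded_action_axioms.intro module_axioms)
  show "F (Suc n) \<subseteq> F n" for n by (rule F_Suc)
  show "ideal_power R \<qq> (Suc n) \<subseteq> ideal_power R \<qq> n" for n by (rule R.ideal_power_Suc_subset[OF q_ideal])
  show "a \<otimes> b \<in> ideal_power R \<qq> (i + j)" if "a \<in> ideal_power R \<qq> i" "b \<in> ideal_power R \<qq> j" for a b i j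
    using R.ideal_power_mult[OF q_ideal that] .
  show "a \<odot>\<^bsub>M\<^esub> x \<in> F (i + j)" if "a \<in> ideal_power R \<qq> i" "x \<in> F j" for a x i j
    using q_power_smult_F[OF that] .
qed (simp_all add: sub_F R.ideal_power_ideal[OF q_ideal])

interpretation GA: graded_action R M F "ideal_power R \<qq>"
  by (rule graded_action_power)

lemma gr_ring_eq: "gr_ring R \<qq> = GA.GR"
proof -
  have "(\<lambda>n. if n = 0 then ideal_power R \<qq> 1 +>\<^bsub>R\<^esub> \<one> else ideal_power R \<qq> (Suc n)) = GA.QQ.hom 0 \<one>"
  proof
    fix n :: nat
    have "ideal_power R \<qq> (Suc n) +>\<^bsub>R\<^esub> \<zero> = ideal_power R \<qq> (Suc n)"
      using GA.QQ.coset_filt_zero[of n] by (simp add: a_r_coset_regular_module)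
    then show "(if n = 0 then ideal_power R \<qq> 1 +>\<^bsub>R\<^esub> \<one> else ideal_power R \<qq> (Suc n)) = GA.QQ.hom 0 \<one> n"
      by (simp add: GA.QQ.hom_def GA.QQ.cls_def GA.QQ.single_def a_r_coset_regular_module)
  qed
  then show ?thesis unfolding gr_ring_def Let_def GA.GR_def by simp
qed

end

section \<open>Regularity of the initial forms\<close>

context superficial_module
begin

interpretation GA: graded_action R M F "ideal_power R \<qq>"
  by (rule graded_action_power)

interpretation GM: module GA.GR GA.gr
  by (rule GA.module_GR)

abbreviation "initial_forms \<equiv> map (GA.QQ.hom 1) as"

definition KK :: "nat \<Rightarrow> (nat \<Rightarrow> 'c set) set"
  where "KK i = GM.add_scales (carrier GA.gr) {\<zero>\<^bsub>GA.gr\<^esub>} (take i initial_forms)"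

lemma nth_Q1: "i < r \<Longrightarrow> as ! i \<in> ideal_power R \<qq> 1"
  using nth_q R.ideal_power_one[OF q_ideal] by simp

lemma initial_forms_closed: "set initial_forms \<subseteq> carrier GA.GR"
  using GA.hom_GR as_q R.ideal_power_one[OF q_ideal] by auto

lemma sub_KK: "GM.sub (KK i)"
  unfolding KK_def using initial_forms_closed set_take_subset[of i initial_forms]
  by (intro GM.sub_add_scales GM.sub_whole GM.sub_zero_set) blast

lemma KK_Suc: "i < r \<Longrightarrow> KK (Suc i) = GM.adj (KK i) (GA.QQ.hom 1 (as ! i))"
  by (simp add: KK_def take_Suc_conv_app_nth GM.add_scales_snoc)

lemma homogeneous_KK: "i \<le> r \<Longrightarrow> GA.homogeneous (KK i)"
proof (induction i)
  case 0 then show ?case using GA.homogeneous_zero by (simp add: KK_def)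
next
  case (Suc i)
  then show ?case using GA.homogeneous_adj[OF _ sub_KK nth_Q1] KK_Suc by simp
qed

context
  assumes W: "\<And>i n. i < r \<Longrightarrow> W i n = 0"
begin

lemma FF_descend: "i < r \<Longrightarrow> u \<in> carrier M \<Longrightarrow> as ! i \<odot>\<^bsub>M\<^esub> u \<in> FF i (Suc n) \<Longrightarrow> u \<in> FF i n"
  using W W_eq_0_iff unfolding colon_def by blast

text \<open>Write w = w' + a m with a = \<open>as ! i\<close> and w' in N i. As \<open>W i\<close>
  vanishes, m lies in F (n - 1) + N i; its part in N i can be moved into w', which leaves a times an
  element of F (n - 1) and an element of N i for the induction hypothesis.\<close>

lemma KK_hom_N: "i \<le> r \<Longrightarrow> w \<in> N i \<Longrightarrow> w \<in> F n \<Longrightarrow> GA.hom n w \<in> KK i"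
proof (induction i arbitrary: w n)
  case 0
  then show ?case using GA.hom_zero[of n] GM.sub_zero[OF sub_KK] by (simp add: N_zero)
next
  case (Suc i)
  have i: "i < r" using Suc.prems(1) by simp
  obtain w' m where w: "w' \<in> N i" "m \<in> carrier M" "w = w' \<oplus>\<^bsub>M\<^esub> as ! i \<odot>\<^bsub>M\<^esub> m"
    using Suc.prems(2) unfolding N_Suc[OF i] adj_iff by blast
  have wc: "w' \<in> carrier M" using sub_carrier[OF sub_N w(1)] .
  show ?case
  proof (cases n)
    case 0
    have "w \<in> F (Suc n)" using N_F1[OF Suc.prems(1)] Suc.prems(2) 0 by auto
    then have "GA.hom n w = \<zero>\<^bsub>GA.gr\<^esub>" using GA.hom_eq_zero_iff[OF Suc.prems(3)] by simp
    then show ?thesis using GM.sub_zero[OF sub_KK] by simp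
  next
    case (Suc k)
    have "w \<in> FF i n" "w' \<in> FF i n" using subsetD[OF F_FF Suc.prems(3)] subsetD[OF N_FF w(1)] by auto
    then have "as ! i \<odot>\<^bsub>M\<^esub> m \<in> FF i (Suc k)"
      using sub_add_cancel(2)[OF sub_FF \<open>w' \<in> FF i n\<close>, of "as ! i \<odot>\<^bsub>M\<^esub> m"] w nth_carrier[OF i] Suc by simp
    then have "m \<in> FF i k" using FF_descend[OF i w(2)] by blast
    then obtain m' w'' where m: "m' \<in> F k" "w'' \<in> N i" "m = m' \<oplus>\<^bsub>M\<^esub> w''" by (auto simp: FF_def set_add_iff)
    have mc: "m' \<in> carrier M" "w'' \<in> carrier M" using m sub_carrier[OF sub_F] sub_carrier[OF sub_N] by auto
    have am: "as ! i \<odot>\<^bsub>M\<^esub> m' \<in> F n" using q_smult_F[OF nth_q[OF i] m(1)] Suc by simp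
    let ?v = "w' \<oplus>\<^bsub>M\<^esub> as ! i \<odot>\<^bsub>M\<^esub> w''"
    have vN: "?v \<in> N i" using sub_add[OF sub_N w(1) sub_smult[OF sub_N nth_carrier[OF i] m(2)]] .
    have vc: "?v \<in> carrier M" using sub_carrier[OF sub_N vN] .
    have e: "w = ?v \<oplus>\<^bsub>M\<^esub> as ! i \<odot>\<^bsub>M\<^esub> m'"
      unfolding w(3) m(3) using wc mc nth_carrier[OF i] by (simp add: smult_r_distr M.a_ac)
    then have vF: "?v \<in> F n" using sub_add_cancel(1)[OF sub_F am vc] Suc.prems(3) by simp
    have "GA.hom n w = GA.hom n ?v \<oplus>\<^bsub>GA.gr\<^esub> GA.hom n (as ! i \<odot>\<^bsub>M\<^esub> m')"
      using GA.hom_add[OF vF am] e by simp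
    also have "GA.hom n (as ! i \<odot>\<^bsub>M\<^esub> m') = GA.QQ.hom 1 (as ! i) \<odot>\<^bsub>GA.gr\<^esub> GA.hom k m'"
      using GA.hom_smult[OF nth_Q1[OF i] m(1)] Suc by simp
    finally show ?thesis
      unfolding KK_Suc[OF i] GM.adj_iff using Suc.IH[OF _ vN vF] i GA.hom_closed[OF m(1)] by auto
  qed
qed

text \<open>This identifies the graded module modulo the first i initial forms with the graded
  module of the induced filtration on M / N i. The vanishing of W is used in the direction from
  right to left.\<close>

lemma KK_hom_iff: "i \<le> r \<Longrightarrow> u \<in> F n \<Longrightarrow> GA.hom n u \<in> KK i \<longleftrightarrow> u \<in> FF i (Suc n)"
proof
  assume i: "i \<le> r" and u: "u \<in> F n" and "u \<in> FF i (Suc n)"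
  then obtain v w where vw: "v \<in> F (Suc n)" "w \<in> N i" "u = v \<oplus>\<^bsub>M\<^esub> w" by (auto simp: FF_def set_add_iff)
  have c: "w \<in> carrier M" using sub_carrier[OF sub_N vw(2)] .
  have v: "v \<in> F n" using vw(1) F_Suc by blast
  have wF: "w \<in> F n" using sub_add_cancel(2)[OF sub_F v c] u vw(3) by simp
  have "GA.hom n u = \<zero>\<^bsub>GA.gr\<^esub> \<oplus>\<^bsub>GA.gr\<^esub> GA.hom n w"
    using GA.hom_add[OF v wF] vw(1,3) GA.hom_eq_zero_iff[OF v] by simp
  then show "GA.hom n u \<in> KK i" using KK_hom_N[OF i vw(2) wF] GA.hom_closed[OF wF] by simp
next
  show "i \<le> r \<Longrightarrow> u \<in> F n \<Longrightarrow> GA.hom n u \<in> KK i \<Longrightarrow> u \<in> FF i (Suc n)"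
  proof (induction i arbitrary: u n)
    case 0
    then show ?case using GA.hom_eq_zero_iff FF_0 by (simp add: KK_def)
  next
    case (Suc i)
    have i: "i < r" using Suc.prems(1) by simp
    obtain y z where yz: "y \<in> KK i" "z \<in> carrier GA.gr" "GA.hom n u = y \<oplus>\<^bsub>GA.gr\<^esub> GA.QQ.hom 1 (as ! i) \<odot>\<^bsub>GA.gr\<^esub> z"
      using Suc.prems(3) unfolding KK_Suc[OF i] GM.adj_iff by blast
    have yc: "y \<in> carrier GA.gr" using GM.sub_carrier[OF sub_KK yz(1)] .
    obtain v where v: "v \<in> F n" "GA.comp n y = GA.hom n v" using GA.comp_is_hom[OF yc] by blast
    have "GA.comp n y \<in> KK i" using homogeneous_KK[of i] i yz(1) unfolding GA.homogeneous_def by simp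
    then have vFF: "v \<in> FF i (Suc n)" using Suc.IH[OF _ v(1)] i v(2) by simp
    have T: "GA.QQ.hom 1 (as ! i) \<in> carrier GA.GR" using GA.hom_GR nth_Q1[OF i] by blast
    have e: "GA.hom n u = GA.hom n v \<oplus>\<^bsub>GA.gr\<^esub>
        (if 1 \<le> n then GA.QQ.hom 1 (as ! i) \<odot>\<^bsub>GA.gr\<^esub> GA.comp (n - 1) z else \<zero>\<^bsub>GA.gr\<^esub>)"
      using arg_cong[OF yz(3), of "GA.comp n"] GA.comp_hom[OF Suc.prems(2), of n] yc yz(2) T v(2)
        GA.comp_smult[OF nth_Q1[OF i] yz(2), of n] by (simp add: GA.comp_add)
    obtain x where x: "x \<in> F n" "x \<in> FF (Suc i) (Suc n)" "GA.hom n u = GA.hom n v \<oplus>\<^bsub>GA.gr\<^esub> GA.hom n x"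
    proof (cases n)
      case 0
      then have "GA.hom n u = GA.hom n v \<oplus>\<^bsub>GA.gr\<^esub> GA.hom n \<zero>\<^bsub>M\<^esub>" using e GA.hom_zero by simp
      then show ?thesis using sub_zero[OF sub_F] sub_zero[OF sub_FF] that by blast
    next
      case (Suc k)
      obtain m where m: "m \<in> F k" "GA.comp k z = GA.hom k m" using GA.comp_is_hom[OF yz(2)] by blast
      have "GA.QQ.hom 1 (as ! i) \<odot>\<^bsub>GA.gr\<^esub> GA.comp k z = GA.hom n (as ! i \<odot>\<^bsub>M\<^esub> m)"
        using GA.hom_smult[OF nth_Q1[OF i] m(1)] Suc m(2) by simp
      then have 1: "GA.hom n u = GA.hom n v \<oplus>\<^bsub>GA.gr\<^esub> GA.hom n (as ! i \<odot>\<^bsub>M\<^esub> m)" using e Suc by simp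
      have 2: "as ! i \<odot>\<^bsub>M\<^esub> m \<in> F n" using q_smult_F[OF nth_q[OF i] m(1)] Suc by simp
      have "as ! i \<odot>\<^bsub>M\<^esub> m \<in> FF (Suc i) (Suc n)"
        unfolding FF_Suc[OF i] using adj_scale[OF sub_FF nth_carrier[OF i]] sub_carrier[OF sub_F m(1)] by blast
      then show ?thesis using 1 2 that by blast
    qed
    have c: "u \<in> carrier M" "v \<in> carrier M" "x \<in> carrier M" using sub_carrier[OF sub_F] Suc.prems(2) v(1) x(1) by auto
    have vx: "v \<oplus>\<^bsub>M\<^esub> x \<in> F n" using sub_add[OF sub_F v(1) x(1)] .
    have d: "u \<ominus>\<^bsub>M\<^esub> (v \<oplus>\<^bsub>M\<^esub> x) \<in> F n" using sub_minus[OF sub_F Suc.prems(2) vx] .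
    have "GA.hom n (u \<ominus>\<^bsub>M\<^esub> (v \<oplus>\<^bsub>M\<^esub> x)) \<oplus>\<^bsub>GA.gr\<^esub> GA.hom n u = GA.hom n u"
      using GA.hom_add[OF d vx] x(3) GA.hom_add[OF v(1) x(1)] c by (simp add: add_minus_cancel)
    then have "GA.hom n (u \<ominus>\<^bsub>M\<^esub> (v \<oplus>\<^bsub>M\<^esub> x)) = \<zero>\<^bsub>GA.gr\<^esub>"
      using GM.M.add.r_cancel_one[of "GA.hom n u"] GA.hom_closed d Suc.prems(2) by auto
    then have "u \<ominus>\<^bsub>M\<^esub> (v \<oplus>\<^bsub>M\<^esub> x) \<in> F (Suc n)" using GA.hom_eq_zero_iff[OF d] by simp
    then have 3: "u \<ominus>\<^bsub>M\<^esub> (v \<oplus>\<^bsub>M\<^esub> x) \<in> FF (Suc i) (Suc n)" using F_FF by blast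
    have "v \<in> FF (Suc i) (Suc n)" unfolding FF_Suc[OF i] using adj_superset[OF sub_FF nth_carrier[OF i]] vFF by blast
    then have "v \<oplus>\<^bsub>M\<^esub> x \<in> FF (Suc i) (Suc n)" using sub_add[OF sub_FF _ x(2)] by blast
    then show ?case using sub_add_cancel(3)[OF sub_FF, of "v \<oplus>\<^bsub>M\<^esub> x" "Suc i" "Suc n" u] c 3 by blast
  qed
qed

text \<open>Under \<open>KK_hom_iff\<close>, multiplication by the initial form of
  \<open>as ! i\<close> becomes multiplication by \<open>as ! i\<close> on the graded module of M /
  N i, and the vanishing of \<open>W i\<close> makes it injective.\<close>

lemma initial_forms_regular: "GM.regular_seq_mod {\<zero>\<^bsub>GA.gr\<^esub>} initial_forms"
  unfolding GM.regular_seq_mod_nth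
proof (intro allI impI)
  fix i assume "i < length initial_forms"
  then have i: "i < r" by simp
  have "GM.regular_mod (KK i) (GA.QQ.hom 1 (as ! i))"
  proof (rule GA.regular_mod_homogeneous[OF homogeneous_KK sub_KK nth_Q1[OF i]])
    fix n x assume x: "x \<in> F n" "GA.hom (1 + n) (as ! i \<odot>\<^bsub>M\<^esub> x) \<in> KK i"
    have "as ! i \<odot>\<^bsub>M\<^esub> x \<in> FF i (Suc (Suc n))"
      using KK_hom_iff[of i "as ! i \<odot>\<^bsub>M\<^esub> x" "Suc n"] x(2) i q_smult_F[OF nth_q[OF i] x(1)] by simp
    then have "x \<in> FF i (Suc n)" using FF_descend[OF i] sub_carrier[OF sub_F x(1)] by blast
    then show "GA.hom n x \<in> KK i" using KK_hom_iff[of i x n] x(1) i by simp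
  qed (use i in simp)
  then show "GM.regular_mod (GM.add_scales (carrier GA.gr) {\<zero>\<^bsub>GA.gr\<^esub>} (take i initial_forms)) (initial_forms ! i)"
    unfolding KK_def using i by simp
qed

end

end

section \<open>Zariski's lemma\<close>

context domain
begin

lemma pow_nonzero: "x \<in> carrier R \<Longrightarrow> x \<noteq> \<zero> \<Longrightarrow> x [^] (n::nat) \<noteq> \<zero>"
  by (induction n) (auto simp: integral_iff)

primrec vals :: "'a set \<Rightarrow> 'a \<Rightarrow> nat \<Rightarrow> 'a set"
  where
    "vals C y 0 = {\<zero>}"
  | "vals C y (Suc n) = {v \<oplus> c \<otimes> y [^] n | v c. v \<in> vals C y n \<and> c \<in> C}"

text \<open>\<open>vals C y n\<close> holds the values at \<open>y\<close> of the polynomials over \<open>C\<close> of degree \<open>< n\<close>.\<close>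

definition adjoin :: "'a set \<Rightarrow> 'a \<Rightarrow> 'a set"
  where "adjoin C y = (\<Union>n. vals C y n)"

primrec adjoin_list :: "'a set \<Rightarrow> 'a list \<Rightarrow> 'a set"
  where
    "adjoin_list C [] = C"
  | "adjoin_list C (y # ys) = adjoin_list (adjoin C y) ys"

text \<open>The leading coefficient c may be any nonzero element because C is only a subring; over a
  field it is divided out, as in \<open>zariski\<close>.\<close>

definition algebraic_elem :: "'a set \<Rightarrow> 'a \<Rightarrow> bool"
  where "algebraic_elem C y \<longleftrightarrow> (\<exists>d. \<exists>c\<in>C. c \<noteq> \<zero> \<and> c \<otimes> y [^] d \<in> vals C y d)"

context
  fixes C y
  assumes C: "subring C R" and y: "y \<in> carrier R"
begin

lemma Cc: "c \<in> C \<Longrightarrow> c \<in> carrier R"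
  using subringE(1)[OF C] by blast

lemma Cpow: "c \<in> C \<Longrightarrow> c [^] (n::nat) \<in> C"
  by (induction n) (use subringE(3,6)[OF C] in auto)

lemma ypow: "y [^] (n::nat) \<in> carrier R"
  using y by simp

lemma vals_carrier: "v \<in> vals C y n \<Longrightarrow> v \<in> carrier R"
  by (induction n arbitrary: v) (use Cc ypow in auto)

lemma vals_zero: "\<zero> \<in> vals C y n"
proof (induction n)
  case (Suc n)
  have "\<zero> = \<zero> \<oplus> \<zero> \<otimes> y [^] n" using ypow by simp
  then show ?case using Suc subringE(2)[OF C] by auto
qed simp

lemma vals_sum: "u \<in> vals C y n \<Longrightarrow> v \<in> vals C y n \<Longrightarrow> u \<oplus> v \<in> vals C y n"
proof (induction n arbitrary: u v)
  case (Suc n)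
  then obtain u' v' c d where uv: "u' \<in> vals C y n" "c \<in> C" "u = u' \<oplus> c \<otimes> y [^] n"
    "v' \<in> vals C y n" "d \<in> C" "v = v' \<oplus> d \<otimes> y [^] n" by auto
  have "u \<oplus> v = (u' \<oplus> v') \<oplus> (c \<oplus> d) \<otimes> y [^] n"
    unfolding uv(3,6) using uv vals_carrier Cc ypow[of n] by (simp add: l_distr a_ac)
  then show ?case using Suc.IH[OF uv(1,4)] subringE(7)[OF C uv(2,5)] by auto
qed simp

lemma vals_scale: "c \<in> C \<Longrightarrow> v \<in> vals C y n \<Longrightarrow> c \<otimes> v \<in> vals C y n"
proof (induction n arbitrary: v)
  case 0 then show ?case using Cc by simp
next
  case (Suc n)
  then obtain v' d where v: "v' \<in> vals C y n" "d \<in> C" "v = v' \<oplus> d \<otimes> y [^] n" by auto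
  have "c \<otimes> v = c \<otimes> v' \<oplus> (c \<otimes> d) \<otimes> y [^] n"
    unfolding v(3) using v Suc.prems vals_carrier Cc ypow[of n] by (simp add: r_distr m_assoc)
  then show ?case using Suc.IH[OF Suc.prems(1) v(1)] subringE(6)[OF C Suc.prems(1) v(2)] by auto
qed

lemma vals_neg: "v \<in> vals C y n \<Longrightarrow> \<ominus> v \<in> vals C y n"
  using vals_scale[of "\<ominus> \<one>" v n] subringE(3,5)[OF C] vals_carrier[of v n] by (simp add: l_minus)

lemma vals_diff: "u \<in> vals C y n \<Longrightarrow> v \<in> vals C y n \<Longrightarrow> u \<ominus> v \<in> vals C y n"
  unfolding a_minus_def using vals_sum vals_neg by blast

lemma vals_step: "v \<in> vals C y n \<Longrightarrow> v \<in> vals C y (Suc n)"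
proof -
  assume v: "v \<in> vals C y n"
  have "v = v \<oplus> \<zero> \<otimes> y [^] n" using vals_carrier[OF v] ypow[of n] by simp
  then show ?thesis using v subringE(2)[OF C] by auto
qed

lemma vals_mono: "m \<le> n \<Longrightarrow> v \<in> vals C y m \<Longrightarrow> v \<in> vals C y n"
  by (induction n) (use vals_step le_Suc_eq in auto)

lemma vals_top: "c \<in> C \<Longrightarrow> c \<otimes> y [^] n \<in> vals C y (Suc n)"
proof -
  assume c: "c \<in> C"
  have "c \<otimes> y [^] n = \<zero> \<oplus> c \<otimes> y [^] n" using c Cc ypow[of n] by simp
  then show ?thesis using c vals_zero[of n] by auto
qed

lemma vals_1: "vals C y 1 = C"
proof -
  have "\<zero> \<oplus> c \<otimes> y [^] (0::nat) = c" if "c \<in> C" for c using that Cc by simp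
  then show ?thesis by (auto simp del: nat_pow_0) metis
qed

lemma vals_const: "c \<in> C \<Longrightarrow> 0 < n \<Longrightarrow> c \<in> vals C y n"
  using vals_mono[of 1 n c] unfolding vals_1 by simp

lemma vals_shift: "v \<in> vals C y n \<Longrightarrow> y [^] j \<otimes> v \<in> vals C y (n + j)"
proof (induction n arbitrary: v)
  case 0 then show ?case using vals_zero[of j] ypow[of j] by simp
next
  case (Suc n)
  then obtain v' d where v: "v' \<in> vals C y n" "d \<in> C" "v = v' \<oplus> d \<otimes> y [^] n" by auto
  have "y [^] j \<otimes> v = y [^] j \<otimes> v' \<oplus> d \<otimes> y [^] (n + j)"
    unfolding v(3) using v vals_carrier Cc ypow y
    by (simp add: r_distr m_ac nat_pow_mult[symmetric])
  then show ?case using Suc.IH[OF v(1)] v(2) by auto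
qed

lemma vals_mult: "u \<in> vals C y m \<Longrightarrow> v \<in> vals C y (Suc n) \<Longrightarrow> u \<otimes> v \<in> vals C y (m + n)"
proof (induction m arbitrary: u)
  case 0 then show ?case using vals_zero[of n] vals_carrier[OF 0(2)] by (simp del: vals.simps(2))
next
  case (Suc m)
  then obtain u' c where u: "u' \<in> vals C y m" "c \<in> C" "u = u' \<oplus> c \<otimes> y [^] m" by auto
  have vc: "v \<in> carrier R" using vals_carrier[OF Suc.prems(2)] .
  have "u \<otimes> v = u' \<otimes> v \<oplus> c \<otimes> (y [^] m \<otimes> v)"
    unfolding u(3) using u vc vals_carrier Cc ypow[of m] by (simp add: l_distr m_assoc)
  moreover have "u' \<otimes> v \<in> vals C y (Suc m + n)" by (rule vals_mono[OF _ Suc.IH[OF u(1) Suc.prems(2)]]) simp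
  moreover have "c \<otimes> (y [^] m \<otimes> v) \<in> vals C y (Suc m + n)"
    using vals_scale[OF u(2) vals_shift[OF Suc.prems(2), of m]] by (simp add: add.commute del: vals.simps(2))
  ultimately show ?case using vals_sum by (simp del: vals.simps(2))
qed

lemma subring_adjoin: "subring (adjoin C y) R"
proof (rule subringI)
  show "adjoin C y \<subseteq> carrier R" using vals_carrier by (auto simp: adjoin_def)
  show "\<one> \<in> adjoin C y" using vals_1 subringE(3)[OF C] unfolding adjoin_def by blast
  show "\<ominus> u \<in> adjoin C y" if "u \<in> adjoin C y" for u using that vals_neg unfolding adjoin_def by blast
  fix u v assume "u \<in> adjoin C y" "v \<in> adjoin C y"
  then obtain m n where mn: "u \<in> vals C y m" "v \<in> vals C y n" unfolding adjoin_def by blast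
  show "u \<oplus> v \<in> adjoin C y"
    using vals_sum[OF vals_mono[OF _ mn(1), of "m + n"] vals_mono[OF _ mn(2), of "m + n"]] unfolding adjoin_def by auto
  show "u \<otimes> v \<in> adjoin C y"
    using vals_mult[OF mn(1) vals_step[OF mn(2)]] unfolding adjoin_def by blast
qed

lemma adjoin_superset: "C \<subseteq> adjoin C y" "y \<in> adjoin C y"
proof -
  show "C \<subseteq> adjoin C y" using vals_1 unfolding adjoin_def by blast
  have "\<one> \<otimes> y [^] (1::nat) \<in> vals C y (Suc 1)" using vals_top[OF subringE(3)[OF C]] .
  then have "y \<in> vals C y (Suc 1)" using y by (simp del: vals.simps(2))
  then show "y \<in> adjoin C y" unfolding adjoin_def by blast
qed

lemma vals_leading:
  assumes "v \<in> adjoin C y" "v \<noteq> \<zero>"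
  shows "\<exists>n. \<exists>u\<in>vals C y n. \<exists>c\<in>C. c \<noteq> \<zero> \<and> v = u \<oplus> c \<otimes> y [^] n"
proof -
  obtain m where "v \<in> vals C y m" using assms(1) by (auto simp: adjoin_def)
  then show ?thesis using assms(2)
  proof (induction m)
    case (Suc m)
    then obtain u c where u: "u \<in> vals C y m" "c \<in> C" "v = u \<oplus> c \<otimes> y [^] m" by auto
    show ?case
    proof (cases "c = \<zero>")
      case True
      then have "v = u" using u vals_carrier ypow[of m] by simp
      then show ?thesis using Suc u by blast
    qed (use u in blast)
  qed simp
qed

text \<open>If y satisfies no relation over C, the leading coefficients of two polynomials in y
  multiply to a nonzero one, so a unit of C[y] has degree 0.\<close>

lemma transcendental_no_unit:
  assumes tr: "\<not> algebraic_elem C y" and n: "u \<in> vals C y n" "c \<in> C" "c \<noteq> \<zero>"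
    and r: "r \<in> adjoin C y" "(u \<oplus> c \<otimes> y [^] n) \<otimes> r = \<one>"
  shows "n = 0"
proof (rule ccontr)
  assume n0: "n \<noteq> 0"
  have uc: "u \<in> carrier R" "c \<in> carrier R" using n vals_carrier Cc by auto
  have "r \<noteq> \<zero>" using r(2) uc ypow[of n] by auto
  then obtain m r' f where f: "r' \<in> vals C y m" "f \<in> C" "f \<noteq> \<zero>" "r = r' \<oplus> f \<otimes> y [^] m"
    using vals_leading[OF r(1)] by blast
  have rc: "r' \<in> carrier R" "f \<in> carrier R" "r \<in> carrier R" using f vals_carrier Cc ypow[of m] by auto
  have rV: "r \<in> vals C y (Suc m)" using f by auto
  have "\<one> = u \<otimes> r \<oplus> c \<otimes> y [^] n \<otimes> r" using r(2) uc rc ypow[of n] by (simp add: l_distr)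
  also have "c \<otimes> y [^] n \<otimes> r = c \<otimes> (y [^] n \<otimes> r') \<oplus> (c \<otimes> f) \<otimes> y [^] (n + m)"
    unfolding f(4) using uc rc ypow[of n] ypow[of m] y by (simp add: r_distr m_ac nat_pow_mult[symmetric])
  finally have e: "\<one> = (u \<otimes> r \<oplus> c \<otimes> (y [^] n \<otimes> r')) \<oplus> (c \<otimes> f) \<otimes> y [^] (n + m)"
    using uc rc ypow[of n] ypow[of "n + m"] by (simp add: a_assoc)
  have L: "u \<otimes> r \<oplus> c \<otimes> (y [^] n \<otimes> r') \<in> vals C y (n + m)" (is "?L \<in> _")
    using vals_sum[OF vals_mult[OF n(1) rV] vals_scale[OF n(2) vals_shift[OF f(1), of n, unfolded add.commute[of m]]]] .
  have "\<one> \<in> vals C y (n + m)" using vals_const[OF subringE(3)[OF C]] n0 by simp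
  then have "\<one> \<ominus> ?L \<in> vals C y (n + m)" using vals_diff L by blast
  moreover have "\<one> \<ominus> ?L = (c \<otimes> f) \<otimes> y [^] (n + m)"
    unfolding e using vals_carrier[OF L] uc rc ypow[of "n + m"] by (simp add: a_minus_def a_comm[of ?L] a_assoc r_neg)
  moreover have "c \<otimes> f \<in> C" "c \<otimes> f \<noteq> \<zero>" using subringE(6)[OF C n(2) f(2)] integral_iff uc rc n(3) f(3) by auto
  ultimately show False using tr unfolding algebraic_elem_def by metis
qed

text \<open>The geometric sum: 1 - z divides 1 - z^N inside any subring that contains z.\<close>

lemma geometric_one: "z \<in> carrier R \<Longrightarrow> z \<in> D \<Longrightarrow> subring D R \<Longrightarrow> \<exists>s\<in>D. \<one> = (\<one> \<ominus> z) \<otimes> s \<oplus> z [^] (N::nat)"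
proof (induction N)
  case 0
  then show ?case using subringE(2) by (intro bexI[of _ "\<zero>"]) auto
next
  case (Suc N)
  then obtain s where s: "s \<in> D" "\<one> = (\<one> \<ominus> z) \<otimes> s \<oplus> z [^] N" by blast
  have sc: "s \<in> carrier R" using subringE(1)[OF Suc.prems(3)] s(1) by blast
  have zD: "z [^] N \<in> D" by (induction N) (use subringE(3,6)[OF Suc.prems(3)] Suc.prems(2) in auto)
  have "z [^] N = (\<one> \<ominus> z) \<otimes> z [^] N \<oplus> z [^] Suc N"
    using Suc.prems(1) by (simp add: a_minus_def l_distr l_minus a_assoc l_neg m_comm[of z "z [^] N"])
  then have "\<one> = (\<one> \<ominus> z) \<otimes> s \<oplus> ((\<one> \<ominus> z) \<otimes> z [^] N \<oplus> z [^] Suc N)" using s(2) by simp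
  also have "\<dots> = (\<one> \<ominus> z) \<otimes> (s \<oplus> z [^] N) \<oplus> z [^] Suc N" using Suc.prems(1) sc by (simp add: r_distr a_assoc)
  finally show ?case using subringE(7)[OF Suc.prems(3) s(1) zD] by blast
qed

text \<open>Euclid's argument: 1 + y g is prime to g, so if it divides a power of g it is a unit of
  C[y]. For transcendental y it has positive degree and cannot be a unit.\<close>

lemma divides_powers_imp_algebraic:
  assumes g: "g \<in> adjoin C y" "g \<noteq> \<zero>"
    and div: "\<And>v. v \<in> adjoin C y \<Longrightarrow> v \<noteq> \<zero> \<Longrightarrow> \<exists>N::nat. \<exists>q\<in>adjoin C y. g [^] N = v \<otimes> q"
  shows "algebraic_elem C y"
proof (rule ccontr)
  assume tr: "\<not> algebraic_elem C y"
  note D = subring_adjoin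
  obtain n u e where u: "u \<in> vals C y n" "e \<in> C" "e \<noteq> \<zero>" "g = u \<oplus> e \<otimes> y [^] n" using vals_leading[OF g] by blast
  have c: "u \<in> carrier R" "e \<in> carrier R" "g \<in> carrier R" using u vals_carrier Cc ypow[of n] by auto
  let ?z = "\<ominus> (y \<otimes> g)"
  have z: "?z \<in> carrier R" "?z \<in> adjoin C y" using c y subringE(5,6)[OF D] adjoin_superset(2) g(1) by auto
  let ?w = "\<one> \<ominus> ?z" and ?u = "\<one> \<oplus> y \<otimes> u"
  have "y \<otimes> u \<in> vals C y (Suc n)" using vals_shift[OF u(1), of 1] y by (simp del: vals.simps(2))
  then have uV: "?u \<in> vals C y (Suc n)" using vals_sum vals_const[OF subringE(3)[OF C] zero_less_Suc] by blast
  have w: "?w = ?u \<oplus> e \<otimes> y [^] Suc n"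
    unfolding u(4) using c y ypow[of n] by (simp add: a_minus_def r_distr m_ac a_assoc)
  have wD: "?w \<in> adjoin C y" using subringE(3,5,7)[OF D] z(2) unfolding a_minus_def by blast
  have wc: "?w \<in> carrier R" using z by simp
  have "?w \<noteq> \<zero>"
  proof
    assume "?w = \<zero>"
    then have "?u \<oplus> e \<otimes> y [^] Suc n = \<zero>" using w by simp
    then have "e \<otimes> y [^] Suc n = \<ominus> ?u" using vals_carrier[OF uV] c ypow[of "Suc n"] by (metis minus_equality a_comm m_closed)
    then have "e \<otimes> y [^] Suc n \<in> vals C y (Suc n)" using vals_neg[OF uV] by simp
    then show False using tr u(2,3) unfolding algebraic_elem_def by blast
  qed
  then obtain N :: nat and q where q: "q \<in> adjoin C y" "g [^] N = ?w \<otimes> q" using div[OF wD] by blast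
  have qc: "q \<in> carrier R" using q(1) subringE(1)[OF D] by blast
  obtain s where s: "s \<in> adjoin C y" "\<one> = ?w \<otimes> s \<oplus> ?z [^] N" using geometric_one[OF z D] by blast
  have sc: "s \<in> carrier R" using s(1) subringE(1)[OF D] by blast
  have yD: "(\<ominus> y) [^] N \<in> adjoin C y"
    by (induction N) (use subringE(3,5,6)[OF D] adjoin_superset(2) in auto)
  have "?z = (\<ominus> y) \<otimes> g" using c y by (simp add: l_minus)
  then have "?z [^] N = (\<ominus> y) [^] N \<otimes> g [^] N" using nat_pow_distrib[of "\<ominus> y" g N] y c by simp
  then have "?z [^] N = ?w \<otimes> ((\<ominus> y) [^] N \<otimes> q)" unfolding q(2) using wc qc y by (simp add: m_lcomm)
  then have "?w \<otimes> (s \<oplus> (\<ominus> y) [^] N \<otimes> q) = \<one>" using s(2) wc sc qc y by (simp add: r_distr)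
  moreover have "s \<oplus> (\<ominus> y) [^] N \<otimes> q \<in> adjoin C y" using subringE(6,7)[OF D] s(1) yD q(1) by blast
  ultimately show False using transcendental_no_unit[OF tr uV u(2,3)] unfolding w by blast
qed

text \<open>Each factor c permits replacing the top power of y by lower ones through the relation
  for c y^d, until the degree is below d.\<close>

lemma algebraic_reduce:
  assumes c: "c \<in> C" "c \<otimes> y [^] d \<in> vals C y d" and v: "v \<in> vals C y n"
  shows "\<exists>M::nat. c [^] M \<otimes> v \<in> vals C y d"
  using v
proof (induction n arbitrary: v)
  case 0 then show ?case using vals_zero Cc[OF c(1)] by auto
next
  case (Suc n)
  show ?case
  proof (cases "Suc n \<le> d")
    case True
    then have "c [^] (0::nat) \<otimes> v \<in> vals C y d" using vals_mono[OF True Suc.prems] vals_carrier[OF Suc.prems] by simp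
    then show ?thesis by blast
  next
    case False
    obtain u e where u: "u \<in> vals C y n" "e \<in> C" "v = u \<oplus> e \<otimes> y [^] n" using Suc.prems by auto
    have cc: "u \<in> carrier R" "e \<in> carrier R" "c \<in> carrier R" using u vals_carrier Cc c(1) by auto
    have n: "n = d + (n - d)" using False by simp
    have "c \<otimes> v = c \<otimes> u \<oplus> e \<otimes> (y [^] (n - d) \<otimes> (c \<otimes> y [^] d))"
      unfolding u(3) by (subst (1) n) (use cc ypow y in \<open>simp add: r_distr m_ac nat_pow_mult[symmetric]\<close>)
    moreover have "y [^] (n - d) \<otimes> (c \<otimes> y [^] d) \<in> vals C y n" using vals_shift[OF c(2), of "n - d"] n by simp
    ultimately have "c \<otimes> v \<in> vals C y n" using vals_sum vals_scale c(1) u(1,2) by simp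
    then obtain M :: nat where "c [^] M \<otimes> (c \<otimes> v) \<in> vals C y d" using Suc.IH by blast
    then have "c [^] Suc M \<otimes> v \<in> vals C y d" using cc vals_carrier[OF Suc.prems] by (simp add: m_assoc)
    then show ?thesis by blast
  qed
qed

text \<open>Pseudo-division by \<open>s = v + e y\<^sup>n\<close>, keeping track of the leading coefficient of the quotient.\<close>

lemma pseudo_division:
  assumes s: "s = v \<oplus> e \<otimes> y [^] n" "v \<in> vals C y n" "e \<in> C"
  shows "u \<in> vals C y m \<Longrightarrow> \<exists>t\<in>vals C y (m - n). \<exists>w\<in>vals C y n. e [^] m \<otimes> u = s \<otimes> t \<oplus> w"
    and "c \<in> C \<Longrightarrow> n \<le> m \<Longrightarrow> \<exists>t\<in>vals C y (m - n). \<exists>w\<in>vals C y n.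
      e [^] Suc m \<otimes> (c \<otimes> y [^] m) = s \<otimes> (t \<oplus> (e [^] m \<otimes> c) \<otimes> y [^] (m - n)) \<oplus> w"
proof -
  have ec: "v \<in> carrier R" "e \<in> carrier R" using s vals_carrier Cc by auto
  have sc: "s \<in> carrier R" using s(1) ec ypow by simp
  \<comment> \<open>Monomials are singled out because \<open>constant_multiple\<close> uses the
    leading term e^m c y^(m-n) of their quotient.\<close>
  have top: "\<exists>t\<in>vals C y (m - n). \<exists>w\<in>vals C y n.
      e [^] Suc m \<otimes> (c \<otimes> y [^] m) = s \<otimes> (t \<oplus> (e [^] m \<otimes> c) \<otimes> y [^] (m - n)) \<oplus> w"
    if c: "c \<in> C" and n: "n \<le> m"
      and IH: "\<And>u. u \<in> vals C y m \<Longrightarrow> \<exists>t\<in>vals C y (m - n). \<exists>w\<in>vals C y n. e [^] m \<otimes> u = s \<otimes> t \<oplus> w" for m c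
  proof -
    \<comment> \<open>What remains of e c y^m after subtracting c y^(m-n) s; its degree is below
      m.\<close>
    let ?u = "\<ominus> (c \<otimes> (y [^] (m - n) \<otimes> v))"
    have "y [^] (m - n) \<otimes> v \<in> vals C y m" using vals_shift[OF s(2), of "m - n"] n by simp
    then have uV: "?u \<in> vals C y m" using vals_neg vals_scale c by blast
    obtain t w where tw: "t \<in> vals C y (m - n)" "w \<in> vals C y n" "e [^] m \<otimes> ?u = s \<otimes> t \<oplus> w" using IH[OF uV] by blast
    have cc: "c \<in> carrier R" "t \<in> carrier R" "w \<in> carrier R" "e [^] m \<in> carrier R" "?u \<in> carrier R"
      "y [^] n \<in> carrier R" "y [^] (m - n) \<in> carrier R"
      using c Cc tw vals_carrier ec ypow vals_carrier[OF uV] by auto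
    have ym: "y [^] m = y [^] (m - n) \<otimes> y [^] n" using n y by (simp add: nat_pow_mult)
    have "s \<otimes> (c \<otimes> y [^] (m - n)) \<oplus> ?u = c \<otimes> (y [^] (m - n) \<otimes> v) \<oplus> e \<otimes> (c \<otimes> y [^] m) \<oplus> ?u"
      unfolding s(1) ym using cc ec by (simp add: r_distr l_distr m_ac)
    also have "\<dots> = e \<otimes> (c \<otimes> y [^] m)"
      using cc ec ypow[of m] by (simp add: a_ac r_neg1 r_neg2 r_neg)
    finally have 1: "e \<otimes> (c \<otimes> y [^] m) = s \<otimes> (c \<otimes> y [^] (m - n)) \<oplus> ?u" ..
    have "e [^] Suc m \<otimes> (c \<otimes> y [^] m) = e [^] m \<otimes> (s \<otimes> (c \<otimes> y [^] (m - n)) \<oplus> ?u)"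
      unfolding 1[symmetric] using cc ec ypow[of m] by (simp add: m_assoc)
    also have "\<dots> = e [^] m \<otimes> (s \<otimes> (c \<otimes> y [^] (m - n))) \<oplus> (s \<otimes> t \<oplus> w)"
      unfolding tw(3)[symmetric] using cc sc by (intro r_distr) auto
    also have "\<dots> = s \<otimes> (t \<oplus> (e [^] m \<otimes> c) \<otimes> y [^] (m - n)) \<oplus> w"
      using cc sc by (simp add: r_distr m_ac a_ac)
    finally show ?thesis using tw by blast
  qed
  show gen: "\<exists>t\<in>vals C y (m - n). \<exists>w\<in>vals C y n. e [^] m \<otimes> u = s \<otimes> t \<oplus> w" if "u \<in> vals C y m" for u m
    using that
  proof (induction m arbitrary: u)
    case 0
    then have "e [^] (0::nat) \<otimes> u = s \<otimes> \<zero> \<oplus> \<zero>" using sc by simp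
    then show ?case using vals_zero by blast
  next
    case (Suc m)
    obtain u' c where u: "u' \<in> vals C y m" "c \<in> C" "u = u' \<oplus> c \<otimes> y [^] m" using Suc.prems by auto
    have uc: "u' \<in> carrier R" "c \<in> carrier R" "u \<in> carrier R" using u vals_carrier Cc ypow by auto
    show ?case
    proof (cases "n \<le> m")
      case True
      obtain t w where tw: "t \<in> vals C y (m - n)" "w \<in> vals C y n" "e [^] m \<otimes> u' = s \<otimes> t \<oplus> w" using Suc.IH[OF u(1)] by blast
      obtain t' w' where tw': "t' \<in> vals C y (m - n)" "w' \<in> vals C y n"
        "e [^] Suc m \<otimes> (c \<otimes> y [^] m) = s \<otimes> (t' \<oplus> (e [^] m \<otimes> c) \<otimes> y [^] (m - n)) \<oplus> w'"
        using top[OF u(2) True Suc.IH] by blast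
      let ?t = "(e \<otimes> t \<oplus> t') \<oplus> (e [^] m \<otimes> c) \<otimes> y [^] (m - n)"
      have cc: "t \<in> carrier R" "w \<in> carrier R" "t' \<in> carrier R" "w' \<in> carrier R" "e [^] m \<in> carrier R" "y [^] (m - n) \<in> carrier R"
        using tw tw' vals_carrier ec ypow by auto
      have "e [^] Suc m \<otimes> u = e \<otimes> (e [^] m \<otimes> u') \<oplus> e [^] Suc m \<otimes> (c \<otimes> y [^] m)"
        unfolding u(3) using uc ec cc ypow[of m] by (simp add: r_distr m_ac)
      also have "\<dots> = s \<otimes> ?t \<oplus> (e \<otimes> w \<oplus> w')"
        unfolding tw(3) tw'(3) using uc ec cc sc by (simp add: r_distr m_ac a_ac)
      finally have 1: "e [^] Suc m \<otimes> u = s \<otimes> ?t \<oplus> (e \<otimes> w \<oplus> w')" .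
      have "e \<otimes> t \<oplus> t' \<in> vals C y (m - n)" "e \<otimes> w \<oplus> w' \<in> vals C y n"
        using vals_sum vals_scale s(3) tw tw' by auto
      moreover have "e [^] m \<otimes> c \<in> C" using subringE(6)[OF C Cpow[OF s(3)] u(2)] .
      ultimately have "?t \<in> vals C y (Suc m - n)" "e \<otimes> w \<oplus> w' \<in> vals C y n" using True by (auto simp: Suc_diff_le)
      then show ?thesis using 1 by blast
    next
      case False
      then have "e [^] Suc m \<otimes> u \<in> vals C y n" using vals_scale[OF Cpow[OF s(3), of "Suc m"] vals_mono[OF _ Suc.prems, of n]] by simp
      moreover have "e [^] Suc m \<otimes> u = s \<otimes> \<zero> \<oplus> e [^] Suc m \<otimes> u" using sc ec uc by simp
      ultimately show ?thesis using vals_zero by blast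
    qed
  qed
  show "c \<in> C \<Longrightarrow> n \<le> m \<Longrightarrow> \<exists>t\<in>vals C y (m - n). \<exists>w\<in>vals C y n.
      e [^] Suc m \<otimes> (c \<otimes> y [^] m) = s \<otimes> (t \<oplus> (e [^] m \<otimes> c) \<otimes> y [^] (m - n)) \<oplus> w"
    using top gen by blast
qed

text \<open>Minimality of d amounts to the linear independence of 1, y, ..., y^(d-1) over C, which
  replaces a minimal polynomial.\<close>

lemma least_relation:
  assumes "algebraic_elem C y"
  shows "\<exists>d c. 0 < d \<and> c \<in> C \<and> c \<noteq> \<zero> \<and> c \<otimes> y [^] d \<in> vals C y d \<and>
    (\<forall>n<d. \<forall>b\<in>C. b \<otimes> y [^] n \<in> vals C y n \<longrightarrow> b = \<zero>)"
proof -
  let ?P = "\<lambda>d. \<exists>c\<in>C. c \<noteq> \<zero> \<and> c \<otimes> y [^] d \<in> vals C y d"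
  let ?d = "LEAST d. ?P d"
  obtain c where c: "c \<in> C" "c \<noteq> \<zero>" "c \<otimes> y [^] ?d \<in> vals C y ?d"
    using assms LeastI_ex[of ?P] unfolding algebraic_elem_def by blast
  have "\<forall>n<?d. \<forall>b\<in>C. b \<otimes> y [^] n \<in> vals C y n \<longrightarrow> b = \<zero>" using not_less_Least[of _ ?P] by blast
  moreover have "?d \<noteq> 0"
  proof
    assume "?d = 0"
    then have "c \<otimes> y [^] (0::nat) \<in> vals C y 0" using c(3) by metis
    then show False using c(1,2) Cc by simp
  qed
  ultimately show ?thesis using c by blast
qed

context
  fixes d c
  assumes d: "0 < d" and c: "c \<in> C" "c \<noteq> \<zero>" "c \<otimes> y [^] d \<in> vals C y d"
    and least: "\<And>n b. n < d \<Longrightarrow> b \<in> C \<Longrightarrow> b \<otimes> y [^] n \<in> vals C y n \<Longrightarrow> b = \<zero>"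
begin

text \<open>Take a nonzero multiple s of g of least degree n; the aim is n = 0. Dividing c y^d by s
  both as a monomial and as the polynomial of degree below d given by the relation leaves remainders
  of degree below n. Their difference is a multiple of g, hence zero; so the quotients agree, and
  this is a relation of degree d - n, against the minimality of d if n > 0.\<close>

lemma constant_multiple:
  assumes g: "g \<in> adjoin C y" "g \<noteq> \<zero>"
  shows "\<exists>b\<in>C. b \<noteq> \<zero> \<and> (\<exists>t\<in>adjoin C y. b = g \<otimes> t)"
proof -
  note D = subring_adjoin
  have Dc: "x \<in> adjoin C y \<Longrightarrow> x \<in> carrier R" for x using subringE(1)[OF D] by blast
  have VD: "x \<in> vals C y k \<Longrightarrow> x \<in> adjoin C y" for x k unfolding adjoin_def by blast
  let ?S = "\<lambda>n. \<exists>s\<in>vals C y (Suc n). s \<noteq> \<zero> \<and> (\<exists>t\<in>adjoin C y. s = g \<otimes> t)"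
  let ?n = "LEAST n. ?S n"
  obtain k where "g \<in> vals C y k" using g(1) unfolding adjoin_def by blast
  then have "?S k" using vals_step g(2) Dc[OF g(1)] subringE(3)[OF D] by (metis r_one)
  then have "?S ?n" by (rule LeastI)
  then obtain s t where s: "s \<in> vals C y (Suc ?n)" "s \<noteq> \<zero>" "t \<in> adjoin C y" "s = g \<otimes> t" by blast
  have no: "x = \<zero>" if "x \<in> vals C y ?n" "t' \<in> adjoin C y" "x = g \<otimes> t'" for x t'
  proof (cases ?n)
    case 0
    then have "x \<in> vals C y 0" using that(1) by metis
    then show ?thesis by simp
  next
    case (Suc j)
    have "x \<in> vals C y (Suc j)" using that(1) unfolding Suc .
    moreover have "\<not> ?S j" using not_less_Least[of j ?S] Suc by linarith
    ultimately show ?thesis using that by blast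
  qed
  define n where "n = ?n"
  obtain v e where ve: "v \<in> vals C y n" "e \<in> C" "s = v \<oplus> e \<otimes> y [^] n" using s(1) n_def by auto
  have cc: "v \<in> carrier R" "e \<in> carrier R" "s \<in> carrier R" "t \<in> carrier R" "g \<in> carrier R" "c \<in> carrier R" "y [^] d \<in> carrier R"
    using ve vals_carrier Cc s(1,3) g(1) Dc c(1) ypow by auto
  have e0: "e \<noteq> \<zero>"
  proof
    assume "e = \<zero>"
    then have "s = v" using ve(3) cc(1) ypow[of n] by simp
    then show False using no[of s t] s ve(1) n_def by simp
  qed
  \<comment> \<open>A power of c brings the degree of s below d, and the result is still a nonzero
    multiple of g.\<close>
  have "n < d"
  proof -
    obtain M :: nat where M: "c [^] M \<otimes> s \<in> vals C y d" using algebraic_reduce[OF c(1,3) s(1)] by blast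
    have "c [^] M \<otimes> s \<noteq> \<zero>" using pow_nonzero[OF cc(6) c(2)] integral_iff[of "c [^] M" s] s(2) cc by auto
    moreover have "c [^] M \<otimes> s = g \<otimes> (c [^] M \<otimes> t)" using s(4) cc by (simp add: m_lcomm)
    moreover have "c [^] M \<otimes> t \<in> adjoin C y" using subringE(6)[OF D _ s(3)] Cpow[OF c(1)] adjoin_superset(1) by blast
    moreover have "Suc (d - 1) = d" using d by simp
    ultimately have "?S (d - 1)" using M by auto
    then have "n \<le> d - 1" unfolding n_def by (rule Least_le)
    then show ?thesis using d by simp
  qed
  show ?thesis
  proof (cases n)
    case 0
    then have "s \<in> C" using s(1) vals_1 unfolding n_def[symmetric] by (simp only: One_nat_def)
    then show ?thesis using s by blast
  next
    case (Suc n')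
    \<comment> \<open>The two divisions of c y^d. The first carries one more factor e, so the second
      is multiplied by e before they are compared.\<close>
    obtain t0 w0 where 0: "t0 \<in> vals C y (d - n)" "w0 \<in> vals C y n"
      "e [^] Suc d \<otimes> (c \<otimes> y [^] d) = s \<otimes> (t0 \<oplus> (e [^] d \<otimes> c) \<otimes> y [^] (d - n)) \<oplus> w0"
      using pseudo_division(2)[OF ve(3,1,2) c(1), of d] \<open>n < d\<close> by auto
    obtain t1 w1 where 1: "t1 \<in> vals C y (d - n)" "w1 \<in> vals C y n"
      "e [^] d \<otimes> (c \<otimes> y [^] d) = s \<otimes> t1 \<oplus> w1"
      using pseudo_division(1)[OF ve(3,1,2) c(3)] by blast
    let ?a = "e [^] d \<otimes> c"
    \<comment> \<open>The difference of the two quotients; s times it is the difference of the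
      remainders.\<close>
    let ?T = "(t0 \<oplus> ?a \<otimes> y [^] (d - n)) \<ominus> e \<otimes> t1"
    have kc: "t0 \<in> carrier R" "w0 \<in> carrier R" "t1 \<in> carrier R" "w1 \<in> carrier R" "y [^] (d - n) \<in> carrier R"
      "e [^] d \<in> carrier R" using 0 1 vals_carrier ypow cc by auto
    have aC: "?a \<in> C" using subringE(6)[OF C Cpow[OF ve(2)] c(1)] .
    have "s \<otimes> (t0 \<oplus> ?a \<otimes> y [^] (d - n)) \<oplus> w0 = e \<otimes> (s \<otimes> t1 \<oplus> w1)"
      unfolding 0(3)[symmetric] 1(3)[symmetric] using cc kc by (simp add: m_ac)
    then have eq: "s \<otimes> (t0 \<oplus> ?a \<otimes> y [^] (d - n)) \<oplus> w0 = s \<otimes> (e \<otimes> t1) \<oplus> e \<otimes> w1"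
      using cc kc by (simp add: r_distr m_lcomm)
    have "s \<otimes> ?T = s \<otimes> (t0 \<oplus> ?a \<otimes> y [^] (d - n)) \<ominus> s \<otimes> (e \<otimes> t1)"
      using cc kc by (simp add: a_minus_def r_distr r_minus)
    also have "\<dots> = (s \<otimes> (t0 \<oplus> ?a \<otimes> y [^] (d - n)) \<oplus> w0) \<ominus> w0 \<ominus> s \<otimes> (e \<otimes> t1)"
      using cc kc by (simp add: a_minus_def a_assoc r_neg)
    also have "\<dots> = e \<otimes> w1 \<ominus> w0"
      unfolding eq using cc kc by (simp add: a_minus_def a_ac r_neg r_neg1)
    finally have sT: "s \<otimes> ?T = e \<otimes> w1 \<ominus> w0" .
    have "s \<otimes> ?T \<in> vals C y n" unfolding sT using vals_diff[OF vals_scale[OF ve(2) 1(2)] 0(2)] .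
    moreover have TD: "?T \<in> adjoin C y"
    proof -
      have "t0 \<oplus> ?a \<otimes> y [^] (d - n) \<in> adjoin C y"
        using subringE(7)[OF D VD[OF 0(1)] VD[OF vals_top[OF aC]]] .
      then show ?thesis using subringE(5,7)[OF D] VD[OF vals_scale[OF ve(2) 1(1)]] unfolding a_minus_def by blast
    qed
    moreover have "s \<otimes> ?T = g \<otimes> (t \<otimes> ?T)" unfolding s(4) using cc Dc[OF TD] by (simp add: m_assoc)
    ultimately have "s \<otimes> ?T = \<zero>" using no[of "s \<otimes> ?T" "t \<otimes> ?T"] subringE(6)[OF D s(3) TD] n_def by simp
    then have T0: "?T = \<zero>" using integral[of s ?T] s(2) cc(3) Dc[OF TD] by blast
    have "?a \<otimes> y [^] (d - n) = (?T \<oplus> e \<otimes> t1) \<ominus> t0"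
      using cc kc by (simp add: a_minus_def a_ac l_neg r_neg r_neg1 r_neg2)
    also have "\<dots> = e \<otimes> t1 \<ominus> t0" unfolding T0 using cc kc by simp
    finally have "?a \<otimes> y [^] (d - n) \<in> vals C y (d - n)"
      using vals_diff[OF vals_scale[OF ve(2) 1(1)] 0(1)] by simp
    then have "?a = \<zero>" using least[of "d - n"] aC d Suc by simp
    then show ?thesis using integral_iff[of "e [^] d" c] cc kc pow_nonzero[OF cc(2) e0] c(2) by auto
  qed
qed

text \<open>Below degree d coefficients may be compared: a v is constant, so the coefficients of v
  in positive degree vanish after multiplication by a, hence vanish.\<close>

lemma constant_quotient:
  assumes "a \<in> C" "a \<noteq> \<zero>" "v \<in> vals C y n" "n \<le> d" "a \<otimes> v \<in> C"
  shows "v \<in> C"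
  using assms(3-5)
proof (induction n arbitrary: v)
  case 0 then show ?case using subringE(2)[OF C] by simp
next
  case (Suc n)
  show ?case
  proof (cases n)
    case 0 then show ?thesis using Suc.prems(1) vals_1 by (simp only: One_nat_def)
  next
    case (Suc n')
    obtain u e where u: "u \<in> vals C y n" "e \<in> C" "v = u \<oplus> e \<otimes> y [^] n" using Suc.prems(1) by auto
    have cc: "u \<in> carrier R" "e \<in> carrier R" "a \<in> carrier R" using u vals_carrier Cc assms(1) by auto
    have "(a \<otimes> e) \<otimes> y [^] n = a \<otimes> v \<ominus> a \<otimes> u"
      unfolding u(3) using cc ypow[of n] by (simp add: a_minus_def r_distr a_ac m_assoc r_neg r_neg1 r_neg2)
    moreover have "a \<otimes> v \<in> vals C y n" using vals_const[OF Suc.prems(3), of n] Suc by simp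
    ultimately have "(a \<otimes> e) \<otimes> y [^] n \<in> vals C y n" using vals_diff vals_scale[OF assms(1) u(1)] by simp
    then have "a \<otimes> e = \<zero>" using least[of n "a \<otimes> e"] subringE(6)[OF C assms(1) u(2)] Suc.prems(2) by simp
    then have "e = \<zero>" using integral_iff cc assms(2) by auto
    then have "v = u" using u(3) cc ypow[of n] by simp
    then show ?thesis using Suc.IH[of v] u(1) Suc.prems(2,3) by simp
  qed
qed

text \<open>Let b = g t be a nonzero element of C. A divisibility g^N = v q in C[y] gives b^N = v q
  t^N; a power of c brings q t^N below degree d, and \<open>constant_quotient\<close> puts it into
  C. The element c b absorbs both factors.\<close>

lemma divides_powers_descend:
  assumes g: "g \<in> adjoin C y" "g \<noteq> \<zero>"
    and div: "\<And>v. v \<in> adjoin C y \<Longrightarrow> v \<noteq> \<zero> \<Longrightarrow> \<exists>N::nat. \<exists>q\<in>adjoin C y. g [^] N = v \<otimes> q"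
  shows "\<exists>a\<in>C. a \<noteq> \<zero> \<and> (\<forall>v\<in>C. v \<noteq> \<zero> \<longrightarrow> (\<exists>N::nat. \<exists>q\<in>C. a [^] N = v \<otimes> q))"
proof -
  note D = subring_adjoin
  have Dc: "x \<in> adjoin C y \<Longrightarrow> x \<in> carrier R" for x using subringE(1)[OF D] by blast
  obtain b t where b: "b \<in> C" "b \<noteq> \<zero>" "t \<in> adjoin C y" "b = g \<otimes> t" using constant_multiple[OF g] by blast
  have cc: "b \<in> carrier R" "c \<in> carrier R" "t \<in> carrier R" "g \<in> carrier R" using b Cc c Dc g by auto
  have "\<exists>N::nat. \<exists>q\<in>C. (c \<otimes> b) [^] N = v \<otimes> q" if v: "v \<in> C" "v \<noteq> \<zero>" for v
  proof -
    obtain N :: nat and q where q: "q \<in> adjoin C y" "g [^] N = v \<otimes> q"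
      using div[of v] v adjoin_superset(1) by blast
    have vc: "v \<in> carrier R" "q \<in> carrier R" using Cc v Dc q by auto
    have tD: "t [^] N \<in> adjoin C y" by (induction N) (use subringE(3,6)[OF D] b(3) in auto)
    obtain m where m: "q \<otimes> t [^] N \<in> vals C y m" using subringE(6)[OF D q(1) tD] unfolding adjoin_def by blast
    obtain M :: nat where M: "c [^] M \<otimes> (q \<otimes> t [^] N) \<in> vals C y d" using algebraic_reduce[OF c(1,3) m] by blast
    let ?p = "c [^] M \<otimes> (q \<otimes> t [^] N)"
    have bN: "b [^] N = v \<otimes> (q \<otimes> t [^] N)"
      unfolding b(4) nat_pow_distrib[OF cc(4,3)] q(2) using vc cc by (simp add: m_assoc)
    have e: "v \<otimes> ?p = c [^] M \<otimes> b [^] N" unfolding bN using vc cc by (simp add: m_ac)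
    then have "v \<otimes> ?p \<in> C" using subringE(6)[OF C Cpow[OF c(1)] Cpow[OF b(1)]] by simp
    then have pC: "?p \<in> C" using constant_quotient[OF v M order_refl] by blast
    have "(c \<otimes> b) [^] (M + N) = (c [^] M \<otimes> b [^] N) \<otimes> (c [^] N \<otimes> b [^] M)"
      using cc by (simp add: nat_pow_distrib nat_pow_mult[symmetric] m_ac)
    also have "\<dots> = v \<otimes> (?p \<otimes> (c [^] N \<otimes> b [^] M))" unfolding e[symmetric] using vc cc by (simp add: m_assoc)
    finally show ?thesis
      using subringE(6)[OF C pC subringE(6)[OF C Cpow[OF c(1)] Cpow[OF b(1)]]] by blast
  qed
  moreover have "c \<otimes> b \<in> C" "c \<otimes> b \<noteq> \<zero>" using subringE(6)[OF C c(1) b(1)] integral_iff cc c(2) b(2) by auto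
  ultimately show ?thesis by blast
qed

end

end

text \<open>The property says that inverting the single element a turns C into its field of
  fractions (C is a Goldman domain). It is clear for the field at the top and descends through each
  adjunction.\<close>

lemma adjoin_list_divides_powers:
  assumes "subring C R" "set ys \<subseteq> carrier R" "adjoin_list C ys = carrier R" "field R"
  shows "\<exists>a\<in>C. a \<noteq> \<zero> \<and> (\<forall>v\<in>C. v \<noteq> \<zero> \<longrightarrow> (\<exists>N::nat. \<exists>q\<in>C. a [^] N = v \<otimes> q))"
  using assms
proof (induction ys arbitrary: C)
  case Nil
  then have C: "C = carrier R" by simp
  have "\<exists>q\<in>C. \<one> [^] (0::nat) = v \<otimes> q" if "v \<in> C" "v \<noteq> \<zero>" for v
  proof -
    have "v \<in> Units R" using that C field.field_Units[OF Nil.prems(4)] by blast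
    then show ?thesis using C by (intro bexI[of _ "inv v"]) auto
  qed
  then show ?case using C by (intro bexI[of _ "\<one>"]) (auto intro: exI[of _ "0::nat"])
next
  case (Cons y ys)
  have y: "y \<in> carrier R" "set ys \<subseteq> carrier R" using Cons.prems by auto
  obtain g where g: "g \<in> adjoin C y" "g \<noteq> \<zero>"
    "\<And>v. v \<in> adjoin C y \<Longrightarrow> v \<noteq> \<zero> \<Longrightarrow> \<exists>N::nat. \<exists>q\<in>adjoin C y. g [^] N = v \<otimes> q"
    using Cons.IH[OF subring_adjoin[OF Cons.prems(1) y(1)] y(2) _ Cons.prems(4)] Cons.prems(3)
    unfolding adjoin_list.simps by metis
  have "algebraic_elem C y" by (rule divides_powers_imp_algebraic[OF Cons.prems(1) y(1) g])
  then obtain d c where d: "0 < d" "c \<in> C" "c \<noteq> \<zero>" "c \<otimes> y [^] d \<in> vals C y d"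
    and least: "\<forall>n<d. \<forall>b\<in>C. b \<otimes> y [^] n \<in> vals C y n \<longrightarrow> b = \<zero>"
    using least_relation[OF Cons.prems(1) y(1)] by blast
  show ?case
  proof (rule divides_powers_descend[OF Cons.prems(1) y(1) d _ g])
    show "b = \<zero>" if "n < d" "b \<in> C" "b \<otimes> y [^] n \<in> vals C y n" for n b
      using least that by blast
  qed
qed

text \<open>k[y] inherits the divisibility property from the field generated over it, so y is
  algebraic over k; as nonzero elements of k are invertible, the relation can be made monic. The
  element of interest is the head of the list.\<close>

theorem zariski:
  assumes "subring k R" "set (y # ys) \<subseteq> carrier R" "adjoin_list k (y # ys) = carrier R" "field R"
    and inv: "\<And>c. c \<in> k \<Longrightarrow> c \<noteq> \<zero> \<Longrightarrow> \<exists>c'\<in>k. c' \<otimes> c = \<one>"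
  shows "\<exists>d>0. y [^] d \<in> vals k y d"
proof -
  have y: "y \<in> carrier R" "set ys \<subseteq> carrier R" using assms(2) by auto
  obtain g where g: "g \<in> adjoin k y" "g \<noteq> \<zero>"
    "\<And>v. v \<in> adjoin k y \<Longrightarrow> v \<noteq> \<zero> \<Longrightarrow> \<exists>N::nat. \<exists>q\<in>adjoin k y. g [^] N = v \<otimes> q"
    using adjoin_list_divides_powers[OF subring_adjoin[OF assms(1) y(1)] y(2) _ assms(4)] assms(3) by auto
  have "algebraic_elem k y" by (rule divides_powers_imp_algebraic[OF assms(1) y(1) g])
  then obtain d c where d: "0 < d" "c \<in> k" "c \<noteq> \<zero>" "c \<otimes> y [^] d \<in> vals k y d"
    using least_relation[OF assms(1) y(1)] by blast
  obtain c' where c': "c' \<in> k" "c' \<otimes> c = \<one>" using inv[OF d(2,3)] by blast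
  have cc: "c \<in> carrier R" "c' \<in> carrier R" using d(2) c'(1) subringE(1)[OF assms(1)] by auto
  have "c' \<otimes> (c \<otimes> y [^] d) = (c' \<otimes> c) \<otimes> y [^] d" using cc y(1) by (simp add: m_assoc)
  also have "\<dots> = y [^] d" using c'(2) y(1) by simp
  finally have "y [^] d \<in> vals k y d" using vals_scale[OF assms(1) y(1) c'(1) d(4)] by simp
  then show ?thesis using d(1) by blast
qed

end

lemma (in domain) adjoin_list_subring:
  "subring C R \<Longrightarrow> set ys \<subseteq> carrier R \<Longrightarrow>
    subring (adjoin_list C ys) R \<and> C \<subseteq> adjoin_list C ys \<and> set ys \<subseteq> adjoin_list C ys"
proof (induction ys arbitrary: C)
  case (Cons y ys)
  have y: "y \<in> carrier R" "set ys \<subseteq> carrier R" using Cons.prems by auto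
  have "C \<subseteq> adjoin C y" "y \<in> adjoin C y" using adjoin_superset[OF Cons.prems(1) y(1)] by auto
  then show ?case using Cons.IH[OF subring_adjoin[OF Cons.prems(1) y(1)] y(2)] by auto
qed simp

lemma (in cring) idealI':
  assumes "I \<subseteq> carrier R" "\<zero> \<in> I" "\<And>a b. a \<in> I \<Longrightarrow> b \<in> I \<Longrightarrow> a \<oplus> b \<in> I"
    and "\<And>a x. a \<in> I \<Longrightarrow> x \<in> carrier R \<Longrightarrow> x \<otimes> a \<in> I"
  shows "ideal I R"
proof (rule idealI[OF ring_axioms])
  show "subgroup I (add_monoid R)"
  proof (rule add.subgroupI)
    show "\<ominus> a \<in> I" if "a \<in> I" for a
      using assms(4)[OF that, of "\<ominus> \<one>"] subsetD[OF assms(1) that] by (simp add: l_minus)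
  qed (use assms in auto)
  show "x \<otimes> a \<in> I" "a \<otimes> x \<in> I" if "a \<in> I" "x \<in> carrier R" for a x
    using assms(4)[OF that] m_comm[of a x] subsetD[OF assms(1) that(1)] that(2) by simp_all
qed

section \<open>Maximal ideals of the associated graded ring\<close>

context graded_action
begin

lemma hom_0_ring_hom: "QQ.hom 0 \<in> ring_hom R GR"
proof (rule ring_hom_memI)
  fix a b assume ab: "a \<in> carrier R" "b \<in> carrier R"
  show "QQ.hom 0 a \<in> carrier GR" using hom_GR[of a 0] ab Q_zero by simp
  show "QQ.hom 0 (a \<otimes> b) = QQ.hom 0 a \<otimes>\<^bsub>GR\<^esub> QQ.hom 0 b" using hom_mult_GR[of a 0 b 0] ab Q_zero by simp
  show "QQ.hom 0 (a \<oplus> b) = QQ.hom 0 a \<oplus>\<^bsub>GR\<^esub> QQ.hom 0 b"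
    using QQ.hom_add[of a 0 b] ab Q_zero by (simp add: GR_simps)
qed (simp add: GR_simps)

end

context filtered_module
begin

interpretation GA: graded_action R M F "ideal_power R \<qq>"
  by (rule graded_action_power)

interpretation GM: module GA.GR GA.gr
  by (rule GA.module_GR)

lemma q_power_1: "ideal_power R \<qq> 1 = \<qq>"
  by (rule R.ideal_power_one[OF q_ideal])

lemmas hom_0_ring_hom = GA.hom_0_ring_hom

lemma hom_0_nilpotent: "a \<in> \<mm> \<Longrightarrow> \<exists>n::nat. GA.QQ.hom 0 a [^]\<^bsub>GA.GR\<^esub> n = \<zero>\<^bsub>GA.GR\<^esub>"
proof -
  interpret h: ring_hom_cring R GA.GR "GA.QQ.hom 0"
    by (intro ring_hom_cring.intro ring_hom_cring_axioms.intro R.is_cring GA.cring_GR hom_0_ring_hom)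
  assume "a \<in> \<mm>"
  then obtain n :: nat where n: "a \<in> carrier R" "a [^] n \<in> \<qq>" using primary by (auto simp: primary_to_def ideal_radical_def)
  have "GA.QQ.hom 0 (a [^] n) = \<zero>\<^bsub>GA.GR\<^esub>"
    using GA.QQ.hom_eq_zero_iff[of "a [^] n" 0] n q_power_1 by (simp add: GA.GR_simps)
  moreover have "GA.QQ.hom 0 (a [^] n) = GA.QQ.hom 0 a [^]\<^bsub>GA.GR\<^esub> n" using h.hom_pow[OF n(1)] .
  ultimately show ?thesis by metis
qed

text \<open>The residue field of \<open>Q\<close> is finitely generated over the image of \<open>R\<close>, which is a field because \<open>\<mm>\<close> is
  nilpotent modulo \<open>\<qq>\<close>; so Zariski's lemma applies.\<close>

lemma integral_mod_maximal:
  assumes Q: "maximalideal Q GA.GR" and t: "t \<in> \<qq>"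
  shows "\<exists>d>0. \<exists>l\<in>GA.QQ.deg_lt d. GA.QQ.hom d (t [^] d) \<oplus>\<^bsub>GA.GR\<^esub> l \<in> Q"
proof -
  interpret Qm: maximalideal Q GA.GR by (rule Q)
  define L where "L = GA.GR Quot Q"
  define p where "p = (+>\<^bsub>GA.GR\<^esub>) Q"
  have fieldL: "field L" unfolding L_def by (rule Qm.quotient_is_field[OF GA.cring_GR])
  interpret L: field L by (rule fieldL)
  interpret h0: ring_hom_cring R GA.GR "GA.QQ.hom 0"
    by (intro ring_hom_cring.intro ring_hom_cring_axioms.intro R.is_cring GA.cring_GR hom_0_ring_hom)
  interpret p: ring_hom_cring GA.GR L p
    unfolding L_def p_def by (rule Qm.rcos_ring_hom_cring[OF GA.cring_GR])
  have zL: "\<zero>\<^bsub>L\<^esub> = Q" by (simp add: L_def FactRing_def)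
  have pQ: "g \<in> Q" if "g \<in> carrier GA.GR" "p g = \<zero>\<^bsub>L\<^esub>" for g
    using Qm.a_rcos_self[OF that(1)] that(2) unfolding p_def zL by simp
  have psurj: "\<exists>g\<in>carrier GA.GR. X = p g" if "X \<in> carrier L" for X
    using that unfolding L_def p_def FactRing_def A_RCOSETS_def' by auto
  define k where "k = p ` (GA.QQ.hom 0 ` carrier R)"
  have "subring (GA.QQ.hom 0 ` carrier R) GA.GR"
    by (rule ring_hom_ring.img_is_subring[OF ring_hom_ringI2 R.carrier_is_subring])
      (use R.ring_axioms GM.R.ring_axioms hom_0_ring_hom in auto)
  then have sk: "subring k L" unfolding k_def p_def L_def
    by (rule ring_hom_ring.img_is_subring[OF Qm.rcos_ring_hom_ring])
  have kI: "p (GA.QQ.hom 0 a) \<in> k" if "a \<in> carrier R" for a using that unfolding k_def by blast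
  \<comment> \<open>An element of \<open>\<mm>\<close> becomes nilpotent in the graded ring and
    hence zero in the field L. So a nonzero element of k comes from outside \<open>\<mm>\<close>,
    that is, from a unit.\<close>
  have kinv: "\<exists>c'\<in>k. c' \<otimes>\<^bsub>L\<^esub> c = \<one>\<^bsub>L\<^esub>" if c: "c \<in> k" "c \<noteq> \<zero>\<^bsub>L\<^esub>" for c
  proof -
    obtain a where a: "a \<in> carrier R" "c = p (GA.QQ.hom 0 a)" using c(1) unfolding k_def by blast
    have "a \<notin> \<mm>"
    proof
      assume "a \<in> \<mm>"
      then obtain n :: nat where n: "GA.QQ.hom 0 a [^]\<^bsub>GA.GR\<^esub> n = \<zero>\<^bsub>GA.GR\<^esub>" using hom_0_nilpotent by blast
      have "c [^]\<^bsub>L\<^esub> n = p (GA.QQ.hom 0 a [^]\<^bsub>GA.GR\<^esub> n)" unfolding a(2) using p.hom_pow[OF h0.hom_closed[OF a(1)]] by simp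
      then have "c [^]\<^bsub>L\<^esub> n = \<zero>\<^bsub>L\<^esub>" using n by simp
      moreover have "c \<in> carrier L" unfolding a(2) using a(1) by simp
      ultimately show False using L.pow_nonzero[OF _ c(2)] by blast
    qed
    then obtain b where b: "b \<in> carrier R" "b \<otimes> a = \<one>" using unit_outside a(1) by blast
    have "p (GA.QQ.hom 0 b) \<otimes>\<^bsub>L\<^esub> c = p (GA.QQ.hom 0 (b \<otimes> a))" unfolding a(2) using a(1) b(1) by simp
    then have "p (GA.QQ.hom 0 b) \<otimes>\<^bsub>L\<^esub> c = \<one>\<^bsub>L\<^esub>" using b(2) by simp
    then show ?thesis using kI[OF b(1)] by blast
  qed
  obtain S where S: "S \<subseteq> carrier R" "finite S" "\<qq> = genideal R S"
    using noetherian_ring.finetely_gen[OF ring_noetherian q_ideal] by blast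
  obtain xs where xs: "set xs = S" using finite_list[OF S(2)] by blast
  have Sq: "S \<subseteq> \<qq>" unfolding S(3) by (rule R.genideal_self[OF S(1)])
  define T where "T = (\<lambda>x. p (GA.QQ.hom 1 x))"
  have hq: "GA.QQ.hom 1 x \<in> carrier GA.GR" if "x \<in> \<qq>" for x using GA.hom_GR[of x 1] that q_power_1 by simp
  have Tc: "T x \<in> carrier L" if "x \<in> \<qq>" for x unfolding T_def using hq[OF that] by simp
  define ys where "ys = map T xs"
  \<comment> \<open>T t is put in front of the generators because Zariski's lemma makes its
    assertion about the head of the list.\<close>
  have ysc: "set (T t # ys) \<subseteq> carrier L" using Tc t xs Sq by (auto simp: ys_def)
  define B where "B = L.adjoin_list k (T t # ys)"
  have sB: "subring B L" and kB: "k \<subseteq> B" and yB: "set (T t # ys) \<subseteq> B"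
    unfolding B_def using L.adjoin_list_subring[OF sk ysc] by auto
  have hc: "GA.QQ.hom n a \<in> carrier GA.GR" if "a \<in> ideal_power R \<qq> n" for n a using GA.hom_GR that by blast
  \<comment> \<open>Being an ideal of R, this set contains \<open>\<qq>\<close>^n once it contains
    generators: those of \<open>\<qq>\<close> for n = 1, and products for the higher powers.\<close>
  have idB: "ideal {a \<in> ideal_power R \<qq> n. p (GA.QQ.hom n a) \<in> B} R" for n
  proof (rule R.idealI')
    note I = idealD[OF R.ideal_power_ideal[OF q_ideal, of n]]
    show "{a \<in> ideal_power R \<qq> n. p (GA.QQ.hom n a) \<in> B} \<subseteq> carrier R"
      using ideal_carrier[OF R.ideal_power_ideal[OF q_ideal, of n]] by blast
    have "GA.QQ.hom n \<zero> = \<zero>\<^bsub>GA.GR\<^esub>" using GA.QQ.hom_zero[of n] by (simp add: GA.GR_simps)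
    then show "\<zero> \<in> {a \<in> ideal_power R \<qq> n. p (GA.QQ.hom n a) \<in> B}"
      using additive_subgroup.zero_closed[OF ideal.axioms(1)[OF R.ideal_power_ideal[OF q_ideal, of n]]]
        subringE(2)[OF sB] by simp
    fix a assume a: "a \<in> {a \<in> ideal_power R \<qq> n. p (GA.QQ.hom n a) \<in> B}"
    show "a \<oplus> b \<in> {a \<in> ideal_power R \<qq> n. p (GA.QQ.hom n a) \<in> B}"
      if b: "b \<in> {a \<in> ideal_power R \<qq> n. p (GA.QQ.hom n a) \<in> B}" for b
    proof -
      have "GA.QQ.hom n (a \<oplus> b) = GA.QQ.hom n a \<oplus>\<^bsub>GA.GR\<^esub> GA.QQ.hom n b"
        using GA.QQ.hom_add[of a n b] a b by (simp add: GA.GR_simps)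
      then have "p (GA.QQ.hom n (a \<oplus> b)) \<in> B" using subringE(7)[OF sB] a b hc by simp
      then show ?thesis
        using additive_subgroup.a_closed[OF ideal.axioms(1)[OF R.ideal_power_ideal[OF q_ideal, of n]]] a b by simp
    qed
    show "x \<otimes> a \<in> {a \<in> ideal_power R \<qq> n. p (GA.QQ.hom n a) \<in> B}" if x: "x \<in> carrier R" for x
    proof -
      have "GA.QQ.hom n (x \<otimes> a) = GA.QQ.hom 0 x \<otimes>\<^bsub>GA.GR\<^esub> GA.QQ.hom n a"
        using GA.hom_mult_GR[of x 0 a n] a x by simp
      then have "p (GA.QQ.hom n (x \<otimes> a)) \<in> B" using subringE(6)[OF sB] kB kI[OF x] a x hc[of a n] by auto
      then show ?thesis using ideal.I_l_closed[OF R.ideal_power_ideal[OF q_ideal, of n]] a x by simp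
    qed
  qed
  have T1: "p (GA.QQ.hom 1 x) \<in> B" if "x \<in> \<qq>" for x
  proof -
    have "S \<subseteq> {a \<in> ideal_power R \<qq> 1. p (GA.QQ.hom 1 a) \<in> B}"
      using Sq q_power_1 yB xs unfolding ys_def T_def by auto
    then have "genideal R S \<subseteq> {a \<in> ideal_power R \<qq> 1. p (GA.QQ.hom 1 a) \<in> B}" by (rule R.genideal_minimal[OF idB])
    then show ?thesis using that S(3) by blast
  qed
  have homB: "p (GA.QQ.hom n a) \<in> B" if "a \<in> ideal_power R \<qq> n" for n a
    using that
  proof (induction n arbitrary: a)
    case 0 then show ?case using kB kI[of a] by auto
  next
    case (Suc n)
    have "ideal_prod R \<qq> (ideal_power R \<qq> n) \<subseteq> {a \<in> ideal_power R \<qq> (Suc n). p (GA.QQ.hom (Suc n) a) \<in> B}"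
    proof (rule R.ideal_prod_least[OF idB])
      fix x b assume x: "x \<in> \<qq>" and b: "b \<in> ideal_power R \<qq> n"
      have "GA.QQ.hom (Suc n) (x \<otimes> b) = GA.QQ.hom 1 x \<otimes>\<^bsub>GA.GR\<^esub> GA.QQ.hom n b"
        using GA.hom_mult_GR[of x 1 b n] x b q_power_1 by simp
      then have "p (GA.QQ.hom (Suc n) (x \<otimes> b)) \<in> B"
        using subringE(6)[OF sB T1[OF x] Suc.IH[OF b]] hq[OF x] hc[OF b] by simp
      then show "x \<otimes> b \<in> {a \<in> ideal_power R \<qq> (Suc n). p (GA.QQ.hom (Suc n) a) \<in> B}"
        using ideal_prod.prod[OF x b] by simp
    qed
    then show ?case using Suc.prems by auto
  qed
  have "p g \<in> B" if "g \<in> carrier GA.QQ.gr" for g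
    using that
  proof (rule GA.QQ.gr_induct_hom)
    fix g h assume "g \<in> carrier GA.QQ.gr" "h \<in> carrier GA.QQ.gr" "p g \<in> B" "p h \<in> B"
    then show "p (g \<oplus>\<^bsub>GA.QQ.gr\<^esub> h) \<in> B" using subringE(7)[OF sB] p.hom_add[of g h] by (simp add: GA.GR_simps)
  qed (rule homB)
  then have "carrier L \<subseteq> B" using psurj by (auto simp: GA.GR_simps)
  then have "L.adjoin_list k (T t # ys) = carrier L" using subringE(1)[OF sB] unfolding B_def by blast
  then obtain d where d: "d > 0" "T t [^]\<^bsub>L\<^esub> d \<in> L.vals k (T t) d"
    using L.zariski[OF sk ysc _ fieldL kinv] by blast
  have tq: "t \<in> ideal_power R \<qq> 1" using t q_power_1 by simp
  have tp: "t [^] n \<in> ideal_power R \<qq> n" for n using GA.hom_pow_GR(1)[OF tq] .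
  have Tn: "T t [^]\<^bsub>L\<^esub> n = p (GA.QQ.hom n (t [^] n))" for n
    unfolding T_def GA.hom_pow_GR(2)[OF tq, symmetric] using p.hom_pow[OF hq[OF t]] by simp
  \<comment> \<open>A polynomial in T t over k of degree below n lifts to an element of degree below
    n, because T t is the image of an element of degree 1 and k that of degree 0.\<close>
  have lift: "\<exists>u\<in>GA.QQ.deg_lt n. v = p u" if "v \<in> L.vals k (T t) n" for v n
    using that
  proof (induction n arbitrary: v)
    case 0
    then show ?case using GA.QQ.deg_lt_0 p.hom_zero by (simp add: GA.GR_simps)
  next
    case (Suc n)
    obtain v' c where v: "v' \<in> L.vals k (T t) n" "c \<in> k" "v = v' \<oplus>\<^bsub>L\<^esub> c \<otimes>\<^bsub>L\<^esub> T t [^]\<^bsub>L\<^esub> n" using Suc.prems by auto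
    obtain u where u: "u \<in> GA.QQ.deg_lt n" "v' = p u" using Suc.IH[OF v(1)] by blast
    obtain a where a: "a \<in> carrier R" "c = p (GA.QQ.hom 0 a)" using v(2) unfolding k_def by blast
    have at: "a \<otimes> t [^] n \<in> ideal_power R \<qq> n" using GA.Q_mult[of a 0 "t [^] n" n] a(1) tp[of n] by simp
    have uc: "u \<in> carrier GA.GR" using u(1) GA.QQ.deg_lt_carrier by (auto simp: GA.GR_simps)
    have "c \<otimes>\<^bsub>L\<^esub> T t [^]\<^bsub>L\<^esub> n = p (GA.QQ.hom n (a \<otimes> t [^] n))"
      unfolding Tn a(2) using GA.hom_mult_GR[of a 0 "t [^] n" n] a(1) tp[of n] hc[of a 0] hc[OF tp[of n]]
      by (simp flip: p.hom_mult)
    then have "v = p (u \<oplus>\<^bsub>GA.GR\<^esub> GA.QQ.hom n (a \<otimes> t [^] n))" using v(3) u(2) uc hc[OF at] by simp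
    moreover have "u \<oplus>\<^bsub>GA.GR\<^esub> GA.QQ.hom n (a \<otimes> t [^] n) \<in> GA.QQ.deg_lt (Suc n)"
      using GA.QQ.deg_lt_add[OF subsetD[OF GA.QQ.deg_lt_mono[of n "Suc n"] u(1)] GA.QQ.hom_deg[OF at]]
      by (simp add: GA.GR_simps)
    ultimately show ?case by blast
  qed
  obtain u where u: "u \<in> GA.QQ.deg_lt d" "T t [^]\<^bsub>L\<^esub> d = p u" using lift[OF d(2)] by blast
  have uc: "u \<in> carrier GA.GR" using u(1) GA.QQ.deg_lt_carrier by (auto simp: GA.GR_simps)
  \<comment> \<open>The class of -1 in degree 0: negation becomes a multiplication, to which the
    degree bound for products applies.\<close>
  let ?m = "GA.QQ.hom 0 (\<ominus> \<one>)"
  have mc: "?m \<in> carrier GA.GR" by simp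
  have "?m \<in> GA.QQ.deg_lt (Suc 0)" using GA.QQ.hom_deg[of "\<ominus> \<one>" 0] by simp
  then have lD: "?m \<otimes>\<^bsub>GA.GR\<^esub> u \<in> GA.QQ.deg_lt d"
    using graded_action.deg_smult[OF GA.graded_action_regular, of ?m 0 u d] u(1)
    by (simp only: GA.GR_simps(2) add_0)
  have "p (GA.QQ.hom d (t [^] d) \<oplus>\<^bsub>GA.GR\<^esub> ?m \<otimes>\<^bsub>GA.GR\<^esub> u) = T t [^]\<^bsub>L\<^esub> d \<oplus>\<^bsub>L\<^esub> (\<ominus>\<^bsub>L\<^esub> \<one>\<^bsub>L\<^esub>) \<otimes>\<^bsub>L\<^esub> p u"
    unfolding Tn using uc mc hc[OF tp[of d]] by simp
  also have "\<dots> = \<zero>\<^bsub>L\<^esub>" unfolding u(2) using uc by (simp add: L.l_minus L.r_neg)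
  finally have "GA.QQ.hom d (t [^] d) \<oplus>\<^bsub>GA.GR\<^esub> ?m \<otimes>\<^bsub>GA.GR\<^esub> u \<in> Q"
    by (rule pQ[OF GM.R.a_closed[OF hc[OF tp[of d]] GM.R.m_closed[OF mc uc]]])
  then show ?thesis using d(1) lD by blast
qed

end

section \<open>Dimension of the associated graded module\<close>

lemma (in module) submoduleI':
  assumes "N \<subseteq> carrier M" "\<zero>\<^bsub>M\<^esub> \<in> N" "\<And>u v. u \<in> N \<Longrightarrow> v \<in> N \<Longrightarrow> u \<oplus>\<^bsub>M\<^esub> v \<in> N"
    and "\<And>a u. a \<in> carrier R \<Longrightarrow> u \<in> N \<Longrightarrow> a \<odot>\<^bsub>M\<^esub> u \<in> N"
  shows "sub N"
proof (rule submoduleI)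
  show "\<ominus>\<^bsub>M\<^esub> u \<in> N" if "u \<in> N" for u
    using assms(4)[of "\<ominus> \<one>" u] that subsetD[OF assms(1) that] by (simp add: smult_l_minus)
qed (use assms in auto)

text \<open>The graded objects are viewed over the base ring by way of degree 0; so their
  truncations have lengths over R, comparable with that of M / F n.\<close>

definition restrict_scalars :: "('a \<Rightarrow> 'b) \<Rightarrow> ('b, 'c, 'd) module_scheme \<Rightarrow> ('a, 'c) module"
  where "restrict_scalars h N =
    \<lparr>carrier = carrier N, mult = undefined, one = undefined, zero = zero N, add = add N,
     smult = (\<lambda>a x. h a \<odot>\<^bsub>N\<^esub> x)\<rparr>"

lemma restrict_scalars_simps [simp]:
  "carrier (restrict_scalars h N) = carrier N" "\<zero>\<^bsub>restrict_scalars h N\<^esub> = \<zero>\<^bsub>N\<^esub>"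
  "x \<oplus>\<^bsub>restrict_scalars h N\<^esub> y = x \<oplus>\<^bsub>N\<^esub> y" "a \<odot>\<^bsub>restrict_scalars h N\<^esub> x = h a \<odot>\<^bsub>N\<^esub> x"
  by (simp_all add: restrict_scalars_def)

lemma module_restrict_scalars:
  assumes "module S N" "h \<in> ring_hom R S" "cring R"
  shows "module R (restrict_scalars h N)" (is "module R ?N")
proof (rule moduleI[OF assms(3)])
  interpret N: module S N by fact
  show "abelian_group ?N"
    by (rule abelian_groupI) (auto simp: N.M.a_ac intro: N.M.l_neg)
  note h = ring_hom_closed[OF assms(2)] ring_hom_add[OF assms(2)] ring_hom_mult[OF assms(2)] ring_hom_one[OF assms(2)]
  fix a b x y assume "a \<in> carrier R" "b \<in> carrier R" "x \<in> carrier ?N" "y \<in> carrier ?N"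
  then show "(a \<oplus>\<^bsub>R\<^esub> b) \<odot>\<^bsub>?N\<^esub> x = a \<odot>\<^bsub>?N\<^esub> x \<oplus>\<^bsub>?N\<^esub> b \<odot>\<^bsub>?N\<^esub> x"
    "(a \<otimes>\<^bsub>R\<^esub> b) \<odot>\<^bsub>?N\<^esub> x = a \<odot>\<^bsub>?N\<^esub> (b \<odot>\<^bsub>?N\<^esub> x)"
    using h by (simp_all add: N.smult_l_distr N.smult_assoc1)
next
  interpret N: module S N by fact
  note h = ring_hom_closed[OF assms(2)] ring_hom_one[OF assms(2)]
  fix a x y assume "a \<in> carrier R" "x \<in> carrier ?N" "y \<in> carrier ?N"
  then show "a \<odot>\<^bsub>?N\<^esub> (x \<oplus>\<^bsub>?N\<^esub> y) = a \<odot>\<^bsub>?N\<^esub> x \<oplus>\<^bsub>?N\<^esub> a \<odot>\<^bsub>?N\<^esub> y"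
    using h by (simp add: N.smult_r_distr)
next
  interpret N: module S N by fact
  show "a \<odot>\<^bsub>?N\<^esub> x \<in> carrier ?N"
    if "a \<in> carrier R" "x \<in> carrier ?N" for a x
    using that ring_hom_closed[OF assms(2)] by simp
  show "\<one>\<^bsub>R\<^esub> \<odot>\<^bsub>?N\<^esub> x = x" if "x \<in> carrier ?N" for x
    using that ring_hom_one[OF assms(2)] by simp
qed

section \<open>Lengths of truncations over the base ring\<close>

context graded_action
begin

interpretation GM: module GR gr
  by (rule module_GR)

interpretation GQ: module GR QQ.gr
  by (rule graded_action.module_GR[OF graded_action_regular])

abbreviation "RM \<equiv> restrict_scalars (QQ.hom 0) gr"
abbreviation "RQ \<equiv> restrict_scalars (QQ.hom 0) QQ.gr"

interpretation RM: module R RM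
  by (rule module_restrict_scalars[OF module_GR hom_0_ring_hom R.is_cring])

interpretation RQ: module R RQ
  by (rule module_restrict_scalars[OF GQ.module_axioms hom_0_ring_hom R.is_cring])

lemma hom_0_deg: "a \<in> carrier R \<Longrightarrow> QQ.hom 0 a \<in> QQ.deg_lt (Suc 0)" "a \<in> carrier R \<Longrightarrow> QQ.hom 0 a \<in> carrier GR"
  using QQ.hom_deg[of a 0] Q_zero ring_hom_closed[OF hom_0_ring_hom] by auto

lemma sub_deg_lt: "RM.sub (deg_lt n)"
proof (rule RM.submoduleI')
  show "\<zero>\<^bsub>RM\<^esub> \<in> deg_lt n" using deg_lt_mono[of 0 n] deg_lt_0 by auto
  show "a \<odot>\<^bsub>RM\<^esub> u \<in> deg_lt n" if "a \<in> carrier R" "u \<in> deg_lt n" for a u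
    using deg_smult[OF hom_0_deg(1)[OF that(1)] that(2)] by simp
qed (use deg_lt_carrier deg_lt_add in auto)

lemma sub_hom_preimage:
  assumes "RM.sub N"
  shows "sub {x \<in> F n. hom n x \<in> N}"
proof (rule submoduleI')
  show "{x \<in> F n. hom n x \<in> N} \<subseteq> carrier M" using filt_carrier by blast
  show "\<zero>\<^bsub>M\<^esub> \<in> {x \<in> F n. hom n x \<in> N}" using sub_zero[OF filt_sub] hom_zero[of n] RM.sub_zero[OF assms] by simp
  show "u \<oplus>\<^bsub>M\<^esub> v \<in> {x \<in> F n. hom n x \<in> N}" if "u \<in> {x \<in> F n. hom n x \<in> N}" "v \<in> {x \<in> F n. hom n x \<in> N}" for u v
    using that sub_add[OF filt_sub, of u n v] hom_add[of u n v] RM.sub_add[OF assms, of "hom n u" "hom n v"] by simp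
  show "a \<odot>\<^bsub>M\<^esub> u \<in> {x \<in> F n. hom n x \<in> N}" if "a \<in> carrier R" "u \<in> {x \<in> F n. hom n x \<in> N}" for a u
    using that Q_zero hom_smult[of a 0 u n] RM.sub_smult[OF assms, of a "hom n u"] Q_smult[of a 0 u n] by simp
qed

text \<open>An R-submodule between the two truncations is determined by the elements of F n whose
  classes in degree n it contains.\<close>

lemma length_deg_lt_Suc: "interval_length R RM (deg_lt n) (deg_lt (Suc n)) \<le> ilen (F (Suc n)) (F n)"
proof (rule interval_length_mono_map[where f = "\<lambda>N. {x \<in> F n. hom n x \<in> N}"])
  fix N assume N: "RM.sub N" "deg_lt n \<subseteq> N" "N \<subseteq> deg_lt (Suc n)"
  have "F (Suc n) \<subseteq> {x \<in> F n. hom n x \<in> N}"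
  proof (intro subsetI CollectI conjI)
    fix x assume x: "x \<in> F (Suc n)"
    then show xn: "x \<in> F n" using filt_Suc by blast
    show "hom n x \<in> N" using hom_eq_zero_iff[OF xn] x RM.sub_zero[OF N(1)] by simp
  qed
  then show "sub {x \<in> F n. hom n x \<in> N} \<and> F (Suc n) \<subseteq> {x \<in> F n. hom n x \<in> N} \<and> {x \<in> F n. hom n x \<in> N} \<subseteq> F n"
    using sub_hom_preimage[OF N(1)] by blast
next
  fix N K assume NK: "RM.sub N" "RM.sub K" "deg_lt n \<subseteq> N" "N \<subset> K" "K \<subseteq> deg_lt (Suc n)"
  then obtain g where g: "g \<in> K" "g \<notin> N" by blast
  then obtain g' x where x: "g' \<in> deg_lt n" "x \<in> F n" "g = g' \<oplus>\<^bsub>gr\<^esub> hom n x" using deg_lt_split[of g n] NK(5) by blast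
  have c: "hom n x \<in> carrier gr" "g' \<in> N" "g' \<in> K" using hom_closed[OF x(2)] x(1) NK(3,4) by auto
  have "hom n x \<notin> N" using g(2) x(3) RM.sub_add[OF NK(1) c(2)] by auto
  moreover have "hom n x \<in> K" using RM.sub_add_cancel(2)[OF NK(2) c(3), of "hom n x"] c(1) g(1) x(3) by simp
  ultimately show "{x \<in> F n. hom n x \<in> N} \<subset> {x \<in> F n. hom n x \<in> K}" using x(2) NK(4) by blast
qed

lemma length_deg_lt:
  assumes "F 0 = carrier M"
  shows "interval_length R RM (deg_lt 0) (deg_lt n) \<le> ilen (F n) (carrier M)"
proof (induction n)
  case 0 then show ?case using RM.ilen_self[OF sub_deg_lt] by simp
next
  case (Suc n)
  have anti: "F n \<subseteq> F 0" by (induction n) (use filt_Suc in auto)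
  have "interval_length R RM (deg_lt 0) (deg_lt (Suc n))
      = interval_length R RM (deg_lt 0) (deg_lt n) + interval_length R RM (deg_lt n) (deg_lt (Suc n))"
    by (rule RM.ilen_additive[OF sub_deg_lt sub_deg_lt sub_deg_lt]) (use deg_lt_mono in auto)
  also have "\<dots> \<le> ilen (F n) (carrier M) + ilen (F (Suc n)) (F n)"
    by (rule add_mono[OF Suc length_deg_lt_Suc])
  also have "\<dots> = ilen (F (Suc n)) (carrier M)"
    using ilen_additive[OF filt_sub filt_sub filt_sub filt_Suc anti] assms by (simp add: add.commute)
  finally show ?case .
qed

lemma sub_QQ_deg_lt: "RQ.sub (QQ.deg_lt n)"
  by (rule graded_action.sub_deg_lt[OF graded_action_regular])

lemma smult_minus_left:
  assumes "f \<in> carrier GR" "f' \<in> carrier GR" "u \<in> carrier gr" "f \<odot>\<^bsub>gr\<^esub> u = f' \<odot>\<^bsub>gr\<^esub> u"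
  shows "(f \<ominus>\<^bsub>GR\<^esub> f') \<odot>\<^bsub>gr\<^esub> u = \<zero>\<^bsub>gr\<^esub>"
  using assms by (simp add: a_minus_def GM.smult_l_distr GM.smult_l_minus GM.M.r_neg)

lemma GR_minus_RQ: "f \<ominus>\<^bsub>GR\<^esub> f' = f \<ominus>\<^bsub>RQ\<^esub> f'"
  by (simp add: a_minus_def a_inv_def m_inv_def GR_simps)

text \<open>If \<open>us\<close> generates the graded module, this is the part of its annihilator in
  degrees below n.\<close>

definition killed :: "nat \<Rightarrow> (nat \<Rightarrow> 'c set) list \<Rightarrow> (nat \<Rightarrow> 'a set) set"
  where "killed n us = {f \<in> QQ.deg_lt n. \<forall>u\<in>set us. f \<odot>\<^bsub>gr\<^esub> u = \<zero>\<^bsub>gr\<^esub>}"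

lemma sub_killed: "set us \<subseteq> carrier gr \<Longrightarrow> RQ.sub (killed n us)"
proof (rule RQ.submoduleI')
  assume us: "set us \<subseteq> carrier gr"
  note D = RQ.subD[OF sub_QQ_deg_lt[of n]]
  have c: "f \<in> carrier GR" if "f \<in> QQ.deg_lt n" for f using D(1)[OF that] by (simp add: GR_simps)
  show "killed n us \<subseteq> carrier RQ" using D(1) by (auto simp: killed_def)
  show "\<zero>\<^bsub>RQ\<^esub> \<in> killed n us" using D(2) us GM.smult_l_null by (auto simp: killed_def GR_simps)
  show "u \<oplus>\<^bsub>RQ\<^esub> v \<in> killed n us" if uv: "u \<in> killed n us" "v \<in> killed n us" for u v
  proof -
    have "(u \<oplus>\<^bsub>GR\<^esub> v) \<odot>\<^bsub>gr\<^esub> x = \<zero>\<^bsub>gr\<^esub>" if "x \<in> set us" for x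
      using uv that us c by (auto simp: killed_def GM.smult_l_distr)
    then show ?thesis using D(3)[of u v] uv by (simp add: killed_def GR_simps)
  qed
  show "a \<odot>\<^bsub>RQ\<^esub> u \<in> killed n us" if a: "a \<in> carrier R" and u: "u \<in> killed n us" for a u
  proof -
    have "(QQ.hom 0 a \<otimes>\<^bsub>GR\<^esub> u) \<odot>\<^bsub>gr\<^esub> x = \<zero>\<^bsub>gr\<^esub>" if "x \<in> set us" for x
      using u that us c hom_0_deg(2)[OF a] by (auto simp: killed_def GM.smult_assoc1)
    then show ?thesis using D(6)[OF a, of u] u by (simp add: killed_def GR_simps)
  qed
qed

text \<open>Adding a generator u shrinks \<open>killed\<close>; the map f \<mapsto> f u embeds the
  quotient into the elements of degree below n + c. So each generator contributes at most one such
  length.\<close>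

lemma length_killed:
  assumes "set us \<subseteq> deg_lt (Suc c)"
  shows "interval_length R RQ (killed n us) (QQ.deg_lt n)
    \<le> of_nat (length us) * interval_length R RM (deg_lt 0) (deg_lt (n + c))"
  using assms
proof (induction us)
  case Nil
  have "killed n [] = QQ.deg_lt n" by (simp add: killed_def)
  then show ?case using RQ.ilen_self[OF sub_QQ_deg_lt] by simp
next
  case (Cons u us)
  let ?l = "interval_length R RM (deg_lt 0) (deg_lt (n + c))"
  have u: "u \<in> deg_lt (Suc c)" "u \<in> carrier gr" and us: "set us \<subseteq> carrier gr" "set us \<subseteq> deg_lt (Suc c)"
    using Cons.prems deg_lt_carrier[of "Suc c"] by auto
  have s: "RQ.sub (killed n us)" "RQ.sub (killed n (u # us))" using sub_killed us u(2) by simp_all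
  have "interval_length R RQ (killed n (u # us)) (killed n us) \<le> ?l"
  proof (rule interval_length_mono_map[where f = "\<lambda>N. (\<lambda>f. f \<odot>\<^bsub>gr\<^esub> u) ` N"])
    fix N assume N: "RQ.sub N" "killed n (u # us) \<subseteq> N" "N \<subseteq> killed n us"
    have Nc: "f \<in> carrier GR" if "f \<in> N" for f using RQ.sub_carrier[OF N(1) that] by (simp add: GR_simps)
    have "RM.sub ((\<lambda>f. f \<odot>\<^bsub>gr\<^esub> u) ` N)"
    proof (rule RM.submoduleI')
      show "(\<lambda>f. f \<odot>\<^bsub>gr\<^esub> u) ` N \<subseteq> carrier RM" using Nc u(2) by auto
      have "\<zero>\<^bsub>gr\<^esub> = \<zero>\<^bsub>GR\<^esub> \<odot>\<^bsub>gr\<^esub> u" using u(2) by simp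
      then show "\<zero>\<^bsub>RM\<^esub> \<in> (\<lambda>f. f \<odot>\<^bsub>gr\<^esub> u) ` N" using RQ.sub_zero[OF N(1)] by (auto simp: GR_simps)
      show "x \<oplus>\<^bsub>RM\<^esub> y \<in> (\<lambda>f. f \<odot>\<^bsub>gr\<^esub> u) ` N" if xy: "x \<in> (\<lambda>f. f \<odot>\<^bsub>gr\<^esub> u) ` N" "y \<in> (\<lambda>f. f \<odot>\<^bsub>gr\<^esub> u) ` N" for x y
      proof -
        obtain f h where fh: "f \<in> N" "x = f \<odot>\<^bsub>gr\<^esub> u" "h \<in> N" "y = h \<odot>\<^bsub>gr\<^esub> u" using xy by blast
        then have "x \<oplus>\<^bsub>RM\<^esub> y = (f \<oplus>\<^bsub>RQ\<^esub> h) \<odot>\<^bsub>gr\<^esub> u" using GM.smult_l_distr[of f h u] Nc u(2) by (simp add: GR_simps)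
        then show ?thesis using RQ.sub_add[OF N(1) fh(1,3)] by blast
      qed
      show "a \<odot>\<^bsub>RM\<^esub> x \<in> (\<lambda>f. f \<odot>\<^bsub>gr\<^esub> u) ` N" if a: "a \<in> carrier R" and x: "x \<in> (\<lambda>f. f \<odot>\<^bsub>gr\<^esub> u) ` N" for a x
      proof -
        obtain f where f: "f \<in> N" "x = f \<odot>\<^bsub>gr\<^esub> u" using x by blast
        then have "a \<odot>\<^bsub>RM\<^esub> x = (a \<odot>\<^bsub>RQ\<^esub> f) \<odot>\<^bsub>gr\<^esub> u"
          using GM.smult_assoc1[of "QQ.hom 0 a" f u] hom_0_deg(2)[OF a] Nc[OF f(1)] u(2) by (simp add: GR_simps)
        then show ?thesis using RQ.sub_smult[OF N(1) a f(1)] by blast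
      qed
    qed
    moreover have "f \<odot>\<^bsub>gr\<^esub> u \<in> deg_lt (n + c)" if "f \<in> N" for f
      using deg_smult_less[of f n u "Suc c"] that N(3) u(1) by (auto simp: killed_def)
    ultimately show "RM.sub ((\<lambda>f. f \<odot>\<^bsub>gr\<^esub> u) ` N) \<and> deg_lt 0 \<subseteq> (\<lambda>f. f \<odot>\<^bsub>gr\<^esub> u) ` N \<and> (\<lambda>f. f \<odot>\<^bsub>gr\<^esub> u) ` N \<subseteq> deg_lt (n + c)"
      using RM.sub_zero deg_lt_0 by auto
  next
    fix N K assume NK: "RQ.sub N" "RQ.sub K" "killed n (u # us) \<subseteq> N" "N \<subset> K" "K \<subseteq> killed n us"
    have Kc: "f \<in> carrier GR" if "f \<in> K" for f using RQ.sub_carrier[OF NK(2) that] by (simp add: GR_simps)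
    have "f \<in> N" if f: "f \<in> K" and e: "f \<odot>\<^bsub>gr\<^esub> u \<in> (\<lambda>f. f \<odot>\<^bsub>gr\<^esub> u) ` N" for f
    proof -
      obtain f' where f': "f' \<in> N" "f \<odot>\<^bsub>gr\<^esub> u = f' \<odot>\<^bsub>gr\<^esub> u" using e by blast
      have f'K: "f' \<in> K" using f'(1) NK(4) by blast
      have d: "f \<ominus>\<^bsub>RQ\<^esub> f' \<in> K" using RQ.sub_minus[OF NK(2) f f'K] .
      have "(f \<ominus>\<^bsub>RQ\<^esub> f') \<odot>\<^bsub>gr\<^esub> u = \<zero>\<^bsub>gr\<^esub>"
        using smult_minus_left[OF Kc[OF f] Kc[OF f'K] u(2) f'(2)] by (simp add: GR_minus_RQ)
      then have "f \<ominus>\<^bsub>RQ\<^esub> f' \<in> killed n (u # us)" using d NK(5) by (auto simp: killed_def)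
      then have "f \<ominus>\<^bsub>RQ\<^esub> f' \<in> N" using NK(3) by blast
      then show ?thesis using RQ.sub_add_cancel(3)[OF NK(1) f'(1), of f] RQ.sub_carrier[OF NK(2) f] by blast
    qed
    then show "(\<lambda>f. f \<odot>\<^bsub>gr\<^esub> u) ` N \<subset> (\<lambda>f. f \<odot>\<^bsub>gr\<^esub> u) ` K" using NK(4) by blast
  qed
  moreover have "interval_length R RQ (killed n (u # us)) (QQ.deg_lt n)
      = interval_length R RQ (killed n (u # us)) (killed n us) + interval_length R RQ (killed n us) (QQ.deg_lt n)"
    by (rule RQ.ilen_additive[OF s(2,1) sub_QQ_deg_lt]) (auto simp: killed_def)
  ultimately have "interval_length R RQ (killed n (u # us)) (QQ.deg_lt n) \<le> ?l + of_nat (length us) * ?l"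
    using Cons.IH[OF us(2)] add_mono by metis
  then show ?case by (simp add: distrib_right)
qed

text \<open>A substitute for the Hilbert-Samuel function of GR / P that makes sense when P is not
  homogeneous: elements of degree below n are counted modulo P.\<close>

definition colength :: "(nat \<Rightarrow> 'a set) set \<Rightarrow> nat \<Rightarrow> enat"
  where "colength P n = interval_length R RQ (P \<inter> QQ.deg_lt n) (QQ.deg_lt n)"

lemma sub_ideal: "ideal P GR \<Longrightarrow> RQ.sub (P \<inter> QQ.deg_lt n)"
proof (rule RQ.submoduleI')
  assume P: "ideal P GR"
  note I = idealD[OF P]
  note D = RQ.subD[OF sub_QQ_deg_lt[of n]]
  show "P \<inter> QQ.deg_lt n \<subseteq> carrier RQ" using D(1) by blast
  show "\<zero>\<^bsub>RQ\<^esub> \<in> P \<inter> QQ.deg_lt n"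
    using D(2) additive_subgroup.zero_closed[OF ideal.axioms(1)[OF P]] by (simp add: GR_simps)
  show "u \<oplus>\<^bsub>RQ\<^esub> v \<in> P \<inter> QQ.deg_lt n" if "u \<in> P \<inter> QQ.deg_lt n" "v \<in> P \<inter> QQ.deg_lt n" for u v
    using D(3)[of u v] additive_subgroup.a_closed[OF ideal.axioms(1)[OF P], of u v] that by (simp add: GR_simps)
  show "a \<odot>\<^bsub>RQ\<^esub> u \<in> P \<inter> QQ.deg_lt n" if "a \<in> carrier R" "u \<in> P \<inter> QQ.deg_lt n" for a u
    using D(6)[OF that(1), of u] ideal.I_l_closed[OF P, of u "QQ.hom 0 a"] hom_0_deg(2)[OF that(1)] that by (simp add: GR_simps)
qed

text \<open>Multiplication by g is injective modulo P, raises degrees by at most D and lands in P'.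
  So the elements of degree below D + n, taken modulo P, contain a copy of those of degree below n,
  and the quotient by this copy still maps onto the elements modulo P'.\<close>

lemma colength_step:
  assumes P: "primeideal P GR" and P': "ideal P' GR" "P \<subseteq> P'" and g: "g \<in> P'" "g \<notin> P" "g \<in> QQ.deg_lt (Suc D)"
  shows "colength P n + colength P' (D + n) \<le> colength P (D + n)"
proof -
  have Pi: "ideal P GR" using prime_ideal[OF P] .
  let ?E = "QQ.deg_lt (D + n)"
  let ?g = "\<lambda>N. (P \<inter> ?E) <+>\<^bsub>RQ\<^esub> ((\<lambda>f. g \<otimes>\<^bsub>GR\<^esub> f) ` N)"
  note sPE = sub_ideal[OF Pi, of "D + n"]
  have gc: "g \<in> carrier GR" using g(3) QQ.deg_lt_carrier by (auto simp: GR_simps)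
  have gE: "g \<otimes>\<^bsub>GR\<^esub> f \<in> ?E" if "f \<in> QQ.deg_lt n" for f
    using graded_action.deg_smult[OF graded_action_regular g(3) that] by (simp add: GR_simps)
  have sg: "RQ.sub ((\<lambda>f. g \<otimes>\<^bsub>GR\<^esub> f) ` N)" if N: "RQ.sub N" for N
  proof (rule RQ.submoduleI')
    have Nc: "f \<in> carrier GR" if "f \<in> N" for f using RQ.sub_carrier[OF N that] by (simp add: GR_simps)
    show "(\<lambda>f. g \<otimes>\<^bsub>GR\<^esub> f) ` N \<subseteq> carrier RQ" using Nc gc GM.R.m_closed by (auto simp: GR_simps(1)[symmetric])
    have "\<zero>\<^bsub>RQ\<^esub> = g \<otimes>\<^bsub>GR\<^esub> \<zero>\<^bsub>RQ\<^esub>" using gc GM.R.r_null by (simp add: GR_simps(4)[symmetric])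
    then show "\<zero>\<^bsub>RQ\<^esub> \<in> (\<lambda>f. g \<otimes>\<^bsub>GR\<^esub> f) ` N" using RQ.sub_zero[OF N] by blast
    show "x \<oplus>\<^bsub>RQ\<^esub> y \<in> (\<lambda>f. g \<otimes>\<^bsub>GR\<^esub> f) ` N" if xy: "x \<in> (\<lambda>f. g \<otimes>\<^bsub>GR\<^esub> f) ` N" "y \<in> (\<lambda>f. g \<otimes>\<^bsub>GR\<^esub> f) ` N" for x y
    proof -
      obtain f h where fh: "f \<in> N" "x = g \<otimes>\<^bsub>GR\<^esub> f" "h \<in> N" "y = g \<otimes>\<^bsub>GR\<^esub> h" using xy by blast
      then have "x \<oplus>\<^bsub>RQ\<^esub> y = g \<otimes>\<^bsub>GR\<^esub> (f \<oplus>\<^bsub>RQ\<^esub> h)"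
        using GM.R.r_distr[of f h g] Nc gc by (simp add: GR_simps(5)[symmetric])
      then show ?thesis using RQ.sub_add[OF N fh(1,3)] by blast
    qed
    show "a \<odot>\<^bsub>RQ\<^esub> x \<in> (\<lambda>f. g \<otimes>\<^bsub>GR\<^esub> f) ` N" if a: "a \<in> carrier R" and x: "x \<in> (\<lambda>f. g \<otimes>\<^bsub>GR\<^esub> f) ` N" for a x
    proof -
      obtain f where f: "f \<in> N" "x = g \<otimes>\<^bsub>GR\<^esub> f" using x by blast
      then have "a \<odot>\<^bsub>RQ\<^esub> x = g \<otimes>\<^bsub>GR\<^esub> (a \<odot>\<^bsub>RQ\<^esub> f)"
        using GM.R.m_lcomm[of "QQ.hom 0 a" g f] hom_0_deg(2)[OF a] Nc[OF f(1)] gc by (simp add: GR_simps(2)[symmetric])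
      then show ?thesis using RQ.sub_smult[OF N a f(1)] by blast
    qed
  qed
  have sgE: "RQ.sub (?g N)" if "RQ.sub N" for N by (rule RQ.sub_set_add[OF sPE sg[OF that]])
  have gsub: "?g N \<subseteq> ?E" if "RQ.sub N" "N \<subseteq> QQ.deg_lt n" for N
    by (rule RQ.set_add_least[OF sub_QQ_deg_lt]) (use gE that in auto)
  have sup: "P \<inter> ?E \<subseteq> ?g N" if "RQ.sub N" for N by (rule RQ.set_add_left[OF sPE sg[OF that]])
  have "colength P n \<le> interval_length R RQ (P \<inter> ?E) (?g (QQ.deg_lt n))"
    unfolding colength_def
  proof (rule interval_length_mono_map[where f = ?g])
    fix N assume N: "RQ.sub N" "P \<inter> QQ.deg_lt n \<subseteq> N" "N \<subseteq> QQ.deg_lt n"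
    show "RQ.sub (?g N) \<and> P \<inter> ?E \<subseteq> ?g N \<and> ?g N \<subseteq> ?g (QQ.deg_lt n)"
      using sgE[OF N(1)] sup[OF N(1)] RQ.set_add_mono[OF subset_refl image_mono[OF N(3)]] by (intro conjI)
  next
    fix N K assume NK: "RQ.sub N" "RQ.sub K" "P \<inter> QQ.deg_lt n \<subseteq> N" "N \<subset> K" "K \<subseteq> QQ.deg_lt n"
    obtain f where f: "f \<in> K" "f \<notin> N" using NK(4) by blast
    have Kc: "h \<in> carrier GR" if "h \<in> K" for h using RQ.sub_carrier[OF NK(2) that] by (simp add: GR_simps)
    have "g \<otimes>\<^bsub>GR\<^esub> f \<in> ?g K" using RQ.set_add_right[OF sPE sg[OF NK(2)]] f(1) by blast
    \<comment> \<open>If g f = q + g h with q in P and h in N, then g (f - h) lies in P, so f - h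
      lies in P and in degrees below n, hence in N.\<close>
    moreover have "g \<otimes>\<^bsub>GR\<^esub> f \<notin> ?g N"
    proof
      assume "g \<otimes>\<^bsub>GR\<^esub> f \<in> ?g N"
      then obtain q h where q: "q \<in> P" "h \<in> N" "g \<otimes>\<^bsub>GR\<^esub> f = q \<oplus>\<^bsub>GR\<^esub> g \<otimes>\<^bsub>GR\<^esub> h"
        unfolding RQ.set_add_iff by (auto simp: GR_simps(5)[symmetric])
      have hK: "h \<in> K" using q(2) NK(4) by blast
      have qc: "q \<in> carrier GR" using ideal_carrier[OF Pi q(1)] .
      have "g \<otimes>\<^bsub>GR\<^esub> (f \<ominus>\<^bsub>GR\<^esub> h) = g \<otimes>\<^bsub>GR\<^esub> f \<ominus>\<^bsub>GR\<^esub> g \<otimes>\<^bsub>GR\<^esub> h"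
        using gc Kc[OF f(1)] Kc[OF hK] by (simp add: a_minus_def GM.R.r_distr GM.R.r_minus)
      also have "\<dots> = q" unfolding q(3) using gc qc Kc[OF hK] by (simp add: a_minus_def GM.R.a_assoc GM.R.r_neg)
      finally have "g \<otimes>\<^bsub>GR\<^esub> (f \<ominus>\<^bsub>GR\<^esub> h) \<in> P" using q(1) by simp
      then have "f \<ominus>\<^bsub>GR\<^esub> h \<in> P" using primeideal.I_prime[OF P gc] Kc[OF f(1)] Kc[OF hK] g(2) by blast
      moreover have "f \<ominus>\<^bsub>RQ\<^esub> h \<in> K" using RQ.sub_minus[OF NK(2) f(1) hK] .
      ultimately have "f \<ominus>\<^bsub>RQ\<^esub> h \<in> N" using NK(3,5) by (auto simp: GR_minus_RQ)
      then have "f \<in> N" using RQ.sub_add_cancel(3)[OF NK(1) q(2), of f] RQ.sub_carrier[OF NK(2) f(1)] by blast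
      then show False using f(2) by blast
    qed
    moreover have "?g N \<subseteq> ?g K" by (rule RQ.set_add_mono[OF subset_refl image_mono]) (use NK(4) in blast)
    ultimately show "?g N \<subset> ?g K" by blast
  qed
  moreover have "colength P' (D + n) \<le> interval_length R RQ (?g (QQ.deg_lt n)) ?E"
    unfolding colength_def
  proof (rule RQ.ilen_mono[OF _ subset_refl])
    show "?g (QQ.deg_lt n) \<subseteq> P' \<inter> ?E"
    proof (rule RQ.set_add_least[OF sub_ideal[OF P'(1)]])
      have "g \<otimes>\<^bsub>GR\<^esub> f \<in> P'" if "f \<in> QQ.deg_lt n" for f
        using ideal.I_r_closed[OF P'(1) g(1), of f] that QQ.deg_lt_carrier by (auto simp: GR_simps)
      then show "(\<lambda>f. g \<otimes>\<^bsub>GR\<^esub> f) ` QQ.deg_lt n \<subseteq> P' \<inter> ?E" using gE by blast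
    qed (use P'(2) in blast)
  qed
  moreover have "colength P (D + n)
      = interval_length R RQ (P \<inter> ?E) (?g (QQ.deg_lt n)) + interval_length R RQ (?g (QQ.deg_lt n)) ?E"
    unfolding colength_def
    by (rule RQ.ilen_additive[OF sPE sgE[OF sub_QQ_deg_lt] sub_QQ_deg_lt sup[OF sub_QQ_deg_lt] gsub[OF sub_QQ_deg_lt subset_refl]])
  ultimately show ?thesis using add_mono by metis
qed

end

text \<open>The binomial coefficient grows like m^(r+1) and outruns every polynomial of degree r in
  m.\<close>

lemma choose_not_bounded:
  assumes "\<And>m. (m + Suc r) choose Suc r \<le> K * (D * m + e) ^ r"
  shows False
proof -
  \<comment> \<open>B collects the constants: with D m + e \<le> (D + e) m and the lower bound ((m +
    r + 1) / (r + 1))^(r + 1) for the binomial coefficient, the assumption becomes m^(r+1) \<le> B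
    m^r, which fails for m = B + 1.\<close>
  define B where "B = Suc r ^ Suc r * (K * (D + e) ^ r)"
  define m where "m = Suc B"
  have "(real (m + Suc r) / real (Suc r)) ^ Suc r \<le> real ((m + Suc r) choose Suc r)"
    by (rule binomial_ge_n_over_k_pow_k) simp
  also have "\<dots> \<le> real (K * (D * m + e) ^ r)" using assms of_nat_le_iff by blast
  finally have "real (m + Suc r) ^ Suc r \<le> real (K * (D * m + e) ^ r) * real (Suc r) ^ Suc r"
    by (simp add: power_divide divide_le_eq del: power_Suc)
  then have "(m + Suc r) ^ Suc r \<le> K * (D * m + e) ^ r * Suc r ^ Suc r"
    by (simp only: of_nat_power[symmetric] of_nat_mult[symmetric] of_nat_le_iff)
  moreover have "m ^ Suc r \<le> (m + Suc r) ^ Suc r" by (rule power_mono) simp_all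
  moreover have "(D * m + e) ^ r \<le> ((D + e) * m) ^ r" by (rule power_mono) (simp_all add: m_def distrib_right)
  ultimately have "m ^ Suc r \<le> K * ((D + e) * m) ^ r * Suc r ^ Suc r"
    by (meson le_trans mult_le_mono order_refl)
  then have "m * m ^ r \<le> B * m ^ r" by (simp add: B_def power_mult_distrib mult_ac)
  then show False by (simp add: m_def)
qed

context graded_action
begin

interpretation GM: module GR gr
  by (rule module_GR)

interpretation GQ: module GR QQ.gr
  by (rule graded_action.module_GR[OF graded_action_regular])

interpretation RM: module R RM
  by (rule module_restrict_scalars[OF module_GR hom_0_ring_hom R.is_cring])

interpretation RQ: module R RQ
  by (rule module_restrict_scalars[OF GQ.module_axioms hom_0_ring_hom R.is_cring])

lemma sub_restrict: "GM.sub K \<Longrightarrow> RM.sub K"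
proof (rule RM.submoduleI')
  assume K: "GM.sub K"
  show "a \<odot>\<^bsub>RM\<^esub> u \<in> K" if "a \<in> carrier R" "u \<in> K" for a u
    using GM.sub_smult[OF K hom_0_deg(2)[OF that(1)] that(2)] by simp
qed (use GM.sub_carrier GM.sub_zero GM.sub_add in auto)

lemma colength_pos:
  assumes "primeideal P GR" "0 < n"
  shows "1 \<le> colength P n"
  unfolding colength_def
proof (rule RQ.ilen_pos[OF sub_ideal[OF prime_ideal[OF assms(1)]] sub_QQ_deg_lt])
  have "QQ.hom 0 \<one> \<in> QQ.deg_lt n" using hom_0_deg(1)[of \<one>] QQ.deg_lt_mono[of "Suc 0" n] assms(2) by auto
  moreover have "QQ.hom 0 \<one> \<notin> P" using prime_one[OF assms(1)] by (simp add: GR_simps)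
  ultimately show "P \<inter> QQ.deg_lt n \<subset> QQ.deg_lt n" by blast
qed

text \<open>\<open>colength_step\<close> has the shape of Pascal's rule. The outer induction is on
  the number j of primes above the one considered, the inner one on m.\<close>

lemma colength_chain:
  assumes P: "prime_chain GR P k" and D: "\<And>i. i < k \<Longrightarrow> \<exists>g\<in>P (Suc i) - P i. g \<in> QQ.deg_lt (Suc D)"
  shows "j \<le> k \<Longrightarrow> of_nat ((m + j) choose j) \<le> colength (P (k - j)) (D * m + 1)"
proof (induction j arbitrary: m)
  case 0
  have "1 \<le> colength (P k) (D * m + 1)" by (rule colength_pos) (use P in \<open>auto simp: prime_chain_def\<close>)
  then show ?case by simp
next
  case (Suc j)
  let ?i = "k - Suc j"
  have i: "?i < k" "Suc ?i = k - j" using Suc.prems by auto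
  have pr: "primeideal (P ?i) GR" "primeideal (P (Suc ?i)) GR" "P ?i \<subseteq> P (Suc ?i)"
    using P i(1) unfolding prime_chain_def by (simp, simp, blast)
  obtain g where g: "g \<in> P (Suc ?i)" "g \<notin> P ?i" "g \<in> QQ.deg_lt (Suc D)" using D[OF i(1)] by blast
  have outer: "of_nat ((m + j) choose j) \<le> colength (P (Suc ?i)) (D * m + 1)" for m
    using Suc.IH[of m] Suc.prems i(2) by simp
  show ?case
  proof (induction m)
    case 0
    then show ?case using colength_pos[OF pr(1), of 1] by simp
  next
    case (Suc m)
    have "of_nat ((Suc m + Suc j) choose Suc j) = (of_nat ((m + Suc j) choose Suc j) + of_nat ((Suc m + j) choose j) :: enat)"
      by (simp flip: of_nat_add)
    also have "\<dots> \<le> colength (P ?i) (D * m + 1) + colength (P (Suc ?i)) (D * Suc m + 1)"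
      by (rule add_mono[OF Suc outer[of "Suc m"]])
    also have "\<dots> \<le> colength (P ?i) (D * Suc m + 1)"
      using colength_step[OF pr(1) prime_ideal[OF pr(2)] pr(3) g, of "D * m + 1"] by (simp add: add.assoc)
    finally show ?case .
  qed
qed

text \<open>Each step of the chain raises the order of growth of the colength by one, while the lengths of the
  truncations of the associated graded module grow only like \<open>n\<^sup>r\<close>.\<close>

lemma prime_chain_bound:
  assumes F0: "F 0 = carrier M" and C: "\<And>n. ilen (F n) (carrier M) \<le> of_nat (C * n ^ r)"
    and us: "set us \<subseteq> deg_lt (Suc c)"
    and ann: "\<And>f. f \<in> carrier GR \<Longrightarrow> (\<And>u. u \<in> set us \<Longrightarrow> f \<odot>\<^bsub>gr\<^esub> u = \<zero>\<^bsub>gr\<^esub>) \<Longrightarrow> f \<in> annihilator GR gr"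
    and P: "prime_chain GR P k" "annihilator GR gr \<subseteq> P 0"
  shows "k \<le> r"
proof (rule ccontr)
  assume "\<not> k \<le> r"
  then have P': "prime_chain GR P (Suc r)" using P(1) by (auto simp: prime_chain_def)
  have "\<exists>d. \<exists>g\<in>P (Suc i) - P i. g \<in> QQ.deg_lt d" if "i < Suc r" for i
  proof -
    have "P i \<subset> P (Suc i)" using P' \<open>i < Suc r\<close> unfolding prime_chain_def by blast
    then obtain g where g: "g \<in> P (Suc i) - P i" by blast
    have "primeideal (P (Suc i)) GR" using P' \<open>i < Suc r\<close> unfolding prime_chain_def by simp
    then have "g \<in> carrier QQ.gr" using ideal_carrier[OF prime_ideal, of "P (Suc i)" GR g] g by (simp add: GR_simps)
    then show ?thesis using QQ.deg_lt_Union g by blast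
  qed
  then obtain d where d: "\<And>i. i < Suc r \<Longrightarrow> \<exists>g\<in>P (Suc i) - P i. g \<in> QQ.deg_lt (d i)" by metis
  \<comment> \<open>A common degree bound for the elements that separate consecutive primes of the
    chain.\<close>
  define D where "D = (\<Sum>i<Suc r. d i)"
  have "\<exists>g\<in>P (Suc i) - P i. g \<in> QQ.deg_lt (Suc D)" if "i < Suc r" for i
  proof -
    have "d i \<le> Suc D" using member_le_sum[of i "{..<Suc r}" d] that by (simp add: D_def)
    then show ?thesis using d[OF that] QQ.deg_lt_mono by blast
  qed
  then have low: "of_nat ((m + Suc r) choose Suc r) \<le> colength (P 0) (D * m + 1)" for m
    using colength_chain[OF P', of D "Suc r" m] by simp
  \<comment> \<open>P 0 contains the annihilator, so its colength is at most that of the elements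
    killing all generators; the latter is controlled by the length of M / F (n + c).\<close>
  have up: "colength (P 0) n \<le> of_nat (length us * (C * (n + c) ^ r))" for n
  proof -
    have "killed n us \<subseteq> P 0 \<inter> QQ.deg_lt n"
      using ann P(2) QQ.deg_lt_carrier[of n] by (auto simp: killed_def GR_simps)
    then have "colength (P 0) n \<le> interval_length R RQ (killed n us) (QQ.deg_lt n)"
      unfolding colength_def by (rule RQ.ilen_mono) simp
    also have "\<dots> \<le> of_nat (length us) * interval_length R RM (deg_lt 0) (deg_lt (n + c))" by (rule length_killed[OF us])
    also have "\<dots> \<le> of_nat (length us) * of_nat (C * (n + c) ^ r)"
      by (rule mult_left_mono[OF order_trans[OF length_deg_lt[OF F0] C]]) simp
    finally show ?thesis by simp
  qed
  have "(m + Suc r) choose Suc r \<le> (length us * C) * (D * m + Suc c) ^ r" for m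
  proof -
    have "of_nat ((m + Suc r) choose Suc r) \<le> (of_nat (length us * (C * (D * m + 1 + c) ^ r)) :: enat)"
      using order_trans[OF low up] .
    then show ?thesis by (simp only: of_nat_le_iff) (simp add: mult.assoc)
  qed
  then show False by (rule choose_not_bounded)
qed

end

section \<open>Finite generation of the graded module\<close>

context filtered_module
begin

interpretation GA: graded_action R M F "ideal_power R \<qq>"
  by (rule graded_action_power)

interpretation GM: module GA.GR GA.gr
  by (rule GA.module_GR)

text \<open>From n0 on each step of the filtration is multiplication by \<open>\<qq>\<close>, so the
  classes of generators of F 0, ..., F n0 generate everything. The bound on their degrees enters the
  growth estimate.\<close>

lemma gr_finitely_generated:
  "\<exists>us c. set us \<subseteq> GA.deg_lt (Suc c) \<and> submodule_span GA.GR GA.gr (set us) = carrier GA.gr"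
proof -
  obtain n0 where n0: "\<And>n. n \<ge> n0 \<Longrightarrow> F (Suc n) = ideal_smult R M \<qq> (F n)" using F_stable by blast
  have "\<forall>n. \<exists>T. finite T \<and> T \<subseteq> carrier M \<and> submodule_span R M T = F n" using sub_fg[OF sub_F] by metis
  then obtain S where S: "\<And>n. finite (S n)" "\<And>n. S n \<subseteq> carrier M" "\<And>n. submodule_span R M (S n) = F n" by metis
  have SF: "S n \<subseteq> F n" for n using span_superset[of "S n"] S(3) by simp
  define U where "U = (\<Union>k\<in>{..n0}. GA.hom k ` S k)"
  have "finite U" using S(1) by (simp add: U_def)
  then obtain us where us: "set us = U" using finite_list by blast
  have deg: "U \<subseteq> GA.deg_lt (Suc n0)"
  proof
    fix u assume "u \<in> U"
    then obtain k x where kx: "k \<le> n0" "x \<in> S k" "u = GA.hom k x" by (auto simp: U_def)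
    then have "u \<in> GA.deg_lt (Suc k)" using GA.hom_deg SF by blast
    then show "u \<in> GA.deg_lt (Suc n0)" using GA.deg_lt_mono[of "Suc k" "Suc n0"] kx(1) by auto
  qed
  have Uc: "U \<subseteq> carrier GA.gr" using deg GA.deg_lt_carrier by blast
  let ?P = "submodule_span GA.GR GA.gr U"
  have sP: "GM.sub ?P" using GM.sub_span[OF Uc] .
  note pre = GA.sub_hom_preimage[OF GA.sub_restrict[OF sP]]
  have "F n \<subseteq> {x \<in> F n. GA.hom n x \<in> ?P}" for n
  proof (induction n)
    case 0
    have "S 0 \<subseteq> {x \<in> F 0. GA.hom 0 x \<in> ?P}" using SF[of 0] GM.span_superset[of U] by (auto simp: U_def)
    then have "submodule_span R M (S 0) \<subseteq> {x \<in> F 0. GA.hom 0 x \<in> ?P}" by (rule span_least[OF pre])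
    then show ?case unfolding S(3) .
  next
    case (Suc n)
    show ?case
    proof (cases "Suc n \<le> n0")
      case True
      have "S (Suc n) \<subseteq> {x \<in> F (Suc n). GA.hom (Suc n) x \<in> ?P}"
        using SF[of "Suc n"] GM.span_superset[of U] True unfolding U_def by blast
      then have "submodule_span R M (S (Suc n)) \<subseteq> {x \<in> F (Suc n). GA.hom (Suc n) x \<in> ?P}" by (rule span_least[OF pre])
      then show ?thesis unfolding S(3) .
    next
      case False
      then have "n \<ge> n0" by simp
      have "ideal_smult R M \<qq> (F n) \<subseteq> {x \<in> F (Suc n). GA.hom (Suc n) x \<in> ?P}"
      proof (rule ideal_smult_least[OF pre])
        fix a x assume a: "a \<in> \<qq>" and x: "x \<in> F n"
        have aQ: "a \<in> ideal_power R \<qq> 1" using a q_power_1 by simp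
        have "GA.hom n x \<in> ?P" using Suc x by blast
        then have "GA.QQ.hom 1 a \<odot>\<^bsub>GA.gr\<^esub> GA.hom n x \<in> ?P" by (rule GM.sub_smult[OF sP GA.hom_GR[OF aQ]])
        then show "a \<odot>\<^bsub>M\<^esub> x \<in> {x \<in> F (Suc n). GA.hom (Suc n) x \<in> ?P}"
          using GA.hom_smult[OF aQ x] q_smult_F[OF a x] by simp
      qed
      then show ?thesis unfolding n0[OF \<open>n \<ge> n0\<close>, symmetric] .
    qed
  qed
  then have h: "GA.hom n x \<in> ?P" if "x \<in> F n" for n x using that by blast
  have "g \<in> ?P" if "g \<in> carrier GA.gr" for g
    using that by (rule GA.gr_induct_hom) (use h GM.sub_add[OF sP] in auto)
  then have "?P = carrier GA.gr" using GM.sub_subset[OF sP] by blast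
  then show ?thesis using deg us by blast
qed

end

section \<open>Depth and dimension of the graded module at every maximal ideal\<close>

context superficial_module
begin

interpretation GA: graded_action R M F "ideal_power R \<qq>"
  by (rule graded_action_power)

interpretation GM: module GA.GR GA.gr
  by (rule GA.module_GR)

lemma gr_cohen_macaulay:
  assumes W: "\<And>i n. i < r \<Longrightarrow> W i n = 0"
  shows "cohen_macaulay (gr_ring R \<qq>) GA.gr"
  unfolding gr_ring_eq cohen_macaulay_def
proof (intro allI impI, elim conjE)
  fix Q assume Q: "maximalideal Q GA.GR" and annQ: "annihilator GA.GR GA.gr \<subseteq> Q"
  have Qp: "primeideal Q GA.GR" using GM.R.maximalideal_prime[OF Q] .
  have Qi: "ideal Q GA.GR" using prime_ideal[OF Qp] .
  have Qc: "Q \<subseteq> carrier GA.GR" using ideal_carrier[OF Qi] by blast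
  have zs: "GM.sub {\<zero>\<^bsub>GA.gr\<^esub>}" by (rule GM.sub_zero_set)
  obtain us c where us: "set us \<subseteq> GA.deg_lt (Suc c)" "submodule_span GA.GR GA.gr (set us) = carrier GA.gr"
    using gr_finitely_generated by blast
  have usc: "set us \<subseteq> carrier GA.gr" using us(1) GA.deg_lt_carrier by blast
  have annI: "f \<in> annihilator GA.GR GA.gr"
    if f: "f \<in> carrier GA.GR" "\<And>u. u \<in> set us \<Longrightarrow> f \<odot>\<^bsub>GA.gr\<^esub> u \<in> {\<zero>\<^bsub>GA.gr\<^esub>}" for f
  proof -
    have "carrier GA.gr \<subseteq> GM.colon {\<zero>\<^bsub>GA.gr\<^esub>} f"
      unfolding us(2)[symmetric] by (rule GM.span_least[OF GM.sub_colon[OF f(1) zs]]) (use f usc in \<open>auto simp: GM.colon_def\<close>)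
    then show ?thesis using f(1) by (auto simp: annihilator_def GM.colon_def)
  qed
  \<comment> \<open>Nakayama's lemma at Q without localization: if some s outside Q carried the
    graded module into its multiple by fs, hence into its multiple by Q, some t outside Q would kill
    all generators, although the annihilator lies in Q.\<close>
  have proper: "GM.ann_mod (GM.add_scales (carrier GA.gr) {\<zero>\<^bsub>GA.gr\<^esub>} fs) \<subseteq> Q" if fs: "set fs \<subseteq> Q" for fs
  proof (rule ccontr)
    let ?N = "GM.add_scales (carrier GA.gr) {\<zero>\<^bsub>GA.gr\<^esub>} fs" and ?QN = "ideal_smult GA.GR GA.gr Q (carrier GA.gr)"
    assume "\<not> GM.ann_mod ?N \<subseteq> Q"
    then obtain s where s: "s \<in> carrier GA.GR - Q" "\<And>x. x \<in> carrier GA.gr \<Longrightarrow> s \<odot>\<^bsub>GA.gr\<^esub> x \<in> ?N"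
      by (auto simp: GM.ann_mod_def)
    have sQN: "GM.sub ?QN" by (rule GM.sub_ideal_smult) (use Qc in auto)
    have "?N \<subseteq> ?QN"
    proof (subst GM.add_scales_subset_iff[OF GM.sub_whole zs _ sQN])
      show "set fs \<subseteq> carrier GA.GR" using fs Qc by blast
      show "{\<zero>\<^bsub>GA.gr\<^esub>} \<subseteq> ?QN \<and> (\<forall>a\<in>set fs. GM.scale a (carrier GA.gr) \<subseteq> ?QN)"
        using GM.sub_zero[OF sQN] fs GM.ideal_smultI[of _ Q] by (auto simp: GM.scale_def)
    qed
    also have "?QN \<subseteq> {\<zero>\<^bsub>GA.gr\<^esub>} <+>\<^bsub>GA.gr\<^esub> ?QN" by (rule GM.set_add_right[OF zs sQN])
    finally have "s \<odot>\<^bsub>GA.gr\<^esub> x \<in> {\<zero>\<^bsub>GA.gr\<^esub>} <+>\<^bsub>GA.gr\<^esub> ideal_smult GA.GR GA.gr Q (submodule_span GA.GR GA.gr (set us))"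
      if "x \<in> set us" for x using s(2)[of x] that usc unfolding us(2) by blast
    then obtain t where "t \<in> carrier GA.GR - Q" "\<forall>x\<in>set us. t \<odot>\<^bsub>GA.gr\<^esub> x \<in> {\<zero>\<^bsub>GA.gr\<^esub>}"
      using GM.nakayama_prime[OF Qp zs _ usc s(1)] by blast
    then show False using annI[of t] annQ by blast
  qed
  have proper': "GM.add_scales (carrier GA.gr) {\<zero>\<^bsub>GA.gr\<^esub>} fs \<noteq> carrier GA.gr" if fs: "set fs \<subseteq> Q" for fs
  proof
    assume "GM.add_scales (carrier GA.gr) {\<zero>\<^bsub>GA.gr\<^esub>} fs = carrier GA.gr"
    then have "\<one>\<^bsub>GA.GR\<^esub> \<in> GM.ann_mod (GM.add_scales (carrier GA.gr) {\<zero>\<^bsub>GA.gr\<^esub>} fs)" by (simp add: GM.ann_mod_def)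
    then show False using proper[OF fs] prime_one[OF Qp] by blast
  qed
  \<comment> \<open>The growth rate n^r of the length of M / F n comes from \<open>L_bound\<close>
    with j = r.\<close>
  have upper: "module_dim_at GA.GR GA.gr Q \<le> enat r"
    unfolding module_dim_at_def
  proof (rule Sup_least)
    fix x assume "x \<in> {enat n |n. \<exists>P. prime_chain GA.GR P n \<and> annihilator GA.GR GA.gr \<subseteq> P 0 \<and> P n \<subseteq> Q}"
    then obtain k P where P: "x = enat k" "prime_chain GA.GR P k" "annihilator GA.GR GA.gr \<subseteq> P 0" by blast
    obtain C where C: "\<And>n. L 0 n \<le> C * n ^ r" using L_bound by (metis diff_self_eq_0 order_refl)
    have "ilen (F n) (carrier M) = enat (L 0 n)" for n
      using ilen_eq_len[OF ilen_F_finite[OF subset_refl subset_refl]] FF_0 by (simp add: L_def)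
    then have C': "ilen (F n) (carrier M) \<le> of_nat (C * n ^ r)" for n
      using C[of n] by (simp only: of_nat_eq_enat enat_ord_simps)
    have "k \<le> r"
      by (rule GA.prime_chain_bound[OF F_zero C' us(1) annI P(2,3)]) auto
    then show "x \<le> enat r" using P(1) by simp
  qed
  \<comment> \<open>The chain consisting of Q alone is prolonged downwards by the regular
    sequence.\<close>
  have depth_le: "enat (length fs) \<le> module_dim_at GA.GR GA.gr Q"
    if fs: "set fs \<subseteq> Q" "regular_sequence GA.GR GA.gr fs" for fs
  proof -
    have fc: "set fs \<subseteq> carrier GA.GR" "GM.regular_seq_mod {\<zero>\<^bsub>GA.gr\<^esub>} fs" using fs(2) by (simp_all add: GM.regular_sequence_iff)
    have "prime_chain GA.GR (\<lambda>_. Q) 0" using Qp by (simp add: prime_chain_def)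
    then obtain P where "prime_chain GA.GR P (length fs)" "GM.ann_mod {\<zero>\<^bsub>GA.gr\<^esub>} \<subseteq> P 0" "P (length fs) = Q"
      using GM.prime_chain_extend[OF zs fc _ proper[OF fs(1)], of 0] by auto
    then show ?thesis
      unfolding module_dim_at_def GM.annihilator_eq by (intro Sup_upper) blast
  qed
  have "\<forall>t\<in>\<qq>. \<exists>d l. 0 < d \<and> l \<in> GA.QQ.deg_lt d \<and> GA.QQ.hom d (t [^] d) \<oplus>\<^bsub>GA.GR\<^esub> l \<in> Q"
    using integral_mod_maximal[OF Q] by blast
  then obtain d l where dl: "\<And>t. t \<in> \<qq> \<Longrightarrow> 0 < d t" "\<And>t. t \<in> \<qq> \<Longrightarrow> l t \<in> GA.QQ.deg_lt (d t)"
    "\<And>t. t \<in> \<qq> \<Longrightarrow> GA.QQ.hom (d t) (t [^] d t) \<oplus>\<^bsub>GA.GR\<^esub> l t \<in> Q" by metis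
  \<comment> \<open>Each member lies in Q, and its leading form is the \<open>d t\<close>-th power
    of the initial form of t; the exponent depends on t, which is why
    \<open>regular_seq_mod_pows\<close> allows varying exponents.\<close>
  define fs where "fs = map (\<lambda>t. GA.QQ.hom (d t) (t [^] d t) \<oplus>\<^bsub>GA.GR\<^esub> l t) as"
  have q1: "t \<in> ideal_power R \<qq> 1" if "t \<in> set as" for t using as_q that q_power_1 by auto
  have pows: "GM.regular_seq_mod {\<zero>\<^bsub>GA.gr\<^esub>} (map (\<lambda>t. GA.QQ.hom 1 t [^]\<^bsub>GA.GR\<^esub> d t) as)"
    by (rule GM.regular_seq_mod_pows[OF zs initial_forms_regular[OF W]]) (use q1 GA.hom_GR dl(1) as_q in auto)
  have eq: "map (\<lambda>t. GA.QQ.hom 1 t [^]\<^bsub>GA.GR\<^esub> d t) as = map (\<lambda>t. GA.QQ.hom (d t) (t [^] d t)) as"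
    using GA.hom_pow_GR(2)[OF q1] by simp
  have reg: "GM.regular_seq_mod {\<zero>\<^bsub>GA.gr\<^esub>} fs"
    unfolding fs_def
  proof (rule GA.regular_seq_lift[OF zs zs GA.homogeneous_zero GA.lead_zero pows[unfolded eq]])
    show "t [^] d t \<in> ideal_power R \<qq> (d t)" if "t \<in> set as" for t using GA.hom_pow_GR(1)[OF q1[OF that]] .
    show "l t \<in> GA.QQ.deg_lt (d t)" if "t \<in> set as" for t using dl(2) as_q that by blast
  qed
  have fsQ: "set fs \<subseteq> Q" using dl(3) as_q by (auto simp: fs_def)
  then have rs: "regular_sequence GA.GR GA.gr fs" using GM.regular_sequence_iff reg proper'[OF fsQ] Qc by blast
  have "enat r \<le> module_depth GA.GR Q GA.gr"
    unfolding module_depth_def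
  proof (rule Sup_upper)
    show "enat r \<in> {enat (length as) |as. set as \<subseteq> Q \<and> regular_sequence GA.GR GA.gr as}"
      using fsQ rs by (intro CollectI exI[of _ fs]) (simp add: fs_def)
  qed
  moreover have "module_depth GA.GR Q GA.gr \<le> module_dim_at GA.GR GA.gr Q"
    unfolding module_depth_def by (rule Sup_least) (use depth_le in blast)
  ultimately show "module_depth GA.GR Q GA.gr = module_dim_at GA.GR GA.gr Q" using upper by (meson order.trans order_antisym)
qed

end

theorem theorem2p4p9:
  fixes A :: "('a, 'c) ring_scheme" and \<mm> \<qq> J :: "'a set"
    and M :: "('a, 'b, 'd) module_scheme" and F :: "nat \<Rightarrow> 'b set"
    and as :: "'a list" and r :: nat
  assumes "noetherian_local_ring A \<mm>"
    and "primary_to A \<mm> \<qq>"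
    and "module A M" and "finitely_generated A M" and "carrier M \<noteq> {\<zero>\<^bsub>M\<^esub>}"
    and "good_filtration A \<qq> M F"
    and "cohen_macaulay A M"
    and "module_dim A M = enat r" and "r \<ge> 1"
    and "maximal_superficial_sequence A \<qq> M F as" and "J = genideal A (set as)"
  defines "e \<equiv> hilbert_coeff A M F" and "h \<equiv> h_coeff A M F"
  shows "
    (s_degree A M F \<le> 1 \<longleftrightarrow>
       hilbert_series A M F * (1 - fps_X) ^ r = fps_of_poly [:h 0, h 1:]) \<and>
    (s_degree A M F \<le> 1 \<longleftrightarrow> e 1 = of_int (h 1)) \<and>
    (e 1 = of_int (h 1) \<longleftrightarrow> e 1 = e 0 - of_int (h 0)) \<and>
    (e 1 = of_int (h 1) \<longrightarrow> e 0 = of_int (h 0 + h 1)) \<and>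
    (e 0 = of_int (h 0 + h 1) \<longleftrightarrow> F 2 = ideal_smult A M J (F 1)) \<and>
    (s_degree A M F \<le> 1 \<or> e 1 = of_int (h 1) \<or> e 1 = e 0 - of_int (h 0) \<longrightarrow>
       cohen_macaulay (gr_ring A \<qq>) (gr_module M F))"
proof -
  interpret filtered_module A M \<mm> \<qq> F
    using assms(1-4,6) by (intro filtered_module.intro local_module.intro filtered_module_axioms.intro local_module_axioms.intro)
  \<comment> \<open>This supplies both the equality of the length of the sequence with the dimension
    r and its regularity.\<close>
  note sup = maximal_superficial_length[OF assms(5,7,8,9,10)]
  interpret S: superficial_module A M \<mm> \<qq> F as by (rule sup(2))
  have dim: "module_dim A M = enat (length as)" using assms(8) sup(1) by simp
  note eqs = S.hilbert_equivalences[OF dim, folded e_def h_def, unfolded sup(1)]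
  have gr: "cohen_macaulay (gr_ring A \<qq>) (gr_module M F)" if s: "s_degree A M F \<le> 1"
    by (rule S.gr_cohen_macaulay) (use eqs(6)[OF s] sup(1) in simp)
  show ?thesis
    using eqs(1-5) gr unfolding assms(11) by blast
qed

end
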